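(* Let $\mathcal C$ be a symmetric monoidal category equipped with a class $\mathcal Q$ of regular epimorphisms satisfying the standing assumptions in the context. Let $(A,t_1,t_2,t_3,t_4,e)$ be a regular multiplier bimonoid in $\mathcal C$ for which $(A,t_1,t_2,e)$ is a multiplier Hopf monoid (i.e. $t_1$ and $t_2$ are isomorphisms) whose multiplication $m=e1.t_1$ is non-degenerate and whose counit is dense ($e\in\mathcal Q$). Let $V$ be an object which possesses a left dual $\overline V$ in $\mathcal C$. Then any $A$-comodule with underlying object $V$ possesses a left dual in the monoidal category of $A$-comodules, with underlying object $\overline V$.
   Context: Notation: $\mathcal C$ is written as if strict; the monoidal product (of objects and morphisms) is juxtaposition, the unit is $I$, the braiding is $c_{X,Y}\colon XY\to YX$ (here a symmetry, so $c_{Y,X}=c_{X,Y}^{-1}$). The composite of $f\colon A\to B$ and $g\colon B\to C$ is $g.f$ (juxtaposition binds more tightly than the dot); identity morphisms are written $1$; $A^n=A\cdots A$. Subscripts of $c$ are omitted; $c^{-1}\colon XY\to YX$ means $(c_{Y,X})^{-1}$. $\overline{\mathcal C}$ is the same monoidal category with the inverse braiding (equal to $\mathcal C$ in the symmetric case). A left dual of $V$ is $\overline V$ with $\eta\colon I\to V\overline V$, $\epsilon\colon\overline VV\to I$ satisfying the triangle identities. Standing assumptions: $\mathcal Q$ is a class of regular epimorphisms in $\mathcal C$, closed under composition and monoidal product, containing the isomorphisms, right-cancellative ($s\in\mathcal Q$ and $t.s\in\mathcal Q$ imply $t\in\mathcal Q$), and such that each $q\in \mathcal Q$ is the coequalizer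 of some pair of morphisms for which this coequalizer is preserved by taking the monoidal product with any fixed object. Non-degeneracy of an associative $m\colon A^2\to A$: for all objects $X,Y$ the maps $\mathcal C(X,YA)\to\mathcal C(XA,YA)$, $f\mapsto 1m.f1$, and $\mathcal C(X,AY)\to\mathcal C(AX,AY)$, $g\mapsto m1.1g$, are injective. Multiplier bimonoid: $(A,t_1,t_2,e)$ with $t_1,t_2\colon A^2\to A^2$, $e\colon A\to I$ such that $t_11.c^{-1}1.1t_1.c1.1t_1=1t_1.t_11$ and $1e.t_1=1e$; $1t_2.1c^{-1}.t_21.1c.t_21=t_21.1t_2$ and $e1.t_2=e1$; $1t_1.t_21=t_21.1t_1$ and $e1.t_1=1e.t_2$. Its multiplication $m:=e1.t_1=1e.t_2$ is associative. A regular multiplier bimonoid in $\mathcal C$ is $(A,t_1,t_2,t_3,t_4,e)$ such that $(A,t_1,t_2,e)$ is a multiplier bimonoid in $\mathcal C$, $(A,t_3,t_4,e)$ is a multiplier bimonoid in $\overline{\mathcal C}$, and, with $m:=e1.t_1$: $e1.t_1=e1.t_3.c$; $1m.c1.1t_1=1m.t_31.c1$; $t_41.1t_1=1t_1.t_41$; $m1.1c.t_21=m1.1t_4.1c$; $1t_3.t_21=t_21.1t_3$. An $A$-comodule is $(V,v^1,v^3)$ with $v^1,v^3\colon VA\to VA$ such that $v^11.c^{-1}1.1v^1.c1.1t_1=1t_1.v^11\colon VA^2\to VA^2$ and $1e.v^1=1e$; $v^31.c1.1v^3.c^{-1}1.1t_3=1t_3.v^31\colon VA^2\to VA^2$ and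 $1e.v^3=1e$; $1m.c1.1v^1=1m.v^31.c1\colon AVA\to VA$. A morphism $(V,v^1,v^3)\to(W,w^1,w^3)$ is $f\colon V\to W$ with $w^1.f1=f1.v^1$ and $w^3.f1=f1.v^3$. Monoidal structure on comodules (lifting that of $\mathcal C$): the unit is $I$ with both structure maps the identity of $A$; the product of $(V,v^1,v^3)$ and $(W,w^1,w^3)$ is $VW$ with structure maps $c^{-1}1.1v^1.c1.1w^1\colon VWA\to VWA$ (where $c=c_{V,W}$) and $1w^3.c1.1v^3.c1\colon VWA\to VWA$ (the first $c1$ applied being $c_{V,W}1$ and the last being $c_{W,V}1$); associativity and unit constraints are those of $\mathcal C$. *)

theory Defs
  imports Main
begin

section \<open>Monoidal categories\<close>

text \<open>
  Hom-sets need not be disjoint: composition and tensor product of morphisms do not refer to the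
  objects. This loses no generality (tag every morphism with its source and target), and it lets
  the category of comodules below reuse the morphisms of the base category.
  \<open>g \<cdot> f\<close> is \<open>g\<close> after \<open>f\<close>. Associativity and unit constraints are arbitrary natural
  isomorphisms: no strictness is assumed.
\<close>

record ('o, 'm) moncat =
  Ob :: "'o set"
  Hom :: "'o \<Rightarrow> 'o \<Rightarrow> 'm set"
  Id :: "'o \<Rightarrow> 'm" ("\<one>\<index>")
  Comp :: "'m \<Rightarrow> 'm \<Rightarrow> 'm" (infixl "\<cdot>\<index>" 70)
  TenO :: "'o \<Rightarrow> 'o \<Rightarrow> 'o" (infixl "\<odot>\<index>" 75)
  Ten :: "'m \<Rightarrow> 'm \<Rightarrow> 'm" (infixl "\<otimes>\<index>" 75)
  Unit :: "'o" ("\<I>\<index>")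
  Assoc :: "'o \<Rightarrow> 'o \<Rightarrow> 'o \<Rightarrow> 'm" ("\<alpha>\<index>")
  LUnit :: "'o \<Rightarrow> 'm" ("\<ll>\<index>")
  RUnit :: "'o \<Rightarrow> 'm" ("\<rr>\<index>")

record ('o, 'm) brmoncat = "('o, 'm) moncat" +
  Braid :: "'o \<Rightarrow> 'o \<Rightarrow> 'm" ("\<c>\<index>")

locale category =
  fixes C :: "('o, 'm, 'z) moncat_scheme" (structure)
  assumes hom_ob: "f \<in> Hom C X Y \<Longrightarrow> X \<in> Ob C \<and> Y \<in> Ob C"
    and id_hom: "X \<in> Ob C \<Longrightarrow> \<one> X \<in> Hom C X X"
    and comp_hom: "\<lbrakk>f \<in> Hom C X Y; g \<in> Hom C Y Z\<rbrakk> \<Longrightarrow> g \<cdot> f \<in> Hom C X Z"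
    and id_comp: "f \<in> Hom C X Y \<Longrightarrow> \<one> Y \<cdot> f = f"
    and comp_id: "f \<in> Hom C X Y \<Longrightarrow> f \<cdot> \<one> X = f"
    and comp_assoc: "\<lbrakk>f \<in> Hom C W X; g \<in> Hom C X Y; h \<in> Hom C Y Z\<rbrakk>
      \<Longrightarrow> h \<cdot> g \<cdot> f = h \<cdot> (g \<cdot> f)"

context fixes C :: "('o, 'm, 'z) moncat_scheme" (structure)
begin

definition inverse_pair :: "'o \<Rightarrow> 'o \<Rightarrow> 'm \<Rightarrow> 'm \<Rightarrow> bool" where
  "inverse_pair X Y f g \<longleftrightarrow>
     f \<in> Hom C X Y \<and> g \<in> Hom C Y X \<and> g \<cdot> f = \<one> X \<and> f \<cdot> g = \<one> Y"

definition is_iso :: "'o \<Rightarrow> 'o \<Rightarrow> 'm \<Rightarrow> bool" where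
  "is_iso X Y f \<longleftrightarrow> (\<exists>g. inverse_pair X Y f g)"

definition inverse_mor :: "'o \<Rightarrow> 'o \<Rightarrow> 'm \<Rightarrow> 'm" where
  "inverse_mor X Y f = (THE g. inverse_pair X Y f g)"

definition Assoc_inv :: "'o \<Rightarrow> 'o \<Rightarrow> 'o \<Rightarrow> 'm" where
  "Assoc_inv X Y Z = inverse_mor (X \<odot> Y \<odot> Z) (X \<odot> (Y \<odot> Z)) (\<alpha> X Y Z)"

definition coequalizer :: "'o \<Rightarrow> 'o \<Rightarrow> 'o \<Rightarrow> 'm \<Rightarrow> 'm \<Rightarrow> 'm \<Rightarrow> bool" where
  "coequalizer W X Y f g q \<longleftrightarrow>
     f \<in> Hom C W X \<and> g \<in> Hom C W X \<and> q \<in> Hom C X Y \<and> q \<cdot> f = q \<cdot> g \<and>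
     (\<forall>Z. \<forall>h \<in> Hom C X Z. h \<cdot> f = h \<cdot> g \<longrightarrow> (\<exists>!k. k \<in> Hom C Y Z \<and> k \<cdot> q = h))"

definition regular_epi :: "'o \<Rightarrow> 'o \<Rightarrow> 'm \<Rightarrow> bool" where
  "regular_epi X Y q \<longleftrightarrow> (\<exists>W f g. coequalizer W X Y f g q)"

definition left_dual :: "'o \<Rightarrow> 'o \<Rightarrow> 'm \<Rightarrow> 'm \<Rightarrow> bool" where
  "left_dual V V' \<eta> \<epsilon> \<longleftrightarrow>
     V \<in> Ob C \<and> V' \<in> Ob C \<and> \<eta> \<in> Hom C \<I> (V \<odot> V') \<and> \<epsilon> \<in> Hom C (V' \<odot> V) \<I> \<and>
     \<rr> V \<cdot> \<one> V \<otimes> \<epsilon> \<cdot> \<alpha> V V' V \<cdot> \<eta> \<otimes> \<one> V = \<ll> V \<and>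
     \<ll> V' \<cdot> \<epsilon> \<otimes> \<one> V' \<cdot> Assoc_inv V' V V' \<cdot> \<one> V' \<otimes> \<eta> = \<rr> V'"

end

locale monoidal_category = category C
  for C :: "('o, 'm, 'z) moncat_scheme" (structure) +
  assumes tensor_ob: "\<lbrakk>X \<in> Ob C; Y \<in> Ob C\<rbrakk> \<Longrightarrow> X \<odot> Y \<in> Ob C"
    and unit_ob: "\<I> \<in> Ob C"
    and tensor_hom: "\<lbrakk>f \<in> Hom C X Y; f' \<in> Hom C X' Y'\<rbrakk>
      \<Longrightarrow> f \<otimes> f' \<in> Hom C (X \<odot> X') (Y \<odot> Y')"
    and tensor_id: "\<lbrakk>X \<in> Ob C; Y \<in> Ob C\<rbrakk> \<Longrightarrow> \<one> X \<otimes> \<one> Y = \<one> (X \<odot> Y)"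
    and tensor_comp: "\<lbrakk>f \<in> Hom C X Y; g \<in> Hom C Y Z; f' \<in> Hom C X' Y'; g' \<in> Hom C Y' Z'\<rbrakk>
      \<Longrightarrow> (g \<cdot> f) \<otimes> (g' \<cdot> f') = g \<otimes> g' \<cdot> f \<otimes> f'"
    and assoc_iso: "\<lbrakk>X \<in> Ob C; Y \<in> Ob C; Z \<in> Ob C\<rbrakk>
      \<Longrightarrow> is_iso C (X \<odot> Y \<odot> Z) (X \<odot> (Y \<odot> Z)) (\<alpha> X Y Z)"
    and assoc_natural: "\<lbrakk>f \<in> Hom C X X'; g \<in> Hom C Y Y'; h \<in> Hom C Z Z'\<rbrakk>
      \<Longrightarrow> \<alpha> X' Y' Z' \<cdot> (f \<otimes> g \<otimes> h) = f \<otimes> (g \<otimes> h) \<cdot> \<alpha> X Y Z"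
    and lunit_iso: "X \<in> Ob C \<Longrightarrow> is_iso C (\<I> \<odot> X) X (\<ll> X)"
    and lunit_natural: "f \<in> Hom C X Y \<Longrightarrow> \<ll> Y \<cdot> \<one> \<I> \<otimes> f = f \<cdot> \<ll> X"
    and runit_iso: "X \<in> Ob C \<Longrightarrow> is_iso C (X \<odot> \<I>) X (\<rr> X)"
    and runit_natural: "f \<in> Hom C X Y \<Longrightarrow> \<rr> Y \<cdot> f \<otimes> \<one> \<I> = f \<cdot> \<rr> X"
    and pentagon: "\<lbrakk>W \<in> Ob C; X \<in> Ob C; Y \<in> Ob C; Z \<in> Ob C\<rbrakk>
      \<Longrightarrow> \<one> W \<otimes> \<alpha> X Y Z \<cdot> \<alpha> W (X \<odot> Y) Z \<cdot> \<alpha> W X Y \<otimes> \<one> Z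
        = \<alpha> W X (Y \<odot> Z) \<cdot> \<alpha> (W \<odot> X) Y Z"
    and triangle: "\<lbrakk>X \<in> Ob C; Y \<in> Ob C\<rbrakk>
      \<Longrightarrow> \<one> X \<otimes> \<ll> Y \<cdot> \<alpha> X \<I> Y = \<rr> X \<otimes> \<one> Y"

context fixes C :: "('o, 'm, 'z) brmoncat_scheme" (structure)
begin

text \<open>As in the informal notation, \<open>Braid_inv X Y\<close> goes from \<open>X \<odot> Y\<close> to \<open>Y \<odot> X\<close>.\<close>

definition Braid_inv :: "'o \<Rightarrow> 'o \<Rightarrow> 'm" where
  "Braid_inv X Y = inverse_mor C (Y \<odot> X) (X \<odot> Y) (\<c> Y X)"

end

definition reverse_braiding :: "('o, 'm, 'z) brmoncat_scheme \<Rightarrow> ('o, 'm, 'z) brmoncat_scheme" where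
  "reverse_braiding C = C\<lparr>Braid := Braid_inv C\<rparr>"

locale braided_monoidal_category = monoidal_category C
  for C :: "('o, 'm, 'z) brmoncat_scheme" (structure) +
  assumes braid_iso: "\<lbrakk>X \<in> Ob C; Y \<in> Ob C\<rbrakk> \<Longrightarrow> is_iso C (X \<odot> Y) (Y \<odot> X) (\<c> X Y)"
    and braid_natural: "\<lbrakk>f \<in> Hom C X X'; g \<in> Hom C Y Y'\<rbrakk>
      \<Longrightarrow> \<c> X' Y' \<cdot> f \<otimes> g = g \<otimes> f \<cdot> \<c> X Y"
    and hexagon1: "\<lbrakk>X \<in> Ob C; Y \<in> Ob C; Z \<in> Ob C\<rbrakk>
      \<Longrightarrow> \<alpha> Y Z X \<cdot> \<c> X (Y \<odot> Z) \<cdot> \<alpha> X Y Z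
        = \<one> Y \<otimes> \<c> X Z \<cdot> \<alpha> Y X Z \<cdot> \<c> X Y \<otimes> \<one> Z"
    and hexagon2: "\<lbrakk>X \<in> Ob C; Y \<in> Ob C; Z \<in> Ob C\<rbrakk>
      \<Longrightarrow> Assoc_inv C Z X Y \<cdot> \<c> (X \<odot> Y) Z \<cdot> Assoc_inv C X Y Z
        = \<c> X Z \<otimes> \<one> Y \<cdot> Assoc_inv C X Z Y \<cdot> \<one> X \<otimes> \<c> Y Z"

locale symmetric_monoidal_category = braided_monoidal_category C
  for C :: "('o, 'm, 'z) brmoncat_scheme" (structure) +
  assumes symmetry: "\<lbrakk>X \<in> Ob C; Y \<in> Ob C\<rbrakk> \<Longrightarrow> \<c> Y X \<cdot> \<c> X Y = \<one> (X \<odot> Y)"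

text \<open>\<open>Q X Y\<close> is the set of those morphisms from \<open>X\<close> to \<open>Y\<close> that belong to the class.\<close>

locale regular_epi_class = monoidal_category C
  for C :: "('o, 'm, 'z) moncat_scheme" (structure) and Q :: "'o \<Rightarrow> 'o \<Rightarrow> 'm set" +
  assumes Q_regular_epi: "q \<in> Q X Y \<Longrightarrow> regular_epi C X Y q"
    and Q_comp: "\<lbrakk>q \<in> Q X Y; r \<in> Q Y Z\<rbrakk> \<Longrightarrow> r \<cdot> q \<in> Q X Z"
    and Q_tensor: "\<lbrakk>q \<in> Q X Y; q' \<in> Q X' Y'\<rbrakk> \<Longrightarrow> q \<otimes> q' \<in> Q (X \<odot> X') (Y \<odot> Y')"
    and Q_iso: "is_iso C X Y f \<Longrightarrow> f \<in> Q X Y"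
    and Q_right_cancel: "\<lbrakk>s \<in> Q X Y; t \<in> Hom C Y Z; t \<cdot> s \<in> Q X Z\<rbrakk> \<Longrightarrow> t \<in> Q Y Z"
    and Q_preserved: "q \<in> Q X Y \<Longrightarrow> \<exists>W f g. coequalizer C W X Y f g q \<and>
      (\<forall>Z \<in> Ob C.
         coequalizer C (Z \<odot> W) (Z \<odot> X) (Z \<odot> Y) (\<one> Z \<otimes> f) (\<one> Z \<otimes> g) (\<one> Z \<otimes> q) \<and>
         coequalizer C (W \<odot> Z) (X \<odot> Z) (Y \<odot> Z) (f \<otimes> \<one> Z) (g \<otimes> \<one> Z) (q \<otimes> \<one> Z))"

section \<open>Multiplier bimonoids and their comodules\<close>

text \<open>
  Triple products are bracketed to the left. In a composite written as if \<open>C\<close> were strict,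
  the factor \<open>1f\<close> becomes \<open>whisk X Y Z Y' Z' f\<close> if \<open>f\<close> goes from \<open>Y \<odot> Z\<close> to
  \<open>Y' \<odot> Z'\<close>; the factor \<open>1m\<close> becomes \<open>one_mult A m X\<close>, and the factors
  \<open>1e\<close>, \<open>e1\<close> become \<open>one_counit e X\<close>, \<open>counit_one e X\<close>.
\<close>

context fixes C :: "('o, 'm, 'z) brmoncat_scheme" (structure)
begin

definition whisk :: "'o \<Rightarrow> 'o \<Rightarrow> 'o \<Rightarrow> 'o \<Rightarrow> 'o \<Rightarrow> 'm \<Rightarrow> 'm" where
  "whisk X Y Z Y' Z' f = Assoc_inv C X Y' Z' \<cdot> \<one> X \<otimes> f \<cdot> \<alpha> X Y Z"

definition one_mult :: "'o \<Rightarrow> 'm \<Rightarrow> 'o \<Rightarrow> 'm" where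
  "one_mult A m X = \<one> X \<otimes> m \<cdot> \<alpha> X A A"

definition one_counit :: "'m \<Rightarrow> 'o \<Rightarrow> 'm" where
  "one_counit e X = \<rr> X \<cdot> \<one> X \<otimes> e"

definition counit_one :: "'m \<Rightarrow> 'o \<Rightarrow> 'm" where
  "counit_one e X = \<ll> X \<cdot> e \<otimes> \<one> X"

definition mult :: "'o \<Rightarrow> 'm \<Rightarrow> 'm \<Rightarrow> 'm" where
  "mult A t1 e = counit_one e A \<cdot> t1"

definition nondegenerate :: "'o \<Rightarrow> 'm \<Rightarrow> bool" where
  "nondegenerate A m \<longleftrightarrow> (\<forall>X \<in> Ob C. \<forall>Y \<in> Ob C.
     inj_on (\<lambda>f. one_mult A m Y \<cdot> f \<otimes> \<one> A) (Hom C X (Y \<odot> A)) \<and>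
     inj_on (\<lambda>g. m \<otimes> \<one> Y \<cdot> Assoc_inv C A A Y \<cdot> \<one> A \<otimes> g) (Hom C X (A \<odot> Y)))"

definition multiplier_bimonoid :: "'o \<Rightarrow> 'm \<Rightarrow> 'm \<Rightarrow> 'm \<Rightarrow> bool" where
  "multiplier_bimonoid A t1 t2 e \<longleftrightarrow>
     (let W = whisk A A A A A in
     A \<in> Ob C \<and> t1 \<in> Hom C (A \<odot> A) (A \<odot> A) \<and> t2 \<in> Hom C (A \<odot> A) (A \<odot> A) \<and>
     e \<in> Hom C A \<I> \<and>
     t1 \<otimes> \<one> A \<cdot> Braid_inv C A A \<otimes> \<one> A \<cdot> W t1 \<cdot> \<c> A A \<otimes> \<one> A \<cdot> W t1
       = W t1 \<cdot> t1 \<otimes> \<one> A \<and>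
     one_counit e A \<cdot> t1 = one_counit e A \<and>
     W t2 \<cdot> W (Braid_inv C A A) \<cdot> t2 \<otimes> \<one> A \<cdot> W (\<c> A A) \<cdot> t2 \<otimes> \<one> A
       = t2 \<otimes> \<one> A \<cdot> W t2 \<and>
     counit_one e A \<cdot> t2 = counit_one e A \<and>
     W t1 \<cdot> t2 \<otimes> \<one> A = t2 \<otimes> \<one> A \<cdot> W t1 \<and>
     counit_one e A \<cdot> t1 = one_counit e A \<cdot> t2)"

end

context fixes C :: "('o, 'm, 'z) brmoncat_scheme" (structure)
begin

definition regular_multiplier_bimonoid ::
    "'o \<Rightarrow> 'm \<Rightarrow> 'm \<Rightarrow> 'm \<Rightarrow> 'm \<Rightarrow> 'm \<Rightarrow> bool" where
  "regular_multiplier_bimonoid A t1 t2 t3 t4 e \<longleftrightarrow>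
     (let W = whisk C A A A A A; m = mult C A t1 e in
     multiplier_bimonoid C A t1 t2 e \<and>
     multiplier_bimonoid (reverse_braiding C) A t3 t4 e \<and>
     counit_one C e A \<cdot> t1 = counit_one C e A \<cdot> t3 \<cdot> \<c> A A \<and>
     one_mult C A m A \<cdot> \<c> A A \<otimes> \<one> A \<cdot> W t1
       = one_mult C A m A \<cdot> t3 \<otimes> \<one> A \<cdot> \<c> A A \<otimes> \<one> A \<and>
     t4 \<otimes> \<one> A \<cdot> W t1 = W t1 \<cdot> t4 \<otimes> \<one> A \<and>
     m \<otimes> \<one> A \<cdot> W (\<c> A A) \<cdot> t2 \<otimes> \<one> A = m \<otimes> \<one> A \<cdot> W t4 \<cdot> W (\<c> A A) \<and>
     W t3 \<cdot> t2 \<otimes> \<one> A = t2 \<otimes> \<one> A \<cdot> W t3)"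

definition multiplier_Hopf_monoid :: "'o \<Rightarrow> 'm \<Rightarrow> 'm \<Rightarrow> 'm \<Rightarrow> bool" where
  "multiplier_Hopf_monoid A t1 t2 e \<longleftrightarrow>
     multiplier_bimonoid C A t1 t2 e \<and>
     is_iso C (A \<odot> A) (A \<odot> A) t1 \<and> is_iso C (A \<odot> A) (A \<odot> A) t2"

definition comodule ::
    "'o \<Rightarrow> 'm \<Rightarrow> 'm \<Rightarrow> 'm \<Rightarrow> 'o \<times> 'm \<times> 'm \<Rightarrow> bool" where
  "comodule A t1 t3 e = (\<lambda>(V, v1, v3).
     let m = mult C A t1 e in
     V \<in> Ob C \<and> v1 \<in> Hom C (V \<odot> A) (V \<odot> A) \<and> v3 \<in> Hom C (V \<odot> A) (V \<odot> A) \<and>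
     v1 \<otimes> \<one> A \<cdot> Braid_inv C A V \<otimes> \<one> A \<cdot> whisk C A V A V A v1 \<cdot> \<c> V A \<otimes> \<one> A \<cdot>
         whisk C V A A A A t1
       = whisk C V A A A A t1 \<cdot> v1 \<otimes> \<one> A \<and>
     one_counit C e V \<cdot> v1 = one_counit C e V \<and>
     v3 \<otimes> \<one> A \<cdot> \<c> A V \<otimes> \<one> A \<cdot> whisk C A V A V A v3 \<cdot> Braid_inv C V A \<otimes> \<one> A \<cdot>
         whisk C V A A A A t3
       = whisk C V A A A A t3 \<cdot> v3 \<otimes> \<one> A \<and>
     one_counit C e V \<cdot> v3 = one_counit C e V \<and>
     one_mult C A m V \<cdot> \<c> A V \<otimes> \<one> A \<cdot> whisk C A V A V A v1
       = one_mult C A m V \<cdot> v3 \<otimes> \<one> A \<cdot> \<c> A V \<otimes> \<one> A)"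

definition comodule_hom ::
    "'o \<Rightarrow> 'm \<Rightarrow> 'm \<Rightarrow> 'm \<Rightarrow> 'o \<times> 'm \<times> 'm \<Rightarrow> 'o \<times> 'm \<times> 'm \<Rightarrow> 'm set" where
  "comodule_hom A t1 t3 e = (\<lambda>(V, v1, v3) (W, w1, w3).
     {f \<in> Hom C V W. comodule A t1 t3 e (V, v1, v3) \<and> comodule A t1 t3 e (W, w1, w3) \<and>
        w1 \<cdot> f \<otimes> \<one> A = f \<otimes> \<one> A \<cdot> v1 \<and> w3 \<cdot> f \<otimes> \<one> A = f \<otimes> \<one> A \<cdot> v3})"

definition comodule_tensor ::
    "'o \<Rightarrow> 'o \<times> 'm \<times> 'm \<Rightarrow> 'o \<times> 'm \<times> 'm \<Rightarrow> 'o \<times> 'm \<times> 'm" where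
  "comodule_tensor A = (\<lambda>(V, v1, v3) (W, w1, w3).
     (V \<odot> W,
      Braid_inv C W V \<otimes> \<one> A \<cdot> whisk C W V A V A v1 \<cdot> \<c> V W \<otimes> \<one> A \<cdot>
        whisk C V W A W A w1,
      whisk C V W A W A w3 \<cdot> \<c> W V \<otimes> \<one> A \<cdot> whisk C W V A V A v3 \<cdot>
        \<c> V W \<otimes> \<one> A))"

text \<open>
  The structure maps of the unit comodule, identities of \<open>A\<close> when \<open>C\<close> is strict, are
  identities of \<open>\<I> \<odot> A\<close>.
\<close>

definition comodules ::
    "'o \<Rightarrow> 'm \<Rightarrow> 'm \<Rightarrow> 'm \<Rightarrow> ('o \<times> 'm \<times> 'm, 'm) moncat" where
  "comodules A t1 t3 e =
     \<lparr>Ob = {M. comodule A t1 t3 e M},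
      Hom = comodule_hom A t1 t3 e,
      Id = (\<lambda>M. \<one> (fst M)),
      Comp = Comp C,
      TenO = comodule_tensor A,
      Ten = Ten C,
      Unit = (\<I>, \<one> (\<I> \<odot> A), \<one> (\<I> \<odot> A)),
      Assoc = (\<lambda>L M N. \<alpha> (fst L) (fst M) (fst N)),
      LUnit = (\<lambda>M. \<ll> (fst M)),
      RUnit = (\<lambda>M. \<rr> (fst M))\<rparr>"

end

end

theory Submission
  imports Defs
begin

text \<open>
  An expression such as \<open>on2 f v a x\<close> is read as ``\<open>f\<close> applied to the legs \<open>v\<close>, \<open>a\<close> of \<open>x\<close>'', where
  \<open>x\<close> is a generalised element of a tensor product whose factors are labelled and unordered. In this form
  the axioms contain neither associators nor braidings; for instance the first comodule axiom becomes
  \<open>v\<^sup>1\<^sub>v\<^sub>a v\<^sup>1\<^sub>v\<^sub>b t\<^sub>1\<^sub>a\<^sub>b = t\<^sub>1\<^sub>a\<^sub>b v\<^sup>1\<^sub>v\<^sub>a\<close>.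

  Let \<open>\<mu>\<^sub>b\<^sub>a\<close> denote multiplication of the legs \<open>b\<close>, \<open>a\<close> and \<open>e\<^sub>b\<close> the counit on the leg \<open>b\<close>. Non-degeneracy
  and the third axiom \<open>\<mu>\<^sub>b\<^sub>a v\<^sup>1\<^sub>v\<^sub>a = \<mu>\<^sub>b\<^sub>a v\<^sup>3\<^sub>v\<^sub>b\<close> transport every property of \<open>v\<^sup>1\<close> to \<open>v\<^sup>3\<close>; in particular
  the conditions on the second structure maps of comodules and of their morphisms are automatic.
  Since \<open>t\<^sub>1\<close> is invertible, the operation \<open>e\<^sub>b (t\<^sub>1\<^sub>b\<^sub>a)\<^sup>-\<^sup>1 v\<^sup>3\<^sub>v\<^sub>b t\<^sub>1\<^sub>b\<^sub>a\<close> composes with \<open>v\<^sup>1\<^sub>v\<^sub>a\<close>, on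
  either side, to \<open>e\<^sub>b\<close>. As \<open>1e\<close> is a coequalizer, it descends along \<open>e\<^sub>b\<close> to an inverse \<open>w\<close> of \<open>v\<^sup>1\<close>.
  In the same way \<open>e\<^sub>b (t\<^sub>2\<^sub>a\<^sub>b)\<^sup>-\<^sup>1 v\<^sup>1\<^sub>v\<^sub>b t\<^sub>2\<^sub>a\<^sub>b\<close> descends to a map \<open>y\<close> that stands to \<open>w\<close> as \<open>v\<^sup>3\<close> stands
  to \<open>v\<^sup>1\<close>. The transposes of \<open>w\<close> and \<open>y\<close> along the duality make \<open>V'\<close> a comodule, and evaluation and
  coevaluation are morphisms because the transpose of \<open>w\<close> cancels against \<open>v\<^sup>1\<close>.
\<close>

section \<open>Morphisms tagged with source and target\<close>

text \<open>With f, g, t for \<open>v\<^sup>1\<close>, \<open>v\<^sup>3\<close>,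
  \<open>t\<^sub>1\<close>, what makes f invertible is the mixed law g_b t_ba f_a = t_ba g_b:
  multiplied by a fresh leg d, g_b becomes f_d, and since d, a may be taken in the image of t_da,
  the coaction law of f applies. Cancelling t_ba and applying e_b gives one inverse law. For the
  other, the test leg d multiplies from the left and d, b are taken in the image of
  \<open>t\<^sub>2\<close>; this calls for the companion law g_d g_b \<open>t\<^sub>2\<close> =
  \<open>t\<^sub>2\<close> g_b, which in turn takes two test legs.

  Descent requires the candidate to depend on e_b x alone. For w this holds because f after the
  candidate is e_b x and f is injective; for y because its product with a fresh leg d is w_d applied
  to e_b x.

  The inverse obeys w_b w_a t_ab = t_ab w_a, with the factors reversed; transposition reverses them
  again, which is why the dual is built from w and not from f.

  Fresh legs can be adjoined at will because operations are natural in a prefix object P and every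
  object in use is given infinitely many labels.\<close>

text \<open>
  The second component of a tagged morphism is \<open>None\<close> if the morphism arises from an ill-typed composition;
  thus composition is associative without side conditions.
\<close>

context symmetric_monoidal_category
begin

definition dm :: "'o \<times> 'm option \<times> 'o \<Rightarrow> 'o" where "dm f = fst f"
definition cd :: "'o \<times> 'm option \<times> 'o \<Rightarrow> 'o" where "cd f = snd (snd f)"
definition raw :: "'o \<times> 'm option \<times> 'o \<Rightarrow> 'm" where "raw f = the (fst (snd f))"
definition mor :: "'o \<times> 'm option \<times> 'o \<Rightarrow> bool" where
  "mor f \<longleftrightarrow> fst (snd f) \<noteq> None \<and> raw f \<in> Hom C (dm f) (cd f)"
definition tag :: "'o \<Rightarrow> 'o \<Rightarrow> 'm \<Rightarrow> 'o \<times> 'm option \<times> 'o" where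
  "tag X Y h = (X, if h \<in> Hom C X Y then Some h else None, Y)"

definition cmp :: "'o \<times> 'm option \<times> 'o \<Rightarrow> 'o \<times> 'm option \<times> 'o \<Rightarrow> 'o \<times> 'm option \<times> 'o"
    (infixr "\<bullet>" 70) where
  "g \<bullet> f = (if mor g \<and> mor f \<and> dm g = cd f then tag (dm f) (cd g) (raw g \<cdot> raw f)
     else (dm f, None, cd g))"
definition ten :: "'o \<times> 'm option \<times> 'o \<Rightarrow> 'o \<times> 'm option \<times> 'o \<Rightarrow> 'o \<times> 'm option \<times> 'o"
    (infixl "\<star>" 75) where
  "f \<star> g = (if mor f \<and> mor g then tag (dm f \<odot> dm g) (cd f \<odot> cd g) (raw f \<otimes> raw g)
     else (dm f \<odot> dm g, None, cd f \<odot> cd g))"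
definition idt :: "'o \<Rightarrow> 'o \<times> 'm option \<times> 'o" where "idt X = tag X X (\<one> X)"

definition al where "al X Y Z = tag (X \<odot> Y \<odot> Z) (X \<odot> (Y \<odot> Z)) (\<alpha> X Y Z)"
definition ali where "ali X Y Z = tag (X \<odot> (Y \<odot> Z)) (X \<odot> Y \<odot> Z) (Assoc_inv C X Y Z)"
definition lun where "lun X = tag (\<I> \<odot> X) X (\<ll> X)"
definition luni where "luni X = tag X (\<I> \<odot> X) (inverse_mor C (\<I> \<odot> X) X (\<ll> X))"
definition run where "run X = tag (X \<odot> \<I>) X (\<rr> X)"
definition runi where "runi X = tag X (X \<odot> \<I>) (inverse_mor C (X \<odot> \<I>) X (\<rr> X))"
definition bra where "bra X Y = tag (X \<odot> Y) (Y \<odot> X) (\<c> X Y)"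

lemma inverse_pair_unique:
  assumes "inverse_pair C X Y f g" "inverse_pair C X Y f g'" shows "g = g'"
proof -
  have g: "g \<in> Hom C Y X" "g \<cdot> f = \<one> X" and f: "f \<in> Hom C X Y"
    and g': "g' \<in> Hom C Y X" "f \<cdot> g' = \<one> Y"
    using assms by (auto simp: inverse_pair_def)
  have "g = g \<cdot> (f \<cdot> g')" using g g' comp_id by metis
  also have "\<dots> = g'" using comp_assoc[OF g'(1) f g(1)] g g' id_comp by metis
  finally show ?thesis .
qed

lemma inverse_mor_pair: "inverse_pair C X Y f g \<Longrightarrow> inverse_mor C X Y f = g"
  unfolding inverse_mor_def by (rule the_equality) (auto intro: inverse_pair_unique)

lemma is_iso_pair: "is_iso C X Y f \<Longrightarrow> inverse_pair C X Y f (inverse_mor C X Y f)"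
  using inverse_mor_pair unfolding is_iso_def by metis

lemma dm_tag[simp]: "dm (tag X Y h) = X" and cd_tag[simp]: "cd (tag X Y h) = Y"
  by (auto simp: dm_def cd_def tag_def)
lemma mor_tag[simp]: "mor (tag X Y h) \<longleftrightarrow> h \<in> Hom C X Y"
  by (auto simp: mor_def dm_def cd_def tag_def raw_def)
lemma raw_tag: "h \<in> Hom C X Y \<Longrightarrow> raw (tag X Y h) = h"
  by (auto simp: tag_def raw_def)
lemma tag_raw: "mor f \<Longrightarrow> tag (dm f) (cd f) (raw f) = f"
  by (cases f) (auto simp: tag_def raw_def mor_def dm_def cd_def)
lemma raw_hom: "mor f \<Longrightarrow> raw f \<in> Hom C (dm f) (cd f)"
  by (simp add: mor_def)
lemma mor_obtain: "mor f \<Longrightarrow> dm f = X \<Longrightarrow> cd f = Y \<Longrightarrow> \<exists>h. h \<in> Hom C X Y \<and> f = tag X Y h"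
  using tag_raw raw_hom by metis

lemma mor_dm[simp]: "mor f \<Longrightarrow> dm f \<in> Ob C" and mor_cd[simp]: "mor f \<Longrightarrow> cd f \<in> Ob C"
  using raw_hom hom_ob by blast+

lemma dm_cmp[simp]: "dm (g \<bullet> f) = dm f" and cd_cmp[simp]: "cd (g \<bullet> f) = cd g"
  by (auto simp: cmp_def dm_def cd_def tag_def)
lemma mor_cmp[simp]: "mor (g \<bullet> f) \<longleftrightarrow> mor g \<and> mor f \<and> dm g = cd f"
proof (cases "mor g \<and> mor f \<and> dm g = cd f")
  case True
  then have "raw g \<cdot> raw f \<in> Hom C (dm f) (cd g)" using comp_hom raw_hom by metis
  with True show ?thesis by (simp add: cmp_def)
qed (auto simp: cmp_def mor_def)

lemma dm_ten[simp]: "dm (f \<star> g) = dm f \<odot> dm g" and cd_ten[simp]: "cd (f \<star> g) = cd f \<odot> cd g"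
  by (auto simp: ten_def dm_def cd_def tag_def)
lemma mor_ten[simp]: "mor (f \<star> g) \<longleftrightarrow> mor f \<and> mor g"
  by (auto simp: ten_def raw_hom tensor_hom) (auto simp: mor_def)

lemma dm_idt[simp]: "dm (idt X) = X" and cd_idt[simp]: "cd (idt X) = X"
  by (auto simp: idt_def)
lemma mor_idt[simp]: "mor (idt X) \<longleftrightarrow> X \<in> Ob C"
  using hom_ob id_hom by (auto simp: idt_def)

lemma cmp_nmor: "\<not> mor (g \<bullet> f) \<Longrightarrow> g \<bullet> f = (dm f, None, cd g)"
  by (subst cmp_def, rule if_not_P) (simp only: mor_cmp simp_thms)
lemma ten_nmor: "\<not> mor (f \<star> g) \<Longrightarrow> f \<star> g = (dm f \<odot> dm g, None, cd f \<odot> cd g)"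
  by (subst ten_def, rule if_not_P) (simp only: mor_ten simp_thms)

lemma cmp_tag: "f \<in> Hom C X Y \<Longrightarrow> g \<in> Hom C Y Z \<Longrightarrow> tag Y Z g \<bullet> tag X Y f = tag X Z (g \<cdot> f)"
  by (simp add: cmp_def raw_tag)
lemma ten_tag: "f \<in> Hom C X Y \<Longrightarrow> g \<in> Hom C X' Y' \<Longrightarrow>
    tag X Y f \<star> tag X' Y' g = tag (X \<odot> X') (Y \<odot> Y') (f \<otimes> g)"
  by (simp add: ten_def raw_tag)
text \<open>In the ill-typed case both bracketings collapse to the same triple, with source
  \<open>dm f\<close>, no morphism, and target \<open>cd h\<close>.\<close>

lemma cmp_assoc: "(h \<bullet> g) \<bullet> f = h \<bullet> g \<bullet> f"
proof (cases "mor h \<and> mor g \<and> mor f \<and> dm h = cd g \<and> dm g = cd f")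
  case True
  then have e: "dm h = cd g" "dm g = cd f" and m: "mor h" "mor g" "mor f" by auto
  have h: "raw h \<in> Hom C (cd g) (cd h)" "raw g \<in> Hom C (cd f) (cd g)" "raw f \<in> Hom C (dm f) (cd f)"
    using raw_hom[OF m(1)] raw_hom[OF m(2)] raw_hom[OF m(3)] by (simp_all add: e)
  have t: "h = tag (cd g) (cd h) (raw h)" "g = tag (cd f) (cd g) (raw g)" "f = tag (dm f) (cd f) (raw f)"
    using tag_raw[OF m(1)] tag_raw[OF m(2)] tag_raw[OF m(3)] by (simp_all add: e)
  have "(tag (cd g) (cd h) (raw h) \<bullet> tag (cd f) (cd g) (raw g)) \<bullet> tag (dm f) (cd f) (raw f) =
     tag (cd g) (cd h) (raw h) \<bullet> tag (cd f) (cd g) (raw g) \<bullet> tag (dm f) (cd f) (raw f)"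
    by (simp add: cmp_tag h comp_hom[OF h(2) h(1)] comp_hom[OF h(3) h(2)] comp_assoc[OF h(3) h(2) h(1)])
  then show ?thesis unfolding t[symmetric] .
next
  case False
  then have "\<not> mor ((h \<bullet> g) \<bullet> f)" "\<not> mor (h \<bullet> g \<bullet> f)" by auto
  then show ?thesis
    by (metis cmp_nmor dm_cmp cd_cmp)
qed

text \<open>Composites are kept bracketed to the right, so an equation for
  \<open>a \<bullet> b\<close> matches inside a longer composite only in this extended form.\<close>

lemma reassoc: "a \<bullet> b = c \<Longrightarrow> a \<bullet> b \<bullet> x = c \<bullet> x"
  by (metis cmp_assoc)

lemma idt_cmp[simp]: "mor f \<Longrightarrow> cd f = Y \<Longrightarrow> idt Y \<bullet> f = f"
  using cmp_tag[OF raw_hom[of f] id_hom[OF mor_cd[of f]]] id_comp[OF raw_hom[of f]] tag_raw[of f]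
  by (auto simp: idt_def)
lemma cmp_idt[simp]: "mor f \<Longrightarrow> dm f = X \<Longrightarrow> f \<bullet> idt X = f"
  using cmp_tag[OF id_hom[OF mor_dm[of f]] raw_hom[of f]] comp_id[OF raw_hom[of f]] tag_raw[of f]
  by (auto simp: idt_def)

text \<open>Matching types suffice as hypotheses: if a factor is not a morphism, both sides are the
  same undefined triple.\<close>

lemma ten_cmp: "dm g = cd f \<Longrightarrow> dm g' = cd f' \<Longrightarrow> (g \<bullet> f) \<star> (g' \<bullet> f') = g \<star> g' \<bullet> f \<star> f'"
proof (cases "mor g \<and> mor f \<and> mor g' \<and> mor f'")
  case True
  assume e: "dm g = cd f" "dm g' = cd f'"
  have h: "raw g \<in> Hom C (cd f) (cd g)" "raw g' \<in> Hom C (cd f') (cd g')"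
     "raw f \<in> Hom C (dm f) (cd f)" "raw f' \<in> Hom C (dm f') (cd f')"
    using True raw_hom e by metis+
  have t: "g = tag (cd f) (cd g) (raw g)" "g' = tag (cd f') (cd g') (raw g')"
     "f = tag (dm f) (cd f) (raw f)" "f' = tag (dm f') (cd f') (raw f')"
    using True tag_raw e by metis+
  have "tag (cd f) (cd g) (raw g) \<bullet> tag (dm f) (cd f) (raw f) = tag (dm f) (cd g) (raw g \<cdot> raw f)"
    "tag (cd f') (cd g') (raw g') \<bullet> tag (dm f') (cd f') (raw f') = tag (dm f') (cd g') (raw g' \<cdot> raw f')"
    using h by (auto simp: cmp_tag)
  moreover have "tag (cd f) (cd g) (raw g) \<star> tag (cd f') (cd g') (raw g') =
     tag (cd f \<odot> cd f') (cd g \<odot> cd g') (raw g \<otimes> raw g')"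
    "tag (dm f) (cd f) (raw f) \<star> tag (dm f') (cd f') (raw f') =
     tag (dm f \<odot> dm f') (cd f \<odot> cd f') (raw f \<otimes> raw f')"
    using h by (auto simp: ten_tag)
  moreover have "tag (dm f) (cd g) (raw g \<cdot> raw f) \<star> tag (dm f') (cd g') (raw g' \<cdot> raw f')
     = tag (dm f \<odot> dm f') (cd g \<odot> cd g') ((raw g \<cdot> raw f) \<otimes> (raw g' \<cdot> raw f'))"
    by (rule ten_tag[OF comp_hom[OF h(3,1)] comp_hom[OF h(4,2)]])
  moreover have "tag (cd f \<odot> cd f') (cd g \<odot> cd g') (raw g \<otimes> raw g')
     \<bullet> tag (dm f \<odot> dm f') (cd f \<odot> cd f') (raw f \<otimes> raw f')
     = tag (dm f \<odot> dm f') (cd g \<odot> cd g') (raw g \<otimes> raw g' \<cdot> raw f \<otimes> raw f')"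
    using h by (auto simp: cmp_tag tensor_hom)
  ultimately show ?thesis using t tensor_comp[OF h(3) h(1) h(4) h(2)] by metis
next
  case False
  assume e: "dm g = cd f" "dm g' = cd f'"
  show ?thesis using False e
    by (subst cmp_nmor[of "g \<star> g'"], force, subst ten_nmor) auto
qed

lemma idt_ten[simp]: "X \<in> Ob C \<Longrightarrow> Y \<in> Ob C \<Longrightarrow> idt X \<star> idt Y = idt (X \<odot> Y)"
  by (simp add: idt_def ten_tag id_hom tensor_id)

declare tensor_ob[simp] unit_ob[simp]

lemma wr_cmp: "dm g = cd f \<Longrightarrow> Y \<in> Ob C \<Longrightarrow> (g \<bullet> f) \<star> idt Y = g \<star> idt Y \<bullet> f \<star> idt Y"
  using ten_cmp[of g f "idt Y" "idt Y"] by simp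
lemma wl_cmp: "dm g = cd f \<Longrightarrow> Y \<in> Ob C \<Longrightarrow> idt Y \<star> (g \<bullet> f) = idt Y \<star> g \<bullet> idt Y \<star> f"
  using ten_cmp[of "idt Y" "idt Y" g f] by simp
lemma interchange: "mor f \<Longrightarrow> mor g \<Longrightarrow> dm f = X \<Longrightarrow> cd f = X' \<Longrightarrow> dm g = Y \<Longrightarrow> cd g = Y' \<Longrightarrow>
    f \<star> idt Y' \<bullet> idt X \<star> g = idt X' \<star> g \<bullet> f \<star> idt Y"
  using ten_cmp[of f "idt X" "idt Y'" g] ten_cmp[of "idt X'" f g "idt Y"] by simp
lemma assoc_pair: assumes "X \<in> Ob C" "Y \<in> Ob C" "Z \<in> Ob C"
  shows "inverse_pair C (X \<odot> Y \<odot> Z) (X \<odot> (Y \<odot> Z)) (\<alpha> X Y Z) (Assoc_inv C X Y Z)"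
  unfolding Assoc_inv_def using assms by (intro is_iso_pair assoc_iso)

lemma dm_al[simp]: "dm (al X Y Z) = X \<odot> Y \<odot> Z" and cd_al[simp]: "cd (al X Y Z) = X \<odot> (Y \<odot> Z)"
  and dm_ali[simp]: "dm (ali X Y Z) = X \<odot> (Y \<odot> Z)" and cd_ali[simp]: "cd (ali X Y Z) = X \<odot> Y \<odot> Z"
  and dm_lun[simp]: "dm (lun X) = \<I> \<odot> X" and cd_lun[simp]: "cd (lun X) = X"
  and dm_luni[simp]: "dm (luni X) = X" and cd_luni[simp]: "cd (luni X) = \<I> \<odot> X"
  and dm_run[simp]: "dm (run X) = X \<odot> \<I>" and cd_run[simp]: "cd (run X) = X"
  and dm_runi[simp]: "dm (runi X) = X" and cd_runi[simp]: "cd (runi X) = X \<odot> \<I>"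
  and dm_bra[simp]: "dm (bra X Y) = X \<odot> Y" and cd_bra[simp]: "cd (bra X Y) = Y \<odot> X"
  by (simp_all add: al_def ali_def lun_def luni_def run_def runi_def bra_def)

context
  fixes X Y Z assumes ob: "X \<in> Ob C" "Y \<in> Ob C" "Z \<in> Ob C"
begin

lemma mor_al[simp]: "mor (al X Y Z)" and mor_ali[simp]: "mor (ali X Y Z)"
  and al_ali[simp]: "al X Y Z \<bullet> ali X Y Z = idt (X \<odot> (Y \<odot> Z))"
  and ali_al[simp]: "ali X Y Z \<bullet> al X Y Z = idt (X \<odot> Y \<odot> Z)"
  using assoc_pair[OF ob] by (auto simp: al_def ali_def inverse_pair_def cmp_tag idt_def)

end

lemma mor_lun[simp]: "X \<in> Ob C \<Longrightarrow> mor (lun X)" and mor_luni[simp]: "X \<in> Ob C \<Longrightarrow> mor (luni X)"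
  and lun_luni[simp]: "X \<in> Ob C \<Longrightarrow> lun X \<bullet> luni X = idt X"
  and luni_lun[simp]: "X \<in> Ob C \<Longrightarrow> luni X \<bullet> lun X = idt (\<I> \<odot> X)"
  using is_iso_pair[OF lunit_iso[of X]] by (auto simp: lun_def luni_def inverse_pair_def cmp_tag idt_def)

lemma mor_run[simp]: "X \<in> Ob C \<Longrightarrow> mor (run X)" and mor_runi[simp]: "X \<in> Ob C \<Longrightarrow> mor (runi X)"
  and run_runi[simp]: "X \<in> Ob C \<Longrightarrow> run X \<bullet> runi X = idt X"
  and runi_run[simp]: "X \<in> Ob C \<Longrightarrow> runi X \<bullet> run X = idt (X \<odot> \<I>)"
  using is_iso_pair[OF runit_iso[of X]] by (auto simp: run_def runi_def inverse_pair_def cmp_tag idt_def)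

lemma mor_bra[simp]: "X \<in> Ob C \<Longrightarrow> Y \<in> Ob C \<Longrightarrow> mor (bra X Y)"
  using is_iso_pair[OF braid_iso[of X Y]] by (auto simp: bra_def inverse_pair_def)

lemma bra_bra[simp]: "X \<in> Ob C \<Longrightarrow> Y \<in> Ob C \<Longrightarrow> bra Y X \<bullet> bra X Y = idt (X \<odot> Y)"
  using mor_bra[of X Y] mor_bra[of Y X] symmetry[of X Y] unfolding bra_def
  by (simp add: cmp_tag idt_def)

lemma Braid_inv_eq: "X \<in> Ob C \<Longrightarrow> Y \<in> Ob C \<Longrightarrow> Braid_inv C X Y = \<c> X Y"
  unfolding Braid_inv_def using mor_bra[of X Y] mor_bra[of Y X] symmetry[of X Y] symmetry[of Y X]
  by (intro inverse_mor_pair) (auto simp: inverse_pair_def bra_def)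

lemma al_nat: "mor f \<Longrightarrow> mor g \<Longrightarrow> mor h \<Longrightarrow> dm f = X \<Longrightarrow> cd f = X' \<Longrightarrow> dm g = Y \<Longrightarrow> cd g = Y' \<Longrightarrow>
    dm h = Z \<Longrightarrow> cd h = Z' \<Longrightarrow> al X' Y' Z' \<bullet> f \<star> g \<star> h = f \<star> (g \<star> h) \<bullet> al X Y Z"
proof -
  assume a: "mor f" "mor g" "mor h" "dm f = X" "cd f = X'" "dm g = Y" "cd g = Y'" "dm h = Z" "cd h = Z'"
  obtain ff gg hh where h: "ff \<in> Hom C X X'" "f = tag X X' ff" "gg \<in> Hom C Y Y'" "g = tag Y Y' gg"
     "hh \<in> Hom C Z Z'" "h = tag Z Z' hh"
    using mor_obtain a by metis
  have o: "X \<in> Ob C" "Y \<in> Ob C" "Z \<in> Ob C" "X' \<in> Ob C" "Y' \<in> Ob C" "Z' \<in> Ob C"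
    using a mor_dm mor_cd by blast+
  have "\<alpha> X Y Z \<in> Hom C (X \<odot> Y \<odot> Z) (X \<odot> (Y \<odot> Z))" "\<alpha> X' Y' Z' \<in> Hom C (X' \<odot> Y' \<odot> Z') (X' \<odot> (Y' \<odot> Z'))"
    using assoc_pair o by (auto simp: inverse_pair_def)
  then show ?thesis using h assoc_natural[OF h(1,3,5)]
    by (simp add: al_def ten_tag cmp_tag tensor_hom)
qed

lemma lun_nat: "mor f \<Longrightarrow> dm f = X \<Longrightarrow> cd f = Y \<Longrightarrow> lun Y \<bullet> idt \<I> \<star> f = f \<bullet> lun X"
proof -
  assume a: "mor f" "dm f = X" "cd f = Y"
  obtain ff where h: "ff \<in> Hom C X Y" "f = tag X Y ff" using mor_obtain a by metis
  have o: "X \<in> Ob C" "Y \<in> Ob C" using h hom_ob by blast+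
  show ?thesis using h mor_lun[OF o(1)] mor_lun[OF o(2)] lunit_natural[OF h(1)]
    by (simp add: lun_def idt_def ten_tag cmp_tag tensor_hom id_hom)
qed

lemma run_nat: "mor f \<Longrightarrow> dm f = X \<Longrightarrow> cd f = Y \<Longrightarrow> run Y \<bullet> f \<star> idt \<I> = f \<bullet> run X"
proof -
  assume a: "mor f" "dm f = X" "cd f = Y"
  obtain ff where h: "ff \<in> Hom C X Y" "f = tag X Y ff" using mor_obtain a by metis
  have o: "X \<in> Ob C" "Y \<in> Ob C" using h hom_ob by blast+
  show ?thesis using h mor_run[OF o(1)] mor_run[OF o(2)] runit_natural[OF h(1)]
    by (simp add: run_def idt_def ten_tag cmp_tag tensor_hom id_hom)
qed

lemma bra_nat: "mor f \<Longrightarrow> mor g \<Longrightarrow> dm f = X \<Longrightarrow> cd f = X' \<Longrightarrow> dm g = Y \<Longrightarrow> cd g = Y' \<Longrightarrow>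
   bra X' Y' \<bullet> f \<star> g = g \<star> f \<bullet> bra X Y"
proof -
  assume a: "mor f" "mor g" "dm f = X" "cd f = X'" "dm g = Y" "cd g = Y'"
  obtain ff gg where h: "ff \<in> Hom C X X'" "f = tag X X' ff" "gg \<in> Hom C Y Y'" "g = tag Y Y' gg"
    using mor_obtain a by metis
  have o: "X \<in> Ob C" "Y \<in> Ob C" "X' \<in> Ob C" "Y' \<in> Ob C" using h hom_ob by blast+
  show ?thesis using h mor_bra[OF o(1,2)] mor_bra[OF o(3,4)] braid_natural[OF h(1,3)]
    by (simp add: bra_def ten_tag cmp_tag tensor_hom)
qed

lemma raw_mem: "X \<in> Ob C \<Longrightarrow> Y \<in> Ob C \<Longrightarrow> Z \<in> Ob C \<Longrightarrow> \<alpha> X Y Z \<in> Hom C (X \<odot> Y \<odot> Z) (X \<odot> (Y \<odot> Z))"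
    "X \<in> Ob C \<Longrightarrow> Y \<in> Ob C \<Longrightarrow> Z \<in> Ob C \<Longrightarrow> Assoc_inv C X Y Z \<in> Hom C (X \<odot> (Y \<odot> Z)) (X \<odot> Y \<odot> Z)"
    "X \<in> Ob C \<Longrightarrow> \<ll> X \<in> Hom C (\<I> \<odot> X) X" "X \<in> Ob C \<Longrightarrow> \<rr> X \<in> Hom C (X \<odot> \<I>) X"
    "X \<in> Ob C \<Longrightarrow> Y \<in> Ob C \<Longrightarrow> \<c> X Y \<in> Hom C (X \<odot> Y) (Y \<odot> X)"
  using mor_al mor_ali mor_lun mor_run mor_bra
  by (auto simp: al_def ali_def lun_def run_def bra_def)

lemma pentagon_al: assumes ob: "X \<in> Ob C" "Y \<in> Ob C" "Z \<in> Ob C" "W \<in> Ob C"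
  shows "idt W \<star> al X Y Z \<bullet> al W (X \<odot> Y) Z \<bullet> al W X Y \<star> idt Z = al W X (Y \<odot> Z) \<bullet> al (W \<odot> X) Y Z"
proof -
  \<comment> \<open>Raw composition brackets to the left and \<open>cmp\<close> to the right; the
    typings \<open>h\<close> let \<open>comp_assoc\<close> pass from one to the other.\<close>
  have h: "\<alpha> W X Y \<otimes> \<one> Z \<in> Hom C (W \<odot> X \<odot> Y \<odot> Z) (W \<odot> (X \<odot> Y) \<odot> Z)"
     "\<alpha> W (X \<odot> Y) Z \<in> Hom C (W \<odot> (X \<odot> Y) \<odot> Z) (W \<odot> (X \<odot> Y \<odot> Z))"
     "\<one> W \<otimes> \<alpha> X Y Z \<in> Hom C (W \<odot> (X \<odot> Y \<odot> Z)) (W \<odot> (X \<odot> (Y \<odot> Z)))"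
    using ob by (simp_all add: tensor_hom id_hom raw_mem)
  have "idt W \<star> al X Y Z \<bullet> al W (X \<odot> Y) Z \<bullet> al W X Y \<star> idt Z
     = tag (W \<odot> X \<odot> Y \<odot> Z) (W \<odot> (X \<odot> (Y \<odot> Z)))
        (\<one> W \<otimes> \<alpha> X Y Z \<cdot> \<alpha> W (X \<odot> Y) Z \<cdot> \<alpha> W X Y \<otimes> \<one> Z)"
    unfolding comp_assoc[OF h] al_def idt_def using ob h
    by (simp add: ten_tag id_hom raw_mem cmp_tag comp_hom[OF h(1) h(2)])
  then show ?thesis using ob pentagon[of W X Y Z] unfolding al_def idt_def
    by (simp add: cmp_tag raw_mem)
qed

lemma triangle_al: assumes "X \<in> Ob C" "Y \<in> Ob C"
  shows "idt X \<star> lun Y \<bullet> al X \<I> Y = run X \<star> idt Y"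
  using triangle[of X Y] assms unfolding al_def idt_def lun_def run_def
  by (simp add: ten_tag cmp_tag tensor_hom comp_hom id_hom raw_mem)

lemma hexagon_al: assumes ob: "X \<in> Ob C" "Y \<in> Ob C" "Z \<in> Ob C"
  shows "al Y Z X \<bullet> bra X (Y \<odot> Z) \<bullet> al X Y Z = idt Y \<star> bra X Z \<bullet> al Y X Z \<bullet> bra X Y \<star> idt Z"
proof -
  have h: "\<c> X Y \<otimes> \<one> Z \<in> Hom C (X \<odot> Y \<odot> Z) (Y \<odot> X \<odot> Z)"
     "\<alpha> Y X Z \<in> Hom C (Y \<odot> X \<odot> Z) (Y \<odot> (X \<odot> Z))"
     "\<one> Y \<otimes> \<c> X Z \<in> Hom C (Y \<odot> (X \<odot> Z)) (Y \<odot> (Z \<odot> X))"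
    using ob by (simp_all add: tensor_hom id_hom raw_mem)
  have h': "\<alpha> X Y Z \<in> Hom C (X \<odot> Y \<odot> Z) (X \<odot> (Y \<odot> Z))"
     "\<c> X (Y \<odot> Z) \<in> Hom C (X \<odot> (Y \<odot> Z)) (Y \<odot> Z \<odot> X)"
     "\<alpha> Y Z X \<in> Hom C (Y \<odot> Z \<odot> X) (Y \<odot> (Z \<odot> X))"
    using ob by (simp_all add: raw_mem)
  have "idt Y \<star> bra X Z \<bullet> al Y X Z \<bullet> bra X Y \<star> idt Z
     = tag (X \<odot> Y \<odot> Z) (Y \<odot> (Z \<odot> X)) (\<one> Y \<otimes> \<c> X Z \<cdot> \<alpha> Y X Z \<cdot> \<c> X Y \<otimes> \<one> Z)"
    unfolding comp_assoc[OF h] al_def idt_def bra_def using ob h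
    by (simp add: ten_tag id_hom raw_mem cmp_tag comp_hom[OF h(1) h(2)])
  moreover have "al Y Z X \<bullet> bra X (Y \<odot> Z) \<bullet> al X Y Z
     = tag (X \<odot> Y \<odot> Z) (Y \<odot> (Z \<odot> X)) (\<alpha> Y Z X \<cdot> \<c> X (Y \<odot> Z) \<cdot> \<alpha> X Y Z)"
    unfolding comp_assoc[OF h'] al_def idt_def bra_def using ob h'
    by (simp add: raw_mem cmp_tag comp_hom[OF h'(1) h'(2)])
  ultimately show ?thesis using hexagon1[OF ob] by simp
qed

end

section \<open>Words and natural families of morphisms\<close>

context symmetric_monoidal_category
begin

section \<open>Isomorphisms and coherence of the unit\<close>

definition isom :: "'o \<times> 'm option \<times> 'o \<Rightarrow> bool" where
  "isom f \<longleftrightarrow> mor f \<and> (\<exists>g. mor g \<and> dm g = cd f \<and> cd g = dm f \<and> g \<bullet> f = idt (dm f) \<and> f \<bullet> g = idt (cd f))"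

lemma isomI: "mor f \<Longrightarrow> mor g \<Longrightarrow> dm g = cd f \<Longrightarrow> cd g = dm f \<Longrightarrow> g \<bullet> f = idt (dm f) \<Longrightarrow>
    f \<bullet> g = idt (cd f) \<Longrightarrow> isom f"
  unfolding isom_def by blast

lemma isom_mor[simp]: "isom f \<Longrightarrow> mor f" by (simp add: isom_def)

lemma isom_mono:
  assumes "isom f" "f \<bullet> g = f \<bullet> h" "mor g" "mor h" "cd g = dm f" "cd h = dm f" shows "g = h"
proof -
  obtain k where k: "k \<bullet> f = idt (dm f)" using assms(1) unfolding isom_def by blast
  have "(k \<bullet> f) \<bullet> g = (k \<bullet> f) \<bullet> h" unfolding cmp_assoc assms(2) ..
  then show ?thesis using assms(3-6) by (simp add: k)
qed

lemma isom_epi: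
  assumes "isom f" "g \<bullet> f = h \<bullet> f" "mor g" "mor h" "dm g = cd f" "dm h = cd f" shows "g = h"
proof -
  obtain k where k: "f \<bullet> k = idt (cd f)" using assms(1) unfolding isom_def by blast
  have "g \<bullet> f \<bullet> k = h \<bullet> f \<bullet> k" unfolding cmp_assoc[symmetric] assms(2) ..
  then show ?thesis using assms(3-6) by (simp add: k)
qed

lemma isom_cmp[simp]:
  assumes "isom f" "isom g" "dm g = cd f" shows "isom (g \<bullet> f)"
proof -
  obtain f' g' where f: "mor f'" "dm f' = cd f" "cd f' = dm f" "f' \<bullet> f = idt (dm f)" "f \<bullet> f' = idt (cd f)"
    and g: "mor g'" "dm g' = cd g" "cd g' = dm g" "g' \<bullet> g = idt (dm g)" "g \<bullet> g' = idt (cd g)"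
    using assms unfolding isom_def by blast
  show ?thesis using assms f g
    by (intro isomI[of _ "f' \<bullet> g'"]) (simp_all add: cmp_assoc g(4,5)[THEN reassoc] f(4,5)[THEN reassoc])
qed

lemma isom_ten[simp]:
  assumes "isom f" "isom g" shows "isom (f \<star> g)"
proof -
  obtain f' g' where f: "mor f'" "dm f' = cd f" "cd f' = dm f" "f' \<bullet> f = idt (dm f)" "f \<bullet> f' = idt (cd f)"
    and g: "mor g'" "dm g' = cd g" "cd g' = dm g" "g' \<bullet> g = idt (dm g)" "g \<bullet> g' = idt (cd g)"
    using assms unfolding isom_def by blast
  show ?thesis using assms f g
    by (intro isomI[of _ "f' \<star> g'"]) (simp_all add: ten_cmp[symmetric])
qed

lemma isom_idt[simp]: "X \<in> Ob C \<Longrightarrow> isom (idt X)"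
  by (rule isomI[of _ "idt X"]) simp_all

context
  fixes X Y Z assumes ob: "X \<in> Ob C" "Y \<in> Ob C" "Z \<in> Ob C"
begin
lemma isom_al[simp]: "isom (al X Y Z)" and isom_ali[simp]: "isom (ali X Y Z)"
  using ob by (auto intro!: isomI[of "al X Y Z" "ali X Y Z"] isomI[of "ali X Y Z" "al X Y Z"])
end
lemma isom_lun[simp]: "X \<in> Ob C \<Longrightarrow> isom (lun X)" and isom_luni[simp]: "X \<in> Ob C \<Longrightarrow> isom (luni X)"
  by (auto intro!: isomI[of "lun X" "luni X"] isomI[of "luni X" "lun X"])
lemma isom_run[simp]: "X \<in> Ob C \<Longrightarrow> isom (run X)" and isom_runi[simp]: "X \<in> Ob C \<Longrightarrow> isom (runi X)"
  by (auto intro!: isomI[of "run X" "runi X"] isomI[of "runi X" "run X"])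
lemma isom_bra[simp]: "X \<in> Ob C \<Longrightarrow> Y \<in> Ob C \<Longrightarrow> isom (bra X Y)"
  by (auto intro!: isomI[of "bra X Y" "bra Y X"])

text \<open>Naturality of the invertible \<open>lun\<close> recovers \<open>f\<close> from its
  whiskering with the unit.\<close>

lemma unit_whisker_faithful:
  assumes "mor f" "mor g" "dm f = dm g" "cd f = cd g" "idt \<I> \<star> f = idt \<I> \<star> g" shows "f = g"
proof -
  have "f \<bullet> lun (dm f) = g \<bullet> lun (dm f)"
    using lun_nat[of f, OF assms(1) refl refl] lun_nat[of g, OF assms(2) refl refl] assms(3-5) by simp
  then show ?thesis using assms(1-4) by (intro isom_epi[of "lun (dm f)" f g]) simp_all
qed

lemma unit_whisker_faithful_right:
  assumes "mor f" "mor g" "dm f = dm g" "cd f = cd g" "f \<star> idt \<I> = g \<star> idt \<I>" shows "f = g"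
proof -
  have "f \<bullet> run (dm f) = g \<bullet> run (dm f)"
    using run_nat[of f, OF assms(1) refl refl] run_nat[of g, OF assms(2) refl refl] assms(3-5) by simp
  then show ?thesis using assms(1-4) by (intro isom_epi[of "run (dm f)" f g]) simp_all
qed

text \<open>Kelly's argument: after whiskering with \<I> on the right, which is faithful, the claim
  follows from the pentagon at X, Y, \<I>, \<I> and two instances of the triangle axiom.\<close>

lemma run_tensor:
  assumes ob: "X \<in> Ob C" "Y \<in> Ob C" shows "idt X \<star> run Y \<bullet> al X Y \<I> = run (X \<odot> Y)"
proof -
  have "al X Y \<I> \<bullet> (idt X \<star> run Y \<bullet> al X Y \<I>) \<star> idt \<I>
     = al X Y \<I> \<bullet> (idt X \<star> run Y) \<star> idt \<I> \<bullet> al X Y \<I> \<star> idt \<I>"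
    using ob by (simp add: wr_cmp)
  also have "\<dots> = idt X \<star> (run Y \<star> idt \<I>) \<bullet> al X (Y \<odot> \<I>) \<I> \<bullet> al X Y \<I> \<star> idt \<I>"
    using ob al_nat[of "idt X" "run Y" "idt \<I>", OF _ _ _ refl refl refl refl refl refl, THEN reassoc]
    by (simp add: cmp_assoc)
  also have "\<dots> = idt X \<star> (idt Y \<star> lun \<I> \<bullet> al Y \<I> \<I>) \<bullet> al X (Y \<odot> \<I>) \<I> \<bullet> al X Y \<I> \<star> idt \<I>"
    using ob triangle_al[of Y \<I>] by simp
  also have "\<dots> = idt X \<star> (idt Y \<star> lun \<I>) \<bullet> al X Y (\<I> \<odot> \<I>) \<bullet> al (X \<odot> Y) \<I> \<I>"
    using ob pentagon_al[of Y \<I> \<I> X] by (simp add: wl_cmp cmp_assoc)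
  also have "\<dots> = al X Y \<I> \<bullet> idt (X \<odot> Y) \<star> lun \<I> \<bullet> al (X \<odot> Y) \<I> \<I>"
    using ob al_nat[of "idt X" "idt Y" "lun \<I>", OF _ _ _ refl refl refl refl refl refl, THEN reassoc]
    by (simp add: cmp_assoc)
  also have "\<dots> = al X Y \<I> \<bullet> run (X \<odot> Y) \<star> idt \<I>"
    using ob triangle_al[of "X \<odot> Y" \<I>] by simp
  finally have "(idt X \<star> run Y \<bullet> al X Y \<I>) \<star> idt \<I> = run (X \<odot> Y) \<star> idt \<I>"
    by (rule isom_mono[rotated]) (use ob in simp_all)
  then show ?thesis by (rule unit_whisker_faithful_right[rotated -1]) (use ob in simp_all)
qed

text \<open>The hexagon at X, \<I>, \<I>, read through \<open>run_tensor\<close>, gives the claim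
  whiskered with \<I> and precomposed with isomorphisms, which are then cancelled.\<close>

lemma lun_bra:
  assumes ob: "X \<in> Ob C" shows "lun X \<bullet> bra X \<I> = run X"
proof -
  have "(idt \<I> \<star> (lun X \<bullet> bra X \<I>) \<bullet> al \<I> X \<I>) \<bullet> bra X \<I> \<star> idt \<I>
     = idt \<I> \<star> lun X \<bullet> idt \<I> \<star> bra X \<I> \<bullet> al \<I> X \<I> \<bullet> bra X \<I> \<star> idt \<I>"
    using ob by (simp add: wl_cmp cmp_assoc)
  also have "\<dots> = idt \<I> \<star> lun X \<bullet> al \<I> \<I> X \<bullet> bra X (\<I> \<odot> \<I>) \<bullet> al X \<I> \<I>"
    using ob by (simp add: hexagon_al[symmetric])
  also have "\<dots> = run \<I> \<star> idt X \<bullet> bra X (\<I> \<odot> \<I>) \<bullet> al X \<I> \<I>"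
    using ob triangle_al[of \<I> X, THEN reassoc] by simp
  also have "\<dots> = bra X \<I> \<bullet> idt X \<star> run \<I> \<bullet> al X \<I> \<I>"
    using ob bra_nat[of "idt X" "run \<I>", OF _ _ refl refl refl refl, THEN reassoc] by (simp add: cmp_assoc)
  also have "\<dots> = bra X \<I> \<bullet> run (X \<odot> \<I>)" using ob run_tensor[of X \<I>] by simp
  also have "\<dots> = run (\<I> \<odot> X) \<bullet> bra X \<I> \<star> idt \<I>" using ob run_nat[of "bra X \<I>"] by simp
  also have "\<dots> = (idt \<I> \<star> run X \<bullet> al \<I> X \<I>) \<bullet> bra X \<I> \<star> idt \<I>" using ob run_tensor[of \<I> X] by simp
  finally have "idt \<I> \<star> (lun X \<bullet> bra X \<I>) \<bullet> al \<I> X \<I> = idt \<I> \<star> run X \<bullet> al \<I> X \<I>"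
    by (rule isom_epi[rotated]) (use ob in simp_all)
  then have "idt \<I> \<star> (lun X \<bullet> bra X \<I>) = idt \<I> \<star> run X"
    by (rule isom_epi[rotated]) (use ob in simp_all)
  then show ?thesis by (rule unit_whisker_faithful[rotated -1]) (use ob in simp_all)
qed

lemma runi_tensor: assumes ob: "X \<in> Ob C" "Y \<in> Ob C"
  shows "idt X \<star> runi Y = al X Y \<I> \<bullet> runi (X \<odot> Y)"
proof (rule isom_mono[of "idt X \<star> run Y"])
  have "idt X \<star> run Y \<bullet> al X Y \<I> \<bullet> runi (X \<odot> Y) = idt (X \<odot> Y)"
    using ob run_tensor[THEN reassoc, of X Y] by simp
  then show "idt X \<star> run Y \<bullet> idt X \<star> runi Y = idt X \<star> run Y \<bullet> al X Y \<I> \<bullet> runi (X \<odot> Y)"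
    using ob by (simp add: wl_cmp[symmetric])
qed (use ob in simp_all)

lemma runi_nat: "mor f \<Longrightarrow> dm f = X \<Longrightarrow> cd f = Y \<Longrightarrow> f \<star> idt \<I> \<bullet> runi X = runi Y \<bullet> f"
proof (rule isom_mono[of "run Y"])
  assume a: "mor f" "dm f = X" "cd f = Y"
  then have o: "X \<in> Ob C" "Y \<in> Ob C" by auto
  then show "run Y \<bullet> f \<star> idt \<I> \<bullet> runi X = run Y \<bullet> runi Y \<bullet> f"
    using a by (simp add: run_nat[THEN reassoc] run_runi[THEN reassoc] cmp_assoc)
  show "isom (run Y)" using o by simp
qed auto

lemma ali_nat: "mor f \<Longrightarrow> mor g \<Longrightarrow> mor h \<Longrightarrow> dm f = X \<Longrightarrow> cd f = X' \<Longrightarrow> dm g = Y \<Longrightarrow> cd g = Y' \<Longrightarrow>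
    dm h = Z \<Longrightarrow> cd h = Z' \<Longrightarrow> ali X' Y' Z' \<bullet> f \<star> (g \<star> h) = f \<star> g \<star> h \<bullet> ali X Y Z"
proof (rule isom_epi[of "al X Y Z"])
  assume a: "mor f" "mor g" "mor h" "dm f = X" "cd f = X'" "dm g = Y" "cd g = Y'" "dm h = Z" "cd h = Z'"
  then have o: "X \<in> Ob C" "X' \<in> Ob C" "Y \<in> Ob C" "Y' \<in> Ob C" "Z \<in> Ob C" "Z' \<in> Ob C" by auto
  show "isom (al X Y Z)" using o by simp
  show "(ali X' Y' Z' \<bullet> f \<star> (g \<star> h)) \<bullet> al X Y Z = (f \<star> g \<star> h \<bullet> ali X Y Z) \<bullet> al X Y Z"
    using a o by (simp add: cmp_assoc al_nat[symmetric] ali_al[THEN reassoc])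
qed auto

text \<open>The exchange of the last two letters of a word P x y; as a family in P it is the one
  given by the braiding \<open>bra x y\<close>.\<close>

definition sg where "sg P x y = ali P y x \<bullet> idt P \<star> bra x y \<bullet> al P x y"

lemma dm_sg[simp]: "dm (sg P x y) = P \<odot> x \<odot> y" and cd_sg[simp]: "cd (sg P x y) = P \<odot> y \<odot> x"
  by (simp_all add: sg_def)
lemma mor_sg[simp]: "P \<in> Ob C \<Longrightarrow> x \<in> Ob C \<Longrightarrow> y \<in> Ob C \<Longrightarrow> mor (sg P x y)" by (simp add: sg_def)

lemma sg_sg: "P \<in> Ob C \<Longrightarrow> x \<in> Ob C \<Longrightarrow> y \<in> Ob C \<Longrightarrow> sg P y x \<bullet> sg P x y = idt (P \<odot> x \<odot> y)"
  by (simp add: sg_def cmp_assoc al_ali[THEN reassoc] wl_cmp[symmetric, THEN reassoc])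

text \<open>Words are read from right to left: in \<open>x # xs\<close>, the letter \<open>x\<close> is the rightmost factor.\<close>

primrec ob :: "'o \<Rightarrow> 'o list \<Rightarrow> 'o" where
  "ob P [] = P" | "ob P (x # xs) = ob P xs \<odot> x"
text \<open>Coherence maps for words with a variable prefix: \<open>rw\<close> whiskers a map of
  prefixes by the letters, \<open>aw\<close> splits a factor Q off the prefix Q P, and
  \<open>kw\<close> carries the last letter x of the prefix past all the letters to the right
  end.\<close>

primrec rw :: "'o list \<Rightarrow> 'o \<times> 'm option \<times> 'o \<Rightarrow> 'o \<times> 'm option \<times> 'o" where
  "rw [] g = g" | "rw (x # xs) g = rw xs g \<star> idt x"
primrec aw :: "'o \<Rightarrow> 'o \<Rightarrow> 'o list \<Rightarrow> 'o \<times> 'm option \<times> 'o" where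
  "aw Q P [] = idt (Q \<odot> P)" | "aw Q P (x # xs) = al Q (ob P xs) x \<bullet> aw Q P xs \<star> idt x"
primrec kw :: "'o \<Rightarrow> 'o \<Rightarrow> 'o list \<Rightarrow> 'o \<times> 'm option \<times> 'o" where
  "kw P x [] = idt (P \<odot> x)" | "kw P x (y # ys) = sg (ob P ys) x y \<bullet> kw P x ys \<star> idt y"

lemma ob_append[simp]: "ob P (xs @ ys) = ob (ob P ys) xs" by (induction xs) auto
lemma ob_Ob[simp]: "P \<in> Ob C \<Longrightarrow> set xs \<subseteq> Ob C \<Longrightarrow> ob P xs \<in> Ob C" by (induction xs) auto
lemma rw_append[simp]: "rw (xs @ ys) g = rw xs (rw ys g)" by (induction xs) auto
lemma dm_rw[simp]: "dm (rw xs g) = ob (dm g) xs" and cd_rw[simp]: "cd (rw xs g) = ob (cd g) xs"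
  by (induction xs) auto
lemma mor_rw[simp]: "set xs \<subseteq> Ob C \<Longrightarrow> mor (rw xs g) \<longleftrightarrow> mor g" by (induction xs) auto
lemma rw_cmp: "dm g = cd f \<Longrightarrow> set xs \<subseteq> Ob C \<Longrightarrow> rw xs (g \<bullet> f) = rw xs g \<bullet> rw xs f"
  by (induction xs) (auto simp: wr_cmp)
lemma rw_idt[simp]: "P \<in> Ob C \<Longrightarrow> set xs \<subseteq> Ob C \<Longrightarrow> rw xs (idt P) = idt (ob P xs)"
  by (induction xs) auto
lemma isom_rw[simp]: "isom g \<Longrightarrow> set xs \<subseteq> Ob C \<Longrightarrow> isom (rw xs g)" by (induction xs) auto

lemma dm_aw[simp]: "dm (aw Q P xs) = ob (Q \<odot> P) xs" and cd_aw[simp]: "cd (aw Q P xs) = Q \<odot> ob P xs"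
  by (induction xs) auto
lemma isom_aw[simp]: "Q \<in> Ob C \<Longrightarrow> P \<in> Ob C \<Longrightarrow> set xs \<subseteq> Ob C \<Longrightarrow> isom (aw Q P xs)"
  by (induction xs) auto
lemma dm_kw[simp]: "dm (kw P x xs) = ob (P \<odot> x) xs" and cd_kw[simp]: "cd (kw P x xs) = ob P xs \<odot> x"
  by (induction xs) auto
lemma mor_kw[simp]: "P \<in> Ob C \<Longrightarrow> x \<in> Ob C \<Longrightarrow> set xs \<subseteq> Ob C \<Longrightarrow> mor (kw P x xs)"
  by (induction xs) auto

lemma aw_append: "Q \<in> Ob C \<Longrightarrow> P \<in> Ob C \<Longrightarrow> set xs \<subseteq> Ob C \<Longrightarrow> set ys \<subseteq> Ob C \<Longrightarrow>
    aw Q P (xs @ ys) = aw Q (ob P ys) xs \<bullet> rw xs (aw Q P ys)"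
  by (induction xs) (auto simp: wr_cmp cmp_assoc)
lemma kw_append: "x \<in> Ob C \<Longrightarrow> P \<in> Ob C \<Longrightarrow> set xs \<subseteq> Ob C \<Longrightarrow> set ys \<subseteq> Ob C \<Longrightarrow>
    kw P x (xs @ ys) = kw (ob P ys) x xs \<bullet> rw xs (kw P x ys)"
  by (induction xs) (auto simp: wr_cmp cmp_assoc)

text \<open>The families \<open>F\<close> that act on the end \<open>xs\<close> of every word \<open>P xs\<close>: those of the form \<open>1\<^sub>P f\<close>
  for a morphism \<open>f\<close> from \<open>xs\<close> to \<open>ys\<close>, up to associativity.\<close>

definition oper :: "('o \<Rightarrow> 'o \<times> 'm option \<times> 'o) \<Rightarrow> 'o list \<Rightarrow> 'o list \<Rightarrow> bool" where
  "oper F xs ys \<longleftrightarrow> set xs \<subseteq> Ob C \<and> set ys \<subseteq> Ob C \<and>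
    (\<forall>P \<in> Ob C. mor (F P) \<and> dm (F P) = ob P xs \<and> cd (F P) = ob P ys) \<and>
    (\<forall>g. mor g \<longrightarrow> rw ys g \<bullet> F (dm g) = F (cd g) \<bullet> rw xs g) \<and>
    (\<forall>Q \<in> Ob C. \<forall>P \<in> Ob C. aw Q P ys \<bullet> F (Q \<odot> P) = idt Q \<star> F P \<bullet> aw Q P xs) \<and>
    (\<forall>P \<in> Ob C. \<forall>x \<in> Ob C. kw P x ys \<bullet> F (P \<odot> x) = F P \<star> idt x \<bullet> kw P x xs)"

lemma operD:
  assumes "oper F xs ys"
  shows "set xs \<subseteq> Ob C" "set ys \<subseteq> Ob C"
    and "P \<in> Ob C \<Longrightarrow> mor (F P)" and "P \<in> Ob C \<Longrightarrow> dm (F P) = ob P xs" and "P \<in> Ob C \<Longrightarrow> cd (F P) = ob P ys"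
    and "mor g \<Longrightarrow> dm g = P \<Longrightarrow> cd g = P' \<Longrightarrow> rw ys g \<bullet> F P = F P' \<bullet> rw xs g"
    and "Q \<in> Ob C \<Longrightarrow> P \<in> Ob C \<Longrightarrow> aw Q P ys \<bullet> F (Q \<odot> P) = idt Q \<star> F P \<bullet> aw Q P xs"
    and "P \<in> Ob C \<Longrightarrow> x \<in> Ob C \<Longrightarrow> kw P x ys \<bullet> F (P \<odot> x) = F P \<star> idt x \<bullet> kw P x xs"
  using assms unfolding oper_def by blast+

lemma oper_id: "set xs \<subseteq> Ob C \<Longrightarrow> oper (\<lambda>P. idt (ob P xs)) xs xs"
  unfolding oper_def by auto

lemma operI:
  assumes "set xs \<subseteq> Ob C" "set ys \<subseteq> Ob C"
    and "\<And>P. P \<in> Ob C \<Longrightarrow> mor (F P)" and "\<And>P. P \<in> Ob C \<Longrightarrow> dm (F P) = ob P xs"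
    and "\<And>P. P \<in> Ob C \<Longrightarrow> cd (F P) = ob P ys"
    and "\<And>g. mor g \<Longrightarrow> rw ys g \<bullet> F (dm g) = F (cd g) \<bullet> rw xs g"
    and "\<And>Q P. Q \<in> Ob C \<Longrightarrow> P \<in> Ob C \<Longrightarrow> aw Q P ys \<bullet> F (Q \<odot> P) = idt Q \<star> F P \<bullet> aw Q P xs"
    and "\<And>P x. P \<in> Ob C \<Longrightarrow> x \<in> Ob C \<Longrightarrow> kw P x ys \<bullet> F (P \<odot> x) = F P \<star> idt x \<bullet> kw P x xs"
  shows "oper F xs ys"
  using assms unfolding oper_def by blast

lemma oper_cmp:
  assumes F: "oper F xs ys" and G: "oper G ys zs" shows "oper (\<lambda>P. G P \<bullet> F P) xs zs"
proof -
  note f = operD[OF F] and g = operD[OF G]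
  show ?thesis
  proof (rule operI)
    fix h assume h: "mor h"
    show "rw zs h \<bullet> G (dm h) \<bullet> F (dm h) = (G (cd h) \<bullet> F (cd h)) \<bullet> rw xs h"
      unfolding cmp_assoc g(6)[OF h refl refl, THEN reassoc] f(6)[OF h refl refl] ..
  next
    fix Q P assume o: "Q \<in> Ob C" "P \<in> Ob C"
    then have "idt Q \<star> (G P \<bullet> F P) = idt Q \<star> G P \<bullet> idt Q \<star> F P" by (simp add: wl_cmp f(5) g(4))
    then show "aw Q P zs \<bullet> G (Q \<odot> P) \<bullet> F (Q \<odot> P) = idt Q \<star> (G P \<bullet> F P) \<bullet> aw Q P xs"
      by (simp only: cmp_assoc g(7)[OF o, THEN reassoc] f(7)[OF o])
  next
    fix P x assume o: "P \<in> Ob C" "x \<in> Ob C"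
    then have "(G P \<bullet> F P) \<star> idt x = G P \<star> idt x \<bullet> F P \<star> idt x" by (simp add: wr_cmp f(5) g(4))
    then show "kw P x zs \<bullet> G (P \<odot> x) \<bullet> F (P \<odot> x) = (G P \<bullet> F P) \<star> idt x \<bullet> kw P x xs"
      by (simp only: cmp_assoc g(8)[OF o, THEN reassoc] f(8)[OF o])
  qed (simp_all add: f(1-5) g(1-5))
qed

text \<open>Letters \<open>zs\<close> inserted on the left are absorbed into the prefix; the laws
  for \<open>aw\<close> and \<open>kw\<close> then follow from naturality of \<open>F\<close> along
  \<open>aw Q P zs\<close> and \<open>kw P x zs\<close>, which are maps of prefixes.\<close>

lemma oper_pre:
  assumes F: "oper F xs ys" and z: "set zs \<subseteq> Ob C" shows "oper (\<lambda>P. F (ob P zs)) (xs @ zs) (ys @ zs)"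
proof -
  note f = operD[OF F]
  show ?thesis
  proof (rule operI)
    fix h assume h: "mor h"
    show "rw (ys @ zs) h \<bullet> F (ob (dm h) zs) = F (ob (cd h) zs) \<bullet> rw (xs @ zs) h"
      unfolding rw_append using h z by (intro f(6)) simp_all
  next
    fix Q P assume o: "Q \<in> Ob C" "P \<in> Ob C"
    have "aw Q P (ys @ zs) \<bullet> F (ob (Q \<odot> P) zs) = aw Q (ob P zs) ys \<bullet> F (Q \<odot> ob P zs) \<bullet> rw xs (aw Q P zs)"
      using o z f(1-2) f(6)[of "aw Q P zs", OF _ refl refl] by (simp add: aw_append cmp_assoc)
    also have "\<dots> = idt Q \<star> F (ob P zs) \<bullet> aw Q P (xs @ zs)"
      using o z f(1-2) f(7)[of Q "ob P zs", THEN reassoc] by (simp add: aw_append cmp_assoc)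
    finally show "aw Q P (ys @ zs) \<bullet> F (ob (Q \<odot> P) zs) = idt Q \<star> F (ob P zs) \<bullet> aw Q P (xs @ zs)" .
  next
    fix P x assume o: "P \<in> Ob C" "x \<in> Ob C"
    have "kw P x (ys @ zs) \<bullet> F (ob (P \<odot> x) zs) = kw (ob P zs) x ys \<bullet> F (ob P zs \<odot> x) \<bullet> rw xs (kw P x zs)"
      using o z f(1-2) f(6)[of "kw P x zs", OF _ refl refl] by (simp add: kw_append cmp_assoc)
    also have "\<dots> = F (ob P zs) \<star> idt x \<bullet> kw P x (xs @ zs)"
      using o z f(1-2) f(8)[of "ob P zs" x, THEN reassoc] by (simp add: kw_append cmp_assoc)
    finally show "kw P x (ys @ zs) \<bullet> F (ob (P \<odot> x) zs) = F (ob P zs) \<star> idt x \<bullet> kw P x (xs @ zs)" .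
  qed (use f(1-5) z in simp_all)
qed

lemma sg_nat: assumes "mor g" "x \<in> Ob C" "y \<in> Ob C"
  shows "sg (cd g) x y \<bullet> g \<star> idt x \<star> idt y = g \<star> idt y \<star> idt x \<bullet> sg (dm g) x y"
proof -
  have "sg (cd g) x y \<bullet> g \<star> idt x \<star> idt y = ali (cd g) y x \<bullet> idt (cd g) \<star> bra x y \<bullet> g \<star> idt (x \<odot> y) \<bullet> al (dm g) x y"
    unfolding sg_def using assms al_nat[of g "idt x" "idt y", OF _ _ _ refl refl refl refl refl refl]
    by (simp add: cmp_assoc)
  also have "\<dots> = ali (cd g) y x \<bullet> g \<star> idt (y \<odot> x) \<bullet> idt (dm g) \<star> bra x y \<bullet> al (dm g) x y"
    using assms interchange[of g "bra x y", OF _ _ refl refl refl refl, symmetric, THEN reassoc]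
    by (simp add: cmp_assoc)
  also have "\<dots> = g \<star> idt y \<star> idt x \<bullet> sg (dm g) x y"
    unfolding sg_def using assms ali_nat[of g "idt y" "idt x", OF _ _ _ refl refl refl refl refl refl, THEN reassoc]
    by (simp add: cmp_assoc)
  finally show ?thesis .
qed

text \<open>A letter to the right of the acting ones is a bystander; the laws follow from naturality
  of the associator and of the swap.\<close>

lemma oper_post:
  assumes F: "oper F xs ys" and y: "y \<in> Ob C" shows "oper (\<lambda>P. F P \<star> idt y) (y # xs) (y # ys)"
proof -
  note f = operD[OF F]
  have 1: "aw Q P (y # ys) \<bullet> F (Q \<odot> P) \<star> idt y = idt Q \<star> (F P \<star> idt y) \<bullet> aw Q P (y # xs)"
    if o: "Q \<in> Ob C" "P \<in> Ob C" for Q P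
  proof -
    have "aw Q P (y # ys) \<bullet> F (Q \<odot> P) \<star> idt y = al Q (ob P ys) y \<bullet> (aw Q P ys \<bullet> F (Q \<odot> P)) \<star> idt y"
      using o y by (simp add: wr_cmp cmp_assoc f(1-5))
    also have "\<dots> = al Q (ob P ys) y \<bullet> (idt Q \<star> F P) \<star> idt y \<bullet> aw Q P xs \<star> idt y"
      unfolding f(7)[OF o] using o y by (simp add: wr_cmp cmp_assoc f(1-5))
    also have "\<dots> = idt Q \<star> (F P \<star> idt y) \<bullet> aw Q P (y # xs)"
      using o y al_nat[of "idt Q" "F P" "idt y", OF _ _ _ refl refl refl refl refl refl, THEN reassoc]
      by (simp add: f(1-5) cmp_assoc)
    finally show ?thesis .
  qed
  have 2: "kw P x (y # ys) \<bullet> F (P \<odot> x) \<star> idt y = F P \<star> idt y \<star> idt x \<bullet> kw P x (y # xs)"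
    if o: "P \<in> Ob C" "x \<in> Ob C" for P x
  proof -
    have "kw P x (y # ys) \<bullet> F (P \<odot> x) \<star> idt y = sg (ob P ys) x y \<bullet> (kw P x ys \<bullet> F (P \<odot> x)) \<star> idt y"
      using o y by (simp add: wr_cmp cmp_assoc f(1-5))
    also have "\<dots> = sg (ob P ys) x y \<bullet> F P \<star> idt x \<star> idt y \<bullet> kw P x xs \<star> idt y"
      unfolding f(8)[OF o] using o y by (simp add: wr_cmp cmp_assoc f(1-5))
    also have "\<dots> = F P \<star> idt y \<star> idt x \<bullet> kw P x (y # xs)"
      using o y sg_nat[of "F P" x y, THEN reassoc]
      by (simp add: f(1-5) cmp_assoc)
    finally show ?thesis .
  qed
  show ?thesis
  proof (rule operI)
    fix h assume h: "mor h"
    show "rw (y # ys) h \<bullet> F (dm h) \<star> idt y = F (cd h) \<star> idt y \<bullet> rw (y # xs) h"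
      using h y f(6)[OF h refl refl] f(4,5)[OF mor_dm[OF h]] f(4,5)[OF mor_cd[OF h]]
      by (simp add: wr_cmp[symmetric])
  qed (use f(1-5) y 1 2 in simp_all)
qed

text \<open>The structure maps treated in this way have source and target words of at most two
  letters. For longer lists the clauses cut off the tail; the lemmas therefore assume
  \<open>short\<close>.\<close>

fun brk :: "'o list \<Rightarrow> 'o" where
  "brk [] = \<I>" | "brk [x] = x" | "brk (y # x # _) = x \<odot> y"
fun bet :: "'o \<Rightarrow> 'o list \<Rightarrow> 'o \<times> 'm option \<times> 'o" where
  "bet P [] = runi P" | "bet P [x] = idt (P \<odot> x)" | "bet P (y # x # _) = al P x y"
fun beti :: "'o \<Rightarrow> 'o list \<Rightarrow> 'o \<times> 'm option \<times> 'o" where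
  "beti P [] = run P" | "beti P [x] = idt (P \<odot> x)" | "beti P (y # x # _) = ali P x y"

definition short :: "'o list \<Rightarrow> bool" where "short xs \<longleftrightarrow> length xs \<le> 2 \<and> set xs \<subseteq> Ob C"

lemma short_cases:
  assumes "short xs"
  obtains "xs = []" | x where "xs = [x]" "x \<in> Ob C" | x y where "xs = [y, x]" "x \<in> Ob C" "y \<in> Ob C"
proof -
  show thesis
  proof (cases xs rule: brk.cases)
    case (3 y x zs)
    then have "zs = []" using assms by (cases zs) (auto simp: short_def)
    then show ?thesis using 3 assms that by (auto simp: short_def)
  qed (use assms that in \<open>auto simp: short_def\<close>)
qed

lemma short_simps[simp]: "short []" "short [x] \<longleftrightarrow> x \<in> Ob C" "short [y, x] \<longleftrightarrow> x \<in> Ob C \<and> y \<in> Ob C"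
  by (auto simp: short_def)
lemma short_Ob: "short xs \<Longrightarrow> set xs \<subseteq> Ob C" by (simp add: short_def)
lemma brk_Ob[simp]: "short xs \<Longrightarrow> brk xs \<in> Ob C" by (erule short_cases) auto
lemma bet_simps[simp]:
  assumes "short xs" "P \<in> Ob C"
  shows "mor (bet P xs)" "dm (bet P xs) = ob P xs" "cd (bet P xs) = P \<odot> brk xs"
    "mor (beti P xs)" "cd (beti P xs) = ob P xs" "dm (beti P xs) = P \<odot> brk xs"
    "bet P xs \<bullet> beti P xs = idt (P \<odot> brk xs)" "beti P xs \<bullet> bet P xs = idt (ob P xs)"
  using assms by (auto elim!: short_cases)

lemma isom_bet[simp]: "short xs \<Longrightarrow> P \<in> Ob C \<Longrightarrow> isom (bet P xs)"
  by (rule isomI[of "bet P xs" "beti P xs"]) auto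

lemma bet_nat: assumes "short xs" "mor g"
  shows "g \<star> idt (brk xs) \<bullet> bet (dm g) xs = bet (cd g) xs \<bullet> rw xs g"
  using assms(1)
proof (cases rule: short_cases)
  case (3 x y) then show ?thesis
    using assms al_nat[of g "idt x" "idt y", OF _ _ _ refl refl refl refl refl refl] by simp
qed (use assms in \<open>auto simp: runi_nat\<close>)

text \<open>Length two is the pentagon, length zero is \<open>runi_tensor\<close>.\<close>

lemma bet_aw: assumes "short xs" "Q \<in> Ob C" "P \<in> Ob C"
  shows "idt Q \<star> bet P xs \<bullet> aw Q P xs = al Q P (brk xs) \<bullet> bet (Q \<odot> P) xs"
  using assms(1)
proof (cases rule: short_cases)
  case (3 x y) then show ?thesis using assms pentagon_al[of P x y Q] by simp
qed (use assms in \<open>auto simp: runi_tensor\<close>)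

end

section \<open>Families and morphisms determine each other\<close>

context symmetric_monoidal_category
begin

lemma whisker_sg:
  assumes "mor f" "dm f = Y" "cd f = Y'" "P \<in> Ob C" "x \<in> Ob C"
  shows "sg P x Y' \<bullet> idt (P \<odot> x) \<star> f = idt P \<star> f \<star> idt x \<bullet> sg P x Y"
proof -
  have o: "Y \<in> Ob C" "Y' \<in> Ob C" using assms by auto
  have "sg P x Y' \<bullet> idt (P \<odot> x) \<star> f = ali P Y' x \<bullet> idt P \<star> bra x Y' \<bullet> idt P \<star> (idt x \<star> f) \<bullet> al P x Y"
    unfolding sg_def using assms o al_nat[of "idt P" "idt x" f, OF _ _ _ refl refl refl refl refl refl]
    by (simp add: cmp_assoc)
  also have "\<dots> = ali P Y' x \<bullet> idt P \<star> (f \<star> idt x) \<bullet> idt P \<star> bra x Y \<bullet> al P x Y"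
    using assms o bra_nat[of "idt x" f, OF _ _ refl refl refl refl]
    by (simp add: wl_cmp[symmetric, THEN reassoc])
  also have "\<dots> = idt P \<star> f \<star> idt x \<bullet> sg P x Y"
    unfolding sg_def using assms o ali_nat[of "idt P" f "idt x", OF _ _ _ refl refl refl refl refl refl, THEN reassoc]
    by (simp add: cmp_assoc)
  finally show ?thesis .
qed

text \<open>The hexagon transported into a word: carrying z past x and then past y agrees with
  carrying it past their product.\<close>

lemma hexagon_sg: assumes ob: "P \<in> Ob C" "x \<in> Ob C" "y \<in> Ob C" "z \<in> Ob C"
  shows "al P x y \<star> idt z \<bullet> sg (P \<odot> x) z y \<bullet> sg P z x \<star> idt y = sg P z (x \<odot> y) \<bullet> al (P \<odot> z) x y"
proof -
  have h: "bra z (x \<odot> y) \<bullet> al z x y = ali x y z \<bullet> idt x \<star> bra z y \<bullet> al x z y \<bullet> bra z x \<star> idt y"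
    using hexagon_al[of z x y] ob by (simp add: hexagon_al[symmetric] ali_al[THEN reassoc])
  \<comment> \<open>\<open>p2\<close> and \<open>p3\<close> are the pentagon solved for other
    composites of associators.\<close>
  have p2: "idt P \<star> al x z y \<bullet> al P (x \<odot> z) y = al P x (z \<odot> y) \<bullet> al (P \<odot> x) z y \<bullet> ali P x z \<star> idt y"
  proof (rule isom_epi[of "al P x z \<star> idt y"])
    show "(idt P \<star> al x z y \<bullet> al P (x \<odot> z) y) \<bullet> al P x z \<star> idt y
      = (al P x (z \<odot> y) \<bullet> al (P \<odot> x) z y \<bullet> ali P x z \<star> idt y) \<bullet> al P x z \<star> idt y"
      using ob by (simp add: cmp_assoc pentagon_al wr_cmp[symmetric])
  qed (use ob in simp_all)
  have p3: "ali P (x \<odot> y) z \<bullet> idt P \<star> ali x y z \<bullet> al P x (y \<odot> z) = al P x y \<star> idt z \<bullet> ali (P \<odot> x) y z"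
  proof (rule isom_epi[of "al (P \<odot> x) y z"])
    show "(ali P (x \<odot> y) z \<bullet> idt P \<star> ali x y z \<bullet> al P x (y \<odot> z)) \<bullet> al (P \<odot> x) y z
      = (al P x y \<star> idt z \<bullet> ali (P \<odot> x) y z) \<bullet> al (P \<odot> x) y z"
      using ob by (simp add: cmp_assoc pentagon_al[symmetric] wl_cmp[symmetric, THEN reassoc] ali_al[THEN reassoc])
  qed (use ob in simp_all)
  have "sg P z (x \<odot> y) \<bullet> al (P \<odot> z) x y
     = ali P (x \<odot> y) z \<bullet> idt P \<star> bra z (x \<odot> y) \<bullet> idt P \<star> al z x y \<bullet> al P (z \<odot> x) y \<bullet> al P z x \<star> idt y"
    unfolding sg_def using ob by (simp add: cmp_assoc pentagon_al)
  also have "\<dots> = ali P (x \<odot> y) z \<bullet> idt P \<star> ali x y z \<bullet> idt P \<star> (idt x \<star> bra z y) \<bullet> idt P \<star> al x z y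
      \<bullet> idt P \<star> (bra z x \<star> idt y) \<bullet> al P (z \<odot> x) y \<bullet> al P z x \<star> idt y"
    using ob by (simp add: wl_cmp[symmetric, THEN reassoc] h)
  also have "\<dots> = ali P (x \<odot> y) z \<bullet> idt P \<star> ali x y z \<bullet> idt P \<star> (idt x \<star> bra z y) \<bullet> idt P \<star> al x z y
      \<bullet> al P (x \<odot> z) y \<bullet> (idt P \<star> bra z x) \<star> idt y \<bullet> al P z x \<star> idt y"
    using ob al_nat[of "idt P" "bra z x" "idt y", OF _ _ _ refl refl refl refl refl refl, THEN reassoc]
    by (simp add: cmp_assoc)
  also have "\<dots> = ali P (x \<odot> y) z \<bullet> idt P \<star> ali x y z \<bullet> idt P \<star> (idt x \<star> bra z y) \<bullet> al P x (z \<odot> y)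
      \<bullet> al (P \<odot> x) z y \<bullet> ali P x z \<star> idt y \<bullet> (idt P \<star> bra z x) \<star> idt y \<bullet> al P z x \<star> idt y"
    using ob p2[THEN reassoc] by (simp add: cmp_assoc)
  also have "\<dots> = ali P (x \<odot> y) z \<bullet> idt P \<star> ali x y z \<bullet> al P x (y \<odot> z) \<bullet> idt (P \<odot> x) \<star> bra z y
      \<bullet> al (P \<odot> x) z y \<bullet> ali P x z \<star> idt y \<bullet> (idt P \<star> bra z x) \<star> idt y \<bullet> al P z x \<star> idt y"
    using ob al_nat[of "idt P" "idt x" "bra z y", OF _ _ _ refl refl refl refl refl refl, symmetric, THEN reassoc]
    by (simp add: cmp_assoc)
  also have "\<dots> = al P x y \<star> idt z \<bullet> ali (P \<odot> x) y z \<bullet> idt (P \<odot> x) \<star> bra z y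
      \<bullet> al (P \<odot> x) z y \<bullet> ali P x z \<star> idt y \<bullet> (idt P \<star> bra z x) \<star> idt y \<bullet> al P z x \<star> idt y"
    using arg_cong[OF p3, of "\<lambda>h. h \<bullet> idt (P \<odot> x) \<star> bra z y \<bullet> al (P \<odot> x) z y \<bullet> ali P x z \<star> idt y
       \<bullet> (idt P \<star> bra z x) \<star> idt y \<bullet> al P z x \<star> idt y"] by (simp add: cmp_assoc)
  also have "\<dots> = al P x y \<star> idt z \<bullet> sg (P \<odot> x) z y \<bullet> sg P z x \<star> idt y"
    unfolding sg_def using ob by (simp add: cmp_assoc wr_cmp)
  finally show ?thesis ..
qed

text \<open>Length two is \<open>hexagon_sg\<close>; length zero is the unit law of the symmetry,
  \<open>lun_bra\<close>, combined with the triangle axiom.\<close>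

lemma bet_kw: assumes "short xs" "P \<in> Ob C" "z \<in> Ob C"
  shows "bet P xs \<star> idt z \<bullet> kw P z xs = sg P z (brk xs) \<bullet> bet (P \<odot> z) xs"
  using assms(1)
proof (cases rule: short_cases)
  case 1
  have b: "bra z \<I> \<bullet> runi z = luni z"
  proof (rule isom_mono[of "lun z"])
    show "lun z \<bullet> bra z \<I> \<bullet> runi z = lun z \<bullet> luni z"
      using assms lun_bra[of z, THEN reassoc] by simp
  qed (use assms in simp_all)
  have t0: "run P \<star> idt z \<bullet> ali P \<I> z = idt P \<star> lun z"
    using assms by (simp add: triangle_al[symmetric] cmp_assoc)
  have t: "ali P \<I> z \<bullet> idt P \<star> luni z = runi P \<star> idt z"
  proof (rule isom_mono[of "run P \<star> idt z"])
    show "run P \<star> idt z \<bullet> ali P \<I> z \<bullet> idt P \<star> luni z = run P \<star> idt z \<bullet> runi P \<star> idt z"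
      using assms by (simp add: t0[THEN reassoc] wl_cmp[symmetric] wr_cmp[symmetric])
  qed (use assms in simp_all)
  have "sg P z \<I> \<bullet> runi (P \<odot> z) = ali P \<I> z \<bullet> idt P \<star> bra z \<I> \<bullet> idt P \<star> runi z"
    using assms by (simp add: sg_def cmp_assoc runi_tensor)
  also have "\<dots> = runi P \<star> idt z" using assms by (simp add: wl_cmp[symmetric] b t)
  finally show ?thesis using 1 assms by simp
next
  case 3 then show ?thesis using assms hexagon_sg by simp
qed (use assms in simp)

definition fam where "fam xs ys f P = beti P ys \<bullet> idt P \<star> f \<bullet> bet P xs"

text \<open>Through \<open>bet_nat\<close>, \<open>bet_aw\<close> and \<open>bet_kw\<close> the
  three laws reduce to the interchange law and to naturality of the associator and of the
  swap.\<close>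

lemma oper_fam:
  assumes s: "short xs" "short ys" and f: "mor f" "dm f = brk xs" "cd f = brk ys"
  shows "oper (fam xs ys f) xs ys"
proof (rule operI)
  note sh = short_Ob[OF s(1)] short_Ob[OF s(2)]
  fix g assume g: "mor g"
  have b: "rw ys g \<bullet> beti (dm g) ys = beti (cd g) ys \<bullet> g \<star> idt (brk ys)"
  proof (rule isom_mono[of "bet (cd g) ys"])
    show "bet (cd g) ys \<bullet> rw ys g \<bullet> beti (dm g) ys = bet (cd g) ys \<bullet> beti (cd g) ys \<bullet> g \<star> idt (brk ys)"
      using bet_nat[OF s(2) g, symmetric, THEN reassoc] s g by (simp add: cmp_assoc bet_simps(7)[THEN reassoc])
  qed (use s g sh in simp_all)
  show "rw ys g \<bullet> fam xs ys f (dm g) = fam xs ys f (cd g) \<bullet> rw xs g"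
    unfolding fam_def using f g s
    by (simp add: cmp_assoc b[THEN reassoc] bet_nat[symmetric] interchange[OF g f(1) refl refl f(2,3), THEN reassoc])
next
  note sh = short_Ob[OF s(1)] short_Ob[OF s(2)]
  fix Q P assume o: "Q \<in> Ob C" "P \<in> Ob C"
  have b: "aw Q P ys \<bullet> beti (Q \<odot> P) ys = idt Q \<star> beti P ys \<bullet> al Q P (brk ys)"
  proof (rule isom_mono[of "idt Q \<star> bet P ys"])
    show "idt Q \<star> bet P ys \<bullet> aw Q P ys \<bullet> beti (Q \<odot> P) ys
        = idt Q \<star> bet P ys \<bullet> idt Q \<star> beti P ys \<bullet> al Q P (brk ys)"
      using bet_aw[OF s(2) o, THEN reassoc] s o by (simp add: cmp_assoc wl_cmp[symmetric, THEN reassoc])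
  qed (use s o sh in simp_all)
  show "aw Q P ys \<bullet> fam xs ys f (Q \<odot> P) = idt Q \<star> fam xs ys f P \<bullet> aw Q P xs"
    unfolding fam_def using f o s al_nat[of "idt Q" "idt P" f, OF _ _ _ refl refl refl refl refl refl, THEN reassoc]
    by (simp add: cmp_assoc b[THEN reassoc] bet_aw wl_cmp)
next
  note sh = short_Ob[OF s(1)] short_Ob[OF s(2)]
  fix P x assume o: "P \<in> Ob C" "x \<in> Ob C"
  have b: "kw P x ys \<bullet> beti (P \<odot> x) ys = beti P ys \<star> idt x \<bullet> sg P x (brk ys)"
  proof (rule isom_mono[of "bet P ys \<star> idt x"])
    show "bet P ys \<star> idt x \<bullet> kw P x ys \<bullet> beti (P \<odot> x) ys
        = bet P ys \<star> idt x \<bullet> beti P ys \<star> idt x \<bullet> sg P x (brk ys)"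
      using bet_kw[OF s(2) o, THEN reassoc] s o by (simp add: cmp_assoc wr_cmp[symmetric, THEN reassoc])
  qed (use s o sh in simp_all)
  show "kw P x ys \<bullet> fam xs ys f (P \<odot> x) = fam xs ys f P \<star> idt x \<bullet> kw P x xs"
    unfolding fam_def using f o s whisker_sg[of f, OF _ refl refl, THEN reassoc]
    by (simp add: cmp_assoc b[THEN reassoc] bet_kw wr_cmp)
qed (use s f in \<open>simp_all add: fam_def short_Ob\<close>)

text \<open>Families are rigid: compatibility with \<open>aw\<close> determines the value at P \<I>
  from the value at \<I>, and naturality along the invertible \<open>run P\<close> determines the
  value at P.\<close>

lemma oper_ext:
  assumes F: "oper F xs ys" and G: "oper G xs ys" and e: "F \<I> = G \<I>" and P: "P \<in> Ob C"
  shows "F P = G P"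
proof -
  note f = operD[OF F] and g = operD[OF G]
  have "aw P \<I> ys \<bullet> F (P \<odot> \<I>) = aw P \<I> ys \<bullet> G (P \<odot> \<I>)"
    using f(7)[of P \<I>] g(7)[of P \<I>] P e by simp
  then have e': "F (P \<odot> \<I>) = G (P \<odot> \<I>)"
    by (rule isom_mono[rotated]) (use P f(1-5) g(1-5) in simp_all)
  have "F P \<bullet> rw xs (run P) = G P \<bullet> rw xs (run P)"
    using f(6)[of "run P" "P \<odot> \<I>" P] g(6)[of "run P" "P \<odot> \<I>" P] P e' by simp
  then show ?thesis
    by (rule isom_epi[rotated]) (use P f(1-5) g(1-5) in simp_all)
qed

lemma fam_unit_ex:
  assumes k: "mor k" "dm k = ob \<I> xs" "cd k = ob \<I> ys" and s: "short xs" "short ys"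
  obtains f where "mor f" "dm f = brk xs" "cd f = brk ys" "fam xs ys f \<I> = k"
proof -
  \<comment> \<open>The equation \<open>fam xs ys f \<I> = k\<close> solved for \<open>f\<close>:
    the rebracketings are cancelled and the whiskering with \<I> is undone by
    \<open>lun\<close>.\<close>
  define f where "f = lun (brk ys) \<bullet> bet \<I> ys \<bullet> k \<bullet> beti \<I> xs \<bullet> luni (brk xs)"
  have m: "mor f" "dm f = brk xs" "cd f = brk ys" using s k by (simp_all add: f_def)
  have "idt \<I> \<star> f = luni (brk ys) \<bullet> lun (brk ys) \<bullet> idt \<I> \<star> f"
    using m s by (simp add: luni_lun[THEN reassoc])
  also have "\<dots> = luni (brk ys) \<bullet> f \<bullet> lun (brk xs)" by (simp only: lun_nat[OF m])
  also have "\<dots> = bet \<I> ys \<bullet> k \<bullet> beti \<I> xs"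
    unfolding f_def using s k by (simp add: cmp_assoc luni_lun[THEN reassoc])
  finally have "fam xs ys f \<I> = k"
    unfolding fam_def using s k by (simp add: cmp_assoc bet_simps(8)[THEN reassoc])
  then show thesis using that m by blast
qed

text \<open>Converse of \<open>oper_fam\<close>: the value at \<I> yields the morphism, and rigidity
  extends the equality to all prefixes.\<close>

lemma oper_fam_ex:
  assumes F: "oper F xs ys" and s: "short xs" "short ys"
  obtains f where "mor f" "dm f = brk xs" "cd f = brk ys" "\<And>P. P \<in> Ob C \<Longrightarrow> F P = fam xs ys f P"
proof -
  note o = operD[OF F]
  obtain f where f: "mor f" "dm f = brk xs" "cd f = brk ys" "fam xs ys f \<I> = F \<I>"
    using fam_unit_ex[of "F \<I>" xs ys] o(3-5) s by auto
  then have "F P = fam xs ys f P" if "P \<in> Ob C" for P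
    using oper_ext[OF F oper_fam[OF s f(1-3)]] that by simp
  then show thesis using that f by blast
qed

end

section \<open>Labelled legs\<close>

context symmetric_monoidal_category
begin

lemma oper_sg: assumes "x \<in> Ob C" "y \<in> Ob C" shows "oper (\<lambda>P. sg P x y) [y, x] [x, y]"
proof -
  have "(\<lambda>P. sg P x y) = fam [y, x] [x, y] (bra x y)" by (auto simp: fam_def sg_def)
  then show ?thesis using assms by (simp add: oper_fam)
qed

text \<open>The \<open>kw\<close> law of the family \<open>sg\<close>, spelled out for its two
  letters, is exactly this equation.\<close>

lemma yang_baxter:
  assumes "R \<in> Ob C" "y \<in> Ob C" "a \<in> Ob C" "b \<in> Ob C"
  shows "sg R a b \<star> idt y \<bullet> sg (R \<odot> a) y b \<bullet> sg R y a \<star> idt b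
     = sg (R \<odot> b) y a \<bullet> sg R y b \<star> idt a \<bullet> sg (R \<odot> y) a b"
  using operD(8)[OF oper_sg, of a b R y] assms by (simp add: cmp_assoc)

end

section \<open>Words of labelled letters and their sorting\<close>

locale legs = symmetric_monoidal_category C
  for C :: "('o, 'm, 'z) brmoncat_scheme" (structure) +
  fixes ty :: "nat \<Rightarrow> 'o"
  assumes ty_Ob[simp]: "ty n \<in> Ob C"
begin

abbreviation "obl l \<equiv> ob \<I> (map ty l)"
abbreviation "rwl l \<equiv> rw (map ty l)"

lemma ty_sub[simp]: "ty ` A \<subseteq> Ob C" by auto

text \<open>Sorting puts the largest label rightmost, that is, at the head of the list.\<close>

primrec insl :: "nat \<Rightarrow> nat list \<Rightarrow> nat list" where
  "insl x [] = [x]" | "insl x (y # ys) = (if y < x then x # y # ys else y # insl x ys)"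
text \<open>The permutation of tensor factors that accompanies \<open>insl\<close>;
  \<open>srt\<close> accompanies \<open>srtl\<close> in the same way.\<close>

primrec insm :: "nat \<Rightarrow> nat list \<Rightarrow> 'o \<times> 'm option \<times> 'o" where
  "insm x [] = idt (\<I> \<odot> ty x)" |
  "insm x (y # ys) = (if y < x then idt (obl ys \<odot> ty y \<odot> ty x)
     else insm x ys \<star> idt (ty y) \<bullet> sg (obl ys) (ty y) (ty x))"
primrec srtl :: "nat list \<Rightarrow> nat list" where
  "srtl [] = []" | "srtl (x # xs) = insl x (srtl xs)"
primrec srt :: "nat list \<Rightarrow> 'o \<times> 'm option \<times> 'o" where
  "srt [] = idt \<I>" | "srt (x # xs) = insm x (srtl xs) \<bullet> srt xs \<star> idt (ty x)"

definition can :: "nat set \<Rightarrow> nat list" where "can S = rev (sorted_list_of_set S)"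

lemma dm_insm[simp]: "dm (insm x l) = obl l \<odot> ty x" and cd_insm[simp]: "cd (insm x l) = obl (insl x l)"
  by (induction l) auto
lemma isom_sg[simp]: "P \<in> Ob C \<Longrightarrow> x \<in> Ob C \<Longrightarrow> y \<in> Ob C \<Longrightarrow> isom (sg P x y)"
  by (simp add: sg_def)
lemma isom_insm[simp]: "isom (insm x l)" by (induction l) auto
lemma mor_insm[simp]: "mor (insm x l)" by simp

lemma set_insl[simp]: "set (insl x l) = insert x (set l)" by (induction l) auto
lemma set_srtl[simp]: "set (srtl l) = set l" by (induction l) auto
lemma insl_sorted: "x \<notin> set l \<Longrightarrow> sorted_wrt (>) l \<Longrightarrow> sorted_wrt (>) (insl x l)"
  by (induction l) (auto simp: not_less order_le_less)
lemma srtl_sorted: "distinct l \<Longrightarrow> sorted_wrt (>) (srtl l)"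
  by (induction l) (auto intro: insl_sorted)

lemma srtl_can: assumes "distinct l" shows "srtl l = can (set l)"
proof -
  have "sorted_wrt (<) (rev (srtl l))" using srtl_sorted[OF assms] by (simp add: sorted_wrt_rev)
  then have "rev (srtl l) = sorted_list_of_set (set l)"
    by (intro strict_sorted_equal) auto
  then show ?thesis unfolding can_def by (metis rev_rev_ident)
qed

lemma can_simps[simp]: "finite S \<Longrightarrow> set (can S) = S" "distinct (can S)"
  by (auto simp: can_def)

lemma dm_srt[simp]: "dm (srt l) = obl l" and cd_srt[simp]: "cd (srt l) = obl (srtl l)"
  by (induction l) auto
lemma isom_srt[simp]: "isom (srt l)" by (induction l) auto

text \<open>The substantial case is the one where both letters pass the head y: there the equation
  is Yang-Baxter together with naturality of the swap.\<close>

lemma insm_swap_less: "a < b \<Longrightarrow> insm b (insl a l) \<bullet> insm a l \<star> idt (ty b)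
    = insm a (insl b l) \<bullet> insm b l \<star> idt (ty a) \<bullet> sg (obl l) (ty a) (ty b)"
proof (induction l)
  case Nil then show ?case by (simp add: sg_sg cmp_assoc)
next
  case (Cons y l)
  consider "y < a" | "a \<le> y" "y < b" | "b \<le> y" using Cons.prems by linarith
  then show ?case
  proof cases
    case 3
    have "insm b (insl a (y # l)) \<bullet> insm a (y # l) \<star> idt (ty b)
       = insm b (insl a l) \<star> idt (ty y) \<bullet> sg (obl (insl a l)) (ty y) (ty b)
           \<bullet> insm a l \<star> idt (ty y) \<star> idt (ty b) \<bullet> sg (obl l) (ty y) (ty a) \<star> idt (ty b)"
      using 3 Cons.prems by (simp add: wr_cmp cmp_assoc)
    also have "\<dots> = (insm b (insl a l) \<bullet> insm a l \<star> idt (ty b)) \<star> idt (ty y)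
           \<bullet> sg (obl l \<odot> ty a) (ty y) (ty b) \<bullet> sg (obl l) (ty y) (ty a) \<star> idt (ty b)"
      using sg_nat[of "insm a l" "ty y" "ty b", THEN reassoc] by (simp add: wr_cmp cmp_assoc)
    also have "\<dots> = insm a (insl b l) \<star> idt (ty y) \<bullet> insm b l \<star> idt (ty a) \<star> idt (ty y)
         \<bullet> sg (obl l) (ty a) (ty b) \<star> idt (ty y)
         \<bullet> sg (obl l \<odot> ty a) (ty y) (ty b) \<bullet> sg (obl l) (ty y) (ty a) \<star> idt (ty b)"
      unfolding Cons.IH[OF Cons.prems] by (simp add: wr_cmp cmp_assoc)
    also have "\<dots> = insm a (insl b l) \<star> idt (ty y) \<bullet> insm b l \<star> idt (ty a) \<star> idt (ty y)
         \<bullet> sg (obl l \<odot> ty b) (ty y) (ty a) \<bullet> sg (obl l) (ty y) (ty b) \<star> idt (ty a)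
         \<bullet> sg (obl l \<odot> ty y) (ty a) (ty b)"
      by (simp add: yang_baxter)
    also have "\<dots> = insm a (insl b l) \<star> idt (ty y) \<bullet> sg (obl (insl b l)) (ty y) (ty a)
         \<bullet> insm b l \<star> idt (ty y) \<star> idt (ty a) \<bullet> sg (obl l) (ty y) (ty b) \<star> idt (ty a)
         \<bullet> sg (obl l \<odot> ty y) (ty a) (ty b)"
      using sg_nat[of "insm b l" "ty y" "ty a", THEN reassoc] by (simp add: cmp_assoc)
    also have "\<dots> = insm a (insl b (y # l)) \<bullet> insm b (y # l) \<star> idt (ty a) \<bullet> sg (obl (y # l)) (ty a) (ty b)"
      using 3 Cons.prems by (simp add: wr_cmp cmp_assoc)
    finally show ?thesis .
  qed (use Cons.prems in \<open>simp_all add: sg_sg cmp_assoc\<close>)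
qed

lemma insm_swap: assumes "a \<noteq> b"
  shows "insm b (insl a l) \<bullet> insm a l \<star> idt (ty b)
    = insm a (insl b l) \<bullet> insm b l \<star> idt (ty a) \<bullet> sg (obl l) (ty a) (ty b)"
proof (cases "a < b")
  case False
  then show ?thesis using assms insm_swap_less[of b a l]
    by (simp add: cmp_assoc insm_swap_less[of b a l, THEN reassoc] sg_sg)
qed (rule insm_swap_less)

text \<open>Sorting absorbs a swap of the two last letters; this is what makes elements independent
  of the order in which their factors are listed.\<close>

lemma srt_swap: assumes "a \<noteq> b"
  shows "srt (b # a # p) = srt (a # b # p) \<bullet> sg (obl p) (ty a) (ty b)"
proof -
  have "srt (b # a # p) = (insm b (insl a (srtl p)) \<bullet> insm a (srtl p) \<star> idt (ty b)) \<bullet> srt p \<star> idt (ty a) \<star> idt (ty b)"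
    by (simp add: wr_cmp cmp_assoc)
  also have "\<dots> = insm a (insl b (srtl p)) \<bullet> insm b (srtl p) \<star> idt (ty a) \<bullet> srt p \<star> idt (ty b) \<star> idt (ty a) \<bullet> sg (obl p) (ty a) (ty b)"
    unfolding insm_swap[OF assms] using sg_nat[of "srt p" "ty a" "ty b"] by (simp add: cmp_assoc)
  also have "\<dots> = srt (a # b # p) \<bullet> sg (obl p) (ty a) (ty b)" by (simp add: wr_cmp cmp_assoc)
  finally show ?thesis .
qed

text \<open>Inserts the letters \<open>q\<close> into an already sorted word; by
  \<open>srt_append\<close> the sorting of \<open>q @ r\<close> factors through the sorting of
  \<open>r\<close>.\<close>

primrec srtm :: "nat list \<Rightarrow> nat list \<Rightarrow> 'o \<times> 'm option \<times> 'o" where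
  "srtm [] l = idt (obl l)" | "srtm (x # q) l = insm x (foldr insl q l) \<bullet> srtm q l \<star> idt (ty x)"

lemma srtl_append: "srtl (q @ r) = foldr insl q (srtl r)" by (induction q) auto
lemma dm_srtm[simp]: "dm (srtm q l) = ob (obl l) (map ty q)" and cd_srtm[simp]: "cd (srtm q l) = obl (foldr insl q l)"
  by (induction q) auto

lemma srt_append: "srt (q @ r) = srtm q (srtl r) \<bullet> rwl q (srt r)"
  by (induction q) (simp_all add: srtl_append wr_cmp cmp_assoc)

definition srti :: "nat list \<Rightarrow> 'o \<times> 'm option \<times> 'o" where
  "srti l = (SOME g. mor g \<and> dm g = obl (srtl l) \<and> cd g = obl l \<and> g \<bullet> srt l = idt (obl l) \<and> srt l \<bullet> g = idt (obl (srtl l)))"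

lemma srti: "mor (srti l) \<and> dm (srti l) = obl (srtl l) \<and> cd (srti l) = obl l \<and>
    srti l \<bullet> srt l = idt (obl l) \<and> srt l \<bullet> srti l = idt (obl (srtl l))"
  unfolding srti_def by (rule someI_ex) (use isom_srt[of l] in \<open>unfold isom_def, auto\<close>)

lemma srti_simps[simp]: "mor (srti l)" "dm (srti l) = obl (srtl l)" "cd (srti l) = obl l"
    "srti l \<bullet> srt l = idt (obl l)" "srt l \<bullet> srti l = idt (obl (srtl l))"
  using srti by blast+

text \<open>Generalised elements of an unordered tensor product: a pair \<open>(S, g)\<close>, where \<open>g\<close> is a morphism into the
  product of the objects \<open>ty n\<close>, \<open>n \<in> S\<close>, taken in increasing order of the labels.\<close>

definition El :: "nat set \<Rightarrow> (nat set \<times> ('o \<times> 'm option \<times> 'o)) set" where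
  "El S = {x. fst x = S \<and> finite S \<and> mor (snd x) \<and> cd (snd x) = obl (can S)}"
text \<open>\<open>at x l\<close> reads the element \<open>x\<close> in the order \<open>l\<close>,
  as a morphism into the word \<open>l\<close>; \<open>mk l\<close> is the inverse
  operation.\<close>

definition at :: "nat set \<times> ('o \<times> 'm option \<times> 'o) \<Rightarrow> nat list \<Rightarrow> 'o \<times> 'm option \<times> 'o" where
  "at x l = srti l \<bullet> snd x"
definition mk :: "nat list \<Rightarrow> 'o \<times> 'm option \<times> 'o \<Rightarrow> nat set \<times> ('o \<times> 'm option \<times> 'o)" where
  "mk l h = (set l, srt l \<bullet> h)"

lemma El_fin: "x \<in> El S \<Longrightarrow> finite S" and El_fst: "x \<in> El S \<Longrightarrow> fst x = S"
  by (auto simp: El_def)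

lemma dm_at[simp]: "dm (at x l) = dm (snd x)" and cd_at[simp]: "cd (at x l) = obl l"
  by (simp_all add: at_def)
lemma mor_at: "x \<in> El S \<Longrightarrow> distinct l \<Longrightarrow> set l = S \<Longrightarrow> mor (at x l)"
  by (auto simp: at_def El_def srtl_can)

lemma mk_El: "distinct l \<Longrightarrow> set l = S \<Longrightarrow> mor h \<Longrightarrow> cd h = obl l \<Longrightarrow> mk l h \<in> El S"
  by (auto simp: mk_def El_def srtl_can)
lemma at_mk: "mor h \<Longrightarrow> cd h = obl l \<Longrightarrow> at (mk l h) l = h"
  by (simp add: at_def mk_def srti_simps(4)[THEN reassoc])
lemma mk_at: "x \<in> El S \<Longrightarrow> distinct l \<Longrightarrow> set l = S \<Longrightarrow> mk l (at x l) = x"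
  by (cases x) (auto simp: at_def mk_def El_def srti_simps(5)[THEN reassoc] srtl_can)
lemma El_eqI: "x \<in> El S \<Longrightarrow> y \<in> El S \<Longrightarrow> distinct l \<Longrightarrow> set l = S \<Longrightarrow> at x l = at y l \<Longrightarrow> x = y"
  by (metis mk_at)

text \<open>Both readings become \<open>snd x\<close> when sorted, and the sorting of
  \<open>q @ r\<close> starts with that of \<open>r\<close>; so a change of order within
  \<open>r\<close> is a map of prefixes, whiskered by \<open>q\<close>.\<close>

lemma at_reorder:
  assumes x: "x \<in> El S" and d: "distinct (q @ r)" "set (q @ r) = S" "distinct r'" "set r' = set r"
  shows "at x (q @ r') = rwl q (srti r' \<bullet> srt r) \<bullet> at x (q @ r)"
proof -
  have s: "srtl r' = srtl r" using d by (simp add: srtl_can)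
  have "srt (q @ r') \<bullet> at x (q @ r') = srt (q @ r') \<bullet> rwl q (srti r' \<bullet> srt r) \<bullet> at x (q @ r)"
  proof -
    have l: "srt (q @ r') \<bullet> at x (q @ r') = snd x" if "distinct (q @ r')" "set (q @ r') = S" for r'
      using x that unfolding at_def El_def by (auto simp: srti_simps(5)[THEN reassoc] srtl_can simp del: set_append distinct_append)
    have "srt (q @ r') \<bullet> rwl q (srti r' \<bullet> srt r) = srtm q (srtl r) \<bullet> rwl q (srt r' \<bullet> srti r' \<bullet> srt r)"
      using d by (simp add: srt_append s cmp_assoc rw_cmp)
    also have "\<dots> = srt (q @ r)"
      by (simp add: srt_append srti_simps(5)[THEN reassoc] s)
    finally have "srt (q @ r') \<bullet> rwl q (srti r' \<bullet> srt r) = srt (q @ r)" .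
    then show ?thesis using l[of r'] l[of r] d by (simp add: cmp_assoc[symmetric])
  qed
  then show ?thesis
    by (rule isom_mono[rotated]) (use x d in \<open>auto intro!: mor_at[OF x] simp: s\<close>)
qed

text \<open>By \<open>srt_swap\<close> the reordering isomorphism of two adjacent legs is the
  symmetry itself.\<close>

lemma at_swap:
  assumes x: "x \<in> El S" and d: "distinct (q @ b # a # p)" "set (q @ b # a # p) = S"
  shows "at x (q @ a # b # p) = rwl q (sg (obl p) (ty a) (ty b)) \<bullet> at x (q @ b # a # p)"
proof -
  have "srti (a # b # p) \<bullet> srt (b # a # p) = srti (a # b # p) \<bullet> srt (a # b # p) \<bullet> sg (obl p) (ty a) (ty b)"
    using d srt_swap[of a b p] by simp
  also have "\<dots> = sg (obl p) (ty a) (ty b)"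
    unfolding srti_simps(4)[THEN reassoc] by simp
  finally have "srti (a # b # p) \<bullet> srt (b # a # p) = sg (obl p) (ty a) (ty b)" .
  then show ?thesis using at_reorder[OF x, of q "b # a # p" "a # b # p"] d by auto
qed

text \<open>Iteration of \<open>at_swap\<close>, one letter of \<open>js\<close> at a time.\<close>

lemma at_kw:
  assumes x: "x \<in> El S" and d: "distinct (q @ z # js @ p)" "set (q @ z # js @ p) = S"
  shows "at x (q @ z # js @ p) = rwl q (kw (obl p) (ty z) (map ty js)) \<bullet> at x (q @ js @ z # p)"
  using d
proof (induction js arbitrary: q)
  case Nil then show ?case using x mor_at[OF x, of "q @ z # p"] by simp
next
  case (Cons j js)
  have 1: "at x (q @ z # j # js @ p) = rwl q (sg (obl (js @ p)) (ty z) (ty j)) \<bullet> at x (q @ j # z # js @ p)"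
    using Cons.prems by (intro at_swap[OF x]) auto
  have 2: "at x ((q @ [j]) @ z # js @ p) = rwl (q @ [j]) (kw (obl p) (ty z) (map ty js)) \<bullet> at x ((q @ [j]) @ js @ z # p)"
    using Cons.prems by (intro Cons.IH) auto
  show ?case using 1 2 by (simp add: rw_cmp cmp_assoc)
qed

text \<open>The untouched legs, in sorted order, form the prefix \<open>r\<close>; by
  \<open>act_at\<close> any other order of them gives the same element. The lists \<open>is\<close>
  and \<open>js\<close> name the legs consumed and produced, rightmost first.\<close>

definition act where
  "act F is js x = (let r = can (fst x - set is) in mk (js @ r) (F (obl r) \<bullet> at x (is @ r)))"

definition lop where
  "lop F is js \<longleftrightarrow> oper F (map ty is) (map ty js) \<and> distinct is \<and> distinct js"
text \<open>Produced labels may reuse consumed ones, but must not clash with the legs that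
  stay.\<close>

definition ready where
  "ready is js S \<longleftrightarrow> set is \<subseteq> S \<and> set js \<inter> (S - set is) = {}"

lemma lopD:
  assumes "lop F is js"
  shows "oper F (map ty is) (map ty js)" "distinct is" "distinct js"
    "P \<in> Ob C \<Longrightarrow> mor (F P)" "P \<in> Ob C \<Longrightarrow> dm (F P) = ob P (map ty is)" "P \<in> Ob C \<Longrightarrow> cd (F P) = ob P (map ty js)"
  using assms operD(3-5)[of F "map ty is" "map ty js"] unfolding lop_def by blast+

lemma act_El:
  assumes x: "x \<in> El S" and F: "lop F is js" and r: "ready is js S"
  shows "act F is js x \<in> El (S - set is \<union> set js)"
proof -
  have f: "finite S" "fst x = S" using x by (auto simp: El_def)
  have "distinct (js @ can (S - set is))" "set (js @ can (S - set is)) = S - set is \<union> set js"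
    "distinct (is @ can (S - set is))" "set (is @ can (S - set is)) = S"
    using f r lopD(2,3)[OF F] by (auto simp: ready_def)
  then show ?thesis unfolding act_def Let_def f(2) using lopD(4-6)[OF F]
    by (intro mk_El) (auto intro!: mor_at[OF x])
qed

lemma act_El': "x \<in> El S \<Longrightarrow> lop F is js \<Longrightarrow> ready is js S \<Longrightarrow> S' = S - set is \<union> set js \<Longrightarrow> act F is js x \<in> El S'"
  using act_El by simp

text \<open>Reordering the untouched legs is a map of prefixes, along which \<open>F\<close> is
  natural.\<close>

lemma act_at:
  assumes x: "x \<in> El S" and F: "lop F is js" and rd: "ready is js S" and r: "distinct r" "set r = S - set is"
  shows "at (act F is js x) (js @ r) = F (obl r) \<bullet> at x (is @ r)"
proof -
  let ?c = "can (S - set is)"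
  have f: "finite S" "fst x = S" using x by (auto simp: El_def)
  have d: "distinct (js @ ?c)" "set (js @ ?c) = S - set is \<union> set js" "distinct (js @ r)"
    "distinct (is @ ?c)" "set (is @ ?c) = S" "distinct (is @ r)" "set r = set ?c"
    using f rd r lopD(2,3)[OF F] by (auto simp: ready_def)
  have m: "mor (at x (is @ ?c))" using mor_at[OF x] d by blast
  have 0: "at (act F is js x) (js @ ?c) = F (obl ?c) \<bullet> at x (is @ ?c)"
    unfolding act_def Let_def f(2) using lopD(4-6)[OF F] m by (intro at_mk) auto
  have s: "srtl r = srtl ?c" using r d by (simp add: srtl_can)
  have 1: "at (act F is js x) (js @ r) = rwl js (srti r \<bullet> srt ?c) \<bullet> at (act F is js x) (js @ ?c)"
    by (rule at_reorder[OF act_El[OF x F rd] d(1,2)]) (use r d in auto)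
  have 2: "at x (is @ r) = rwl is (srti r \<bullet> srt ?c) \<bullet> at x (is @ ?c)"
    by (rule at_reorder[OF x d(4,5)]) (use r d in auto)
  have "rwl js (srti r \<bullet> srt ?c) \<bullet> F (obl ?c) = F (obl r) \<bullet> rwl is (srti r \<bullet> srt ?c)"
    by (rule operD(6)[OF lopD(1)[OF F]]) (use s in simp_all)
  then show ?thesis unfolding 1 2 0 by (simp add: cmp_assoc[symmetric])
qed

text \<open>Induction on \<open>q\<close>: the letter of \<open>q\<close> next to the acting legs is
  moved into the prefix, and the \<open>kw\<close> law of \<open>F\<close> moves it back.\<close>

lemma act_at_mid:
  assumes x: "x \<in> El S" and F: "lop F is js" and rd: "ready is js S" and r: "distinct (q @ is @ p)" "set (q @ is @ p) = S"
  shows "at (act F is js x) (q @ js @ p) = rwl q (F (obl p)) \<bullet> at x (q @ is @ p)"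
  using r
proof (induction q arbitrary: p rule: rev_induct)
  case Nil
  then show ?case using act_at[OF x F rd, of p] by auto
next
  case (snoc z q)
  have S': "distinct (q @ z # js @ p)" "set (q @ z # js @ p) = S - set is \<union> set js"
    using snoc.prems lopD(2,3)[OF F] rd by (auto simp: ready_def)
  have "at (act F is js x) (q @ z # js @ p) = rwl q (kw (obl p) (ty z) (map ty js)) \<bullet> at (act F is js x) (q @ js @ z # p)"
    by (rule at_kw[OF act_El[OF x F rd] S'])
  also have "\<dots> = rwl q (kw (obl p) (ty z) (map ty js)) \<bullet> rwl q (F (obl (z # p))) \<bullet> at x (q @ is @ z # p)"
    using snoc.IH[of "z # p"] snoc.prems by auto
  also have "\<dots> = rwl q (F (obl p) \<star> idt (ty z)) \<bullet> rwl q (kw (obl p) (ty z) (map ty is)) \<bullet> at x (q @ is @ z # p)"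
    using operD(8)[OF lopD(1)[OF F], of "obl p" "ty z"] lopD(4-6)[OF F]
    by (simp add: rw_cmp[symmetric, THEN reassoc])
  also have "\<dots> = rwl (q @ [z]) (F (obl p)) \<bullet> at x (q @ z # is @ p)"
    using at_kw[OF x, of q z "is" p] snoc.prems by simp
  finally show ?case by simp
qed

end

section \<open>Calculus of operations on labelled legs\<close>

context legs
begin

lemma act_cong: "finite (fst x) \<Longrightarrow> (\<And>P. P \<in> Ob C \<Longrightarrow> F P = G P) \<Longrightarrow> act F is js x = act G is js x"
  by (simp add: act_def Let_def)

text \<open>All three actions are computed over the same prefix of untouched legs; hence the
  intermediate labels \<open>js\<close> have to avoid it as well.\<close>

lemma act_cmp:
  assumes x: "x \<in> El S" and F: "lop F is js" and G: "lop G js ks" and r: "ready is js S" "ready is ks S"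
  shows "act (\<lambda>P. G P \<bullet> F P) is ks x = act G js ks (act F is js x)"
proof -
  let ?r = "can (S - set is)"
  have f: "finite S" using x by (rule El_fin)
  have GF: "lop (\<lambda>P. G P \<bullet> F P) is ks" using F G by (auto simp: lop_def intro: oper_cmp)
  have r': "ready js ks (S - set is \<union> set js)" using r by (auto simp: ready_def)
  have y: "act F is js x \<in> El (S - set is \<union> set js)" by (rule act_El[OF x F r(1)])
  have s: "S - set is \<union> set js - set js \<union> set ks = S - set is \<union> set ks" 
    "S - set is \<union> set js - set js = S - set is" using r by (auto simp: ready_def)
  have "at (act (\<lambda>P. G P \<bullet> F P) is ks x) (ks @ ?r) = G (obl ?r) \<bullet> F (obl ?r) \<bullet> at x (is @ ?r)"
    using act_at[OF x GF r(2), of ?r] f by (simp add: cmp_assoc)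
  also have "\<dots> = at (act G js ks (act F is js x)) (ks @ ?r)"
    using act_at[OF y G r', of ?r] act_at[OF x F r(1), of ?r] f s by simp
  finally show ?thesis
    using act_El[OF x GF r(2)] act_El[OF y G r'] r lopD(3)[OF G] f unfolding s
    by (elim El_eqI) (auto simp: ready_def)
qed

text \<open>Together with \<open>act_pre\<close>, this drops bystander legs on the right or on the
  left, so that composites can be assembled from families of different widths.\<close>

lemma act_post:
  assumes x: "x \<in> El S" and F: "lop F is js" and r: "ready is js S" "y \<in> S" "y \<notin> set is" "y \<notin> set js"
  shows "act (\<lambda>P. F P \<star> idt (ty y)) (y # is) (y # js) x = act F is js x"
proof -
  let ?r = "can (S - set (y # is))"
  have f: "finite S" using x by (rule El_fin)
  have G: "lop (\<lambda>P. F P \<star> idt (ty y)) (y # is) (y # js)"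
    using F r oper_post[of F "map ty is" "map ty js" "ty y"] by (auto simp: lop_def)
  have r': "ready (y # is) (y # js) S" using r by (auto simp: ready_def)
  have "at (act (\<lambda>P. F P \<star> idt (ty y)) (y # is) (y # js) x) ((y # js) @ ?r) = F (obl ?r) \<star> idt (ty y) \<bullet> at x ((y # is) @ ?r)"
    by (rule act_at[OF x G r']) (use f in auto)
  also have "\<dots> = at (act F is js x) ((y # js) @ ?r)"
  proof -
    have "distinct ([y] @ is @ ?r)" "set ([y] @ is @ ?r) = S" using r lopD(2)[OF F] f by (auto simp: ready_def)
    from act_at_mid[OF x F r(1) this] show ?thesis by simp
  qed
  finally have e: "at (act (\<lambda>P. F P \<star> idt (ty y)) (y # is) (y # js) x) ((y # js) @ ?r) = at (act F is js x) ((y # js) @ ?r)" .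
  have "S - set (y # is) \<union> set (y # js) = S - set is \<union> set js" using r by auto
  then show ?thesis
    by (intro El_eqI[OF act_El[OF x G r'] act_El'[OF x F r(1)] _ _ e]) (use r lopD(3)[OF F] f in \<open>auto simp: ready_def\<close>)
qed

lemma act_pre:
  assumes x: "x \<in> El S" and F: "lop F is js" and r: "ready is js S" "set pre \<subseteq> S" "distinct pre"
    "set pre \<inter> set is = {}" "set pre \<inter> set js = {}"
  shows "act (\<lambda>P. F (ob P (map ty pre))) (is @ pre) (js @ pre) x = act F is js x"
proof -
  let ?r = "can (S - set (is @ pre))"
  have f: "finite S" using x by (rule El_fin)
  have G: "lop (\<lambda>P. F (ob P (map ty pre))) (is @ pre) (js @ pre)"
    using F r oper_pre[of F "map ty is" "map ty js" "map ty pre"] by (auto simp: lop_def)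
  have r': "ready (is @ pre) (js @ pre) S" using r by (auto simp: ready_def)
  have "at (act (\<lambda>P. F (ob P (map ty pre))) (is @ pre) (js @ pre) x) ((js @ pre) @ ?r) = F (ob (obl ?r) (map ty pre)) \<bullet> at x ((is @ pre) @ ?r)"
    by (rule act_at[OF x G r']) (use f in auto)
  also have "\<dots> = at (act F is js x) ((js @ pre) @ ?r)"
  proof -
    have "distinct (pre @ ?r)" "set (pre @ ?r) = S - set is" using r f by auto
    from act_at[OF x F r(1) this] show ?thesis by simp
  qed
  finally have e: "at (act (\<lambda>P. F (ob P (map ty pre))) (is @ pre) (js @ pre) x) ((js @ pre) @ ?r) = at (act F is js x) ((js @ pre) @ ?r)" .
  have "S - set (is @ pre) \<union> set (js @ pre) = S - set is \<union> set js" using r by auto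
  then show ?thesis
    by (intro El_eqI[OF act_El[OF x G r'] act_El'[OF x F r(1)] _ _ e]) (use r lopD(3)[OF F] f in \<open>auto simp: ready_def\<close>)
qed

lemma lop_sg: "a \<noteq> b \<Longrightarrow> lop (\<lambda>P. sg P (ty a) (ty b)) [b, a] [a, b]"
  by (auto simp: lop_def intro: oper_sg)

text \<open>The symmetry only changes the order in which the legs are listed; hence braidings
  disappear from all leg equations.\<close>

lemma act_swap:
  assumes x: "x \<in> El S" and r: "a \<noteq> b" "a \<in> S" "b \<in> S"
  shows "act (\<lambda>P. sg P (ty a) (ty b)) [b, a] [a, b] x = x"
proof -
  let ?r = "can (S - {a, b})" and ?y = "act (\<lambda>P. sg P (ty a) (ty b)) [b, a] [a, b] x"
  have f: "finite S" using x by (rule El_fin)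
  have r': "ready [b, a] [a, b] S" using r by (auto simp: ready_def)
  have "at ?y ([a, b] @ ?r) = sg (obl ?r) (ty a) (ty b) \<bullet> at x ([b, a] @ ?r)"
    by (rule act_at[OF x lop_sg[OF r(1)] r']) (use f in auto)
  also have "\<dots> = at x ([a, b] @ ?r)"
  proof -
    have "distinct ([] @ b # a # ?r)" "set ([] @ b # a # ?r) = S" using r f by auto
    from at_swap[OF x this] show ?thesis by simp
  qed
  finally show ?thesis
    by (rule El_eqI[rotated -1, OF _ act_El'[OF x lop_sg[OF r(1)] r', of S] x]) (use r f in auto)
qed

lemma lop_idt: "distinct is \<Longrightarrow> distinct js \<Longrightarrow> map ty is = map ty js \<Longrightarrow> lop (\<lambda>P. idt (ob P (map ty is))) is js"
  using oper_id[of "map ty is"] by (auto simp: lop_def)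

lemma act_idt:
  assumes x: "x \<in> El S" and r: "distinct is" "set is \<subseteq> S"
  shows "act (\<lambda>P. idt (ob P (map ty is))) is is x = x"
proof -
  let ?r = "can (S - set is)" and ?y = "act (\<lambda>P. idt (ob P (map ty is))) is is x"
  have f: "finite S" using x by (rule El_fin)
  have r': "ready is is S" using r by (auto simp: ready_def)
  have l: "lop (\<lambda>P. idt (ob P (map ty is))) is is" using r by (intro lop_idt) auto
  have "mor (at x (is @ ?r))" by (rule mor_at[OF x]) (use r f in auto)
  then have "at ?y (is @ ?r) = at x (is @ ?r)"
    using act_at[OF x l r', of ?r] f by auto
  then show ?thesis
    by (rule El_eqI[rotated -1, OF _ act_El'[OF x l r', of S] x]) (use r f in auto)
qed

text \<open>In the order \<open>ls @ js @ r\<close> the family \<open>F\<close> acts inside the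
  prefix of \<open>G\<close>, so the claim is naturality of \<open>G\<close> along
  \<open>F\<close>.\<close>

lemma act_comm:
  assumes x: "x \<in> El S" and F: "lop F is js" and G: "lop G ks ls"
    and r: "ready is js S" "ready ks ls S" "set is \<inter> set ks = {}" "set js \<inter> set ks = {}" "set is \<inter> set ls = {}" "set js \<inter> set ls = {}"
  shows "act F is js (act G ks ls x) = act G ks ls (act F is js x)"
proof -
  let ?r = "can (S - set is - set ks)"
  have f: "finite S" using x by (rule El_fin)
  have y: "act F is js x \<in> El (S - set is \<union> set js)" "act G ks ls x \<in> El (S - set ks \<union> set ls)"
    by (rule act_El[OF x F r(1)] act_El[OF x G r(2)])+
  have r': "ready is js (S - set ks \<union> set ls)" "ready ks ls (S - set is \<union> set js)"
    using r by (auto simp: ready_def)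
  have z: "act F is js (act G ks ls x) \<in> El (set ?r \<union> set js \<union> set ls)"
    "act G ks ls (act F is js x) \<in> El (set ?r \<union> set js \<union> set ls)"
    by (rule act_El'[OF y(2) F r'(1)] act_El'[OF y(1) G r'(2)], use r f in auto)+
  note l = lopD(2,3)[OF F] lopD(2,3)[OF G]
  have "at (act F is js (act G ks ls x)) (ls @ js @ ?r) = rwl ls (F (obl ?r)) \<bullet> at (act G ks ls x) (ls @ is @ ?r)"
    by (rule act_at_mid[OF y(2) F r'(1)]) (use r f l in \<open>auto simp: ready_def\<close>)
  also have "at (act G ks ls x) (ls @ is @ ?r) = G (obl (is @ ?r)) \<bullet> at x (ks @ is @ ?r)"
    by (rule act_at[OF x G r(2)]) (use r f l in \<open>auto simp: ready_def\<close>)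
  also have "rwl ls (F (obl ?r)) \<bullet> G (obl (is @ ?r)) \<bullet> at x (ks @ is @ ?r)
     = G (obl (js @ ?r)) \<bullet> rwl ks (F (obl ?r)) \<bullet> at x (ks @ is @ ?r)"
    using operD(6)[OF lopD(1)[OF G], of "F (obl ?r)", THEN reassoc] lopD(4-6)[OF F] by (simp add: cmp_assoc)
  also have "rwl ks (F (obl ?r)) \<bullet> at x (ks @ is @ ?r) = at (act F is js x) (ks @ js @ ?r)"
    by (rule act_at_mid[OF x F r(1), symmetric]) (use r f l in \<open>auto simp: ready_def\<close>)
  also have "G (obl (js @ ?r)) \<bullet> at (act F is js x) (ks @ js @ ?r) = at (act G ks ls (act F is js x)) (ls @ js @ ?r)"
    by (rule act_at[OF y(1) G r'(2), symmetric]) (use r f l in \<open>auto simp: ready_def\<close>)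
  finally show ?thesis
    by (rule El_eqI[OF z, rotated -1]) (use r f l in \<open>auto simp: ready_def\<close>)
qed

text \<open>Change of stage of a generalised element, by precomposition with
  \<open>p\<close>.\<close>

definition cp where "cp x p = (fst x, snd x \<bullet> p)"

lemma cp_El: "x \<in> El S \<Longrightarrow> mor p \<Longrightarrow> cd p = dm (snd x) \<Longrightarrow> cp x p \<in> El S"
  by (auto simp: cp_def El_def)
lemma fst_cp[simp]: "fst (cp x p) = fst x"
  by (auto simp: cp_def)
lemma at_cp: "at (cp x p) l = at x l \<bullet> p" by (simp add: at_def cp_def cmp_assoc)
lemma cp_mk: "cp (mk l h) p = mk l (h \<bullet> p)" by (simp add: cp_def mk_def cmp_assoc)
lemma act_cp: "act F is js (cp x p) = cp (act F is js x) p"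
  by (simp add: act_def Let_def at_cp cp_mk cmp_assoc)
lemma dm_act[simp]: "dm (snd (act F is js x)) = dm (snd x)"
  by (simp add: act_def Let_def mk_def)

text \<open>The generic element, given by the identity; by \<open>El_uni\<close> every element on
  the legs \<open>l\<close> arises from it by a change of stage.\<close>

definition uni where "uni l = mk l (idt (obl l))"
lemma uni_El: "distinct l \<Longrightarrow> uni l \<in> El (set l)" unfolding uni_def by (rule mk_El) auto
lemma dm_uni[simp]: "dm (snd (uni l)) = obl l" by (simp add: uni_def mk_def)
lemma at_uni: "at (uni l) l = idt (obl l)" by (simp add: uni_def at_mk)
lemma El_uni: "x \<in> El S \<Longrightarrow> distinct l \<Longrightarrow> set l = S \<Longrightarrow> x = cp (uni l) (at x l)"
  using mk_at[of x S l] mor_at[of x S l] by (simp add: uni_def cp_mk)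

text \<open>Adjoins a leg \<open>d\<close> that is generic in its own factor: the source is tensored
  with \<open>ty d\<close>. Tests by multiplication with a fresh leg, or by its counit, are stated
  for such elements.\<close>

definition ext where
  "ext d x = (let l = can (fst x) in mk (d # l) (at x l \<star> idt (ty d)))"

lemma ext_El: "x \<in> El S \<Longrightarrow> d \<notin> S \<Longrightarrow> ext d x \<in> El (insert d S)"
  unfolding ext_def Let_def by (rule mk_El) (auto simp: El_fst El_fin intro!: mor_at[of x S])
lemma dm_ext[simp]: "dm (snd (ext d x)) = dm (snd x) \<odot> ty d"
  by (simp add: ext_def mk_def Let_def)
lemma at_ext: assumes x: "x \<in> El S" and d: "d \<notin> S" "distinct l" "set l = S"
  shows "at (ext d x) (d # l) = at x l \<star> idt (ty d)"
proof -
  let ?c = "can S"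
  have f: "finite S" "fst x = S" using x by (auto simp: El_def)
  have m: "mor (at x ?c)" by (rule mor_at[OF x]) (use f in auto)
  have s: "srtl l = srtl ?c" using d f by (simp add: srtl_can)
  have 0: "at (ext d x) (d # ?c) = at x ?c \<star> idt (ty d)"
    unfolding ext_def Let_def f(2) using m by (intro at_mk) auto
  have "at (ext d x) ([d] @ l) = rwl [d] (srti l \<bullet> srt ?c) \<bullet> at (ext d x) ([d] @ ?c)"
    by (rule at_reorder[OF ext_El[OF x d(1)]]) (use d f in auto)
  also have "\<dots> = ((srti l \<bullet> srt ?c) \<bullet> at x ?c) \<star> idt (ty d)"
    using 0 m s by (simp add: wr_cmp cmp_assoc)
  also have "(srti l \<bullet> srt ?c) \<bullet> at x ?c = at x l"
    using at_reorder[OF x, of "[]" ?c l] d f by auto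
  finally show ?thesis by simp
qed

lemma act_ext:
  assumes x: "x \<in> El S" and F: "lop F is js" and r: "ready is js S" "d \<notin> S" "d \<notin> set js"
  shows "act F is js (ext d x) = ext d (act F is js x)"
proof -
  let ?r = "can (S - set is)"
  have f: "finite S" using x by (rule El_fin)
  have r': "ready is js (insert d S)" using r by (auto simp: ready_def)
  have y: "act F is js x \<in> El (S - set is \<union> set js)" by (rule act_El[OF x F r(1)])
  have d: "d \<notin> S - set is \<union> set js" "d \<notin> set is" using r by (auto simp: ready_def)
  have m: "mor (at x (is @ ?r))" by (rule mor_at[OF x]) (use r f lopD(2)[OF F] in \<open>auto simp: ready_def\<close>)
  have "at (act F is js (ext d x)) ([d] @ js @ ?r) = rwl [d] (F (obl ?r)) \<bullet> at (ext d x) ([d] @ is @ ?r)"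
    by (rule act_at_mid[OF ext_El[OF x r(2)] F r']) (use r d f lopD(2)[OF F] in \<open>auto simp: ready_def\<close>)
  also have "at (ext d x) ([d] @ is @ ?r) = at x (is @ ?r) \<star> idt (ty d)"
    using at_ext[OF x r(2), of "is @ ?r"] r f lopD(2)[OF F] by (auto simp: ready_def)
  also have "rwl [d] (F (obl ?r)) \<bullet> at x (is @ ?r) \<star> idt (ty d) = at (act F is js x) (js @ ?r) \<star> idt (ty d)"
    using act_at[OF x F r(1), of ?r] lopD(4-6)[OF F] m f by (simp add: wr_cmp)
  also have "\<dots> = at (ext d (act F is js x)) ([d] @ js @ ?r)"
  proof -
    have "distinct (js @ ?r)" "set (js @ ?r) = S - set is \<union> set js" using r f lopD(3)[OF F] by (auto simp: ready_def)
    from at_ext[OF y d(1) this] show ?thesis by simp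
  qed
  finally show ?thesis
    by (rule El_eqI[rotated -1, OF _ act_El'[OF ext_El[OF x r(2)] F r', of "insert d (S - set is \<union> set js)"] ext_El[OF y d(1)]])
      (use r d f lopD(3)[OF F] in \<open>auto simp: ready_def\<close>)
qed

end

section \<open>Comodules on labelled legs\<close>

context legs
begin

text \<open>Since words are read from right to left, \<open>on2 F a b\<close> applies \<open>F\<close> to the legs \<open>a\<close>, \<open>b\<close> in this order.\<close>

abbreviation "on2 F a b \<equiv> act F [b, a] [b, a]"

lemma on2_El: "x \<in> El S \<Longrightarrow> oper F [ty b, ty a] [ty b, ty a] \<Longrightarrow> a \<noteq> b \<Longrightarrow> a \<in> S \<Longrightarrow> b \<in> S \<Longrightarrow> on2 F a b x \<in> El S"
  by (rule act_El') (auto simp: lop_def ready_def)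

lemma on2_comm:
  "x \<in> El S \<Longrightarrow> oper F [ty b, ty a] [ty b, ty a] \<Longrightarrow> oper G [ty d, ty c] [ty d, ty c] \<Longrightarrow> distinct [a, b, c, d]
    \<Longrightarrow> {a, b, c, d} \<subseteq> S \<Longrightarrow> on2 F a b (on2 G c d x) = on2 G c d (on2 F a b x)"
  by (rule act_comm) (auto simp: lop_def ready_def)

lemma on2_ext:
  "x \<in> El S \<Longrightarrow> oper F [ty b, ty a] [ty b, ty a] \<Longrightarrow> a \<noteq> b \<Longrightarrow> a \<in> S \<Longrightarrow> b \<in> S \<Longrightarrow> d \<notin> S \<Longrightarrow>
    on2 F a b (ext d x) = ext d (on2 F a b x)"
  by (rule act_ext) (auto simp: lop_def ready_def)

end

text \<open>The hypotheses on A in leg notation; a sublocale statement further down supplies the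
  families of the given monoid. Non-degeneracy and density speak of a fresh leg adjoined by
  \<open>ext\<close>. The assumption \<open>descent\<close> is the coequalizer property of 1e: a map
  that identifies whatever \<open>ef P\<close> identifies factors through it.\<close>

locale hopf_legs = legs C ty
  for C :: "('o, 'm, 'z) brmoncat_scheme" (structure) and ty +
  fixes A :: 'o and tf tif t2f t2if t3f ef mf :: "'o \<Rightarrow> 'o \<times> 'm option \<times> 'o"
  assumes A_Ob[simp]: "A \<in> Ob C"
    and fresh_inf: "infinite {n. ty n = A}"
    and oper_tf: "oper tf [A, A] [A, A]" and oper_tif: "oper tif [A, A] [A, A]"
    and oper_t2f: "oper t2f [A, A] [A, A]" and oper_t2if: "oper t2if [A, A] [A, A]"
    and oper_t3f: "oper t3f [A, A] [A, A]"
    and oper_ef: "oper ef [A] []" and oper_mf: "oper mf [A, A] [A]"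
    and fusion: "\<lbrakk>x \<in> El S; {a, b, c} \<subseteq> S; distinct [a, b, c]; ty a = A; ty b = A; ty c = A\<rbrakk> \<Longrightarrow>
      on2 tf a b (on2 tf a c (on2 tf b c x)) = on2 tf b c (on2 tf a b x)"
    and counit_tf: "\<lbrakk>x \<in> El S; {a, b} \<subseteq> S; a \<noteq> b; ty a = A; ty b = A\<rbrakk> \<Longrightarrow>
      act ef [b] [] (on2 tf a b x) = act ef [b] [] x"
    and tf_t2f: "\<lbrakk>x \<in> El S; {a, b, c} \<subseteq> S; distinct [a, b, c]; ty a = A; ty b = A; ty c = A\<rbrakk> \<Longrightarrow>
      on2 tf b c (on2 t2f a b x) = on2 t2f a b (on2 tf b c x)"
    and mf_tf: "\<lbrakk>x \<in> El S; {a, b} \<subseteq> S; a \<noteq> b; ty a = A; ty b = A\<rbrakk> \<Longrightarrow>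
      act mf [b, a] [b] x = act ef [a] [] (on2 tf a b x)"
    and mf_t2f: "\<lbrakk>x \<in> El S; {a, b} \<subseteq> S; a \<noteq> b; ty a = A; ty b = A\<rbrakk> \<Longrightarrow>
      act mf [b, a] [a] x = act ef [b] [] (on2 t2f a b x)"
    and tf_inv: "\<lbrakk>x \<in> El S; {a, b} \<subseteq> S; a \<noteq> b; ty a = A; ty b = A\<rbrakk> \<Longrightarrow> on2 tf a b (on2 tif a b x) = x"
    and tif_inv: "\<lbrakk>x \<in> El S; {a, b} \<subseteq> S; a \<noteq> b; ty a = A; ty b = A\<rbrakk> \<Longrightarrow> on2 tif a b (on2 tf a b x) = x"
    and t2f_inv: "\<lbrakk>x \<in> El S; {a, b} \<subseteq> S; a \<noteq> b; ty a = A; ty b = A\<rbrakk> \<Longrightarrow> on2 t2f a b (on2 t2if a b x) = x"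
    and t2if_inv: "\<lbrakk>x \<in> El S; {a, b} \<subseteq> S; a \<noteq> b; ty a = A; ty b = A\<rbrakk> \<Longrightarrow> on2 t2if a b (on2 t2f a b x) = x"
    and mf_t3f: "\<lbrakk>x \<in> El S; {a, b, c} \<subseteq> S; distinct [a, b, c]; ty a = A; ty b = A; ty c = A\<rbrakk> \<Longrightarrow>
      act mf [c, b] [c] (on2 t3f a b x) = act mf [c, b] [c] (on2 tf a c x)"
    and nondeg_right: "\<lbrakk>x \<in> El S; y \<in> El S; a \<in> S; d \<notin> S; ty a = A; ty d = A;
      dm (snd x) = dm (snd y);
      act mf [d, a] [d] (ext d x) = act mf [d, a] [d] (ext d y)\<rbrakk> \<Longrightarrow> x = y"
    and nondeg_left: "\<lbrakk>x \<in> El S; y \<in> El S; a \<in> S; d \<notin> S; ty a = A; ty d = A;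
      dm (snd x) = dm (snd y);
      act mf [a, d] [a] (ext d x) = act mf [a, d] [a] (ext d y)\<rbrakk> \<Longrightarrow> x = y"
    and counit_epi: "\<lbrakk>x \<in> El S; y \<in> El S; d \<notin> S; ty d = A;
      dm (snd x) = dm (snd y);
      act ef [d] [] (ext d x) = act ef [d] [] (ext d y)\<rbrakk> \<Longrightarrow> x = y"
    and descent: "\<lbrakk>P \<in> Ob C; mor u; dm u = P \<odot> A;
      \<And>x y. mor x \<Longrightarrow> mor y \<Longrightarrow> dm x = dm y \<Longrightarrow> cd x = P \<odot> A \<Longrightarrow> cd y = P \<odot> A \<Longrightarrow> ef P \<bullet> x = ef P \<bullet> y \<Longrightarrow> u \<bullet> x = u \<bullet> y\<rbrakk>
      \<Longrightarrow> \<exists>k. mor k \<and> dm k = P \<and> cd k = cd u \<and> k \<bullet> ef P = u"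
begin

abbreviation "Ep a \<equiv> act ef [a] []"
text \<open>\<open>Mu a b\<close> and \<open>Mu2 a b\<close> form the same product, of leg a with
  leg b in this order; they differ in the label of the result, \<open>b\<close> or
  \<open>a\<close>.\<close>

abbreviation "Mu a b \<equiv> act mf [b, a] [b]"
abbreviation "Mu2 a b \<equiv> act mf [b, a] [a]"

lemmas opers[simp] = oper_tf oper_tif oper_t2f oper_t2if oper_t3f oper_ef oper_mf

lemma fresh: "finite S \<Longrightarrow> \<exists>d. d \<notin> S \<and> ty d = A"
  using fresh_inf by (metis (mono_tags, lifting) finite_subset mem_Collect_eq subsetI)

lemma Ep_El: "x \<in> El S \<Longrightarrow> ty a = A \<Longrightarrow> a \<in> S \<Longrightarrow> S' = S - {a} \<Longrightarrow> Ep a x \<in> El S'"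
  by (rule act_El') (auto simp: lop_def ready_def)
lemma Mu_El: "x \<in> El S \<Longrightarrow> ty a = A \<Longrightarrow> ty b = A \<Longrightarrow> a \<in> S \<Longrightarrow> b \<in> S \<Longrightarrow> a \<noteq> b \<Longrightarrow> S' = S - {a} \<Longrightarrow> Mu a b x \<in> El S'"
  by (rule act_El') (auto simp: lop_def ready_def)
lemma Ep_on2: "x \<in> El S \<Longrightarrow> oper F [ty b, ty a] [ty b, ty a] \<Longrightarrow> distinct [a, b, c] \<Longrightarrow> {a, b, c} \<subseteq> S \<Longrightarrow> ty c = A \<Longrightarrow>
    Ep c (on2 F a b x) = on2 F a b (Ep c x)"
  by (rule act_comm) (auto simp: lop_def ready_def)
lemma Mu_on2: "x \<in> El S \<Longrightarrow> oper F [ty b, ty a] [ty b, ty a] \<Longrightarrow> distinct [a, b, c, d] \<Longrightarrow> {a, b, c, d} \<subseteq> S \<Longrightarrow>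
    ty c = A \<Longrightarrow> ty d = A \<Longrightarrow> Mu c d (on2 F a b x) = on2 F a b (Mu c d x)"
  by (rule act_comm) (auto simp: lop_def ready_def)
lemma Ep_Ep: "x \<in> El S \<Longrightarrow> a \<noteq> b \<Longrightarrow> {a, b} \<subseteq> S \<Longrightarrow> ty a = A \<Longrightarrow> ty b = A \<Longrightarrow> Ep a (Ep b x) = Ep b (Ep a x)"
  by (rule act_comm) (auto simp: lop_def ready_def)
lemma Ep_Mu: "x \<in> El S \<Longrightarrow> distinct [a, b, c] \<Longrightarrow> {a, b, c} \<subseteq> S \<Longrightarrow> ty a = A \<Longrightarrow> ty b = A \<Longrightarrow> ty c = A \<Longrightarrow>
    Ep a (Mu b c x) = Mu b c (Ep a x)"
  by (rule act_comm) (auto simp: lop_def ready_def)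
lemma Mu_Mu: "x \<in> El S \<Longrightarrow> distinct [a, b, c, d] \<Longrightarrow> {a, b, c, d} \<subseteq> S \<Longrightarrow> ty a = A \<Longrightarrow> ty b = A \<Longrightarrow> ty c = A \<Longrightarrow>
   ty d = A \<Longrightarrow> Mu a b (Mu c d x) = Mu c d (Mu a b x)"
  by (rule act_comm) (auto simp: lop_def ready_def)
lemma Ep_ext: "x \<in> El S \<Longrightarrow> ty a = A \<Longrightarrow> a \<in> S \<Longrightarrow> d \<notin> S \<Longrightarrow> Ep a (ext d x) = ext d (Ep a x)"
  by (rule act_ext) (auto simp: lop_def ready_def)

text \<open>The counit on the leg a of the fusion equation turns \<open>tf\<close> on a, b into the
  product.\<close>

lemma tf_mf: 
  assumes x: "x \<in> El S" and l: "{a, b, c} \<subseteq> S" "distinct [a, b, c]" "ty a = A" "ty b = A" "ty c = A"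
  shows "on2 tf b c (Mu a b x) = Mu a b (on2 tf a c (on2 tf b c x))"
proof -
  have m: "on2 tf b c x \<in> El S" "on2 tf a c (on2 tf b c x) \<in> El S" "on2 tf a b x \<in> El S"
    using x l by (simp_all add: on2_El)
  have "Mu a b (on2 tf a c (on2 tf b c x)) = Ep a (on2 tf b c (on2 tf a b x))"
    using m l by (simp add: mf_tf[OF m(2)] fusion[OF x])
  also have "\<dots> = on2 tf b c (Mu a b x)"
    using m l by (simp add: Ep_on2[OF m(3)] mf_tf[OF x])
  finally show ?thesis ..
qed

text \<open>Multiplicativity of the counit: the product is the counit of one leg after
  \<open>tf\<close>, and the counit of the other leg absorbs \<open>tf\<close>.\<close>

lemma Ep_Mu_eq:
  assumes x: "x \<in> El S" and l: "{a, b} \<subseteq> S" "a \<noteq> b" "ty a = A" "ty b = A"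
  shows "Ep b (Mu a b x) = Ep b (Ep a x)"
proof -
  have m: "on2 tf a b x \<in> El S" using x l by (simp add: on2_El)
  have "Ep b (Mu a b x) = Ep b (Ep a (on2 tf a b x))" using l by (simp add: mf_tf[OF x])
  also have "\<dots> = Ep a (Ep b (on2 tf a b x))" using l by (intro Ep_Ep[OF m]) auto
  also have "\<dots> = Ep a (Ep b x)" using l by (simp add: counit_tf[OF x])
  also have "\<dots> = Ep b (Ep a x)" using l by (intro Ep_Ep[OF x]) auto
  finally show ?thesis .
qed

text \<open>Writing the outer product through \<open>tf\<close> reduces associativity to
  \<open>tf_mf\<close> and multiplicativity of the counit.\<close>

lemma Mu_assoc:
  assumes x: "x \<in> El S" and l: "{a, b, c} \<subseteq> S" "distinct [a, b, c]" "ty a = A" "ty b = A" "ty c = A"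
  shows "Mu b c (Mu a b x) = Mu a c (Mu b c x)"
proof -
  let ?y = "on2 tf b c x"
  have m: "?y \<in> El S" "on2 tf a c ?y \<in> El S" "Mu a b x \<in> El (S - {a})"
    using x l by (simp_all add: on2_El Mu_El)
  have "Mu b c (Mu a b x) = Ep b (on2 tf b c (Mu a b x))" using l by (intro mf_tf[OF m(3)]) auto
  also have "\<dots> = Ep b (Mu a b (on2 tf a c ?y))" using l by (simp add: tf_mf[OF x])
  also have "\<dots> = Ep b (Ep a (on2 tf a c ?y))" using l by (intro Ep_Mu_eq[OF m(2)]) auto
  also have "\<dots> = Ep b (Mu a c ?y)" using l by (simp add: mf_tf[OF m(1)])
  also have "\<dots> = Mu a c (Ep b ?y)" using l by (intro Ep_Mu[OF m(1)]) auto
  also have "\<dots> = Mu a c (Mu b c x)" using l by (simp add: mf_tf[OF x])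
  finally show ?thesis .
qed

text \<open>The two sides differ only in the label of an intermediate result; both are the action of
  one composite family.\<close>

lemma Mu_relabel:
  assumes x: "x \<in> El S" and l: "{a, b, c} \<subseteq> S" "distinct [a, b, c]" "ty a = A" "ty b = A" "ty c = A"
  shows "Mu b c (Mu a b x) = Mu a c (Mu2 a b x)"
proof -
  let ?F = "\<lambda>P. mf P \<star> idt A"
  have F: "oper ?F [A, A, A] [A, A]" using oper_post[OF oper_mf A_Ob] .
  have "Mu b c (Mu a b x) = Mu b c (act ?F [c, b, a] [c, b] x)"
    using act_post[OF x, of mf "[b, a]" "[b]" c] l by (simp add: lop_def ready_def)
  also have "\<dots> = act (\<lambda>P. mf P \<bullet> ?F P) [c, b, a] [c] x"
    using F l by (intro act_cmp[OF x, symmetric]) (auto simp: lop_def ready_def)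
  also have "\<dots> = Mu a c (act ?F [c, b, a] [c, a] x)"
    using F l by (intro act_cmp[OF x]) (auto simp: lop_def ready_def)
  also have "\<dots> = Mu a c (Mu2 a b x)"
    using act_post[OF x, of mf "[b, a]" "[a]" c] l by (simp add: lop_def ready_def)
  finally show ?thesis .
qed

lemma Mu_assoc2:
  assumes x: "x \<in> El S" and l: "{a, b, c} \<subseteq> S" "distinct [a, b, c]" "ty a = A" "ty b = A" "ty c = A"
  shows "Mu a c (Mu2 a b x) = Mu a c (Mu b c x)"
  using Mu_relabel[OF assms] Mu_assoc[OF assms] by simp

text \<open>This is the counit on the leg b of the commutation of \<open>tf\<close> with
  \<open>t2f\<close>.\<close>

lemma Mu_t2f:
  assumes x: "x \<in> El S" and l: "{a, b, c} \<subseteq> S" "distinct [a, b, c]" "ty a = A" "ty b = A" "ty c = A"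
  shows "Mu b c (on2 t2f a b x) = Mu2 a b (on2 tf b c x)"
proof -
  have m: "on2 t2f a b x \<in> El S" "on2 tf b c x \<in> El S" using x l by (simp_all add: on2_El)
  have "Mu b c (on2 t2f a b x) = Ep b (on2 tf b c (on2 t2f a b x))" using l by (intro mf_tf[OF m(1)]) auto
  also have "\<dots> = Ep b (on2 t2f a b (on2 tf b c x))" using l by (simp add: tf_t2f[OF x])
  also have "\<dots> = Mu2 a b (on2 tf b c x)" using l by (simp add: mf_t2f[OF m(2)])
  finally show ?thesis .
qed

text \<open>\<open>coaction\<close> and \<open>counital\<close> are the conditions on the first
  structure map, \<open>compatible\<close> is its link to the second. Coassociativity and
  counitality of the second map are derived from these in \<open>coassoc_right\<close> and
  \<open>counital_compatible\<close>.\<close>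

definition coaction where
  "coaction V f \<longleftrightarrow> V \<in> Ob C \<and> oper f [A, V] [A, V] \<and>
    (\<forall>S x v a b. x \<in> El S \<longrightarrow> {v, a, b} \<subseteq> S \<longrightarrow> distinct [v, a, b] \<longrightarrow> ty v = V \<longrightarrow> ty a = A \<longrightarrow> ty b = A \<longrightarrow>
      on2 f v a (on2 f v b (on2 tf a b x)) = on2 tf a b (on2 f v a x))"
definition compatible where
  "compatible V f g \<longleftrightarrow> oper g [A, V] [A, V] \<and>
    (\<forall>S x v a b. x \<in> El S \<longrightarrow> {v, a, b} \<subseteq> S \<longrightarrow> distinct [v, a, b] \<longrightarrow> ty v = V \<longrightarrow> ty a = A \<longrightarrow> ty b = A \<longrightarrow>
      Mu b a (on2 f v a x) = Mu b a (on2 g v b x))"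
definition counital where
  "counital V f \<longleftrightarrow>
    (\<forall>S x v a. x \<in> El S \<longrightarrow> {v, a} \<subseteq> S \<longrightarrow> distinct [v, a] \<longrightarrow> ty v = V \<longrightarrow> ty a = A \<longrightarrow>
      Ep a (on2 f v a x) = Ep a x)"

lemma coactionD:
  assumes "coaction V f" shows "V \<in> Ob C" "oper f [A, V] [A, V]"
    "\<lbrakk>x \<in> El S; {v, a, b} \<subseteq> S; distinct [v, a, b]; ty v = V; ty a = A; ty b = A\<rbrakk> \<Longrightarrow>
      on2 f v a (on2 f v b (on2 tf a b x)) = on2 tf a b (on2 f v a x)"
  using assms unfolding coaction_def by blast+
lemma compatibleD:
  assumes "compatible V f g" shows "oper g [A, V] [A, V]"
    "\<lbrakk>x \<in> El S; {v, a, b} \<subseteq> S; distinct [v, a, b]; ty v = V; ty a = A; ty b = A\<rbrakk> \<Longrightarrow>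
      Mu b a (on2 f v a x) = Mu b a (on2 g v b x)"
  using assms unfolding compatible_def by blast+
lemma counitalD:
  assumes "counital V f" shows 
    "\<lbrakk>x \<in> El S; {v, a} \<subseteq> S; distinct [v, a]; ty v = V; ty a = A\<rbrakk> \<Longrightarrow> Ep a (on2 f v a x) = Ep a x"
  using assms unfolding counital_def by blast+

text \<open>The counit is applied to compatibility at a fresh leg: multiplicativity splits the
  product, \<open>f\<close> is absorbed, and density removes the fresh leg.\<close>

lemma counital_compatible:
  assumes c: "counital V f" "compatible V f g" "oper f [A, V] [A, V]" shows "counital V g"
  unfolding counital_def
proof (intro allI impI)
  fix S x v a assume x: "x \<in> El S" and l: "{v, a} \<subseteq> S" "distinct [v, a]" "ty v = V" "ty a = A"
  note g = compatibleD[OF c(2)]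
  obtain d where d: "d \<notin> S" "ty d = A" using fresh El_fin[OF x] by blast
  let ?x = "ext d x" and ?S = "insert d S"
  have x': "?x \<in> El ?S" using x d by (rule_tac ext_El)
  have ne: "a \<noteq> d" "v \<noteq> d" using l d by auto
  have m: "on2 f v d ?x \<in> El ?S" "on2 g v a ?x \<in> El ?S" "on2 g v a x \<in> El S"
    using x x' l d ne c g by (simp_all add: on2_El)
  have "Ep d (ext d (Ep a (on2 g v a x))) = Ep d (Ep a (on2 g v a ?x))"
    using l d m g x by (simp add: Ep_ext[OF m(3)] on2_ext[OF x])
  also have "\<dots> = Ep d (Mu a d (on2 g v a ?x))"
    using l d ne by (subst Ep_Mu_eq[OF m(2)]) auto
  also have "\<dots> = Ep d (Mu a d (on2 f v d ?x))"
    using l d ne g(2)[OF x', of v d a] by auto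
  also have "\<dots> = Ep d (Ep a (on2 f v d ?x))" using l d ne by (intro Ep_Mu_eq[OF m(1)]) auto
  also have "\<dots> = Ep a (Ep d (on2 f v d ?x))" using l d ne by (intro Ep_Ep[OF m(1)]) auto
  also have "\<dots> = Ep a (Ep d ?x)" using counitalD[OF c(1) x', of v d] l d ne by auto
  also have "\<dots> = Ep d (Ep a ?x)" using l d ne by (intro Ep_Ep[OF x']) auto
  also have "\<dots> = Ep d (ext d (Ep a x))" using l d by (simp add: Ep_ext[OF x])
  finally show "Ep a (on2 g v a x) = Ep a x"
    by (rule counit_epi[of _ "S - {a}", rotated -1]) (use l d x m in \<open>auto intro!: Ep_El\<close>)
qed

text \<open>The mixed coassociativity laws are tested against right multiplication by fresh legs; as \<open>tf\<close> is invertible,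
  these legs may be taken in its image, where coassociativity of \<open>f\<close> applies.\<close>

lemma mixed_coassoc:
  assumes c: "coaction V f" "compatible V f g"
    and x: "x \<in> El S" and l: "{v, a, b} \<subseteq> S" "distinct [v, a, b]" "ty v = V" "ty a = A" "ty b = A"
  shows "on2 g v a (on2 tf a b (on2 f v b x)) = on2 tf a b (on2 g v a x)" (is "?L x = ?R x")
proof -
  note f = coactionD[OF c(1)] and g = compatibleD[OF c(2)]
  obtain d where d: "d \<notin> S" "ty d = A" using fresh El_fin[OF x] by blast
  let ?S = "insert d S"
  define z where "z = on2 tif d b (ext d x)"
  have x': "ext d x \<in> El ?S" using x d by (rule_tac ext_El)
  have ne: "a \<noteq> d" "v \<noteq> d" "b \<noteq> d" using l d by auto
  note s = l d ne f(1,2) g(1)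
  have z: "z \<in> El ?S" unfolding z_def using s x' by (simp_all add: on2_El)
  have e: "ext d x = on2 tf d b z" unfolding z_def using s by (simp add: tf_inv[OF x'])
  have m: "on2 tf d b z \<in> El ?S" "on2 f v b (on2 tf d b z) \<in> El ?S" "on2 tf a b (on2 f v b (on2 tf d b z)) \<in> El ?S"
     "on2 f v d z \<in> El ?S" "on2 g v a z \<in> El ?S"
    using s z by (simp_all add: on2_El)
  have mx: "on2 f v b x \<in> El S" "on2 tf a b (on2 f v b x) \<in> El S" "on2 g v a x \<in> El S" "?L x \<in> El S" "?R x \<in> El S"
    using s x by (simp_all add: on2_El)
  have "Mu a d (ext d (?L x)) = Mu a d (?L (ext d x))"
    using s mx x by (simp add: on2_ext[OF x] on2_ext[OF mx(1)] on2_ext[OF mx(2)])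
  also have "\<dots> = Mu a d (on2 g v a (on2 tf a b (on2 f v b (on2 tf d b z))))" by (simp only: e)
  also have "\<dots> = Mu a d (on2 f v d (on2 tf a b (on2 f v b (on2 tf d b z))))"
    using s by (intro g(2)[OF m(3), symmetric]) auto
  also have "\<dots> = Mu a d (on2 tf a b (on2 f v d (on2 f v b (on2 tf d b z))))"
    using s by (subst on2_comm[OF m(2), of tf]) auto
  also have "\<dots> = Mu a d (on2 tf a b (on2 tf d b (on2 f v d z)))"
    using s by (subst f(3)[OF z]) auto
  also have "\<dots> = on2 tf d b (Mu a d (on2 f v d z))"
    using s by (subst tf_mf[OF m(4)]) auto
  also have "\<dots> = on2 tf d b (Mu a d (on2 g v a z))"
    using s g(2)[OF z, of v d a] by auto
  also have "\<dots> = Mu a d (on2 tf a b (on2 tf d b (on2 g v a z)))"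
    using s by (intro tf_mf[OF m(5)]) auto
  also have "\<dots> = Mu a d (on2 tf a b (on2 g v a (on2 tf d b z)))"
    using s by (subst on2_comm[OF z, of tf]) auto
  also have "\<dots> = Mu a d (?R (ext d x))" by (simp only: e)
  also have "\<dots> = Mu a d (ext d (?R x))"
    using s mx x by (simp add: on2_ext[OF x] on2_ext[OF mx(3)])
  finally show ?thesis
    by (rule nondeg_right[rotated -1]) (use s mx in auto)
qed

text \<open>A common argument for \<open>X\<close> = \<open>t2f\<close> and \<open>X\<close> =
  \<open>t3f\<close>. On the left both a and b carry \<open>g\<close>, so each is multiplied by a
  test leg, a by d and b by e; hypothesis \<open>h\<close> says that after these tests
  \<open>X\<close> following \<open>tf\<close> on d, e depends only on the product of k and
  d.\<close>

lemma coassoc_lift: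
  assumes c: "coaction V f" "compatible V f g" and X: "oper X [A, A] [A, A]"
    and x: "x \<in> El S" and l: "{v, a, b} \<subseteq> S" "distinct [v, a, b]" "ty v = V" "ty a = A" "ty b = A" "k = a \<or> k = b"
    and h: "\<And>S s d e. s \<in> El S \<Longrightarrow> {a, b, d, e} \<subseteq> S \<Longrightarrow> distinct [a, b, d, e] \<Longrightarrow> ty d = A \<Longrightarrow> ty e = A \<Longrightarrow>
      Mu b e (Mu a d (on2 X a b (on2 tf d e s))) = \<Phi> d e (Mu k d s)"
  shows "on2 g v a (on2 g v b (on2 X a b x)) = on2 X a b (on2 g v k x)" (is "?L x = ?R x")
proof -
  note f = coactionD[OF c(1)] and g = compatibleD[OF c(2)]
  obtain d where d: "d \<notin> S" "ty d = A" using fresh El_fin[OF x] by blast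
  obtain e where e: "e \<notin> insert d S" "ty e = A" using fresh El_fin[OF x] by (metis finite.insertI)
  let ?S = "insert e (insert d S)"
  let ?x = "ext e (ext d x)"
  define z where "z = on2 tif d e ?x"
  have x1: "ext d x \<in> El (insert d S)" using x d by (rule_tac ext_El)
  have x': "?x \<in> El ?S" using x1 e by (rule_tac ext_El)
  have ne: "a \<noteq> d" "v \<noteq> d" "b \<noteq> d" "a \<noteq> e" "v \<noteq> e" "b \<noteq> e" "d \<noteq> e" using l d e by auto
  have k: "k \<in> S" "k \<noteq> v" "k \<noteq> d" "k \<noteq> e" "ty k = A" using l ne by auto
  note s = l d e ne f(1,2) g(1) X k
  have z: "z \<in> El ?S" unfolding z_def using s x' by (simp_all add: on2_El)
  have ez: "?x = on2 tf d e z" unfolding z_def using s by (simp add: tf_inv[OF x'])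
  have m: "?x \<in> El ?S" "on2 X a b ?x \<in> El ?S" "on2 f v e (on2 X a b ?x) \<in> El ?S" "on2 g v b (on2 X a b ?x) \<in> El ?S"
     "on2 f v e ?x \<in> El ?S" "on2 f v d z \<in> El ?S" "on2 g v k z \<in> El ?S" "on2 g v a (on2 f v e (on2 X a b ?x)) \<in> El ?S"
     "on2 f v d (on2 f v e (on2 X a b ?x)) \<in> El ?S"  "on2 g v a (on2 g v b (on2 X a b ?x)) \<in> El ?S"
    using s x' by (simp_all add: on2_El z)
  have mx: "on2 X a b x \<in> El S" "on2 g v b (on2 X a b x) \<in> El S" "on2 g v k x \<in> El S" "?L x \<in> El S" "?R x \<in> El S"
    using s x by (simp_all add: on2_El)
  have mx1: "on2 X a b (ext d x) \<in> El (insert d S)" "on2 g v b (on2 X a b (ext d x)) \<in> El (insert d S)" "on2 g v k (ext d x) \<in> El (insert d S)"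
    "?L (ext d x) \<in> El (insert d S)" "?R (ext d x) \<in> El (insert d S)"
    using s x1 by (simp_all add: on2_El)
  have L1: "?L ?x = ext e (?L (ext d x))"
    using s mx1 by (simp add: on2_ext[OF x1] on2_ext[OF mx1(1)] on2_ext[OF mx1(2)])
  have L: "ext e (ext d (?L x)) = ?L ?x" unfolding L1
    using s mx by (simp add: on2_ext[OF x] on2_ext[OF mx(1)] on2_ext[OF mx(2)])
  have R1: "?R ?x = ext e (?R (ext d x))"
    using s mx1 by (simp add: on2_ext[OF x1] on2_ext[OF mx1(3)])
  have R: "ext e (ext d (?R x)) = ?R ?x" unfolding R1
    using s mx by (simp add: on2_ext[OF x] on2_ext[OF mx(3)])
  have "Mu b e (Mu a d (?L ?x)) = Mu a d (Mu b e (?L ?x))"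
    using s by (intro Mu_Mu[OF m(10)]) auto
  also have "\<dots> = Mu a d (on2 g v a (Mu b e (on2 g v b (on2 X a b ?x))))"
    using s by (subst Mu_on2[OF m(4)]) auto
  also have "\<dots> = Mu a d (on2 g v a (Mu b e (on2 f v e (on2 X a b ?x))))"
    using s g(2)[OF m(2), of v e b] by auto
  also have "\<dots> = Mu a d (Mu b e (on2 g v a (on2 f v e (on2 X a b ?x))))"
    using s by (subst Mu_on2[OF m(3)]) auto
  also have "\<dots> = Mu b e (Mu a d (on2 g v a (on2 f v e (on2 X a b ?x))))"
    using s by (intro Mu_Mu[OF m(8)]) auto
  also have "\<dots> = Mu b e (Mu a d (on2 f v d (on2 f v e (on2 X a b ?x))))"
    using s g(2)[OF m(3), of v d a] by auto
  also have "\<dots> = Mu b e (Mu a d (on2 X a b (on2 f v d (on2 f v e ?x))))"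
  proof -
    have "on2 f v e (on2 X a b ?x) = on2 X a b (on2 f v e ?x)"
      by (rule on2_comm[OF m(1)]) (use s in auto)
    moreover have "on2 f v d (on2 X a b (on2 f v e ?x)) = on2 X a b (on2 f v d (on2 f v e ?x))"
      by (rule on2_comm[OF m(5)]) (use s in auto)
    ultimately show ?thesis by simp
  qed
  also have "\<dots> = Mu b e (Mu a d (on2 X a b (on2 tf d e (on2 f v d z))))"
    unfolding ez using s by (subst f(3)[OF z]) auto
  also have "\<dots> = \<Phi> d e (Mu k d (on2 f v d z))" using s by (intro h[OF m(6)]) auto
  also have "\<dots> = \<Phi> d e (Mu k d (on2 g v k z))" using s g(2)[OF z, of v d k] by auto
  also have "\<dots> = Mu b e (Mu a d (on2 X a b (on2 tf d e (on2 g v k z))))" using s by (intro h[OF m(7), symmetric]) auto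
  also have "\<dots> = Mu b e (Mu a d (?R ?x))" unfolding ez using s by (subst on2_comm[OF z, of tf]) auto
  \<comment> \<open>Non-degeneracy removes the test legs one at a time, first e against b, then d
    against a.\<close>
  finally have "Mu a d (ext d (?L x)) = Mu a d (ext d (?R x))"
    unfolding L[symmetric] R[symmetric]
  proof -
    assume a: "Mu b e (Mu a d (ext e (ext d (?L x)))) = Mu b e (Mu a d (ext e (ext d (?R x))))"
    have me: "Mu a d (ext e y) = ext e (Mu a d y)" if "y \<in> El (insert d S)" for y
      using s that by (intro act_ext[OF that]) (auto simp: lop_def ready_def)
    have y: "ext d (?L x) \<in> El (insert d S)" "ext d (?R x) \<in> El (insert d S)"
      using mx d by (auto intro!: ext_El)
    show ?thesis
      by (rule nondeg_right[of _ "insert d S - {a}" _ b e])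
        (use s y a me in \<open>auto intro!: Mu_El\<close>)
  qed
  then show ?thesis
    by (rule nondeg_right[rotated -1]) (use s mx in auto)
qed

text \<open>Instance \<open>k = b\<close>: by \<open>Mu_t2f\<close> the test leg e replaces
  \<open>t2f\<close> on a, b by \<open>tf\<close> on b, e, and associativity followed by
  \<open>tf_mf\<close> leaves the product of b and d.\<close>

lemma mixed_coassoc2:
  assumes c: "coaction V f" "compatible V f g"
    and x: "x \<in> El S" and l: "{v, a, b} \<subseteq> S" "distinct [v, a, b]" "ty v = V" "ty a = A" "ty b = A"
  shows "on2 g v a (on2 g v b (on2 t2f a b x)) = on2 t2f a b (on2 g v b x)"
proof (rule coassoc_lift[OF c oper_t2f x l, of b "\<lambda>d e y. Mu a d (on2 tf d e y)"])
  fix S s d e assume s: "s \<in> El S" "{a, b, d, e} \<subseteq> S" "distinct [a, b, d, e]" "ty d = A" "ty e = A"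
  have m: "on2 tf d e s \<in> El S" "on2 t2f a b (on2 tf d e s) \<in> El S" "on2 tf b e (on2 tf d e s) \<in> El S"
    using s l by (simp_all add: on2_El)
  have "Mu b e (Mu a d (on2 t2f a b (on2 tf d e s))) = Mu a d (Mu b e (on2 t2f a b (on2 tf d e s)))"
    using s l by (intro Mu_Mu[OF m(2)]) auto
  also have "\<dots> = Mu a d (Mu2 a b (on2 tf b e (on2 tf d e s)))"
    using s l by (subst Mu_t2f[OF m(1)]) auto
  also have "\<dots> = Mu a d (Mu b d (on2 tf b e (on2 tf d e s)))"
    using s l by (intro Mu_assoc2[OF m(3)]) auto
  also have "\<dots> = Mu a d (on2 tf d e (Mu b d s))" using s l by (subst tf_mf[OF s(1)]) auto
  finally show "Mu b e (Mu a d (on2 t2f a b (on2 tf d e s))) = Mu a d (on2 tf d e (Mu b d s))" .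
qed simp

text \<open>The second coassociativity axiom of comodules. Instance \<open>k = a\<close>: by
  \<open>mf_t3f\<close> the test leg e replaces \<open>t3f\<close> on a, b by \<open>tf\<close> on
  a, e.\<close>

lemma coassoc_right:
  assumes c: "coaction V f" "compatible V f g"
    and x: "x \<in> El S" and l: "{v, a, b} \<subseteq> S" "distinct [v, a, b]" "ty v = V" "ty a = A" "ty b = A"
  shows "on2 g v a (on2 g v b (on2 t3f a b x)) = on2 t3f a b (on2 g v a x)"
proof (rule coassoc_lift[OF c oper_t3f x l, of a "\<lambda>d e y. Mu b e (on2 tf d e y)"])
  fix S s d e assume s: "s \<in> El S" "{a, b, d, e} \<subseteq> S" "distinct [a, b, d, e]" "ty d = A" "ty e = A"
  have m: "on2 tf d e s \<in> El S" "on2 t3f a b (on2 tf d e s) \<in> El S" "on2 tf a e (on2 tf d e s) \<in> El S"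
    using s l by (simp_all add: on2_El)
  have "Mu b e (Mu a d (on2 t3f a b (on2 tf d e s))) = Mu a d (Mu b e (on2 t3f a b (on2 tf d e s)))"
    using s l by (intro Mu_Mu[OF m(2)]) auto
  also have "\<dots> = Mu a d (Mu b e (on2 tf a e (on2 tf d e s)))"
    using s l by (subst mf_t3f[OF m(1)]) auto
  also have "\<dots> = Mu b e (Mu a d (on2 tf a e (on2 tf d e s)))"
    using s l by (intro Mu_Mu[OF m(3)]) auto
  also have "\<dots> = Mu b e (on2 tf d e (Mu a d s))" using s l by (subst tf_mf[OF s(1)]) auto
  finally show "Mu b e (Mu a d (on2 t3f a b (on2 tf d e s))) = Mu b e (on2 tf d e (Mu a d s))" .
qed simp

end

section \<open>From identities on legs back to families\<close>

context legs
begin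

text \<open>A family is determined by its value at \<I>, and this value is read off from the action
  on the generic element \<open>uni is\<close>.\<close>

lemma oper_eqI_act:
  assumes F: "oper F (map ty is) (map ty js)" and G: "oper G (map ty is) (map ty js)"
    and d: "distinct is" "distinct js" and e: "\<And>x. x \<in> El (set is) \<Longrightarrow> act F is js x = act G is js x"
    and P: "P \<in> Ob C"
  shows "F P = G P"
proof (rule oper_ext[OF F G _ P])
  have u: "uni is \<in> El (set is)" using d by (intro uni_El)
  have l: "lop F is js" "lop G is js" and r: "ready is js (set is)" using F G d by (auto simp: lop_def ready_def)
  have "F \<I> = at (act F is js (uni is)) js" if "lop F is js" for F
    using act_at[OF u that r, of "[]"] that lopD(4,5)[OF that, of \<I>] by (simp add: at_uni)
  then show "F \<I> = G \<I>" using l e[OF u] by metis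
qed

text \<open>Leg numbering for three-letter words P X Y Z: \<open>F\<close> acts on the letters 1 and
  2, 2 and 3, or 1 and 3, the last by conjugation with a swap.\<close>

definition pos12 where "pos12 F Z P = F P \<star> idt Z"
definition pos23 where "pos23 F X P = F (P \<odot> X)"
definition pos13 where "pos13 F X Y Z P = sg P Y X \<star> idt Z \<bullet> F (P \<odot> Y) \<bullet> sg P X Y \<star> idt Z"

lemma oper_pos12: "oper F [Y, X] [Y, X] \<Longrightarrow> Z \<in> Ob C \<Longrightarrow> oper (pos12 F Z) [Z, Y, X] [Z, Y, X]"
  using oper_post[of F "[Y, X]" "[Y, X]" Z] by (simp add: pos12_def[abs_def])
lemma oper_pos23: "oper F [Z, Y] [Z, Y] \<Longrightarrow> X \<in> Ob C \<Longrightarrow> oper (pos23 F X) [Z, Y, X] [Z, Y, X]"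
  using oper_pre[of F "[Z, Y]" "[Z, Y]" "[X]"] by (simp add: pos23_def[abs_def])
lemma oper_pos13: assumes "oper F [Z, X] [Z, X]" "Y \<in> Ob C" shows "oper (pos13 F X Y Z) [Z, Y, X] [Z, Y, X]"
proof -
  have o: "X \<in> Ob C" "Z \<in> Ob C" using operD(1)[OF assms(1)] by auto
  have "oper (\<lambda>P. sg P X Y \<star> idt Z) [Z, Y, X] [Z, X, Y]" "oper (\<lambda>P. sg P Y X \<star> idt Z) [Z, X, Y] [Z, Y, X]"
    using oper_post[OF oper_sg[of X Y], of Z] oper_post[OF oper_sg[of Y X], of Z] o assms(2) by simp_all
  moreover have "oper (\<lambda>P. F (P \<odot> Y)) [Z, X, Y] [Z, X, Y]" using oper_pre[OF assms(1), of "[Y]"] assms(2) by simp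
  ultimately have "oper (\<lambda>P. sg P Y X \<star> idt Z \<bullet> F (P \<odot> Y) \<bullet> sg P X Y \<star> idt Z) [Z, Y, X] [Z, Y, X]"
    by (intro oper_cmp)
  then show ?thesis by (simp add: pos13_def[abs_def])
qed

lemma act_pos12: "x \<in> El S \<Longrightarrow> oper F [ty b, ty a] [ty b, ty a] \<Longrightarrow> distinct [a, b, c] \<Longrightarrow> {a, b, c} \<subseteq> S \<Longrightarrow>
    act (pos12 F (ty c)) [c, b, a] [c, b, a] x = on2 F a b x"
  unfolding pos12_def[abs_def] by (rule act_post) (auto simp: lop_def ready_def)
lemma act_pos23: "x \<in> El S \<Longrightarrow> oper F [ty c, ty b] [ty c, ty b] \<Longrightarrow> distinct [a, b, c] \<Longrightarrow> {a, b, c} \<subseteq> S \<Longrightarrow>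
    act (pos23 F (ty a)) [c, b, a] [c, b, a] x = on2 F b c x"
  unfolding pos23_def[abs_def] using act_pre[of x S F "[c, b]" "[c, b]" "[a]"] by (auto simp: lop_def ready_def)
lemma act_sg_post:
  assumes x: "x \<in> El S" and l: "distinct [p, q, c]" "{p, q, c} \<subseteq> S"
  shows "lop (\<lambda>P. sg P (ty p) (ty q) \<star> idt (ty c)) [c, q, p] [c, p, q]"
    "act (\<lambda>P. sg P (ty p) (ty q) \<star> idt (ty c)) [c, q, p] [c, p, q] x = x"
proof -
  show "lop (\<lambda>P. sg P (ty p) (ty q) \<star> idt (ty c)) [c, q, p] [c, p, q]"
    using l oper_post[OF oper_sg[of "ty p" "ty q"], of "ty c"] by (auto simp: lop_def)
  show "act (\<lambda>P. sg P (ty p) (ty q) \<star> idt (ty c)) [c, q, p] [c, p, q] x = x"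
    using act_post[OF x lop_sg[of p q], of c] act_swap[OF x, of p q] l by (auto simp: ready_def)
qed
text \<open>On labelled legs the conjugating swaps act as identities.\<close>

lemma act_pos13:
  assumes x: "x \<in> El S" and F: "oper F [ty c, ty a] [ty c, ty a]" and l: "distinct [a, b, c]" "{a, b, c} \<subseteq> S"
  shows "act (pos13 F (ty a) (ty b) (ty c)) [c, b, a] [c, b, a] x = on2 F a c x"
proof -
  have p: "lop (\<lambda>P. F (P \<odot> ty b)) [c, a, b] [c, a, b]"
    using F l oper_pre[OF F, of "[ty b]"] by (auto simp: lop_def)
  have m: "on2 F a c x \<in> El S" using x F l by (auto intro!: on2_El)
  have r: "ready [c, b, a] [c, a, b] S" "ready [c, b, a] [c, b, a] S" using l by (auto simp: ready_def)
  have pl: "lop (\<lambda>P. F (P \<odot> ty b) \<bullet> sg P (ty a) (ty b) \<star> idt (ty c)) [c, b, a] [c, a, b]"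
    using act_sg_post(1)[OF x, of a b c] p l by (auto simp: lop_def intro: oper_cmp)
  have "act (pos13 F (ty a) (ty b) (ty c)) [c, b, a] [c, b, a] x
    = act (\<lambda>P. sg P (ty b) (ty a) \<star> idt (ty c)) [c, a, b] [c, b, a]
       (act (\<lambda>P. F (P \<odot> ty b) \<bullet> sg P (ty a) (ty b) \<star> idt (ty c)) [c, b, a] [c, a, b] x)"
    unfolding pos13_def[abs_def] using act_sg_post(1)[OF x, of b a c] l by (intro act_cmp[OF x pl _ r]) auto
  also have "act (\<lambda>P. F (P \<odot> ty b) \<bullet> sg P (ty a) (ty b) \<star> idt (ty c)) [c, b, a] [c, a, b] x
     = act (\<lambda>P. F (P \<odot> ty b)) [c, a, b] [c, a, b] (act (\<lambda>P. sg P (ty a) (ty b) \<star> idt (ty c)) [c, b, a] [c, a, b] x)"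
    using act_sg_post(1)[OF x, of a b c] l by (intro act_cmp[OF x _ p r(1) r(1)]) auto
  also have "\<dots> = on2 F a c x"
    using act_sg_post(2)[OF x, of a b c] l act_pre[OF x, of F "[c, a]" "[c, a]" "[b]"] F by (auto simp: lop_def ready_def)
  also have "act (\<lambda>P. sg P (ty b) (ty a) \<star> idt (ty c)) [c, a, b] [c, b, a] (on2 F a c x) = on2 F a c x"
    using act_sg_post(2)[OF m, of b a c] l by auto
  finally show ?thesis .
qed

lemma act_inverse:
  assumes F: "oper F [Y, X] [Y, X]" and G: "oper G [Y, X] [Y, X]"
    and e: "\<And>P. P \<in> Ob C \<Longrightarrow> G P \<bullet> F P = idt (P \<odot> X \<odot> Y)"
    and x: "x \<in> El S" and l: "{a, b} \<subseteq> S" "a \<noteq> b" "ty a = X" "ty b = Y"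
  shows "on2 G a b (on2 F a b x) = x"
proof -
  have "on2 G a b (on2 F a b x) = on2 (\<lambda>P. G P \<bullet> F P) a b x"
    using F G l by (intro act_cmp[OF x, symmetric]) (auto simp: lop_def ready_def)
  also have "\<dots> = on2 (\<lambda>P. idt (ob P (map ty [b, a]))) a b x"
    using x e l by (intro act_cong) (auto simp: El_fst El_fin)
  also have "\<dots> = x" using l by (intro act_idt[OF x]) auto
  finally show ?thesis .
qed

end

section \<open>Inverting a coaction by descent along the counit\<close>

context hopf_legs
begin

text \<open>Tested by multiplication with a fresh leg d from the left, where d and b are taken in
  the image of \<open>t2f\<close>: compatibility turns \<open>f\<close> on a into \<open>g\<close>
  on d, and \<open>mixed_coassoc2\<close> merges the two copies of \<open>g\<close> into one, which
  the counit removes.\<close>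

lemma antipode_right:
  assumes c: "coaction V f" "compatible V f g" "counital V f"
    and x: "x \<in> El S" and l: "{v, a, b} \<subseteq> S" "distinct [v, a, b]" "ty v = V" "ty a = A" "ty b = A"
  shows "on2 f v a (Ep b (on2 tif b a (on2 g v b x))) = Ep b (on2 tif b a x)" (is "on2 f v a ?y = ?y'")
proof -
  note f = coactionD[OF c(1)] and g = compatibleD[OF c(2)]
  have gc: "counital V g" using counital_compatible[OF c(3,2) f(2)] .
  obtain d where d: "d \<notin> S" "ty d = A" using fresh El_fin[OF x] by blast
  let ?S = "insert d S"
  define z where "z = on2 t2if d b (ext d x)"
  have x': "ext d x \<in> El ?S" using x d by (rule_tac ext_El)
  have ne: "a \<noteq> d" "v \<noteq> d" "b \<noteq> d" using l d by auto
  note s = l d ne f(1,2) g(1)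
  have z: "z \<in> El ?S" unfolding z_def using s x' by (simp_all add: on2_El)
  have e: "ext d x = on2 t2f d b z" unfolding z_def using s by (simp add: t2f_inv[OF x'])
  have mx: "on2 g v b x \<in> El S" "on2 tif b a (on2 g v b x) \<in> El S" "on2 tif b a x \<in> El S"
    "?y \<in> El (S - {b})" "on2 f v a ?y \<in> El (S - {b})" "?y' \<in> El (S - {b})"
    using s x by (simp_all add: on2_El Ep_El[OF _ _ _ refl])
  \<comment> \<open>\<open>t2f\<close> on d, b commutes with \<open>tif\<close> on b, a; under the
    counit it becomes the product of d and b, and associativity moves b onto a, where
    \<open>tif\<close> cancels.\<close>
  have t: "Mu d a (Ep b (on2 tif b a (on2 t2f d b w))) = Mu d a (Ep b w)" if w: "w \<in> El ?S" for w
  proof -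
    have m: "on2 tif b a w \<in> El ?S" "on2 t2f d b w \<in> El ?S" "on2 t2f d b (on2 tif b a w) \<in> El ?S" 
      using s w by (simp_all add: on2_El)
    have "on2 tif b a (on2 t2f d b w) = on2 tif b a (on2 t2f d b (on2 tf b a (on2 tif b a w)))"
      using s by (simp add: tf_inv[OF w])
    also have "\<dots> = on2 tif b a (on2 tf b a (on2 t2f d b (on2 tif b a w)))"
      using s by (subst tf_t2f[OF m(1)]) auto
    also have "\<dots> = on2 t2f d b (on2 tif b a w)" using s by (simp add: tif_inv[OF m(3)])
    finally have "Mu d a (Ep b (on2 tif b a (on2 t2f d b w))) = Mu d a (Mu2 d b (on2 tif b a w))"
      using s by (simp add: mf_t2f[OF m(1)])
    also have "\<dots> = Mu d a (Mu b a (on2 tif b a w))" using s by (intro Mu_assoc2[OF m(1)]) auto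
    also have "\<dots> = Mu d a (Ep b w)" using s by (simp add: mf_tf[OF m(1)] tf_inv[OF w])
    finally show ?thesis .
  qed
  have m: "on2 g v b (on2 t2f d b z) \<in> El ?S" "on2 tif b a (on2 g v b (on2 t2f d b z)) \<in> El ?S"
    "Ep b (on2 tif b a (on2 g v b (on2 t2f d b z))) \<in> El (?S - {b})" "on2 g v b z \<in> El ?S" "on2 t2f d b z \<in> El ?S"
    using s z by (simp_all add: on2_El Ep_El[OF _ _ _ refl])
  have "Mu d a (ext d (on2 f v a ?y)) = Mu d a (on2 f v a (ext d ?y))"
    using s by (simp add: on2_ext[OF mx(4)])
  also have "\<dots> = Mu d a (on2 f v a (Ep b (on2 tif b a (on2 g v b (on2 t2f d b z)))))"
    unfolding e[symmetric] using s by (simp add: Ep_ext[OF mx(2)] on2_ext[OF mx(1)] on2_ext[OF x])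
  also have "\<dots> = Mu d a (on2 g v d (Ep b (on2 tif b a (on2 g v b (on2 t2f d b z)))))"
    using s by (intro g(2)[OF m(3)]) auto
  also have "\<dots> = Mu d a (Ep b (on2 g v d (on2 tif b a (on2 g v b (on2 t2f d b z)))))"
    using s by (subst Ep_on2[OF m(2)]) auto
  also have "\<dots> = Mu d a (Ep b (on2 tif b a (on2 g v d (on2 g v b (on2 t2f d b z)))))"
    using s by (subst on2_comm[OF m(1)]) auto
  also have "\<dots> = Mu d a (Ep b (on2 tif b a (on2 t2f d b (on2 g v b z))))"
    using s mixed_coassoc2[OF c(1,2) z, of v d b] by simp
  also have "\<dots> = Mu d a (Ep b (on2 g v b z))" by (rule t[OF m(4)])
  also have "\<dots> = Mu d a (Ep b z)" using s counitalD[OF gc z, of v b] by simp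
  also have "\<dots> = Mu d a (Ep b (on2 tif b a (on2 t2f d b z)))" by (rule t[OF z, symmetric])
  also have "\<dots> = Mu d a (ext d ?y')"
    unfolding e[symmetric] using s by (simp add: Ep_ext[OF mx(3)] on2_ext[OF x])
  finally show ?thesis
    by (rule nondeg_left[of _ "S - {b}" _ a d, rotated -1]) (use s mx in auto)
qed

text \<open>\<open>mixed_coassoc\<close> with the legs b, a replaces \<open>g\<close> after
  \<open>tf\<close> after \<open>f\<close> by \<open>tf\<close> after \<open>g\<close>; then
  \<open>tif\<close> cancels \<open>tf\<close> and the counit absorbs \<open>g\<close>.\<close>

lemma antipode_left:
  assumes c: "coaction V f" "compatible V f g" "counital V f"
    and x: "x \<in> El S" and l: "{v, a, b} \<subseteq> S" "distinct [v, a, b]" "ty v = V" "ty a = A" "ty b = A"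
  shows "Ep b (on2 tif b a (on2 g v b (on2 tf b a (on2 f v a x)))) = Ep b x"
proof -
  note f = coactionD[OF c(1)] and g = compatibleD[OF c(2)]
  have gc: "counital V g" using counital_compatible[OF c(3,2) f(2)] .
  have m: "on2 g v b x \<in> El S" using x l g by (simp add: on2_El)
  show ?thesis using mixed_coassoc[OF c(1,2) x, of v b a] counitalD[OF gc x, of v b] l
    by (simp add: tif_inv[OF m])
qed

text \<open>From the image under \<open>f\<close>, \<open>antipode_left\<close> recovers the counit
  of an adjoined leg, hence by density the element itself.\<close>

lemma coaction_mono:
  assumes c: "coaction V f" "compatible V f g" "counital V f"
    and x: "x \<in> El S" "y \<in> El S" and l: "{v, a} \<subseteq> S" "v \<noteq> a" "ty v = V" "ty a = A"
    and e: "on2 f v a x = on2 f v a y"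
  shows "x = y"
proof -
  note f = coactionD[OF c(1)]
  obtain b where b: "b \<notin> S" "ty b = A" using fresh El_fin[OF x(1)] by blast
  have ne: "v \<noteq> b" "a \<noteq> b" using b l by auto
  have X: "ext b x \<in> El (insert b S)" "ext b y \<in> El (insert b S)" using x b by (auto intro: ext_El)
  have "on2 f v a (ext b x) = on2 f v a (ext b y)"
    using l b e f(2) by (simp add: on2_ext[OF x(1)] on2_ext[OF x(2)])
  then have "Ep b (ext b x) = Ep b (ext b y)"
    using antipode_left[OF c X(1), of v a b] antipode_left[OF c X(2), of v a b] l b ne by simp
  moreover have "dm (snd x) = dm (snd y)" using arg_cong[OF e, of "\<lambda>x. dm (snd x)"] by simp
  ultimately show ?thesis using x b by (intro counit_epi[of x S y b]) auto
qed

text \<open>An operation natural in the stage is determined by its value on the generic element,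
  hence by one morphism \<open>k\<close>. The hypothesis on \<open>Ep b\<close> lets
  \<open>k\<close> factor through the counit, and \<open>fam_unit_ex\<close> turns the factor into a
  family.\<close>

lemma descend:
  assumes l: "distinct [v, a, b]" "ty v = V" "ty a = A" "ty b = A"
    and El: "\<And>x. x \<in> El {v, a, b} \<Longrightarrow> \<Phi> x \<in> El {v, a}"
    and cp: "\<And>x p. x \<in> El {v, a, b} \<Longrightarrow> \<Phi> (cp x p) = cp (\<Phi> x) p"
    and dm: "\<And>x. x \<in> El {v, a, b} \<Longrightarrow> dm (snd (\<Phi> x)) = dm (snd x)"
    and e: "\<And>x y. x \<in> El {v, a, b} \<Longrightarrow> y \<in> El {v, a, b} \<Longrightarrow> Ep b x = Ep b y \<Longrightarrow> \<Phi> x = \<Phi> y"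
  obtains w where "oper w [A, V] [A, V]" "\<And>x. x \<in> El {v, a, b} \<Longrightarrow> on2 w v a (Ep b x) = \<Phi> x"
proof -
  let ?S = "{v, a, b}" and ?P = "obl [a, v]" and ?l = "[b, a, v]"
  have V: "V \<in> Ob C" using l ty_Ob by metis
  have u: "uni ?l \<in> El ?S" using uni_El[of ?l] l by (simp add: insert_commute)
  define k where "k = at (\<Phi> (uni ?l)) [a, v]"
  have k: "mor k" "dm k = ?P \<odot> A" "cd k = ?P"
    unfolding k_def using l u by (auto intro!: mor_at[OF El[OF u]] simp: dm)
  have atP: "at (Ep b x) [a, v] = ef ?P \<bullet> at x ?l" if "x \<in> El ?S" for x
    using act_at[OF that, of ef "[b]" "[]" "[a, v]"] l by (auto simp: lop_def ready_def)
  have Ex: "cp (uni ?l) x \<in> El ?S" "at (cp (uni ?l) x) ?l = x" "k \<bullet> x = at (\<Phi> (cp (uni ?l) x)) [a, v]"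
    if "mor x" "cd x = ?P \<odot> A" for x
    using that l u by (auto intro!: cp_El simp: at_cp at_uni cp k_def)
  have "\<exists>w. mor w \<and> dm w = ?P \<and> cd w = cd k \<and> w \<bullet> ef ?P = k"
  proof (rule descent)
    fix x y assume h: "mor x" "mor y" "dm x = dm y" "cd x = ?P \<odot> A" "cd y = ?P \<odot> A" "ef ?P \<bullet> x = ef ?P \<bullet> y"
    let ?x = "cp (uni ?l) x" and ?y = "cp (uni ?l) y"
    note X = Ex[OF h(1,4)] and Y = Ex[OF h(2,5)]
    have "at (Ep b ?x) [a, v] = at (Ep b ?y) [a, v]"
      unfolding atP[OF X(1)] atP[OF Y(1)] X(2) Y(2) by (rule h(6))
    moreover have "Ep b ?x \<in> El {v, a}" "Ep b ?y \<in> El {v, a}"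
      using l by (auto intro!: Ep_El[OF X(1)] Ep_El[OF Y(1)])
    ultimately have "Ep b ?x = Ep b ?y" using l by (intro El_eqI[of _ "{v, a}" _ "[a, v]"]) auto
    then have "\<Phi> ?x = \<Phi> ?y" by (rule e[OF X(1) Y(1)])
    then show "k \<bullet> x = k \<bullet> y" unfolding X(3) Y(3) by simp
  qed (use k in simp_all)
  then obtain w0 where w0: "mor w0" "dm w0 = ?P" "cd w0 = ?P" "w0 \<bullet> ef ?P = k" using k by auto
  then obtain w where w: "mor w" "dm w = V \<odot> A" "cd w = V \<odot> A" "fam [A, V] [A, V] w \<I> = w0"
    using fam_unit_ex[of w0 "[A, V]" "[A, V]"] l V by auto
  have o: "oper (fam [A, V] [A, V] w) [A, V] [A, V]" using V w by (intro oper_fam) auto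
  show thesis
  proof (rule that[OF o])
    fix x assume x: "x \<in> El ?S"
    have m: "Ep b x \<in> El {v, a}" using x l by (auto intro!: Ep_El[of _ ?S])
    have m2: "mor (at x ?l)" by (rule mor_at[OF x]) (use l in auto)
    have "at (on2 (fam [A, V] [A, V] w) v a (Ep b x)) [a, v] = w0 \<bullet> at (Ep b x) [a, v]"
      using act_at[OF m, of _ "[a, v]" "[a, v]" "[]"] o l w by (auto simp: lop_def ready_def)
    also have "\<dots> = k \<bullet> at x ?l" using w0 by (simp add: atP[OF x] cmp_assoc[symmetric])
    also have "\<dots> = at (\<Phi> x) [a, v]" 
      using Ex(3)[OF m2] El_uni[OF x, of ?l] l by (simp add: insert_commute)
    finally have e: "at (on2 (fam [A, V] [A, V] w) v a (Ep b x)) [a, v] = at (\<Phi> x) [a, v]" .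
    have "on2 (fam [A, V] [A, V] w) v a (Ep b x) \<in> El {v, a}" using m o l by (auto intro!: on2_El)
    then show "on2 (fam [A, V] [A, V] w) v a (Ep b x) = \<Phi> x"
      using El[OF x] l e by (intro El_eqI[of _ "{v, a}" _ "[a, v]"]) auto
  qed
qed

text \<open>The candidate \<Phi> depends on the counit of b alone: \<open>f\<close> after \<Phi> is
  that counit by \<open>antipode_right\<close>, and \<open>f\<close> is injective.\<close>

lemma coaction_invertible:
  assumes c: "coaction V f" "compatible V f g" "counital V f" and V: "\<exists>v. ty v = V"
  obtains w where "oper w [A, V] [A, V]"
    "\<And>P. P \<in> Ob C \<Longrightarrow> w P \<bullet> f P = idt (P \<odot> V \<odot> A)" "\<And>P. P \<in> Ob C \<Longrightarrow> f P \<bullet> w P = idt (P \<odot> V \<odot> A)"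
proof -
  note f = coactionD[OF c(1)] and g = compatibleD[OF c(2)]
  obtain v where v: "ty v = V" using V by blast
  obtain a where a: "a \<noteq> v" "ty a = A" using fresh[of "{v}"] by auto
  obtain b where b: "b \<noteq> v" "b \<noteq> a" "ty b = A" using fresh[of "{v, a}"] by auto
  note l = v a b a(1)[symmetric] b(1,2)[symmetric] f(1,2) g(1)
  define \<Phi> where "\<Phi> x = Ep b (on2 tif b a (on2 g v b (on2 tf b a x)))" for x
  let ?S = "{v, a, b}"
  have El: "\<Phi> x \<in> El {v, a}" if "x \<in> El ?S" for x
    unfolding \<Phi>_def by (rule Ep_El[of _ ?S]) (use l that in \<open>auto simp: on2_El\<close>)
  have fP: "on2 f v a (\<Phi> x) = Ep b x" if x: "x \<in> El ?S" for x
  proof -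
    have "on2 tf b a x \<in> El ?S" using x l by (simp add: on2_El)
    from antipode_right[OF c this, of v a b] show ?thesis
      unfolding \<Phi>_def using l x by (simp add: tif_inv[OF x])
  qed
  obtain w where w: "oper w [A, V] [A, V]" "\<And>x. x \<in> El ?S \<Longrightarrow> on2 w v a (Ep b x) = \<Phi> x"
  proof (rule descend[of v a b V \<Phi>])
    fix x y assume "x \<in> El ?S" "y \<in> El ?S" "Ep b x = Ep b y"
    then show "\<Phi> x = \<Phi> y" using l
      by (intro coaction_mono[OF c El El, of x y v a]) (auto simp: fP)
  qed (use l El in \<open>auto simp: \<Phi>_def act_cp\<close>)
  have X: "ext b x \<in> El ?S" if "x \<in> El {v, a}" for x using ext_El[OF that, of b] l by (simp add: insert_commute)
  \<comment> \<open>Both inverse laws are checked after adjoining b and applying its counit, where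
    \<open>w\<close> is given by \<Phi>.\<close>
  have 1: "on2 w v a (on2 f v a x) = x" if x: "x \<in> El {v, a}" for x
  proof -
    have m: "on2 f v a x \<in> El {v, a}" "on2 w v a (on2 f v a x) \<in> El {v, a}" "on2 f v a (ext b x) \<in> El ?S"
      using x w(1) X l by (simp_all add: on2_El)
    have "Ep b (ext b (on2 w v a (on2 f v a x))) = on2 w v a (Ep b (on2 f v a (ext b x)))"
      using l w(1) X[OF m(1)] by (simp add: on2_ext[OF m(1), symmetric] on2_ext[OF x] Ep_on2[of _ ?S])
    also have "\<dots> = Ep b (ext b x)"
      unfolding w(2)[OF m(3)] \<Phi>_def using antipode_left[OF c X[OF x], of v a b] l by simp
    finally show ?thesis by (rule counit_epi[rotated -1]) (use l m x in auto)
  qed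
  have 2: "on2 f v a (on2 w v a x) = x" if x: "x \<in> El {v, a}" for x
  proof -
    have m: "on2 w v a x \<in> El {v, a}" "on2 f v a (on2 w v a x) \<in> El {v, a}" 
      using x w(1) X l by (simp_all add: on2_El)
    have "Ep b (ext b (on2 f v a (on2 w v a x))) = on2 f v a (on2 w v a (Ep b (ext b x)))"
      using l w(1) X[OF m(1)] X[OF x]
      by (simp add: on2_ext[OF m(1), symmetric] on2_ext[OF x, symmetric] Ep_on2[of _ ?S] on2_El)
    also have "\<dots> = Ep b (ext b x)" by (simp add: w(2)[OF X[OF x]] fP[OF X[OF x]])
    finally show ?thesis by (rule counit_epi[rotated -1]) (use l m x in auto)
  qed
  \<comment> \<open>The laws on elements whose only legs are v and a determine the composite
    families.\<close>
  have E: "G P \<bullet> F P = idt (P \<odot> V \<odot> A)" if P: "P \<in> Ob C" and FG: "oper F [A, V] [A, V]" "oper G [A, V] [A, V]"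
     "\<And>x. x \<in> El {v, a} \<Longrightarrow> on2 G v a (on2 F v a x) = x" for F G P
  proof -
    have i: "oper (\<lambda>P. idt (P \<odot> V \<odot> A)) [A, V] [A, V]" using oper_id[of "[A, V]"] l by simp
    show ?thesis
    proof (rule oper_eqI_act[of _ "[a, v]" "[a, v]" "\<lambda>P. idt (P \<odot> V \<odot> A)", OF _ _ _ _ _ P])
      fix x assume "x \<in> El (set [a, v])"
      then have x: "x \<in> El {v, a}" by (simp add: insert_commute)
      have "act (\<lambda>P. G P \<bullet> F P) [a, v] [a, v] x = on2 G v a (on2 F v a x)"
        using FG l by (intro act_cmp[OF x]) (auto simp: lop_def ready_def)
      also have "\<dots> = act (\<lambda>P. idt (P \<odot> V \<odot> A)) [a, v] [a, v] x"
        using FG(3)[OF x] act_idt[OF x, of "[a, v]"] l by simp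
      finally show "act (\<lambda>P. G P \<bullet> F P) [a, v] [a, v] x = act (\<lambda>P. idt (P \<odot> V \<odot> A)) [a, v] [a, v] x" .
    qed (use l i FG in \<open>auto intro: oper_cmp\<close>)
  qed
  show thesis by (rule that[OF w(1)]) (use E f(2) w(1) 1 2 in auto)
qed

text \<open>The heart is \<open>test\<close>: after multiplication of a by d, the expression that is
  to define \<open>y\<close> depends on its argument through the counit of b only, and equals
  \<open>w\<close> on the leg d. This yields the descent, by non-degeneracy, and also the
  compatibility of \<open>w\<close> with the resulting \<open>y\<close>.\<close>

lemma inverse_compatible_ex:
  assumes c: "coaction V f" "compatible V f g" "counital V f" and V: "\<exists>v. ty v = V"
    and w: "oper w [A, V] [A, V]"
    "\<And>P. P \<in> Ob C \<Longrightarrow> w P \<bullet> f P = idt (P \<odot> V \<odot> A)" "\<And>P. P \<in> Ob C \<Longrightarrow> f P \<bullet> w P = idt (P \<odot> V \<odot> A)"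
  obtains y where "compatible V w y"
proof -
  note f = coactionD[OF c(1)] and g = compatibleD[OF c(2)]
  have wf: "on2 w v a (on2 f v a x) = x" if "x \<in> El S" "{v, a} \<subseteq> S" "v \<noteq> a" "ty v = V" "ty a = A" for x S v a
    using act_inverse[OF f(2) w(1,2) that(1)] that by auto
  have fw: "on2 f v a (on2 w v a x) = x" if "x \<in> El S" "{v, a} \<subseteq> S" "v \<noteq> a" "ty v = V" "ty a = A" for x S v a
    using act_inverse[OF w(1) f(2) w(3) that(1)] that by auto
  have test: "Mu a d (Ep b (on2 t2if a b (on2 f v b z))) = Mu a d (on2 w v d (Ep b (on2 t2if a b z)))"
    if z: "z \<in> El S" and l: "{v, a, b, d} \<subseteq> S" "distinct [v, a, b, d]" "ty v = V" "ty a = A" "ty b = A" "ty d = A" for S z v a b d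
  proof -
    note s = l f(1,2) w(1)
    \<comment> \<open>Chosen so that \<open>z\<close> is \<open>f\<close> on d after
      \<open>tf\<close> on b, d; the coaction law then applies to \<open>f\<close> on b of
      \<open>z\<close>.\<close>
    define y where "y = on2 tif b d (on2 w v d z)"
    have m: "on2 w v d z \<in> El S" "y \<in> El S" "on2 f v b y \<in> El S" "on2 tf b d y \<in> El S" "on2 f v d (on2 tf b d y) \<in> El S"
      unfolding y_def using s z by (simp_all add: on2_El)
    have ez: "z = on2 f v d (on2 tf b d y)" unfolding y_def using s by (simp add: tf_inv[OF m(1)] fw[OF z])
    \<comment> \<open>Mirror image of the corresponding step in \<open>antipode_right\<close>, with
      the roles of \<open>tf\<close> and \<open>t2f\<close> exchanged.\<close>
    have t: "Mu a d (Ep b (on2 t2if a b (on2 tf b d r))) = Mu a d (Ep b r)" if r: "r \<in> El S" for r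
    proof -
      have m: "on2 t2if a b r \<in> El S" "on2 tf b d (on2 t2if a b r) \<in> El S" using s r by (simp_all add: on2_El)
      have "on2 tf b d r = on2 tf b d (on2 t2f a b (on2 t2if a b r))" using s by (simp add: t2f_inv[OF r])
      also have "\<dots> = on2 t2f a b (on2 tf b d (on2 t2if a b r))" using s by (intro tf_t2f[OF m(1)]) auto
      finally have "Ep b (on2 t2if a b (on2 tf b d r)) = Ep b (on2 tf b d (on2 t2if a b r))"
        using s by (simp add: t2if_inv[OF m(2)])
      then have "Mu a d (Ep b (on2 t2if a b (on2 tf b d r))) = Mu a d (Mu b d (on2 t2if a b r))"
        using s by (simp add: mf_tf[OF m(1)])
      also have "\<dots> = Mu a d (Mu2 a b (on2 t2if a b r))" using s by (intro Mu_assoc2[OF m(1), symmetric]) auto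
      also have "\<dots> = Mu a d (Ep b r)" using s by (simp add: mf_t2f[OF m(1)] t2f_inv[OF r])
      finally show ?thesis .
    qed
    have m3: "on2 t2if a b (on2 f v d (on2 tf b d y)) \<in> El S" "on2 t2if a b (on2 tf b d y) \<in> El S"
      "Ep b (on2 t2if a b (on2 tf b d y)) \<in> El (S - {b})"
      using s z m by (simp_all add: on2_El Ep_El[OF _ _ _ refl])
    have "on2 f v b z = on2 f v b (on2 f v d (on2 tf b d y))" by (simp only: ez)
    also have "\<dots> = on2 tf b d (on2 f v b y)" using s by (intro f(3)[OF m(2)]) auto
    finally have "Mu a d (Ep b (on2 t2if a b (on2 f v b z))) = Mu a d (Ep b (on2 f v b y))"
      by (simp add: t[OF m(3)])
    also have "\<dots> = Mu a d (Ep b y)" using s counitalD[OF c(3) m(2), of v b] by simp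
    also have "\<dots> = Mu a d (Ep b (on2 t2if a b (on2 tf b d y)))" by (rule t[OF m(2), symmetric])
    also have "\<dots> = Mu a d (on2 w v d (on2 f v d (Ep b (on2 t2if a b (on2 tf b d y)))))"
      using s by (simp add: wf[OF m3(3)])
    also have "on2 f v d (Ep b (on2 t2if a b (on2 tf b d y))) = Ep b (on2 f v d (on2 t2if a b (on2 tf b d y)))"
      using s by (intro Ep_on2[OF m3(2), symmetric]) auto
    also have "on2 f v d (on2 t2if a b (on2 tf b d y)) = on2 t2if a b (on2 f v d (on2 tf b d y))"
      using s by (intro on2_comm[OF m(4)]) auto
    finally show ?thesis by (simp only: ez[symmetric])
  qed
  obtain v where v: "ty v = V" using V by blast
  obtain a where a: "a \<noteq> v" "ty a = A" using fresh[of "{v}"] by auto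
  obtain b where b: "b \<noteq> v" "b \<noteq> a" "ty b = A" using fresh[of "{v, a}"] by auto
  obtain d where d: "d \<noteq> v" "d \<noteq> a" "d \<noteq> b" "ty d = A" using fresh[of "{v, a, b}"] by auto
  note l = v a b d a(1)[symmetric] b(1,2)[symmetric] d(1-3)[symmetric] f(1,2) g(1) w(1)
  define \<Phi> where "\<Phi> v a b x = Ep b (on2 t2if a b (on2 f v b (on2 t2f a b x)))" for v a b x
  let ?S = "{v, a, b}"
  have El: "\<Phi> v a b x \<in> El {v, a}" if "x \<in> El ?S" for x
    unfolding \<Phi>_def by (rule Ep_El[of _ ?S]) (use l that in \<open>auto simp: on2_El\<close>)
  have M: "Mu a d (ext d (\<Phi> v a b x)) = Mu a d (on2 w v d (ext d (Ep b x)))" if x: "x \<in> El ?S" for x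
  proof -
    have m1: "on2 t2f a b x \<in> El ?S" by (rule on2_El[OF x]) (use l in simp_all)
    have m2: "on2 f v b (on2 t2f a b x) \<in> El ?S" by (rule on2_El[OF m1]) (use l in simp_all)
    have m3: "on2 t2if a b (on2 f v b (on2 t2f a b x)) \<in> El ?S" by (rule on2_El[OF m2]) (use l in simp_all)
    note m = m1 m2 m3
    have X: "ext d x \<in> El (insert d ?S)" by (rule ext_El[OF x]) (use l in simp)
    have m': "on2 t2f a b (ext d x) \<in> El (insert d ?S)" by (rule on2_El[OF X]) (use l in simp_all)
    have "ext d (\<Phi> v a b x) = Ep b (on2 t2if a b (on2 f v b (on2 t2f a b (ext d x))))"
      unfolding \<Phi>_def using l by (simp add: Ep_ext[OF m(3)] on2_ext[OF m(2)] on2_ext[OF m(1)] on2_ext[OF x])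
    then show ?thesis using test[OF m', of v a b d] l by (simp add: t2if_inv[OF X] Ep_ext[OF x])
  qed
  obtain y where y: "oper y [A, V] [A, V]" "\<And>x. x \<in> El ?S \<Longrightarrow> on2 y v a (Ep b x) = \<Phi> v a b x"
  proof (rule descend[of v a b V "\<Phi> v a b"])
    fix x x' assume h: "x \<in> El ?S" "x' \<in> El ?S" "Ep b x = Ep b x'"
    have "Mu a d (ext d (\<Phi> v a b x)) = Mu a d (ext d (\<Phi> v a b x'))"
      unfolding M[OF h(1)] M[OF h(2)] h(3) ..
    moreover have "dm (snd x) = dm (snd x')" using arg_cong[OF h(3), of "\<lambda>x. dm (snd x)"] by simp
    then have "dm (snd (\<Phi> v a b x)) = dm (snd (\<Phi> v a b x'))" by (simp add: \<Phi>_def)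
    ultimately show "\<Phi> v a b x = \<Phi> v a b x'"
      using l by (intro nondeg_right[OF El[OF h(1)] El[OF h(2)], of a d]) simp_all
  qed (use l El in \<open>auto simp: \<Phi>_def act_cp\<close>)
  \<comment> \<open>The equation for \<open>y\<close> is known only on the fixed legs v, a, b.
    Writing both sides as families \<open>F\<close> and \<open>G\<close> on three-letter words
    carries it over to arbitrary labels and further legs, which is \<open>Y\<close> below.\<close>
  define F where "F P = y P \<bullet> ef (P \<odot> V \<odot> A)" for P
  define G where "G P = ef (P \<odot> V \<odot> A) \<bullet> pos23 t2if V P \<bullet> pos13 f V A A P \<bullet> pos23 t2f V P" for P
  have Fe: "oper (\<lambda>P. ef (P \<odot> V \<odot> A)) [A, A, V] [A, V]"
    using oper_pre[OF oper_ef, of "[A, V]"] l by simp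
  have FO: "oper F [A, A, V] [A, V]" unfolding F_def[abs_def] by (rule oper_cmp[OF Fe y(1)])
  have p: "oper (pos23 t2f V) [A, A, V] [A, A, V]" "oper (pos13 f V A A) [A, A, V] [A, A, V]" "oper (pos23 t2if V) [A, A, V] [A, A, V]"
    using l by (simp_all add: oper_pos23 oper_pos13)
  have p1: "oper (\<lambda>P. pos13 f V A A P \<bullet> pos23 t2f V P) [A, A, V] [A, A, V]" by (rule oper_cmp[OF p(1,2)])
  have p2: "oper (\<lambda>P. pos23 t2if V P \<bullet> pos13 f V A A P \<bullet> pos23 t2f V P) [A, A, V] [A, A, V]" by (rule oper_cmp[OF p1 p(3)])
  have GO: "oper G [A, A, V] [A, V]" unfolding G_def[abs_def] by (rule oper_cmp[OF p2 Fe])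
  have e: "act (\<lambda>P. ef (P \<odot> V \<odot> A)) [b, a, v] [a, v] x = Ep b x"
    if "x \<in> El S" "{v, a, b} \<subseteq> S" "distinct [v, a, b]" "ty v = V" "ty a = A" "ty b = A" for x S v a b
    using act_pre[OF that(1), of ef "[b]" "[]" "[a, v]"] that by (auto simp: lop_def ready_def)
  have Fa: "act F [b, a, v] [a, v] x = on2 y v a (Ep b x)"
    if x: "x \<in> El S" and l: "{v, a, b} \<subseteq> S" "distinct [v, a, b]" "ty v = V" "ty a = A" "ty b = A" for x S v a b
    unfolding F_def[abs_def] using act_cmp[OF x, of "\<lambda>P. ef (P \<odot> V \<odot> A)" "[b, a, v]" "[a, v]" y "[a, v]"] l Fe y(1) e[OF x l]
    by (simp add: lop_def ready_def)
  have Ga: "act G [b, a, v] [a, v] x = \<Phi> v a b x"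
    if x: "x \<in> El S" and l: "{v, a, b} \<subseteq> S" "distinct [v, a, b]" "ty v = V" "ty a = A" "ty b = A" for x S v a b
  proof -
    note s = l f(1,2)
    have m: "on2 t2f a b x \<in> El S" "on2 f v b (on2 t2f a b x) \<in> El S" "on2 t2if a b (on2 f v b (on2 t2f a b x)) \<in> El S"
      using x s by (simp_all add: on2_El)
    have r: "ready [b, a, v] [b, a, v] S" "ready [b, a, v] [a, v] S" using s by (auto simp: ready_def)
    have lp: "lop K [b, a, v] [b, a, v]" if "oper K [A, A, V] [A, A, V]" for K using that s by (auto simp: lop_def)
    have le: "lop (\<lambda>P. ef (P \<odot> V \<odot> A)) [b, a, v] [a, v]" using Fe s by (auto simp: lop_def)
    have "act G [b, a, v] [a, v] x = act (\<lambda>P. ef (P \<odot> V \<odot> A)) [b, a, v] [a, v]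
        (act (pos23 t2if V) [b, a, v] [b, a, v] (act (pos13 f V A A) [b, a, v] [b, a, v] (act (pos23 t2f V) [b, a, v] [b, a, v] x)))"
      unfolding G_def[abs_def] act_cmp[OF x lp[OF p2] le r] act_cmp[OF x lp[OF p1] lp[OF p(3)] r(1,1)]
        act_cmp[OF x lp[OF p(1)] lp[OF p(2)] r(1,1)] ..
    also have "\<dots> = \<Phi> v a b x"
      unfolding \<Phi>_def using act_pos23[OF x, of t2f b a v] act_pos13[OF m(1), of f b v a] act_pos23[OF m(2), of t2if b a v] e[OF m(3)] s
      by simp
    finally show ?thesis .
  qed
  have FG: "F P = G P" if "P \<in> Ob C" for P
  proof (rule oper_eqI_act[of F "[b, a, v]" "[a, v]" G, OF _ _ _ _ _ that])
    fix x assume "x \<in> El (set [b, a, v])"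
    then have x: "x \<in> El ?S" by (simp add: insert_commute)
    show "act F [b, a, v] [a, v] x = act G [b, a, v] [a, v] x"
      using Fa[OF x, of v a b] Ga[OF x, of v a b] y(2)[OF x] l by simp
  qed (use FO GO l in auto)
  have Y: "on2 y v a (Ep b x) = \<Phi> v a b x"
    if x: "x \<in> El S" and l: "{v, a, b} \<subseteq> S" "distinct [v, a, b]" "ty v = V" "ty a = A" "ty b = A" for x S v a b
    using act_cong[of x F G "[b, a, v]" "[a, v]"] FG Fa[OF that] Ga[OF that] x by (auto simp: El_fst El_fin)
  have "compatible V w y" unfolding compatible_def
  proof (intro conjI allI impI)
    fix S x v a b assume x: "x \<in> El S" and l: "{v, a, b} \<subseteq> S" "distinct [v, a, b]" "ty v = V" "ty a = A" "ty b = A"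
    note s = l f(1,2) w(1) y(1)
    \<comment> \<open>The fresh leg d plays the part of the leg consumed by the descent, and a that
      of the test leg.\<close>
    obtain d where d: "d \<notin> S" "ty d = A" using fresh El_fin[OF x] by blast
    let ?S = "insert d S" and ?x = "ext d x"
    have ne: "a \<noteq> d" "v \<noteq> d" "b \<noteq> d" using l d by auto
    have X: "?x \<in> El ?S" using x d by (intro ext_El)
    have m: "on2 t2f b d ?x \<in> El ?S" "on2 w v a x \<in> El S" "on2 y v b x \<in> El S" "on2 w v a ?x \<in> El ?S" "on2 y v b ?x \<in> El ?S"
      using x X s d ne by (simp_all add: on2_El)
    have me: "Mu b a (ext d r) = ext d (Mu b a r)" if "r \<in> El S" for r
      using s d ne that by (intro act_ext[OF that]) (auto simp: lop_def ready_def)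
    have "Ep d (ext d (Mu b a (on2 w v a x))) = Ep d (Mu b a (on2 w v a ?x))"
      using s d ne m by (simp add: me on2_ext[OF x])
    also have "\<dots> = Mu b a (on2 w v a (Ep d ?x))" 
      using s d ne by (subst Ep_Mu[OF m(4)]; (subst Ep_on2[OF X])?) auto
    also have "\<dots> = Mu b a (\<Phi> v b d ?x)"
      unfolding \<Phi>_def using test[OF m(1), of v b d a] s d ne by (auto simp: t2if_inv[OF X])
    also have "\<dots> = Mu b a (on2 y v b (Ep d ?x))" using Y[OF X, of v b d] s d ne by auto
    also have "\<dots> = Ep d (Mu b a (on2 y v b ?x))"
      using s d ne by (subst Ep_Mu[OF m(5)]; (subst Ep_on2[OF X])?) auto
    also have "\<dots> = Ep d (ext d (Mu b a (on2 y v b x)))"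
      using s d ne m by (simp add: me on2_ext[OF x])
    finally show "Mu b a (on2 w v a x) = Mu b a (on2 y v b x)"
      by (rule counit_epi[of _ "S - {b}", rotated -1]) (use s d m in \<open>auto intro!: Mu_El\<close>)
  qed (rule y(1))
  then show thesis by (rule that)
qed

end

lemma (in symmetric_monoidal_category) oper_cong:
  "(\<And>P. P \<in> Ob C \<Longrightarrow> F P = G P) \<Longrightarrow> oper F xs ys \<Longrightarrow> oper G xs ys"
  unfolding oper_def by auto

section \<open>Renaming, splitting and joining legs\<close>

context legs
begin

text \<open>Renaming of a leg, as an identity with different input and output labels. Duality
  consumes a leg and creates another of the same type, so the triangle identities become
  renamings.\<close>

abbreviation "Rn u v \<equiv> act (\<lambda>P. idt (P \<odot> ty u)) [u] [v]"

lemma lop_rn: "ty u = ty v \<Longrightarrow> lop (\<lambda>P. idt (P \<odot> ty u)) [u] [v]"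
  using lop_idt[of "[u]" "[v]"] by simp

lemma act_id1: "x \<in> El S \<Longrightarrow> u \<in> S \<Longrightarrow> Rn u u x = x"
  using act_idt[of x S "[u]"] by simp

lemma rename_in:
  assumes x: "x \<in> El S" and F: "lop F is' js" and d: "distinct is" "map ty is = map ty is'"
    and r: "ready is is' S" "ready is js S"
  shows "act F is' js (act (\<lambda>P. idt (ob P (map ty is))) is is' x) = act F is js x"
proof -
  have "act F is' js (act (\<lambda>P. idt (ob P (map ty is))) is is' x) = act (\<lambda>P. F P \<bullet> idt (ob P (map ty is))) is js x"
    using d lopD(2)[OF F] by (intro act_cmp[OF x lop_idt F r, symmetric]) auto
  also have "\<dots> = act F is js x"
    using lopD(4,5)[OF F] d x by (intro act_cong) (auto simp: El_fst El_fin)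
  finally show ?thesis .
qed

lemma rename_out:
  assumes x: "x \<in> El S" and F: "lop F is js" and d: "distinct js'" "map ty js = map ty js'"
    and r: "ready is js S" "ready is js' S"
  shows "act (\<lambda>P. idt (ob P (map ty js))) js js' (act F is js x) = act F is js' x"
proof -
  have "act (\<lambda>P. idt (ob P (map ty js))) js js' (act F is js x) = act (\<lambda>P. idt (ob P (map ty js)) \<bullet> F P) is js' x"
    using d lopD(3)[OF F] by (intro act_cmp[OF x F lop_idt r, symmetric]) auto
  also have "\<dots> = act F is js' x"
    using lopD(4,6)[OF F] d x by (intro act_cong) (auto simp: El_fst El_fin)
  finally show ?thesis .
qed

lemma idt_first:
  assumes x: "x \<in> El S" and l: "u \<in> S" "a \<in> S" "u \<noteq> a" "v \<noteq> a" "v \<notin> S - {u}" "ty v = ty u"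
  shows "act (\<lambda>P. idt (ob P (map ty [a, u]))) [a, u] [a, v] x = Rn u v x"
proof -
  have "act (\<lambda>P. idt (ob P (map ty [a, u]))) [a, u] [a, v] x = act (\<lambda>P. idt (P \<odot> ty u) \<star> idt (ty a)) [a, u] [a, v] x"
    using x by (intro act_cong) (auto simp: El_fst El_fin)
  also have "\<dots> = Rn u v x" using l by (intro act_post[OF x lop_rn]) (auto simp: ready_def)
  finally show ?thesis .
qed

lemma idt_second:
  assumes x: "x \<in> El S" and l: "u \<in> S" "a \<in> S" "u \<noteq> a" "v \<noteq> a" "v \<notin> S - {u}" "ty v = ty u"
  shows "act (\<lambda>P. idt (ob P (map ty [u, a]))) [u, a] [v, a] x = Rn u v x"
  using act_pre[OF x lop_rn[of u v], of "[a]"] l by (auto simp: ready_def)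

text \<open>Both sides are the action of \<open>F\<close> with input label u and output label
  v.\<close>

lemma rn_on2:
  assumes x: "x \<in> El S" and F: "oper F [ty a, ty u] [ty a, ty u]"
    and l: "u \<in> S" "a \<in> S" "u \<noteq> a" "v \<notin> S" "ty v = ty u"
  shows "on2 F v a (Rn u v x) = Rn u v (on2 F u a x)"
proof -
  have ne: "v \<noteq> a" "v \<noteq> u" using l by auto
  have m: "on2 F u a x \<in> El S" using x F l by (auto intro!: on2_El)
  have L: "lop F [a, v] [a, v]" "lop F [a, u] [a, u]" "lop F [a, u] [a, v]" using F l ne by (auto simp: lop_def)
  have r: "ready [a, u] [a, v] S" "ready [a, u] [a, u] S" using l by (auto simp: ready_def)
  have "on2 F v a (Rn u v x) = act F [a, u] [a, v] x"
    using rename_in[OF x L(1), of "[a, u]"] idt_first[OF x, of u a v] l ne r by auto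
  also have "\<dots> = Rn u v (on2 F u a x)"
    using rename_out[OF x L(2), of "[a, v]"] idt_first[OF m, of u a v] l ne r by auto
  finally show ?thesis .
qed

lemma rn_rn: assumes x: "x \<in> El S" and l: "u \<in> S" "v \<notin> S" "ty v = ty u" shows "Rn v u (Rn u v x) = x"
  using rename_out[OF x lop_rn[of u v], of "[u]"] l act_id1[OF x, of u] by (auto simp: ready_def)

text \<open>\<open>Sp\<close> splits a leg of type \<open>ty v \<odot> ty w\<close> in two,
  \<open>Jn\<close> joins the two again.\<close>

abbreviation "Sp r v w \<equiv> act (\<lambda>P. ali P (ty v) (ty w)) [r] [w, v]"
abbreviation "Jn v w r \<equiv> act (\<lambda>P. al P (ty v) (ty w)) [w, v] [r]"

lemma oper_sp: assumes "V \<in> Ob C" "W \<in> Ob C"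
  shows "oper (\<lambda>P. ali P V W) [V \<odot> W] [W, V]" "oper (\<lambda>P. al P V W) [W, V] [V \<odot> W]"
proof -
  have "oper (fam [V \<odot> W] [W, V] (idt (V \<odot> W))) [V \<odot> W] [W, V]"
    "oper (fam [W, V] [V \<odot> W] (idt (V \<odot> W))) [W, V] [V \<odot> W]"
    using assms by (intro oper_fam; simp)+
  moreover have "fam [V \<odot> W] [W, V] (idt (V \<odot> W)) P = ali P V W" "fam [W, V] [V \<odot> W] (idt (V \<odot> W)) P = al P V W" 
    if "P \<in> Ob C" for P using assms that by (simp_all add: fam_def)
  ultimately show "oper (\<lambda>P. ali P V W) [V \<odot> W] [W, V]" "oper (\<lambda>P. al P V W) [W, V] [V \<odot> W]"
    by (metis (no_types, lifting) oper_cong)+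
qed

lemma lop_sp: "ty r = ty v \<odot> ty w \<Longrightarrow> v \<noteq> w \<Longrightarrow> lop (\<lambda>P. ali P (ty v) (ty w)) [r] [w, v]"
  and lop_jn: "ty r = ty v \<odot> ty w \<Longrightarrow> v \<noteq> w \<Longrightarrow> lop (\<lambda>P. al P (ty v) (ty w)) [w, v] [r]"
  using oper_sp[of "ty v" "ty w"] by (auto simp: lop_def)

lemma Sp_El: "x \<in> El S \<Longrightarrow> ty r = ty v \<odot> ty w \<Longrightarrow> v \<noteq> w \<Longrightarrow> r \<in> S \<Longrightarrow> v \<notin> S \<Longrightarrow> w \<notin> S \<Longrightarrow>
    Sp r v w x \<in> El (insert v (insert w (S - {r})))"
  by (rule act_El'[OF _ lop_sp]) (auto simp: ready_def)
lemma Jn_El: "x \<in> El S \<Longrightarrow> ty r = ty v \<odot> ty w \<Longrightarrow> v \<noteq> w \<Longrightarrow> v \<in> S \<Longrightarrow> w \<in> S \<Longrightarrow> r \<notin> S \<Longrightarrow> S' = insert r (S - {v, w}) \<Longrightarrow>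
    Jn v w r x \<in> El S'"
  by (rule act_El'[OF _ lop_jn]) (auto simp: ready_def)

lemma Jn_Sp:
  assumes x: "x \<in> El S" and l: "ty r = ty v \<odot> ty w" "v \<noteq> w" "r \<in> S" "v \<notin> S" "w \<notin> S"
  shows "Jn v w r (Sp r v w x) = x"
proof -
  have "Jn v w r (Sp r v w x) = act (\<lambda>P. al P (ty v) (ty w) \<bullet> ali P (ty v) (ty w)) [r] [r] x"
    using l by (intro act_cmp[OF x lop_sp lop_jn, symmetric]) (auto simp: ready_def)
  also have "\<dots> = Rn r r x" using x l by (intro act_cong) (auto simp: El_fst El_fin)
  finally show ?thesis using act_id1[OF x, of r] l by simp
qed

lemma Sp_Jn:
  assumes x: "x \<in> El S" and l: "ty r = ty v \<odot> ty w" "v \<noteq> w" "r \<notin> S" "v \<in> S" "w \<in> S"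
  shows "Sp r v w (Jn v w r x) = x"
proof -
  have "Sp r v w (Jn v w r x) = act (\<lambda>P. ali P (ty v) (ty w) \<bullet> al P (ty v) (ty w)) [w, v] [w, v] x"
    using l by (intro act_cmp[OF x lop_jn lop_sp, symmetric]) (auto simp: ready_def)
  also have "\<dots> = act (\<lambda>P. idt (ob P (map ty [w, v]))) [w, v] [w, v] x" using x l by (intro act_cong) (auto simp: El_fst El_fin)
  also have "\<dots> = x" using act_idt[OF x, of "[w, v]"] l by simp
  finally show ?thesis .
qed

end

section \<open>Morphisms and tensor products of coactions\<close>

context hopf_legs
begin

text \<open>The objects for which a fresh leg can always be found.\<close>

definition labelled where "labelled X \<longleftrightarrow> X \<in> Ob C \<and> infinite {n. ty n = X}"

lemma labelled_fresh: "labelled X \<Longrightarrow> finite S \<Longrightarrow> \<exists>d. d \<notin> S \<and> ty d = X"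
  unfolding labelled_def by (metis (mono_tags, lifting) finite_subset mem_Collect_eq subsetI)
lemma labelled_ex: "labelled X \<Longrightarrow> \<exists>v. ty v = X" using labelled_fresh[of X "{}"] by auto

definition leg_hom where
  "leg_hom X Y f f' H \<longleftrightarrow> (\<forall>S x p q a. x \<in> El S \<longrightarrow> {p, a} \<subseteq> S \<longrightarrow> p \<noteq> a \<longrightarrow> q \<notin> S \<longrightarrow> ty p = X \<longrightarrow> ty q = Y \<longrightarrow> ty a = A \<longrightarrow>
      act H [p] [q] (on2 f p a x) = on2 f' q a (act H [p] [q] x))"

text \<open>The condition on the second structure maps follows from the one on the first, by compatibility and non-degeneracy.\<close>

lemma leg_hom_right:
  assumes H: "oper H [X] [Y]" "leg_hom X Y f f' H"
    and c: "compatible X f g" "compatible Y f' g'" "oper f [A, X] [A, X]" "oper f' [A, Y] [A, Y]"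
  shows "leg_hom X Y g g' H"
  unfolding leg_hom_def
proof (intro allI impI)
  fix S x p q a assume x: "x \<in> El S" and l: "{p, a} \<subseteq> S" "p \<noteq> a" "q \<notin> S" "ty p = X" "ty q = Y" "ty a = A"
  note g = compatibleD[OF c(1)] and g' = compatibleD[OF c(2)]
  obtain d where d: "d \<notin> insert q S" "ty d = A" using fresh El_fin[OF x] by (metis finite.insertI)
  have ne: "d \<noteq> q" "d \<noteq> a" "d \<noteq> p" "a \<noteq> d" "q \<noteq> a" "q \<noteq> d" "p \<noteq> d" "a \<noteq> q" using l d by auto
  note s = l d ne c(3,4) g(1) g'(1) H(1)
  let ?S = "insert d S" and ?T = "insert q (S - {p})" and ?H = "act H [p] [q]" and ?x = "ext d x"
  have hEl: "?H y \<in> El (insert q (R - {p}))" if "y \<in> El R" "p \<in> R" "q \<notin> R" for y R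
    by (rule act_El'[OF that(1)]) (use s that in \<open>auto simp: lop_def ready_def\<close>)
  have X: "?x \<in> El ?S" by (rule ext_El[OF x]) (use s in simp)
  have m1: "on2 f p d ?x \<in> El ?S" "on2 g p a ?x \<in> El ?S" "on2 g p a x \<in> El S"
    using s x X by (simp_all add: on2_El)
  have m2: "?H x \<in> El ?T" "?H ?x \<in> El (insert q (?S - {p}))" "?H (on2 g p a x) \<in> El ?T"
    using s x X m1 by (auto intro!: hEl)
  have m3: "on2 g' q a (?H x) \<in> El ?T" using s m2 by (simp add: on2_El)
  note m = m1 m2(1,2) m3 m2(3)
  have he: "?H (ext d y) = ext d (?H y)" if "y \<in> El S" for y
    by (rule act_ext[OF that]) (use s in \<open>auto simp: lop_def ready_def\<close>)
  have hm: "?H (Mu a d y) = Mu a d (?H y)" if "y \<in> El ?S" for y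
    by (rule act_comm[OF that]) (use s in \<open>auto simp: lop_def ready_def\<close>)
  have hf: "act H [p] [q] (on2 f p d ?x) = on2 f' q d (?H ?x)"
    using H(2) X s unfolding leg_hom_def by (metis insert_iff insert_subset empty_subsetI)
  have "Mu a d (ext d (?H (on2 g p a x))) = Mu a d (?H (on2 g p a ?x))"
    using s by (simp add: he[OF m(3), symmetric] on2_ext[OF x])
  also have "\<dots> = ?H (Mu a d (on2 g p a ?x))" by (rule hm[OF m(2), symmetric])
  also have "\<dots> = ?H (Mu a d (on2 f p d ?x))" using s g(2)[OF X, of p d a] by simp
  also have "\<dots> = Mu a d (?H (on2 f p d ?x))" by (rule hm[OF m(1)])
  also have "\<dots> = Mu a d (on2 f' q d (?H ?x))" unfolding hf ..
  also have "\<dots> = Mu a d (on2 g' q a (?H ?x))" using s g'(2)[OF m(5), of q d a] by simp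
  also have "\<dots> = Mu a d (ext d (on2 g' q a (?H x)))"
    using s by (simp add: he[OF x] on2_ext[OF m(4)])
  finally show "?H (on2 g p a x) = on2 g' q a (?H x)"
    by (rule nondeg_right[OF m(7,6), rotated -1]) (use s in auto)
qed

text \<open>The first and the second structure map of a tensor product, with opposite orders of the
  factors: \<open>g\<close> acts before \<open>f\<close> in \<open>tens\<close> and after it in
  \<open>tens'\<close>.\<close>

definition tens where
  "tens V W f g P = al P V W \<star> idt A \<bullet> pos13 f V W A P \<bullet> pos23 g V P \<bullet> ali P V W \<star> idt A"
definition tens' where
  "tens' V W f g P = al P V W \<star> idt A \<bullet> pos23 g V P \<bullet> pos13 f V W A P \<bullet> ali P V W \<star> idt A"

context
  fixes V W f g
  assumes VW: "V \<in> Ob C" "W \<in> Ob C" and fg: "oper f [A, V] [A, V]" "oper g [A, W] [A, W]"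
begin

lemma oper_tens_parts:
  "oper (\<lambda>P. ali P V W \<star> idt A) [A, V \<odot> W] [A, W, V]" "oper (\<lambda>P. al P V W \<star> idt A) [A, W, V] [A, V \<odot> W]"
  "oper (pos13 f V W A) [A, W, V] [A, W, V]" "oper (pos23 g V) [A, W, V] [A, W, V]"
  using oper_post[OF oper_sp(1)[OF VW], of A] oper_post[OF oper_sp(2)[OF VW], of A] VW fg oper_pos13 oper_pos23 by auto

lemma oper_tens: "oper (tens V W f g) [A, V \<odot> W] [A, V \<odot> W]" "oper (tens' V W f g) [A, V \<odot> W] [A, V \<odot> W]"
  unfolding tens_def[abs_def] tens'_def[abs_def]
  by (intro oper_cmp[OF oper_cmp[OF oper_cmp[OF oper_tens_parts(1) oper_tens_parts(4)] oper_tens_parts(3)] oper_tens_parts(2)]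
     oper_cmp[OF oper_cmp[OF oper_cmp[OF oper_tens_parts(1) oper_tens_parts(3)] oper_tens_parts(4)] oper_tens_parts(2)])+

context
  fixes x S r a v w
  assumes x: "x \<in> El S" and l: "{r, a} \<subseteq> S" "r \<noteq> a" "v \<notin> S" "w \<notin> S" "v \<noteq> w"
    "ty r = V \<odot> W" "ty v = V" "ty w = W" "ty a = A"
begin

lemma act_tens_aux:
  assumes F: "oper F [A, W, V] [A, W, V]" and G: "oper G [A, W, V] [A, W, V]"
  shows "on2 (\<lambda>P. al P V W \<star> idt A \<bullet> F P \<bullet> G P \<bullet> ali P V W \<star> idt A) r a x
     = Jn v w r (act F [a, w, v] [a, w, v] (act G [a, w, v] [a, w, v] (Sp r v w x)))"
proof -
  let ?T = "insert v (insert w (S - {r}))"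
  have ne: "v \<noteq> a" "w \<noteq> a" "w \<noteq> v" "v \<noteq> r" "w \<noteq> r" using l by auto
  note s = l ne
  let ?L = "\<lambda>P. ali P V W \<star> idt A" and ?J = "\<lambda>P. al P V W \<star> idt A"
  have L: "lop ?L [a, r] [a, w, v]" "lop ?J [a, w, v] [a, r]" "lop F [a, w, v] [a, w, v]" "lop G [a, w, v] [a, w, v]"
    using oper_tens_parts F G s by (auto simp: lop_def)
  have G1: "lop (\<lambda>P. G P \<bullet> ?L P) [a, r] [a, w, v]" and FG: "lop (\<lambda>P. F P \<bullet> G P \<bullet> ?L P) [a, r] [a, w, v]"
    using L unfolding lop_def by (auto intro!: oper_cmp)
  have rd: "ready [a, r] [a, w, v] S" "ready [a, r] [a, r] S" using s by (auto simp: ready_def)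
  have m: "Sp r v w x \<in> El ?T" using s by (intro Sp_El[OF x]) auto
  have m2: "act K [a, w, v] [a, w, v] y \<in> El ?T" if "y \<in> El ?T" "lop K [a, w, v] [a, w, v]" for K y
    by (rule act_El'[OF that]) (use s in \<open>auto simp: ready_def\<close>)
  have "on2 (\<lambda>P. ?J P \<bullet> F P \<bullet> G P \<bullet> ?L P) r a x
     = act ?J [a, w, v] [a, r] (act F [a, w, v] [a, w, v] (act G [a, w, v] [a, w, v] (act ?L [a, r] [a, w, v] x)))"
    unfolding act_cmp[OF x FG L(2) rd] act_cmp[OF x G1 L(3) rd(1,1)] act_cmp[OF x L(1) L(4) rd(1,1)] ..
  also have "act ?L [a, r] [a, w, v] x = Sp r v w x"
    using act_post[OF x lop_sp[of r v w], of a] s by (auto simp: ready_def)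
  also have "act ?J [a, w, v] [a, r] (act F [a, w, v] [a, w, v] (act G [a, w, v] [a, w, v] (Sp r v w x)))
     = Jn v w r (act F [a, w, v] [a, w, v] (act G [a, w, v] [a, w, v] (Sp r v w x)))"
    using act_post[OF m2[OF m2[OF m L(4)] L(3)] lop_jn[of r v w], of a] s by (auto simp: ready_def)
  finally show ?thesis .
qed

lemma act_tens: "on2 (tens V W f g) r a x = Jn v w r (on2 f v a (on2 g w a (Sp r v w x)))"
  and act_tens': "on2 (tens' V W f g) r a x = Jn v w r (on2 g w a (on2 f v a (Sp r v w x)))"
proof -
  let ?T = "insert v (insert w (S - {r}))"
  have ne: "v \<noteq> a" "w \<noteq> a" "w \<noteq> v" "v \<noteq> r" "w \<noteq> r" using l by auto
  note s = l ne
  have m: "Sp r v w x \<in> El ?T" using s by (intro Sp_El[OF x]) auto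
  have m2: "on2 f v a (Sp r v w x) \<in> El ?T" "on2 g w a (Sp r v w x) \<in> El ?T"
    using s fg by (auto intro!: on2_El[OF m])
  show "on2 (tens V W f g) r a x = Jn v w r (on2 f v a (on2 g w a (Sp r v w x)))"
    unfolding tens_def[abs_def] act_tens_aux[OF oper_tens_parts(3,4)]
    using act_pos13[OF m2(2), of f a v w] act_pos23[OF m, of g a w v] s fg by auto
  show "on2 (tens' V W f g) r a x = Jn v w r (on2 g w a (on2 f v a (Sp r v w x)))"
    unfolding tens'_def[abs_def] act_tens_aux[OF oper_tens_parts(4,3)]
    using act_pos13[OF m, of f a v w] act_pos23[OF m2(1), of g a w v] s fg by auto
qed

end

lemma Jn_on2:
  "x \<in> El S \<Longrightarrow> oper F [ty b, ty a] [ty b, ty a] \<Longrightarrow> distinct [a, b, v, w] \<Longrightarrow> {a, b, v, w} \<subseteq> S \<Longrightarrow> r \<notin> S \<Longrightarrow> ty r = ty v \<odot> ty w \<Longrightarrow>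
    Jn v w r (on2 F a b x) = on2 F a b (Jn v w r x)"
  by (rule act_comm[OF _ lop_jn]) (auto simp: lop_def ready_def)
lemma Sp_on2:
  "x \<in> El S \<Longrightarrow> oper F [ty b, ty a] [ty b, ty a] \<Longrightarrow> distinct [a, b, v, w, r] \<Longrightarrow> {a, b, r} \<subseteq> S \<Longrightarrow> v \<notin> S \<Longrightarrow> w \<notin> S \<Longrightarrow> ty r = ty v \<odot> ty w \<Longrightarrow>
    Sp r v w (on2 F a b x) = on2 F a b (Sp r v w x)"
  by (rule act_comm[OF _ lop_sp]) (auto simp: lop_def ready_def)

text \<open>Once the leg r is split, \<open>g\<close> on w, a and \<open>f\<close> on v, b have no
  leg in common; exchanging them brings the two copies of each coaction together, and the two
  coaction laws apply in turn.\<close>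

lemma coaction_tens:
  assumes c: "coaction V f" "coaction W g" and lb: "labelled V" "labelled W"
  shows "coaction (V \<odot> W) (tens V W f g)"
  unfolding coaction_def
proof (intro conjI allI impI)
  fix S x r a b
  assume x: "x \<in> El S" and l: "{r, a, b} \<subseteq> S" "distinct [r, a, b]" "ty r = V \<odot> W" "ty a = A" "ty b = A"
  obtain v where v: "v \<notin> S" "ty v = V" using labelled_fresh[OF lb(1)] El_fin[OF x] by blast
  obtain w where w: "w \<notin> insert v S" "ty w = W" using labelled_fresh[OF lb(2)] El_fin[OF x] by (metis finite.insertI)
  let ?T = "insert v (insert w (S - {r}))"
  have ne: "v \<noteq> a" "w \<noteq> a" "w \<noteq> v" "v \<noteq> w" "v \<noteq> r" "w \<noteq> r" "v \<noteq> b" "w \<noteq> b" "b \<noteq> v" "b \<noteq> w" "a \<noteq> v" "a \<noteq> w" "a \<noteq> r" "b \<noteq> r" "b \<noteq> a" using l v w by auto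
  note s = l v w ne fg
  have m: "on2 (tens V W f g) r b x \<in> El S" "on2 tf a b x \<in> El S" "on2 (tens V W f g) r b (on2 tf a b x) \<in> El S"
    using s x oper_tens by (simp_all add: on2_El)
  define y where "y = Sp r v w x"
  have y: "y \<in> El ?T" unfolding y_def using s by (intro Sp_El[OF x]) auto
  have my: "on2 tf a b y \<in> El ?T" "on2 g w b (on2 tf a b y) \<in> El ?T" "on2 f v b (on2 g w b (on2 tf a b y)) \<in> El ?T"
     "on2 g w a y \<in> El ?T" "on2 f v a (on2 g w a y) \<in> El ?T" "on2 g w a (on2 g w b (on2 tf a b y)) \<in> El ?T"
    using s y by (simp_all add: on2_El)
  have Sy: "Sp r v w (on2 tf a b x) = on2 tf a b y" unfolding y_def using s by (intro Sp_on2[OF x]) auto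
  have "on2 (tens V W f g) r a (on2 (tens V W f g) r b (on2 tf a b x))
     = Jn v w r (on2 f v a (on2 g w a (Sp r v w (Jn v w r (on2 f v b (on2 g w b (on2 tf a b y)))))))"
    using act_tens[OF m(3), of r a v w] act_tens[OF m(2), of r b v w] Sy s by simp
  also have "Sp r v w (Jn v w r (on2 f v b (on2 g w b (on2 tf a b y)))) = on2 f v b (on2 g w b (on2 tf a b y))"
    using s by (intro Sp_Jn[OF my(3)]) auto
  also have "on2 g w a (on2 f v b (on2 g w b (on2 tf a b y))) = on2 f v b (on2 g w a (on2 g w b (on2 tf a b y)))"
    using s by (intro on2_comm[OF my(2)]) auto
  also have "on2 g w a (on2 g w b (on2 tf a b y)) = on2 tf a b (on2 g w a y)"
    using s coactionD(3)[OF c(2) y, of w a b] by simp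
  also have "on2 f v a (on2 f v b (on2 tf a b (on2 g w a y))) = on2 tf a b (on2 f v a (on2 g w a y))"
    using s coactionD(3)[OF c(1) my(4), of v a b] by simp
  also have "Jn v w r (on2 tf a b (on2 f v a (on2 g w a y))) = on2 tf a b (Jn v w r (on2 f v a (on2 g w a y)))"
    using s by (intro Jn_on2[OF my(5)]) auto
  also have "\<dots> = on2 tf a b (on2 (tens V W f g) r a x)"
    using act_tens[OF x, of r a v w] s unfolding y_def by simp
  finally show "on2 (tens V W f g) r a (on2 (tens V W f g) r b (on2 tf a b x)) = on2 tf a b (on2 (tens V W f g) r a x)" .
qed (use VW oper_tens in simp_all)

lemma counital_tens:
  assumes c: "counital V f" "counital W g" and lb: "labelled V" "labelled W"
  shows "counital (V \<odot> W) (tens V W f g)"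
  unfolding counital_def
proof (intro conjI allI impI)
  fix S x r a
  assume x: "x \<in> El S" and l: "{r, a} \<subseteq> S" "distinct [r, a]" "ty r = V \<odot> W" "ty a = A"
  obtain v where v: "v \<notin> S" "ty v = V" using labelled_fresh[OF lb(1)] El_fin[OF x] by blast
  obtain w where w: "w \<notin> insert v S" "ty w = W" using labelled_fresh[OF lb(2)] El_fin[OF x] by (metis finite.insertI)
  let ?T = "insert v (insert w (S - {r}))"
  have ne: "v \<noteq> a" "w \<noteq> a" "w \<noteq> v" "v \<noteq> w" "v \<noteq> r" "w \<noteq> r" "a \<noteq> v" "a \<noteq> w" "a \<noteq> r" using l v w by auto
  note s = l v w ne fg
  define y where "y = Sp r v w x"
  have y: "y \<in> El ?T" unfolding y_def using s by (intro Sp_El[OF x]) auto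
  have my: "on2 g w a y \<in> El ?T" "on2 f v a (on2 g w a y) \<in> El ?T" using s y by (simp_all add: on2_El)
  have j: "Ep a (Jn v w r z) = Jn v w r (Ep a z)" if "z \<in> El ?T" for z
    by (rule act_comm[OF that _ lop_jn]) (use s in \<open>auto simp: lop_def ready_def\<close>)
  have "Ep a (on2 (tens V W f g) r a x) = Jn v w r (Ep a (on2 f v a (on2 g w a y)))"
    using act_tens[OF x, of r a v w] s j[OF my(2)] unfolding y_def by simp
  also have "Ep a (on2 f v a (on2 g w a y)) = Ep a y"
    using counitalD[OF c(1) my(1), of v a] counitalD[OF c(2) y, of w a] s by simp
  also have "Jn v w r (Ep a y) = Ep a (Jn v w r y)" by (rule j[OF y, symmetric])
  also have "Jn v w r y = x" unfolding y_def using s by (intro Jn_Sp[OF x]) auto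
  finally show "Ep a (on2 (tens V W f g) r a x) = Ep a x" .
qed

end

text \<open>Compatibility is applied first to \<open>f\<close>, which moves to the leg b and then
  commutes with \<open>g\<close> on a, and afterwards to \<open>g\<close>; this is why the order is
  reversed in \<open>tens'\<close>.\<close>

lemma compatible_tens:
  assumes fg: "V \<in> Ob C" "W \<in> Ob C" "oper f [A, V] [A, V]" "oper g [A, W] [A, W]"
    and c: "compatible V f f'" "compatible W g g'" and lb: "labelled V" "labelled W"
  shows "compatible (V \<odot> W) (tens V W f g) (tens' V W f' g')"
  unfolding compatible_def
proof (intro conjI allI impI)
  note f' = compatibleD[OF c(1)] and g' = compatibleD[OF c(2)]
  show "oper (tens' V W f' g') [A, V \<odot> W] [A, V \<odot> W]" using fg f'(1) g'(1) by (intro oper_tens) auto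
  fix S x r a b
  assume x: "x \<in> El S" and l: "{r, a, b} \<subseteq> S" "distinct [r, a, b]" "ty r = V \<odot> W" "ty a = A" "ty b = A"
  obtain v where v: "v \<notin> S" "ty v = V" using labelled_fresh[OF lb(1)] El_fin[OF x] by blast
  obtain w where w: "w \<notin> insert v S" "ty w = W" using labelled_fresh[OF lb(2)] El_fin[OF x] by (metis finite.insertI)
  let ?T = "insert v (insert w (S - {r}))"
  have ne: "v \<noteq> a" "w \<noteq> a" "w \<noteq> v" "v \<noteq> w" "v \<noteq> r" "w \<noteq> r" "v \<noteq> b" "w \<noteq> b" "b \<noteq> v" "b \<noteq> w" "a \<noteq> v" "a \<noteq> w" "a \<noteq> r" "b \<noteq> r" "b \<noteq> a" using l v w by auto
  note s = l v w ne fg f'(1) g'(1)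
  define y where "y = Sp r v w x"
  have y: "y \<in> El ?T" unfolding y_def using s by (intro Sp_El[OF x]) auto
  have my: "on2 g w a y \<in> El ?T" "on2 f v a (on2 g w a y) \<in> El ?T" "on2 f' v b y \<in> El ?T" "on2 g' w b (on2 f' v b y) \<in> El ?T"
    using s y by (simp_all add: on2_El)
  have j: "Mu b a (Jn v w r z) = Jn v w r (Mu b a z)" if "z \<in> El ?T" for z
    by (rule act_comm[OF that _ lop_jn]) (use s in \<open>auto simp: lop_def ready_def\<close>)
  have "Mu b a (on2 (tens V W f g) r a x) = Jn v w r (Mu b a (on2 f v a (on2 g w a y)))"
    using act_tens[OF fg x, of r a v w] s j[OF my(2)] unfolding y_def by simp
  also have "Mu b a (on2 f v a (on2 g w a y)) = Mu b a (on2 f' v b (on2 g w a y))"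
    using s by (intro f'(2)[OF my(1)]) auto
  also have "on2 f' v b (on2 g w a y) = on2 g w a (on2 f' v b y)" using s by (intro on2_comm[OF y]) auto
  also have "Mu b a (on2 g w a (on2 f' v b y)) = Mu b a (on2 g' w b (on2 f' v b y))"
    using s by (intro g'(2)[OF my(3)]) auto
  also have "Jn v w r (Mu b a (on2 g' w b (on2 f' v b y))) = Mu b a (Jn v w r (on2 g' w b (on2 f' v b y)))"
    by (rule j[OF my(4), symmetric])
  also have "\<dots> = Mu b a (on2 (tens' V W f' g') r b x)"
    using act_tens'[OF fg(1,2) f'(1) g'(1) x, of r b v w] s unfolding y_def by simp
  finally show "Mu b a (on2 (tens V W f g) r a x) = Mu b a (on2 (tens' V W f' g') r b x)" .
qed

text \<open>On legs the associator merely splits and rejoins: for both bracketings \<open>h\<close>,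
  \<open>g\<close>, \<open>f\<close> act in this order on the three separate legs.\<close>

lemma leg_hom_assoc:
  assumes o: "U \<in> Ob C" "V \<in> Ob C" "W \<in> Ob C" and fgh: "oper f [A, U] [A, U]" "oper g [A, V] [A, V]" "oper h [A, W] [A, W]"
    and lb: "labelled U" "labelled V" "labelled W" "labelled (U \<odot> V)" "labelled (V \<odot> W)"
  shows "leg_hom (U \<odot> V \<odot> W) (U \<odot> (V \<odot> W)) (tens (U \<odot> V) W (tens U V f g) h) (tens U (V \<odot> W) f (tens V W g h))
     (\<lambda>P. idt P \<star> al U V W)"
  unfolding leg_hom_def
proof (intro allI impI)
  fix S x r t a assume x: "x \<in> El S" and l: "{r, a} \<subseteq> S" "r \<noteq> a" "t \<notin> S" "ty r = U \<odot> V \<odot> W" "ty t = U \<odot> (V \<odot> W)" "ty a = A"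
  obtain u where u: "u \<notin> {t} \<union> S" "ty u = U" using labelled_fresh[OF lb(1), of "{t} \<union> S"] El_fin[OF x] by auto
  obtain v where v: "v \<notin> {u, t} \<union> S" "ty v = V" using labelled_fresh[OF lb(2), of "{u, t} \<union> S"] El_fin[OF x] by auto
  obtain w where w: "w \<notin> {u, v, t} \<union> S" "ty w = W" using labelled_fresh[OF lb(3), of "{u, v, t} \<union> S"] El_fin[OF x] by auto
  obtain p where p: "p \<notin> {u, v, w, t} \<union> S" "ty p = U \<odot> V" using labelled_fresh[OF lb(4), of "{u, v, w, t} \<union> S"] El_fin[OF x] by auto
  obtain q where q: "q \<notin> {u, v, w, p, t} \<union> S" "ty q = V \<odot> W" using labelled_fresh[OF lb(5), of "{u, v, w, p, t} \<union> S"] El_fin[OF x] by auto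
  have ne: "distinct [u, v, w, p, q, r, t, a]" using l u v w p q by auto
  have oUV: "U \<odot> V \<in> Ob C" "V \<odot> W \<in> Ob C" using o by auto
  have ot: "oper (tens U V f g) [A, U \<odot> V] [A, U \<odot> V]" "oper (tens V W g h) [A, V \<odot> W] [A, V \<odot> W]"
    using o fgh by (auto intro: oper_tens)
  note s = l u v w p q ne fgh o oUV ot
  let ?S1 = "insert p (insert w (S - {r}))" and ?S2 = "insert u (insert v (insert w (S - {r})))" and ?S3 = "insert u (insert q (S - {r}))"
  let ?H = "\<lambda>P. idt P \<star> al U V W"
  \<comment> \<open>By the pentagon, the associator is two splittings followed by two joins.\<close>
  have H: "act ?H [r] [t] z = Jn u q t (Jn v w q (Sp p u v (Sp r p w z)))" if z: "z \<in> El S" for z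
  proof -
    let ?F1 = "\<lambda>P. ali P (U \<odot> V) W" and ?F2 = "\<lambda>P. ali P U V \<star> idt W" and ?F3 = "\<lambda>P. al (P \<odot> U) V W" and ?F4 = "\<lambda>P. al P U (V \<odot> W)"
    have F: "lop ?F1 [r] [w, p]" "lop ?F2 [w, p] [w, v, u]" "lop ?F3 [w, v, u] [q, u]" "lop ?F4 [q, u] [t]"
      using oper_sp[of "U \<odot> V" W] oper_post[OF oper_sp(1)[of U V], of W] oper_pre[OF oper_sp(2)[of V W], of "[U]"] oper_sp[of U "V \<odot> W"] s
      by (auto simp: lop_def)
    have G: "lop (\<lambda>P. ?F2 P \<bullet> ?F1 P) [r] [w, v, u]" "lop (\<lambda>P. ?F3 P \<bullet> ?F2 P \<bullet> ?F1 P) [r] [q, u]"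
      using F unfolding lop_def by (auto intro!: oper_cmp)
    have rd: "ready [r] [w, p] S" "ready [r] [w, v, u] S" "ready [r] [q, u] S" "ready [r] [t] S" using s by (auto simp: ready_def)
    have e: "?F4 P \<bullet> ?F3 P \<bullet> ?F2 P \<bullet> ?F1 P = ?H P" if P: "P \<in> Ob C" for P
    proof -
      have "?F4 P \<bullet> ?F3 P \<bullet> ?F2 P \<bullet> ?F1 P = (al P U (V \<odot> W) \<bullet> al (P \<odot> U) V W) \<bullet> ali P U V \<star> idt W \<bullet> ali P (U \<odot> V) W"
        by (simp add: cmp_assoc)
      also have "\<dots> = ?H P"
        using o P by (simp add: pentagon_al[symmetric] cmp_assoc wr_cmp[symmetric, THEN reassoc])
      finally show ?thesis .
    qed
    have "act ?H [r] [t] z = act (\<lambda>P. ?F4 P \<bullet> ?F3 P \<bullet> ?F2 P \<bullet> ?F1 P) [r] [t] z"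
      using z by (intro act_cong e[symmetric]) (auto simp: El_fst El_fin)
    also have "\<dots> = act ?F4 [q, u] [t] (act ?F3 [w, v, u] [q, u] (act ?F2 [w, p] [w, v, u] (act ?F1 [r] [w, p] z)))"
      unfolding act_cmp[OF z G(2) F(4) rd(3,4)] act_cmp[OF z G(1) F(3) rd(2,3)] act_cmp[OF z F(1,2) rd(1,2)] ..
    also have "act ?F1 [r] [w, p] z = Sp r p w z" using s by simp
    also have "act ?F2 [w, p] [w, v, u] (Sp r p w z) = Sp p u v (Sp r p w z)"
    proof -
      have m: "Sp r p w z \<in> El ?S1" using s by (intro Sp_El[OF z]) auto
      show ?thesis using act_post[OF m lop_sp[of p u v], of w] s by (auto simp: ready_def)
    qed
    also have "act ?F3 [w, v, u] [q, u] (Sp p u v (Sp r p w z)) = Jn v w q (Sp p u v (Sp r p w z))"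
    proof -
      have m: "Sp r p w z \<in> El ?S1" using s by (intro Sp_El[OF z]) auto
      have "Sp p u v (Sp r p w z) \<in> El (insert u (insert v (?S1 - {p})))" using s by (intro Sp_El[OF m]) auto
      then show ?thesis using act_pre[of _ _ "\<lambda>P. al P V W" "[w, v]" "[q]" "[u]"] lop_jn[of q v w] s by (auto simp: ready_def)
    qed
    finally show ?thesis using s by simp
  qed
  define y where "y = Sp p u v (Sp r p w x)"
  have m1: "Sp r p w x \<in> El ?S1" using s by (intro Sp_El[OF x]) auto
  have S12: "insert u (insert v (?S1 - {p})) = ?S2" using s by auto
  have y: "y \<in> El ?S2" unfolding y_def S12[symmetric] using s by (intro Sp_El[OF m1]) auto
  have my: "on2 h w a y \<in> El ?S2" "on2 g v a (on2 h w a y) \<in> El ?S2" "on2 f u a (on2 g v a (on2 h w a y)) \<in> El ?S2"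
    using s y by (simp_all add: on2_El)
  have mh: "on2 h w a (Sp r p w x) \<in> El ?S1" using s by (intro on2_El[OF m1]) auto
  have tx: "on2 (tens (U \<odot> V) W (tens U V f g) h) r a x \<in> El S"
    using s oper_tens[of "U \<odot> V" W "tens U V f g" h] by (intro on2_El[OF x]) auto
  let ?z = "on2 f u a (on2 g v a (on2 h w a y))"
  have j1: "Jn u v p ?z \<in> El ?S1" using s by (intro Jn_El[OF my(3)]) auto
  have "on2 (tens (U \<odot> V) W (tens U V f g) h) r a x = Jn p w r (on2 (tens U V f g) p a (on2 h w a (Sp r p w x)))"
    using s by (intro act_tens[OF oUV(1) o(3) ot(1) fgh(3) x]) auto
  also have "on2 (tens U V f g) p a (on2 h w a (Sp r p w x)) = Jn u v p (on2 f u a (on2 g v a (Sp p u v (on2 h w a (Sp r p w x)))))"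
    using s by (intro act_tens[OF o(1,2) fgh(1,2) mh]) auto
  also have "Sp p u v (on2 h w a (Sp r p w x)) = on2 h w a y"
    unfolding y_def using s by (intro Sp_on2[OF o(1,2) fgh(1,2) m1]) auto
  finally have L: "on2 (tens (U \<odot> V) W (tens U V f g) h) r a x = Jn p w r (Jn u v p ?z)" .
  have "act ?H [r] [t] (on2 (tens (U \<odot> V) W (tens U V f g) h) r a x) = Jn u q t (Jn v w q (Sp p u v (Sp r p w (Jn p w r (Jn u v p ?z)))))"
    unfolding H[OF tx] unfolding L ..
  also have "Sp r p w (Jn p w r (Jn u v p ?z)) = Jn u v p ?z" using s by (intro Sp_Jn[OF j1]) auto
  also have "Sp p u v (Jn u v p ?z) = ?z" using s by (intro Sp_Jn[OF my(3)]) auto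
  finally have 1: "act ?H [r] [t] (on2 (tens (U \<odot> V) W (tens U V f g) h) r a x) = Jn u q t (Jn v w q ?z)" .
  have jy: "Jn v w q y \<in> El ?S3" using s by (intro Jn_El[OF y]) auto
  have jy2: "Jn u q t (Jn v w q y) \<in> El (insert t (S - {r}))" using s by (intro Jn_El[OF jy]) auto
  have "on2 (tens U (V \<odot> W) f (tens V W g h)) t a (act ?H [r] [t] x)
     = Jn u q t (on2 f u a (on2 (tens V W g h) q a (Sp t u q (Jn u q t (Jn v w q y)))))"
    unfolding H[OF x] y_def[symmetric] using s by (intro act_tens[OF o(1) oUV(2) fgh(1) ot(2) jy2]) auto
  also have "Sp t u q (Jn u q t (Jn v w q y)) = Jn v w q y" using s by (intro Sp_Jn[OF jy]) auto
  also have "on2 (tens V W g h) q a (Jn v w q y) = Jn v w q (on2 g v a (on2 h w a (Sp q v w (Jn v w q y))))"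
    using s by (intro act_tens[OF o(2,3) fgh(2,3) jy]) auto
  also have "Sp q v w (Jn v w q y) = y" using s by (intro Sp_Jn[OF y]) auto
  also have "on2 f u a (Jn v w q (on2 g v a (on2 h w a y))) = Jn v w q ?z"
    using s by (intro Jn_on2[OF o(1,2) fgh(1,2) my(2), symmetric]) auto
  finally show "act ?H [r] [t] (on2 (tens (U \<odot> V) W (tens U V f g) h) r a x) = on2 (tens U (V \<odot> W) f (tens V W g h)) t a (act ?H [r] [t] x)"
    unfolding 1 ..
qed

end

section \<open>Duals on labelled legs\<close>

lemma (in legs) act_fun_cong: assumes "\<And>P. P \<in> Ob C \<Longrightarrow> F P = G P" shows "act F is js = act G is js"
proof
  fix x show "act F is js x = act G is js x" by (simp add: act_def Let_def assms)
qed

context hopf_legs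
begin

text \<open>Families matter only at the objects of C; this lemma and the next two allow a family to
  be replaced by one that agrees with it there.\<close>

lemma coaction_cong:
  assumes f: "\<And>P. P \<in> Ob C \<Longrightarrow> f P = f' P" shows "coaction V f \<longleftrightarrow> coaction V f'"
proof -
  have e: "act f is js = act f' is js" for "is" js by (rule act_fun_cong) (rule f)
  have "oper f [A, V] [A, V] \<longleftrightarrow> oper f' [A, V] [A, V]"
    using oper_cong[of f f' "[A, V]" "[A, V]"] oper_cong[of f' f "[A, V]" "[A, V]"] f by auto
  then show ?thesis unfolding coaction_def e by blast
qed

lemma counital_cong:
  assumes f: "\<And>P. P \<in> Ob C \<Longrightarrow> f P = f' P" shows "counital V f \<longleftrightarrow> counital V f'"
proof -
  have e: "act f is js = act f' is js" for "is" js by (rule act_fun_cong) (rule f)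
  show ?thesis unfolding counital_def e ..
qed

lemma compatible_cong:
  assumes f: "\<And>P. P \<in> Ob C \<Longrightarrow> f P = f' P" and g: "\<And>P. P \<in> Ob C \<Longrightarrow> g P = g' P"
  shows "compatible V f g \<longleftrightarrow> compatible V f' g'"
proof -
  have e: "act f is js = act f' is js" "act g is js = act g' is js" for "is" js
    by (rule act_fun_cong; rule f g; assumption)+
  have "oper g [A, V] [A, V] \<longleftrightarrow> oper g' [A, V] [A, V]"
    using oper_cong[of g g' "[A, V]" "[A, V]"] oper_cong[of g' g "[A, V]" "[A, V]"] g by auto
  then show ?thesis unfolding compatible_def e by blast
qed

definition unit_coaction where "unit_coaction P = idt (P \<odot> \<I> \<odot> A)"

lemma unit_on2: "x \<in> El S \<Longrightarrow> {i, a} \<subseteq> S \<Longrightarrow> i \<noteq> a \<Longrightarrow> ty i = \<I> \<Longrightarrow> ty a = A \<Longrightarrow> on2 unit_coaction i a x = x"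
  using act_idt[of x S "[a, i]"] by (simp add: unit_coaction_def[abs_def])

text \<open>The right unit constraint and its inverse are the families of the identity of \<I>,
  regarded as a map between the words of length one and zero.\<close>

lemma oper_run: "oper run [\<I>] []" and oper_runi: "oper runi [] [\<I>]"
proof -
  have "oper (fam [\<I>] [] (idt \<I>)) [\<I>] []" "oper (fam [] [\<I>] (idt \<I>)) [] [\<I>]" by (intro oper_fam; simp)+
  moreover have "fam [\<I>] [] (idt \<I>) P = run P" "fam [] [\<I>] (idt \<I>) P = runi P" if "P \<in> Ob C" for P
    using that by (simp_all add: fam_def)
  ultimately show "oper run [\<I>] []" "oper runi [] [\<I>]"
    by (metis (no_types, lifting) oper_cong)+
qed

lemma leg_hom_cong:
  assumes "\<And>P. P \<in> Ob C \<Longrightarrow> H P = H' P" "\<And>P. P \<in> Ob C \<Longrightarrow> f P = f0 P" "\<And>P. P \<in> Ob C \<Longrightarrow> f' P = f0' P"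
  shows "leg_hom X Y f f' H \<longleftrightarrow> leg_hom X Y f0 f0' H'"
proof -
  have e: "act H is js = act H' is js" "act f is js = act f0 is js" "act f' is js = act f0' is js" for "is" js
    by (rule act_fun_cong; rule assms; assumption)+
  show ?thesis unfolding leg_hom_def e ..
qed

end

section \<open>Triangle identities and transposes\<close>

locale dual_legs = hopf_legs C ty A
  for C :: "('o, 'm, 'z) brmoncat_scheme" (structure) and ty and A :: 'o +
  fixes V V' :: 'o and etaF epsF :: "'o \<Rightarrow> 'o \<times> 'm option \<times> 'o"
  assumes labelled_V: "labelled V" and labelled_V': "labelled V'"
    and oper_eta: "oper etaF [] [V', V]" and oper_eps: "oper epsF [V, V'] []"
    and zig: "P \<in> Ob C \<Longrightarrow> epsF (P \<odot> V) \<bullet> etaF P \<star> idt V = idt (P \<odot> V)"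
    and zag: "P \<in> Ob C \<Longrightarrow> epsF P \<star> idt V' \<bullet> etaF (P \<odot> V') = idt (P \<odot> V')"
begin

abbreviation "Eta v p \<equiv> act etaF [] [p, v]"
abbreviation "Ev p v \<equiv> act epsF [v, p] []"

lemma V_Ob[simp]: "V \<in> Ob C" "V' \<in> Ob C"
  using labelled_V labelled_V' by (auto simp: labelled_def)

lemma lop_eta: "v \<noteq> p \<Longrightarrow> ty v = V \<Longrightarrow> ty p = V' \<Longrightarrow> lop etaF [] [p, v]"
  and lop_eps: "v \<noteq> p \<Longrightarrow> ty v = V \<Longrightarrow> ty p = V' \<Longrightarrow> lop epsF [v, p] []"
  using oper_eta oper_eps by (auto simp: lop_def)

lemma Eta_El: "x \<in> El S \<Longrightarrow> v \<noteq> p \<Longrightarrow> ty v = V \<Longrightarrow> ty p = V' \<Longrightarrow> v \<notin> S \<Longrightarrow> p \<notin> S \<Longrightarrow> Eta v p x \<in> El (insert v (insert p S))"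
  by (rule act_El'[OF _ lop_eta]) (auto simp: ready_def)
lemma Ev_El: "x \<in> El S \<Longrightarrow> v \<noteq> p \<Longrightarrow> ty v = V \<Longrightarrow> ty p = V' \<Longrightarrow> v \<in> S \<Longrightarrow> p \<in> S \<Longrightarrow> S' = S - {v, p} \<Longrightarrow> Ev p v x \<in> El S'"
  by (rule act_El'[OF _ lop_eps]) (auto simp: ready_def)
lemma Eta_on2: "x \<in> El S \<Longrightarrow> oper F [ty b, ty a] [ty b, ty a] \<Longrightarrow> a \<noteq> b \<Longrightarrow> {a, b} \<subseteq> S \<Longrightarrow> v \<noteq> p \<Longrightarrow> v \<notin> S \<Longrightarrow> p \<notin> S \<Longrightarrow>
    ty v = V \<Longrightarrow> ty p = V' \<Longrightarrow> Eta v p (on2 F a b x) = on2 F a b (Eta v p x)"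
  by (rule act_comm[OF _ lop_eta]) (auto simp: lop_def ready_def)
lemma Ev_on2: "x \<in> El S \<Longrightarrow> oper F [ty b, ty a] [ty b, ty a] \<Longrightarrow> distinct [a, b, v, p] \<Longrightarrow> {a, b, v, p} \<subseteq> S \<Longrightarrow>
    ty v = V \<Longrightarrow> ty p = V' \<Longrightarrow> Ev p v (on2 F a b x) = on2 F a b (Ev p v x)"
  by (rule act_comm[OF _ lop_eps]) (auto simp: lop_def ready_def)
lemma Eta_Eta: "x \<in> El S \<Longrightarrow> distinct [v, p, u, q] \<Longrightarrow> {v, p, u, q} \<inter> S = {} \<Longrightarrow>
    ty v = V \<Longrightarrow> ty p = V' \<Longrightarrow> ty u = V \<Longrightarrow> ty q = V' \<Longrightarrow> Eta v p (Eta u q x) = Eta u q (Eta v p x)"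
  by (rule act_comm[OF _ lop_eta lop_eta]) (auto simp: lop_def ready_def)
lemma Ev_Ev: "x \<in> El S \<Longrightarrow> distinct [v, p, u, q] \<Longrightarrow> {v, p, u, q} \<subseteq> S \<Longrightarrow>
    ty v = V \<Longrightarrow> ty p = V' \<Longrightarrow> ty u = V \<Longrightarrow> ty q = V' \<Longrightarrow> Ev p v (Ev q u x) = Ev q u (Ev p v x)"
  by (rule act_comm[OF _ lop_eps lop_eps]) (auto simp: lop_def ready_def)

lemma lop_cmp: "lop F is js \<Longrightarrow> lop G js ks \<Longrightarrow> lop (\<lambda>P. G P \<bullet> F P) is ks"
  by (auto simp: lop_def intro: oper_cmp)

text \<open>The identity \<open>zig\<close> with labels attached is a renaming, because the leg that
  survives is the created one.\<close>

lemma Ev_Eta_V: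
  assumes x: "x \<in> El S" and l: "u \<in> S" "v \<notin> S" "p \<notin> S" "v \<noteq> p" "ty u = V" "ty v = V" "ty p = V'"
  shows "Ev p u (Eta v p x) = Rn u v x"
proof -
  let ?F = "\<lambda>P. etaF P \<star> idt V" and ?G = "\<lambda>P. epsF (P \<odot> V)"
  have F: "lop ?F [u] [u, p, v]" and G: "lop ?G [u, p, v] [v]"
    using oper_post[OF oper_eta, of V] oper_pre[OF oper_eps, of "[V]"] l by (auto simp: lop_def)
  have m: "Eta v p x \<in> El (insert v (insert p S))" using l by (intro Eta_El[OF x]) auto
  have "act ?F [u] [u, p, v] x = Eta v p x"
    using act_post[OF x lop_eta[of v p], of u] l by (auto simp: ready_def)
  moreover have "act ?G [u, p, v] [v] (Eta v p x) = Ev p u (Eta v p x)"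
    using act_pre[OF m lop_eps[of u p], of "[v]"] l by (auto simp: ready_def)
  moreover have "act (\<lambda>P. ?G P \<bullet> ?F P) [u] [v] x = act ?G [u, p, v] [v] (act ?F [u] [u, p, v] x)"
    by (rule act_cmp[OF x F G]) (use l in \<open>auto simp: ready_def\<close>)
  moreover have "act (\<lambda>P. ?G P \<bullet> ?F P) [u] [v] x = Rn u v x"
    using zig l x by (intro act_cong) (auto simp: El_fst El_fin)
  ultimately show ?thesis by simp
qed

lemma Ev_Eta_V':
  assumes x: "x \<in> El S" and l: "q \<in> S" "v \<notin> S" "p \<notin> S" "v \<noteq> p" "ty q = V'" "ty v = V" "ty p = V'"
  shows "Ev q v (Eta v p x) = Rn q p x"
proof -
  let ?F = "\<lambda>P. etaF (P \<odot> V')" and ?G = "\<lambda>P. epsF P \<star> idt V'"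
  have F: "lop ?F [q] [p, v, q]" and G: "lop ?G [p, v, q] [p]"
    using oper_pre[OF oper_eta, of "[V']"] oper_post[OF oper_eps, of V'] l by (auto simp: lop_def)
  have m: "Eta v p x \<in> El (insert v (insert p S))" using l by (intro Eta_El[OF x]) auto
  have "act ?F [q] [p, v, q] x = Eta v p x"
    using act_pre[OF x lop_eta[of v p], of "[q]"] l by (auto simp: ready_def)
  moreover have "act ?G [p, v, q] [p] (Eta v p x) = Ev q v (Eta v p x)"
    using act_post[OF m lop_eps[of v q], of p] l by (auto simp: ready_def)
  moreover have "act (\<lambda>P. ?G P \<bullet> ?F P) [q] [p] x = act ?G [p, v, q] [p] (act ?F [q] [p, v, q] x)"
    by (rule act_cmp[OF x F G]) (use l in \<open>auto simp: ready_def\<close>)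
  moreover have "act (\<lambda>P. ?G P \<bullet> ?F P) [q] [p] x = Rn q p x"
    using zag l x by (intro act_cong) (auto simp: El_fst El_fin)
  ultimately show ?thesis by simp
qed

lemma Ev_Rn_V:
  assumes x: "x \<in> El S" and l: "u \<in> S" "p \<in> S" "u \<noteq> p" "v \<notin> S" "ty u = V" "ty v = V" "ty p = V'"
  shows "Ev p v (Rn u v x) = Ev p u x"
  using rename_in[OF x lop_eps[of v p], of "[u, p]"] idt_second[OF x, of u p v] l by (auto simp: ready_def)
lemma Ev_Rn_V':
  assumes x: "x \<in> El S" and l: "q \<in> S" "v \<in> S" "v \<noteq> q" "p \<notin> S" "ty q = V'" "ty v = V" "ty p = V'"
  shows "Ev p v (Rn q p x) = Ev q v x"
  using rename_in[OF x lop_eps[of v p], of "[v, q]"] idt_first[OF x, of q v p] l by (auto simp: ready_def)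
lemma Rn_Eta_V:
  assumes x: "x \<in> El S" and l: "u \<notin> S" "v \<notin> S" "p \<notin> S" "u \<noteq> p" "v \<noteq> p" "u \<noteq> v" "ty u = V" "ty v = V" "ty p = V'"
  shows "Rn u v (Eta u p x) = Eta v p x"
  using rename_out[OF x lop_eta[of u p], of "[p, v]"] idt_first[OF Eta_El[OF x, of u p], of u p v] l by (auto simp: ready_def)
lemma Rn_Eta_V':
  assumes x: "x \<in> El S" and l: "v \<notin> S" "q \<notin> S" "p \<notin> S" "v \<noteq> q" "v \<noteq> p" "p \<noteq> q" "ty q = V'" "ty v = V" "ty p = V'"
  shows "Rn q p (Eta v q x) = Eta v p x"
  using rename_out[OF x lop_eta[of v q], of "[p, v]"] idt_second[OF Eta_El[OF x, of v q], of q v p] l by (auto simp: ready_def)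

text \<open>The transpose of \<open>k\<close> along the duality.\<close>

definition dualop where
  "dualop k P = epsF P \<star> idt V' \<star> idt A \<bullet> sg (P \<odot> V' \<odot> V) A V' \<bullet> k (P \<odot> V') \<star> idt V' \<bullet> sg (P \<odot> V' \<odot> V) V' A
     \<bullet> etaF (P \<odot> V') \<star> idt A"

context
  fixes k assumes k: "oper k [A, V] [A, V]"
begin

lemma oper_dualop_parts:
  "oper (\<lambda>P. etaF (P \<odot> V') \<star> idt A) [A, V'] [A, V', V, V']"
  "oper (\<lambda>P. sg (P \<odot> V' \<odot> V) V' A) [A, V', V, V'] [V', A, V, V']"
  "oper (\<lambda>P. k (P \<odot> V') \<star> idt V') [V', A, V, V'] [V', A, V, V']"
  "oper (\<lambda>P. sg (P \<odot> V' \<odot> V) A V') [V', A, V, V'] [A, V', V, V']"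
  "oper (\<lambda>P. epsF P \<star> idt V' \<star> idt A) [A, V', V, V'] [A, V']"
  using oper_post[OF oper_pre[OF oper_eta, of "[V']"], of A] oper_pre[OF oper_sg[of V' A], of "[V, V']"]
    oper_post[OF oper_pre[OF k, of "[V']"], of V'] oper_pre[OF oper_sg[of A V'], of "[V, V']"]
    oper_post[OF oper_post[OF oper_eps, of V'], of A]
  by simp_all

lemma oper_dualop: "oper (dualop k) [A, V'] [A, V']"
  unfolding dualop_def[abs_def] by (intro oper_cmp[OF _ oper_dualop_parts(5)] oper_cmp[OF _ oper_dualop_parts(4)]
    oper_cmp[OF _ oper_dualop_parts(3)] oper_cmp[OF _ oper_dualop_parts(2)] oper_dualop_parts(1))

text \<open>The result sits on the created leg q, since p is consumed by the evaluation;
  \<open>act_dualop\<close> renames it back to p.\<close>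

lemma act_dualop_aux:
  assumes x: "x \<in> El S" and l: "{p, a} \<subseteq> S" "p \<noteq> a" "u \<notin> S" "q \<notin> S" "u \<noteq> q" "ty p = V'" "ty a = A" "ty u = V" "ty q = V'"
  shows "act (dualop k) [a, p] [a, q] x = Ev p u (on2 k u a (Eta u q x))"
proof -
  have ne: "a \<noteq> p" "u \<noteq> a" "u \<noteq> p" "q \<noteq> a" "q \<noteq> p" "a \<noteq> u" "a \<noteq> q" "p \<noteq> u" "p \<noteq> q" "q \<noteq> u" using l by auto
  note s = l ne k
  let ?T = "insert u (insert q S)"
  let ?F1 = "\<lambda>P. etaF (P \<odot> V') \<star> idt A" and ?F2 = "\<lambda>P. sg (P \<odot> V' \<odot> V) V' A" and ?F3 = "\<lambda>P. k (P \<odot> V') \<star> idt V'"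
    and ?F4 = "\<lambda>P. sg (P \<odot> V' \<odot> V) A V'" and ?F5 = "\<lambda>P. epsF P \<star> idt V' \<star> idt A"
  have F: "lop ?F1 [a, p] [a, q, u, p]" "lop ?F2 [a, q, u, p] [q, a, u, p]" "lop ?F3 [q, a, u, p] [q, a, u, p]"
    "lop ?F4 [q, a, u, p] [a, q, u, p]" "lop ?F5 [a, q, u, p] [a, q]"
    using oper_dualop_parts s by (auto simp: lop_def)
  note G2 = lop_cmp[OF F(1,2)]
  note G3 = lop_cmp[OF G2 F(3)]
  note G4 = lop_cmp[OF G3 F(4)]
  have rd: "ready [a, p] [a, q, u, p] S" "ready [a, p] [q, a, u, p] S" "ready [a, p] [a, q] S" using s by (auto simp: ready_def)
  have m: "Eta u q x \<in> El ?T" using s by (intro Eta_El[OF x]) auto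
  have mk: "on2 k u a (Eta u q x) \<in> El ?T" using s by (intro on2_El[OF m]) auto
  have "act (dualop k) [a, p] [a, q] x = act ?F5 [a, q, u, p] [a, q] (act ?F4 [q, a, u, p] [a, q, u, p]
      (act ?F3 [q, a, u, p] [q, a, u, p] (act ?F2 [a, q, u, p] [q, a, u, p] (act ?F1 [a, p] [a, q, u, p] x))))"
    unfolding dualop_def[abs_def] act_cmp[OF x G4 F(5) rd(1,3)] act_cmp[OF x G3 F(4) rd(2,1)] act_cmp[OF x G2 F(3) rd(2,2)]
      act_cmp[OF x F(1,2) rd(1,2)] ..
  also have "act ?F1 [a, p] [a, q, u, p] x = Eta u q x"
  proof -
    have l': "lop (\<lambda>P. etaF (P \<odot> V')) [p] [q, u, p]"
      using oper_pre[OF oper_eta, of "[V']"] s by (auto simp: lop_def)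
    have "act ?F1 [a, p] [a, q, u, p] x = act (\<lambda>P. etaF (P \<odot> V')) [p] [q, u, p] x"
      using act_post[OF x l', of a] s by (auto simp: ready_def)
    also have "\<dots> = Eta u q x" using act_pre[OF x lop_eta[of u q], of "[p]"] s by (auto simp: ready_def)
    finally show ?thesis .
  qed
  also have "act ?F2 [a, q, u, p] [q, a, u, p] (Eta u q x) = Eta u q x"
    using act_pre[OF m lop_sg[of q a], of "[u, p]"] act_swap[OF m, of q a] s by (auto simp: ready_def)
  also have "act ?F3 [q, a, u, p] [q, a, u, p] (Eta u q x) = on2 k u a (Eta u q x)"
  proof -
    have l': "lop (\<lambda>P. k (P \<odot> V')) [a, u, p] [a, u, p]"
      using oper_pre[OF k, of "[V']"] s by (auto simp: lop_def)
    have lk: "lop k [a, u] [a, u]" using s by (auto simp: lop_def)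
    have "act ?F3 [q, a, u, p] [q, a, u, p] (Eta u q x) = act (\<lambda>P. k (P \<odot> V')) [a, u, p] [a, u, p] (Eta u q x)"
      using act_post[OF m l', of q] s by (auto simp: ready_def)
    also have "\<dots> = on2 k u a (Eta u q x)" using act_pre[OF m lk, of "[p]"] s by (auto simp: ready_def)
    finally show ?thesis .
  qed
  also have "act ?F4 [q, a, u, p] [a, q, u, p] (on2 k u a (Eta u q x)) = on2 k u a (Eta u q x)"
    using act_pre[OF mk lop_sg[of a q], of "[u, p]"] act_swap[OF mk, of a q] s by (auto simp: ready_def)
  also have "act ?F5 [a, q, u, p] [a, q] (on2 k u a (Eta u q x)) = Ev p u (on2 k u a (Eta u q x))"
  proof -
    have l': "lop (\<lambda>P. epsF P \<star> idt V') [q, u, p] [q]"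
      using oper_post[OF oper_eps, of V'] s by (auto simp: lop_def)
    have "act ?F5 [a, q, u, p] [a, q] (on2 k u a (Eta u q x)) = act (\<lambda>P. epsF P \<star> idt V') [q, u, p] [q] (on2 k u a (Eta u q x))"
      using act_post[OF mk l', of a] s by (auto simp: ready_def)
    also have "\<dots> = Ev p u (on2 k u a (Eta u q x))" using act_post[OF mk lop_eps[of u p], of q] s by (auto simp: ready_def)
    finally show ?thesis .
  qed
  finally show ?thesis .
qed

lemma act_dualop:
  assumes x: "x \<in> El S" and l: "{p, a} \<subseteq> S" "p \<noteq> a" "u \<notin> S" "q \<notin> S" "u \<noteq> q" "ty p = V'" "ty a = A" "ty u = V" "ty q = V'"
  shows "on2 (dualop k) p a x = Rn q p (Ev p u (on2 k u a (Eta u q x)))"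
proof -
  have L: "lop (dualop k) [a, p] [a, q]" using oper_dualop l by (auto simp: lop_def)
  have r: "ready [a, p] [a, q] S" "ready [a, p] [a, p] S" using l by (auto simp: ready_def)
  have m: "act (dualop k) [a, p] [a, q] x \<in> El (insert q (S - {p}))"
    by (rule act_El'[OF x L r(1)]) (use l in auto)
  show ?thesis
    using rename_out[OF x L, of "[a, p]"] idt_first[OF m, of q a p] r l act_dualop_aux[OF x l] by auto
qed

text \<open>The characteristic property of the transpose: by a triangle identity, the leg v that is
  paired with its output becomes the leg u on which \<open>k\<close> acts.\<close>

lemma Ev_dualop:
  assumes x: "x \<in> El S" and l: "{p, a, v} \<subseteq> S" "distinct [p, a, v]" "ty p = V'" "ty a = A" "ty v = V"
  shows "Ev p v (on2 (dualop k) p a x) = Ev p v (on2 k v a x)"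
proof -
  obtain u where u: "u \<notin> S" "ty u = V" using labelled_fresh[OF labelled_V] El_fin[OF x] by blast
  obtain q where q: "q \<noteq> u" "q \<notin> S" "ty q = V'" using labelled_fresh[OF labelled_V', of "insert u S"] El_fin[OF x] by auto
  have ne: "distinct [p, a, v, u, q]" "distinct [q, u, v, a, p]" using l u q by auto
  note s = l u q ne k
  let ?T = "insert u (insert q S)"
  have m: "Eta u q x \<in> El ?T" using s by (intro Eta_El[OF x]) auto
  have mk: "on2 k u a (Eta u q x) \<in> El ?T" using s by (intro on2_El[OF m]) auto
  have y: "Ev p u (on2 k u a (Eta u q x)) \<in> El (insert q (S - {p}))" using s by (intro Ev_El[OF mk]) auto
  have kx: "on2 k v a x \<in> El S" using s by (intro on2_El[OF x]) auto
  have "Ev p v (on2 (dualop k) p a x) = Ev p v (Rn q p (Ev p u (on2 k u a (Eta u q x))))"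
    using act_dualop[OF x, of p a u q] s by simp
  also have "\<dots> = Ev q v (Ev p u (on2 k u a (Eta u q x)))" using s by (intro Ev_Rn_V'[OF y]) auto
  also have "\<dots> = Ev p u (Ev q v (on2 k u a (Eta u q x)))" using s by (intro Ev_Ev[OF mk]) auto
  also have "Ev q v (on2 k u a (Eta u q x)) = on2 k u a (Ev q v (Eta u q x))" using s by (intro Ev_on2[OF m]) auto
  also have "Ev q v (Eta u q x) = Rn v u x" using s by (intro Ev_Eta_V[OF x]) auto
  also have "on2 k u a (Rn v u x) = Rn v u (on2 k v a x)" using s by (intro rn_on2[OF x]) auto
  also have "Ev p u (Rn v u (on2 k v a x)) = Ev p v (on2 k v a x)" using s by (intro Ev_Rn_V[OF kx]) auto
  finally show ?thesis .
qed

text \<open>Counterpart of \<open>Ev_dualop\<close> for the coevaluation: the evaluation inside the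
  transpose cancels against the given pair v, p and leaves \<open>k\<close> on the pair created by
  the transpose.\<close>

lemma dualop_Eta:
  assumes x: "x \<in> El S" and l: "a \<in> S" "p \<notin> S" "v \<notin> S" "p \<noteq> v" "ty p = V'" "ty a = A" "ty v = V"
  shows "on2 (dualop k) p a (Eta v p x) = on2 k v a (Eta v p x)"
proof -
  obtain u where u: "u \<notin> insert p (insert v S)" "ty u = V" using labelled_fresh[OF labelled_V] El_fin[OF x] by (metis finite.insertI)
  obtain q where q: "q \<notin> insert u (insert p (insert v S))" "ty q = V'" using labelled_fresh[OF labelled_V'] El_fin[OF x] by (metis finite.insertI)
  have ne: "distinct [p, a, v, u, q]" "distinct [q, u, v, a, p]" using l u q by auto
  note s = l u q ne k
  have m1: "Eta v p x \<in> El (insert v (insert p S))" using s by (intro Eta_El[OF x]) auto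
  have m2: "Eta u q x \<in> El (insert u (insert q S))" using s by (intro Eta_El[OF x]) auto
  have m3: "on2 k u a (Eta u q x) \<in> El (insert u (insert q S))" using s by (intro on2_El[OF m2]) auto
  have m4: "Eta v q x \<in> El (insert v (insert q S))" using s by (intro Eta_El[OF x]) auto
  have "on2 (dualop k) p a (Eta v p x) = Rn q p (Ev p u (on2 k u a (Eta u q (Eta v p x))))"
    using s by (intro act_dualop[OF m1]) auto
  also have "Eta u q (Eta v p x) = Eta v p (Eta u q x)" using s by (intro Eta_Eta[OF x]) auto
  also have "on2 k u a (Eta v p (Eta u q x)) = Eta v p (on2 k u a (Eta u q x))" using s by (intro Eta_on2[OF m2, symmetric]) auto
  also have "Ev p u (Eta v p (on2 k u a (Eta u q x))) = Rn u v (on2 k u a (Eta u q x))" using s by (intro Ev_Eta_V[OF m3]) auto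
  also have "\<dots> = on2 k v a (Rn u v (Eta u q x))" using s by (intro rn_on2[OF m2, symmetric]) auto
  also have "Rn u v (Eta u q x) = Eta v q x" using s by (intro Rn_Eta_V[OF x]) auto
  also have "Rn q p (on2 k v a (Eta v q x)) = on2 k v a (Rn q p (Eta v q x))"
    by (rule act_comm[OF m4 lop_rn]) (use s in \<open>auto simp: lop_def ready_def\<close>)
  also have "Rn q p (Eta v q x) = Eta v p x" using s by (intro Rn_Eta_V'[OF x]) auto
  finally show ?thesis .
qed

end

text \<open>By the triangle identity for V', evaluation against one half of a fresh pair renames the
  leg, which is reversible.\<close>

lemma Ev_faithful:
  assumes x: "x \<in> El S" "y \<in> El S" and l: "p \<in> S" "v \<notin> S" "q \<notin> S" "v \<noteq> q" "ty p = V'" "ty v = V" "ty q = V'"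
    and e: "Ev p v (Eta v q x) = Ev p v (Eta v q y)"
  shows "x = y"
proof -
  have "Rn p q x = Rn p q y" using e Ev_Eta_V'[OF x(1), of p v q] Ev_Eta_V'[OF x(2), of p v q] l by simp
  then have "Rn q p (Rn p q x) = Rn q p (Rn p q y)" by simp
  then show ?thesis using rn_rn[OF x(1), of p q] rn_rn[OF x(2), of p q] l by simp
qed

section \<open>The dual coaction\<close>

context
  fixes f w
  assumes cf: "coaction V f" and cu: "counital V f" and w: "oper w [A, V] [A, V]"
    and wf: "\<And>P. P \<in> Ob C \<Longrightarrow> w P \<bullet> f P = idt (P \<odot> V \<odot> A)"
    and fw: "\<And>P. P \<in> Ob C \<Longrightarrow> f P \<bullet> w P = idt (P \<odot> V \<odot> A)"
begin

lemma w_f: "x \<in> El S \<Longrightarrow> {v, a} \<subseteq> S \<Longrightarrow> v \<noteq> a \<Longrightarrow> ty v = V \<Longrightarrow> ty a = A \<Longrightarrow> on2 w v a (on2 f v a x) = x"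
  by (rule act_inverse[OF coactionD(2)[OF cf] w wf]) auto
lemma f_w: "x \<in> El S \<Longrightarrow> {v, a} \<subseteq> S \<Longrightarrow> v \<noteq> a \<Longrightarrow> ty v = V \<Longrightarrow> ty a = A \<Longrightarrow> on2 f v a (on2 w v a x) = x"
  by (rule act_inverse[OF w coactionD(2)[OF cf] fw]) auto

text \<open>Inverting the coaction law reverses the order of the two factors; transposition reverses
  it once more.\<close>

lemma inverse_coassoc:
  assumes x: "x \<in> El S" and l: "{v, a, b} \<subseteq> S" "distinct [v, a, b]" "ty v = V" "ty a = A" "ty b = A"
  shows "on2 w v b (on2 w v a (on2 tf a b x)) = on2 tf a b (on2 w v a x)"
proof -
  note s = l w coactionD(2)[OF cf]
  define y where "y = on2 w v a x"
  have y: "y \<in> El S" unfolding y_def using s by (intro on2_El[OF x]) auto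
  have m: "on2 tf a b y \<in> El S" "on2 f v b (on2 tf a b y) \<in> El S" using s y by (simp_all add: on2_El)
  have xy: "x = on2 f v a y" unfolding y_def using s by (simp add: f_w[OF x])
  have "on2 tf a b x = on2 f v a (on2 f v b (on2 tf a b y))"
    unfolding xy using s coactionD(3)[OF cf y, of v a b] by simp
  then show ?thesis unfolding y_def[symmetric] using s by (simp add: w_f[OF m(2)] w_f[OF m(1)])
qed

text \<open>Tested by evaluation against a fresh leg v: the outer transpose becomes \<open>w\<close>
  on v, commutes past the inner one, and the inner one then becomes \<open>w\<close> acting after
  it. The resulting order is that of \<open>inverse_coassoc\<close>.\<close>

lemma coaction_dual: "coaction V' (dualop w)"
  unfolding coaction_def
proof (intro conjI allI impI)
  fix S x p a b assume x: "x \<in> El S" and l: "{p, a, b} \<subseteq> S" "distinct [p, a, b]" "ty p = V'" "ty a = A" "ty b = A"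
  obtain v where v: "v \<notin> S" "ty v = V" using labelled_fresh[OF labelled_V] El_fin[OF x] by blast
  obtain q where q: "q \<noteq> v" "q \<notin> S" "ty q = V'" using labelled_fresh[OF labelled_V', of "insert v S"] El_fin[OF x] by auto
  have ne: "distinct [p, a, b, v, q]" "distinct [q, v, b, a, p]" using l v q by auto
  note s = l v q ne w oper_dualop[OF w]
  let ?D = "dualop w" and ?T = "insert v (insert q S)"
  define z where "z = Eta v q x"
  have z: "z \<in> El ?T" unfolding z_def using s by (intro Eta_El[OF x]) auto
  have m: "on2 tf a b z \<in> El ?T" "on2 ?D p b (on2 tf a b z) \<in> El ?T" "on2 w v a (on2 tf a b z) \<in> El ?T" "on2 w v a z \<in> El ?T" "on2 ?D p a z \<in> El ?T"
    using s z by (simp_all add: on2_El)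
  have mx: "on2 tf a b x \<in> El S" "on2 ?D p b (on2 tf a b x) \<in> El S" "on2 ?D p a (on2 ?D p b (on2 tf a b x)) \<in> El S"
    "on2 ?D p a x \<in> El S" "on2 tf a b (on2 ?D p a x) \<in> El S"
    using s x by (simp_all add: on2_El)
  have "Ev p v (on2 ?D p a (on2 ?D p b (on2 tf a b z))) = Ev p v (on2 w v a (on2 ?D p b (on2 tf a b z)))"
    using s by (intro Ev_dualop[OF w m(2)]) auto
  also have "on2 w v a (on2 ?D p b (on2 tf a b z)) = on2 ?D p b (on2 w v a (on2 tf a b z))"
    using s by (intro on2_comm[OF m(1)]) auto
  also have "Ev p v \<dots> = Ev p v (on2 w v b (on2 w v a (on2 tf a b z)))"
    using s by (intro Ev_dualop[OF w m(3)]) auto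
  also have "\<dots> = Ev p v (on2 tf a b (on2 w v a z))" using inverse_coassoc[OF z, of v a b] s by simp
  also have "\<dots> = on2 tf a b (Ev p v (on2 w v a z))" using s by (intro Ev_on2[OF m(4)]) auto
  also have "Ev p v (on2 w v a z) = Ev p v (on2 ?D p a z)" using s by (intro Ev_dualop[OF w z, symmetric]) auto
  also have "on2 tf a b (Ev p v (on2 ?D p a z)) = Ev p v (on2 tf a b (on2 ?D p a z))"
    using s by (intro Ev_on2[OF m(5), symmetric]) auto
  finally have e: "Ev p v (on2 ?D p a (on2 ?D p b (on2 tf a b z))) = Ev p v (on2 tf a b (on2 ?D p a z))" .
  have z1: "on2 ?D p a (on2 ?D p b (on2 tf a b z)) = Eta v q (on2 ?D p a (on2 ?D p b (on2 tf a b x)))"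
    unfolding z_def using s by (simp add: Eta_on2[OF mx(2)] Eta_on2[OF mx(1)] Eta_on2[OF x])
  have z2: "on2 tf a b (on2 ?D p a z) = Eta v q (on2 tf a b (on2 ?D p a x))"
    unfolding z_def using s by (simp add: Eta_on2[OF mx(4)] Eta_on2[OF x])
  show "on2 ?D p a (on2 ?D p b (on2 tf a b x)) = on2 tf a b (on2 ?D p a x)"
    by (rule Ev_faithful[OF mx(3,5), of p v q, rotated -1, OF e[unfolded z1 z2]]) (use s in auto)
qed (use oper_dualop[OF w] in simp_all)

text \<open>\<open>w\<close> is counital as the inverse of a counital map, and evaluation transfers
  this to the transpose.\<close>

lemma counital_dual: "counital V' (dualop w)"
  unfolding counital_def
proof (intro conjI allI impI)
  fix S x p a assume x: "x \<in> El S" and l: "{p, a} \<subseteq> S" "distinct [p, a]" "ty p = V'" "ty a = A"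
  obtain v where v: "v \<notin> S" "ty v = V" using labelled_fresh[OF labelled_V] El_fin[OF x] by blast
  obtain q where q: "q \<noteq> v" "q \<notin> S" "ty q = V'" using labelled_fresh[OF labelled_V', of "insert v S"] El_fin[OF x] by auto
  have ne: "distinct [p, a, v, q]" "distinct [q, v, a, p]" using l v q by auto
  note s = l v q ne w oper_dualop[OF w] coactionD(2)[OF cf]
  let ?D = "dualop w" and ?T = "insert v (insert q S)"
  define z where "z = Eta v q x"
  have z: "z \<in> El ?T" unfolding z_def using s by (intro Eta_El[OF x]) auto
  have m: "on2 w v a z \<in> El ?T" "on2 ?D p a z \<in> El ?T" using s z by (simp_all add: on2_El)
  have mx: "on2 ?D p a x \<in> El S" "Ep a (on2 ?D p a x) \<in> El (S - {a})" "Ep a x \<in> El (S - {a})"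
    using s x by (simp_all add: on2_El Ep_El[OF _ _ _ refl])
  have ee: "Ep a (Ev p v y) = Ev p v (Ep a y)" if "y \<in> El ?T" for y
    by (rule act_comm[OF that _ lop_eps]) (use s in \<open>auto simp: lop_def ready_def\<close>)
  have et: "Ep a (Eta v q y) = Eta v q (Ep a y)" if "y \<in> El S" for y
    by (rule act_comm[OF that _ lop_eta]) (use s in \<open>auto simp: lop_def ready_def\<close>)
  have "Ep a (on2 w v a z) = Ep a (on2 f v a (on2 w v a z))" using counitalD[OF cu m(1), of v a] s by simp
  also have "\<dots> = Ep a z" using s by (simp add: f_w[OF z])
  finally have "Ev p v (Ep a (on2 w v a z)) = Ev p v (Ep a z)" by simp
  then have "Ev p v (Ep a (on2 ?D p a z)) = Ev p v (Ep a z)"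
    using Ev_dualop[OF w z, of p a v] s by (simp add: ee[OF m(1), symmetric] ee[OF m(2), symmetric])
  then have e: "Ev p v (Eta v q (Ep a (on2 ?D p a x))) = Ev p v (Eta v q (Ep a x))"
    unfolding z_def using s by (simp add: Eta_on2[OF x, symmetric] et[OF mx(1)] et[OF x])
  show "Ep a (on2 ?D p a x) = Ep a x"
    by (rule Ev_faithful[OF mx(2,3), of p v q, rotated -1, OF e]) (use s in auto)
qed

text \<open>Creating and evaluating the pair does not touch the legs a and b, so both commute with
  the product, and the compatibility of \<open>w\<close> with \<open>y\<close> passes
  through.\<close>

lemma compatible_dual: assumes y: "compatible V w y" shows "compatible V' (dualop w) (dualop y)"
  unfolding compatible_def
proof (intro conjI allI impI)
  note yo = compatibleD(1)[OF y]
  show "oper (dualop y) [A, V'] [A, V']" by (rule oper_dualop[OF yo])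
  fix S x p a b assume x: "x \<in> El S" and l: "{p, a, b} \<subseteq> S" "distinct [p, a, b]" "ty p = V'" "ty a = A" "ty b = A"
  obtain u where u: "u \<notin> S" "ty u = V" using labelled_fresh[OF labelled_V] El_fin[OF x] by blast
  obtain q where q: "q \<noteq> u" "q \<notin> S" "ty q = V'" using labelled_fresh[OF labelled_V', of "insert u S"] El_fin[OF x] by auto
  have ne: "distinct [p, a, b, u, q]" "distinct [q, u, b, a, p]" using l u q by auto
  note s = l u q ne w yo
  let ?T = "insert u (insert q S)"
  have m: "Eta u q x \<in> El ?T" using s by (intro Eta_El[OF x]) auto
  have mk: "on2 w u a (Eta u q x) \<in> El ?T" "on2 y u b (Eta u q x) \<in> El ?T" using s by (simp_all add: on2_El[OF m])
  have e: "Mu b a (Rn q p (Ev p u z)) = Rn q p (Ev p u (Mu b a z))" if z: "z \<in> El ?T" for z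
  proof -
    have z': "Ev p u z \<in> El (insert q (S - {p}))" using s by (intro Ev_El[OF z]) auto
    have "Mu b a (Rn q p (Ev p u z)) = Rn q p (Mu b a (Ev p u z))"
      by (rule act_comm[OF z' _ lop_rn]) (use s in \<open>auto simp: lop_def ready_def\<close>)
    also have "Mu b a (Ev p u z) = Ev p u (Mu b a z)"
      by (rule act_comm[OF z _ lop_eps]) (use s in \<open>auto simp: lop_def ready_def\<close>)
    finally show ?thesis .
  qed
  have d: "on2 (dualop w) p a x = Rn q p (Ev p u (on2 w u a (Eta u q x)))"
    "on2 (dualop y) p b x = Rn q p (Ev p u (on2 y u b (Eta u q x)))"
  proof -
    show "on2 (dualop w) p a x = Rn q p (Ev p u (on2 w u a (Eta u q x)))" using s by (intro act_dualop[OF w x]) auto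
    show "on2 (dualop y) p b x = Rn q p (Ev p u (on2 y u b (Eta u q x)))" using s by (intro act_dualop[OF yo x]) auto
  qed
  have "Mu b a (on2 (dualop w) p a x) = Rn q p (Ev p u (Mu b a (on2 w u a (Eta u q x))))"
    unfolding d(1) by (rule e[OF mk(1)])
  also have "Mu b a (on2 w u a (Eta u q x)) = Mu b a (on2 y u b (Eta u q x))"
    using compatibleD(2)[OF y m, of u a b] s by simp
  also have "Rn q p (Ev p u (Mu b a (on2 y u b (Eta u q x)))) = Mu b a (on2 (dualop y) p b x)"
    unfolding d(2) by (rule e[OF mk(2), symmetric])
  finally show "Mu b a (on2 (dualop w) p a x) = Mu b a (on2 (dualop y) p b x)" .
qed

text \<open>On the created pair, \<open>dualop_Eta\<close> turns the transpose into \<open>w\<close>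
  on v, where \<open>f\<close> cancels it.\<close>

lemma leg_hom_eta: "leg_hom \<I> (V \<odot> V') unit_coaction (tens V V' f (dualop w)) (\<lambda>P. al P V V' \<bullet> etaF P \<bullet> run P)"
  unfolding leg_hom_def
proof (intro allI impI)
  fix S x i r a assume x: "x \<in> El S" and l: "{i, a} \<subseteq> S" "i \<noteq> a" "r \<notin> S" "ty i = \<I>" "ty r = V \<odot> V'" "ty a = A"
  obtain v where v: "v \<notin> {r} \<union> S" "ty v = V" using labelled_fresh[OF labelled_V, of "{r} \<union> S"] El_fin[OF x] by auto
  obtain p where p: "p \<noteq> v" "p \<noteq> r" "p \<notin> S" "ty p = V'" using labelled_fresh[OF labelled_V', of "{r, v} \<union> S"] El_fin[OF x] by auto
  have ne: "distinct [i, a, r, v, p]" "distinct [p, v, r, a, i]" using l v p by auto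
  note s = l v p ne w coactionD(2)[OF cf] oper_dualop[OF w]
  let ?H = "\<lambda>P. al P V V' \<bullet> etaF P \<bullet> run P" and ?x = "act run [i] [] x" and ?T = "insert v (insert p (S - {i}))"
  have L: "lop run [i] []" using oper_run s by (simp add: lop_def)
  have rd: "ready [i] [] S" "ready [i] [p, v] S" "ready [i] [r] S" using s by (auto simp: ready_def)
  have xi: "?x \<in> El (S - {i})" by (rule act_El'[OF x L rd(1)]) simp
  have Le: "lop etaF [] [p, v]" using s by (intro lop_eta) auto
  note L2 = lop_cmp[OF L Le]
  have Lj: "lop (\<lambda>P. al P V V') [p, v] [r]" using lop_jn[of r v p] s by simp
  have H: "act ?H [i] [r] x = Jn v p r (Eta v p ?x)"
    unfolding act_cmp[OF x L2 Lj rd(2,3)] act_cmp[OF x L Le rd(1,2)] using s by simp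
  have m: "Eta v p ?x \<in> El ?T" using s by (intro Eta_El[OF xi]) auto
  have mw: "on2 w v a (Eta v p ?x) \<in> El ?T" using s by (intro on2_El[OF m]) auto
  have j: "Jn v p r (Eta v p ?x) \<in> El (insert r (S - {i}))" using s by (intro Jn_El[OF m]) auto
  have "on2 (tens V V' f (dualop w)) r a (Jn v p r (Eta v p ?x)) = Jn v p r (on2 f v a (on2 (dualop w) p a (Sp r v p (Jn v p r (Eta v p ?x)))))"
    using s by (intro act_tens[OF _ _ _ _ j]) auto
  also have "Sp r v p (Jn v p r (Eta v p ?x)) = Eta v p ?x" using s by (intro Sp_Jn[OF m]) auto
  also have "on2 (dualop w) p a (Eta v p ?x) = on2 w v a (Eta v p ?x)" using s by (intro dualop_Eta[OF w xi]) auto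
  also have "on2 f v a (on2 w v a (Eta v p ?x)) = Eta v p ?x" using s by (simp add: f_w[OF m])
  finally show "act ?H [i] [r] (on2 unit_coaction i a x) = on2 (tens V V' f (dualop w)) r a (act ?H [i] [r] x)"
    unfolding H using unit_on2[OF x, of i a] H s by simp
qed

text \<open>Under the evaluation, \<open>Ev_dualop\<close> replaces the transpose by
  \<open>w\<close> on v, which cancels \<open>f\<close>.\<close>

lemma leg_hom_eps: "leg_hom (V' \<odot> V) \<I> (tens V' V (dualop w) f) unit_coaction (\<lambda>P. runi P \<bullet> epsF P \<bullet> ali P V' V)"
  unfolding leg_hom_def
proof (intro allI impI)
  fix S x r i a assume x: "x \<in> El S" and l: "{r, a} \<subseteq> S" "r \<noteq> a" "i \<notin> S" "ty r = V' \<odot> V" "ty i = \<I>" "ty a = A"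
  obtain v where v: "v \<notin> {i} \<union> S" "ty v = V" using labelled_fresh[OF labelled_V, of "{i} \<union> S"] El_fin[OF x] by auto
  obtain p where p: "p \<noteq> v" "p \<noteq> i" "p \<notin> S" "ty p = V'" using labelled_fresh[OF labelled_V', of "{i, v} \<union> S"] El_fin[OF x] by auto
  have ne: "distinct [i, a, r, v, p]" "distinct [p, v, r, a, i]" using l v p by auto
  note s = l v p ne w coactionD(2)[OF cf] oper_dualop[OF w]
  let ?H = "\<lambda>P. runi P \<bullet> epsF P \<bullet> ali P V' V" and ?t = "tens V' V (dualop w) f" and ?T = "insert p (insert v (S - {r}))"
  have L: "lop runi [] [i]" using oper_runi s by (simp add: lop_def)
  have rd: "ready [r] [v, p] S" "ready [r] [] S" "ready [r] [i] S" using s by (auto simp: ready_def)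
  have Le: "lop epsF [v, p] []" using s by (intro lop_eps) auto
  have Ls: "lop (\<lambda>P. ali P V' V) [r] [v, p]" using lop_sp[of r p v] s by simp
  note L2 = lop_cmp[OF Ls Le]
  have H: "act ?H [r] [i] z = act runi [] [i] (Ev p v (Sp r p v z))" if z: "z \<in> El S" for z
    unfolding act_cmp[OF z L2 L rd(2,3)] act_cmp[OF z Ls Le rd(1,2)] using s by simp
  define y where "y = Sp r p v x"
  have y: "y \<in> El ?T" unfolding y_def using s by (intro Sp_El[OF x]) auto
  have my: "on2 f v a y \<in> El ?T" "on2 (dualop w) p a (on2 f v a y) \<in> El ?T" using s y by (simp_all add: on2_El)
  have tx: "on2 ?t r a x \<in> El S" using s oper_tens[of V' V "dualop w" f] by (intro on2_El[OF x]) auto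
  have hx: "act ?H [r] [i] x \<in> El (insert i (S - {r}))"
    by (rule act_El'[OF x lop_cmp[OF L2 L] rd(3)]) simp
  have "on2 ?t r a x = Jn p v r (on2 (dualop w) p a (on2 f v a y))"
    unfolding y_def using s by (intro act_tens[OF _ _ _ _ x]) auto
  then have "Sp r p v (on2 ?t r a x) = on2 (dualop w) p a (on2 f v a y)"
    using Sp_Jn[OF my(2), of r p v] s by simp
  moreover have "Ev p v (on2 (dualop w) p a (on2 f v a y)) = Ev p v (on2 w v a (on2 f v a y))"
    using s by (intro Ev_dualop[OF w my(1)]) auto
  moreover have "on2 w v a (on2 f v a y) = y" using s by (simp add: w_f[OF y])
  ultimately have "act ?H [r] [i] (on2 ?t r a x) = act ?H [r] [i] x"
    unfolding H[OF tx] H[OF x] y_def by simp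
  then show "act ?H [r] [i] (on2 ?t r a x) = on2 unit_coaction i a (act ?H [r] [i] x)"
    using unit_on2[OF hx, of i a] s by simp
qed

end

end

section \<open>Comodules in the category\<close>

context symmetric_monoidal_category
begin

lemma raw_cmp: assumes "mor (g \<bullet> f)" shows "raw (g \<bullet> f) = raw g \<cdot> raw f"
proof -
  have m: "mor g" "mor f" "dm g = cd f" using assms by auto
  then have "raw g \<cdot> raw f \<in> Hom C (dm f) (cd g)" using comp_hom raw_hom by metis
  then show ?thesis using m by (simp add: cmp_def raw_tag)
qed
lemma raw_ten: assumes "mor f" "mor g" shows "raw (f \<star> g) = raw f \<otimes> raw g"
  using assms tensor_hom[OF raw_hom raw_hom, of f g] by (simp add: ten_def raw_tag)
lemma raw_idt: "X \<in> Ob C \<Longrightarrow> raw (idt X) = \<one> X"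
  by (simp add: idt_def raw_tag id_hom)
lemma raw_str: "X \<in> Ob C \<Longrightarrow> Y \<in> Ob C \<Longrightarrow> Z \<in> Ob C \<Longrightarrow> raw (al X Y Z) = \<alpha> X Y Z"
  "X \<in> Ob C \<Longrightarrow> Y \<in> Ob C \<Longrightarrow> Z \<in> Ob C \<Longrightarrow> raw (ali X Y Z) = Assoc_inv C X Y Z"
  "X \<in> Ob C \<Longrightarrow> raw (lun X) = \<ll> X" "X \<in> Ob C \<Longrightarrow> raw (run X) = \<rr> X"
  "X \<in> Ob C \<Longrightarrow> Y \<in> Ob C \<Longrightarrow> raw (bra X Y) = \<c> X Y"
  by (simp_all add: al_def ali_def lun_def run_def bra_def raw_tag raw_mem)

lemma mor_eq_iff: "mor f \<Longrightarrow> mor g \<Longrightarrow> dm f = dm g \<Longrightarrow> cd f = cd g \<Longrightarrow> f = g \<longleftrightarrow> raw f = raw g"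
  by (metis tag_raw)

text \<open>Tagged counterparts of \<open>whisk\<close>, \<open>one_mult\<close>,
  \<open>one_counit\<close> and \<open>counit_one\<close>. The brackets in \<open>wh\<close> follow
  the left association of composition in C, so that \<open>raw_ops\<close> holds by
  unfolding.\<close>

definition wh where "wh X Y Z Y' Z' k = (ali X Y' Z' \<bullet> idt X \<star> k) \<bullet> al X Y Z"
definition omul where "omul A k X = idt X \<star> k \<bullet> al X A A"
definition oco where "oco k X = run X \<bullet> idt X \<star> k"
definition coo where "coo k X = lun X \<bullet> k \<star> idt X"

lemma wh_simps[simp]: "dm (wh X Y Z Y' Z' k) = X \<odot> Y \<odot> Z" "cd (wh X Y Z Y' Z' k) = X \<odot> Y' \<odot> Z'"
  "X \<in> Ob C \<Longrightarrow> Y \<in> Ob C \<Longrightarrow> Z \<in> Ob C \<Longrightarrow> Y' \<in> Ob C \<Longrightarrow> Z' \<in> Ob C \<Longrightarrow> mor k \<Longrightarrow> dm k = Y \<odot> Z \<Longrightarrow> cd k = Y' \<odot> Z' \<Longrightarrow>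
    mor (wh X Y Z Y' Z' k)"
  by (simp_all add: wh_def)
lemma ops_simps[simp]: "dm (omul A k X) = X \<odot> A \<odot> A" "cd (omul A k X) = X \<odot> cd k"
  "dm (oco k X) = X \<odot> dm k" "cd (oco k X) = X" "dm (coo k X) = dm k \<odot> X" "cd (coo k X) = X"
  "X \<in> Ob C \<Longrightarrow> A \<in> Ob C \<Longrightarrow> mor k \<Longrightarrow> dm k = A \<odot> A \<Longrightarrow> mor (omul A k X)"
  "X \<in> Ob C \<Longrightarrow> mor k \<Longrightarrow> cd k = \<I> \<Longrightarrow> mor (oco k X)" "X \<in> Ob C \<Longrightarrow> mor k \<Longrightarrow> cd k = \<I> \<Longrightarrow> mor (coo k X)"
  by (simp_all add: omul_def oco_def coo_def)

lemma raw_ops: "X \<in> Ob C \<Longrightarrow> Y \<in> Ob C \<Longrightarrow> Z \<in> Ob C \<Longrightarrow> Y' \<in> Ob C \<Longrightarrow> Z' \<in> Ob C \<Longrightarrow> mor k \<Longrightarrow> dm k = Y \<odot> Z \<Longrightarrow> cd k = Y' \<odot> Z' \<Longrightarrow>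
    raw (wh X Y Z Y' Z' k) = whisk C X Y Z Y' Z' (raw k)"
  "X \<in> Ob C \<Longrightarrow> A \<in> Ob C \<Longrightarrow> mor k \<Longrightarrow> dm k = A \<odot> A \<Longrightarrow> raw (omul A k X) = one_mult C A (raw k) X"
  "X \<in> Ob C \<Longrightarrow> mor k \<Longrightarrow> cd k = \<I> \<Longrightarrow> raw (oco k X) = one_counit C (raw k) X"
  "X \<in> Ob C \<Longrightarrow> mor k \<Longrightarrow> cd k = \<I> \<Longrightarrow> raw (coo k X) = counit_one C (raw k) X"
  by (simp_all add: wh_def omul_def oco_def coo_def whisk_def one_mult_def one_counit_def counit_one_def
    raw_cmp raw_ten raw_idt raw_str)

text \<open>\<open>itw b b' G g\<close>: the family \<open>G\<close> is \<open>1\<^sub>P g\<close> up to the rebracketings \<open>b\<close> and \<open>b'\<close>.\<close>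

definition itw where
  "itw b b' G g \<longleftrightarrow> mor g \<and> (\<forall>P \<in> Ob C. isom (b P) \<and> isom (b' P) \<and> cd (b P) = P \<odot> dm g \<and> cd (b' P) = P \<odot> cd g \<and>
     mor (G P) \<and> dm (G P) = dm (b P) \<and> cd (G P) = dm (b' P) \<and> b' P \<bullet> G P = idt P \<star> g \<bullet> b P)"

lemma itw_cmp:
  assumes g: "itw b b' G g" and k: "itw b' b'' K k" and e: "dm k = cd g" shows "itw b b'' (\<lambda>P. K P \<bullet> G P) (k \<bullet> g)"
  unfolding itw_def
proof (intro conjI ballI)
  fix P assume P: "P \<in> Ob C"
  have "b'' P \<bullet> K P \<bullet> G P = (idt P \<star> k \<bullet> b' P) \<bullet> G P"
    using k P unfolding itw_def by (simp add: cmp_assoc[symmetric])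
  also have "\<dots> = idt P \<star> k \<bullet> idt P \<star> g \<bullet> b P" using g P unfolding itw_def by (simp add: cmp_assoc)
  also have "\<dots> = idt P \<star> (k \<bullet> g) \<bullet> b P" using P e by (simp add: wl_cmp cmp_assoc)
  finally show "b'' P \<bullet> K P \<bullet> G P = idt P \<star> (k \<bullet> g) \<bullet> b P" .
qed (use g k e in \<open>simp_all add: itw_def\<close>)

text \<open>The morphism determines the family because \<open>b'\<close> can be cancelled; the
  family determines the morphism because whiskering with \<I> is faithful.\<close>

lemma itw_eq:
  assumes g: "itw b b' G g" and h: "itw b b' H h" and e: "dm g = dm h" "cd g = cd h"
  shows "g = h \<longleftrightarrow> (\<forall>P \<in> Ob C. G P = H P)"
proof
  assume gh: "g = h"
  show "\<forall>P \<in> Ob C. G P = H P"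
  proof
    fix P assume P: "P \<in> Ob C"
    have "b' P \<bullet> G P = b' P \<bullet> H P" using g h P gh unfolding itw_def by simp
    then show "G P = H P" by (rule isom_mono[rotated]) (use g h P in \<open>simp_all add: itw_def\<close>)
  qed
next
  assume GH: "\<forall>P \<in> Ob C. G P = H P"
  have "idt \<I> \<star> g \<bullet> b \<I> = b' \<I> \<bullet> G \<I>" using g unfolding itw_def by simp
  also have "\<dots> = idt \<I> \<star> h \<bullet> b \<I>" using h GH unfolding itw_def by simp
  finally have "idt \<I> \<star> g = idt \<I> \<star> h"
    by (rule isom_epi[rotated]) (use g h e in \<open>simp_all add: itw_def\<close>)
  then show "g = h" by (rule unit_whisker_faithful[rotated -1]) (use g h e in \<open>simp_all add: itw_def\<close>)
qed

definition bet3 where "bet3 X Y Z P = al P (X \<odot> Y) Z \<bullet> al P X Y \<star> idt Z"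
abbreviation "bet2 X Y P \<equiv> al P X Y"
abbreviation "bet1 X P \<equiv> idt (P \<odot> X)"

lemma bet3_simps[simp]: "dm (bet3 X Y Z P) = P \<odot> X \<odot> Y \<odot> Z" "cd (bet3 X Y Z P) = P \<odot> (X \<odot> Y \<odot> Z)"
  "X \<in> Ob C \<Longrightarrow> Y \<in> Ob C \<Longrightarrow> Z \<in> Ob C \<Longrightarrow> P \<in> Ob C \<Longrightarrow> isom (bet3 X Y Z P)"
  by (simp_all add: bet3_def)

lemma bet3_pentagon: "X \<in> Ob C \<Longrightarrow> Y \<in> Ob C \<Longrightarrow> Z \<in> Ob C \<Longrightarrow> P \<in> Ob C \<Longrightarrow>
    idt P \<star> al X Y Z \<bullet> bet3 X Y Z P = al P X (Y \<odot> Z) \<bullet> al (P \<odot> X) Y Z"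
  by (simp add: bet3_def pentagon_al)

lemma itw_fam2: "X \<in> Ob C \<Longrightarrow> Y \<in> Ob C \<Longrightarrow> X' \<in> Ob C \<Longrightarrow> Y' \<in> Ob C \<Longrightarrow> mor k \<Longrightarrow> dm k = X \<odot> Y \<Longrightarrow> cd k = X' \<odot> Y' \<Longrightarrow>
    itw (bet2 X Y) (bet2 X' Y') (fam [Y, X] [Y', X'] k) k"
  by (simp add: itw_def fam_def al_ali[THEN reassoc])

text \<open>Whiskering by X on the left is evaluation of the family at the longer prefix P X; the
  pentagon compares the bracketings.\<close>

lemma itw_wh:
  assumes o: "X \<in> Ob C" "Y \<in> Ob C" "Z \<in> Ob C" "Y' \<in> Ob C" "Z' \<in> Ob C" and k: "mor k" "dm k = Y \<odot> Z" "cd k = Y' \<odot> Z'"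
  shows "itw (bet3 X Y Z) (bet3 X Y' Z') (\<lambda>P. fam [Z, Y] [Z', Y'] k (P \<odot> X)) (wh X Y Z Y' Z' k)"
  unfolding itw_def
proof (intro conjI ballI)
  fix P assume P: "P \<in> Ob C"
  have b: "bet3 X Y' Z' P = idt P \<star> ali X Y' Z' \<bullet> al P X (Y' \<odot> Z') \<bullet> al (P \<odot> X) Y' Z'"
    using o P by (simp add: bet3_pentagon[symmetric] wl_cmp[symmetric, THEN reassoc])
  have "bet3 X Y' Z' P \<bullet> fam [Z, Y] [Z', Y'] k (P \<odot> X)
     = idt P \<star> ali X Y' Z' \<bullet> al P X (Y' \<odot> Z') \<bullet> idt (P \<odot> X) \<star> k \<bullet> al (P \<odot> X) Y Z"
    unfolding b using o P k by (simp add: fam_def cmp_assoc al_ali[THEN reassoc])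
  also have "\<dots> = idt P \<star> ali X Y' Z' \<bullet> idt P \<star> (idt X \<star> k) \<bullet> al P X (Y \<odot> Z) \<bullet> al (P \<odot> X) Y Z"
    using o P k al_nat[of "idt P" "idt X" k, OF _ _ _ refl refl refl refl refl refl, THEN reassoc] by (simp add: cmp_assoc)
  also have "\<dots> = idt P \<star> wh X Y Z Y' Z' k \<bullet> bet3 X Y Z P"
    unfolding wh_def using o P k by (simp add: bet3_pentagon[symmetric] wl_cmp cmp_assoc)
  finally show "bet3 X Y' Z' P \<bullet> fam [Z, Y] [Z', Y'] k (P \<odot> X) = idt P \<star> wh X Y Z Y' Z' k \<bullet> bet3 X Y Z P" .
qed (use o k in \<open>simp_all add: fam_def\<close>)

lemma itw_post:
  assumes o: "X \<in> Ob C" "Y \<in> Ob C" "Z \<in> Ob C" "X' \<in> Ob C" "Y' \<in> Ob C" and k: "mor k" "dm k = X \<odot> Y" "cd k = X' \<odot> Y'"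
  shows "itw (bet3 X Y Z) (bet3 X' Y' Z) (\<lambda>P. fam [Y, X] [Y', X'] k P \<star> idt Z) (k \<star> idt Z)"
  unfolding itw_def
proof (intro conjI ballI)
  fix P assume P: "P \<in> Ob C"
  have "bet3 X' Y' Z P \<bullet> fam [Y, X] [Y', X'] k P \<star> idt Z = al P (X' \<odot> Y') Z \<bullet> (al P X' Y' \<bullet> fam [Y, X] [Y', X'] k P) \<star> idt Z"
    using o P k by (simp add: bet3_def fam_def cmp_assoc wr_cmp)
  also have "al P X' Y' \<bullet> fam [Y, X] [Y', X'] k P = idt P \<star> k \<bullet> al P X Y"
    using o P k by (simp add: fam_def al_ali[THEN reassoc])
  also have "al P (X' \<odot> Y') Z \<bullet> (idt P \<star> k \<bullet> al P X Y) \<star> idt Z = idt P \<star> (k \<star> idt Z) \<bullet> bet3 X Y Z P"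
    using o P k al_nat[of "idt P" k "idt Z", OF _ _ _ refl refl refl refl refl refl, THEN reassoc]
    by (simp add: wr_cmp bet3_def cmp_assoc)
  finally show "bet3 X' Y' Z P \<bullet> fam [Y, X] [Y', X'] k P \<star> idt Z = idt P \<star> (k \<star> idt Z) \<bullet> bet3 X Y Z P" .
qed (use o k in \<open>simp_all add: fam_def\<close>)

lemma sg_fam: "X \<in> Ob C \<Longrightarrow> Y \<in> Ob C \<Longrightarrow> fam [Y, X] [X, Y] (bra X Y) P = sg P X Y"
  by (simp add: fam_def sg_def)

lemma itw_bra:
  assumes o: "X \<in> Ob C" "Y \<in> Ob C" "Z \<in> Ob C"
  shows "itw (bet3 X Y Z) (bet3 Y X Z) (\<lambda>P. sg P X Y \<star> idt Z) (bra X Y \<star> idt Z)"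
  using itw_post[of X Y Z Y X "bra X Y"] o by (simp add: sg_fam)

lemma itw_omul:
  assumes o: "X \<in> Ob C" "A \<in> Ob C" and k: "mor k" "dm k = A \<odot> A" "cd k = A"
  shows "itw (bet3 X A A) (bet2 X A) (\<lambda>P. fam [A, A] [A] k (P \<odot> X)) (omul A k X)"
  unfolding itw_def
proof (intro conjI ballI)
  fix P assume P: "P \<in> Ob C"
  have "al P X A \<bullet> fam [A, A] [A] k (P \<odot> X) = idt P \<star> (idt X \<star> k) \<bullet> al P X (A \<odot> A) \<bullet> al (P \<odot> X) A A"
    using o P k al_nat[of "idt P" "idt X" k, OF _ _ _ refl refl refl refl refl refl, THEN reassoc]
    by (simp add: fam_def cmp_assoc)
  also have "\<dots> = idt P \<star> omul A k X \<bullet> bet3 X A A P"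
    unfolding omul_def using o P k by (simp add: bet3_pentagon[symmetric] wl_cmp cmp_assoc)
  finally show "al P X A \<bullet> fam [A, A] [A] k (P \<odot> X) = idt P \<star> omul A k X \<bullet> bet3 X A A P" .
qed (use o k in \<open>simp_all add: fam_def\<close>)

lemma fam_counit: "mor k \<Longrightarrow> dm k = A \<Longrightarrow> cd k = \<I> \<Longrightarrow> P \<in> Ob C \<Longrightarrow> fam [A] [] k P = run P \<bullet> idt P \<star> k"
  using mor_dm[of k] by (auto simp: fam_def)

text \<open>The unit constraints of X and of the longer prefix P X are compared by
  \<open>run_tensor\<close>; in \<open>itw_coo\<close> the triangle axiom takes this role.\<close>

lemma itw_oco:
  assumes o: "X \<in> Ob C" "A \<in> Ob C" and k: "mor k" "dm k = A" "cd k = \<I>"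
  shows "itw (bet2 X A) (bet1 X) (\<lambda>P. fam [A] [] k (P \<odot> X)) (oco k X)"
  unfolding itw_def
proof (intro conjI ballI)
  fix P assume P: "P \<in> Ob C"
  have "fam [A] [] k (P \<odot> X) = idt P \<star> run X \<bullet> al P X \<I> \<bullet> idt (P \<odot> X) \<star> k"
    using o P k run_tensor[of P X, THEN reassoc] by (simp add: fam_counit)
  also have "\<dots> = idt P \<star> oco k X \<bullet> al P X A"
    using o P k al_nat[of "idt P" "idt X" k, OF _ _ _ refl refl refl refl refl refl]
    by (simp add: oco_def wl_cmp cmp_assoc)
  finally show "idt (P \<odot> X) \<bullet> fam [A] [] k (P \<odot> X) = idt P \<star> oco k X \<bullet> al P X A"
    using o P k by (simp add: fam_counit)
qed (use o k in \<open>simp_all add: fam_counit\<close>)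

lemma itw_coo:
  assumes o: "X \<in> Ob C" "A \<in> Ob C" and k: "mor k" "dm k = A" "cd k = \<I>"
  shows "itw (bet2 A X) (bet1 X) (\<lambda>P. fam [A] [] k P \<star> idt X) (coo k X)"
  unfolding itw_def
proof (intro conjI ballI)
  fix P assume P: "P \<in> Ob C"
  have "fam [A] [] k P \<star> idt X = idt P \<star> lun X \<bullet> al P \<I> X \<bullet> (idt P \<star> k) \<star> idt X"
    using o P k triangle_al[of P X, THEN reassoc] by (simp add: fam_counit wr_cmp)
  also have "\<dots> = idt P \<star> coo k X \<bullet> al P A X"
    using o P k al_nat[of "idt P" k "idt X", OF _ _ _ refl refl refl refl refl refl]
    by (simp add: coo_def wl_cmp cmp_assoc)
  finally show "idt (P \<odot> X) \<bullet> fam [A] [] k P \<star> idt X = idt P \<star> coo k X \<bullet> al P A X"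
    using o P k by (simp add: fam_counit)
qed (use o k in \<open>simp_all add: fam_counit\<close>)

end

section \<open>Equations of families as identities on legs\<close>

context legs
begin

lemma act_chain: "x \<in> El S \<Longrightarrow> lop K l l \<Longrightarrow> lop K' l l \<Longrightarrow> set l \<subseteq> S \<Longrightarrow> act (\<lambda>P. K P \<bullet> K' P) l l x = act K l l (act K' l l x)"
  by (rule act_cmp) (auto simp: ready_def)

context
  fixes V A f t
  assumes o: "V \<in> Ob C" "A \<in> Ob C" and f: "oper f [A, V] [A, V]" and t: "oper t [A, A] [A, A]"
begin

lemma oper_coassoc:
  "oper (\<lambda>P. pos12 f A P \<bullet> pos13 f V A A P \<bullet> pos23 t V P) [A, A, V] [A, A, V]"
  "oper (\<lambda>P. pos23 t V P \<bullet> pos12 f A P) [A, A, V] [A, A, V]"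
  using oper_cmp[OF oper_cmp[OF oper_pos23[OF t o(1)] oper_pos13[OF f o(2)]] oper_pos12[OF f o(2)]]
    oper_cmp[OF oper_pos12[OF f o(2)] oper_pos23[OF t o(1)]] by simp_all

lemma act_coassoc:
  assumes x: "x \<in> El S" and l: "{v, a, b} \<subseteq> S" "distinct [v, a, b]" "ty v = V" "ty a = A" "ty b = A"
  shows "act (\<lambda>P. pos12 f A P \<bullet> pos13 f V A A P \<bullet> pos23 t V P) [b, a, v] [b, a, v] x = on2 f v a (on2 f v b (on2 t a b x))"
    "act (\<lambda>P. pos23 t V P \<bullet> pos12 f A P) [b, a, v] [b, a, v] x = on2 t a b (on2 f v a x)"
proof -
  have L: "lop (pos12 f A) [b, a, v] [b, a, v]" "lop (pos13 f V A A) [b, a, v] [b, a, v]" "lop (pos23 t V) [b, a, v] [b, a, v]"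
    using o f t l oper_pos12[OF f o(2)] oper_pos13[OF f o(2)] oper_pos23[OF t o(1)] by (auto simp: lop_def)
  have L2: "lop (\<lambda>P. pos13 f V A A P \<bullet> pos23 t V P) [b, a, v] [b, a, v]" using L(2,3) by (auto simp: lop_def intro: oper_cmp)
  have m: "on2 t a b x \<in> El S" "on2 f v b (on2 t a b x) \<in> El S" "on2 f v a x \<in> El S"
    using x l f t by (simp_all add: on2_El)
  have sub: "set [b, a, v] \<subseteq> S" using l by auto
  show "act (\<lambda>P. pos12 f A P \<bullet> pos13 f V A A P \<bullet> pos23 t V P) [b, a, v] [b, a, v] x = on2 f v a (on2 f v b (on2 t a b x))"
    unfolding act_chain[OF x L(1) L2 sub] act_chain[OF x L(2,3) sub]
    using act_pos23[OF x, of t b a v] act_pos13[OF m(1), of f b v a] act_pos12[OF m(2), of f a v b] l f t by simp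
  show "act (\<lambda>P. pos23 t V P \<bullet> pos12 f A P) [b, a, v] [b, a, v] x = on2 t a b (on2 f v a x)"
    unfolding act_chain[OF x L(3,1) sub]
    using act_pos12[OF x, of f a v b] act_pos23[OF m(3), of t b a v] l f t by simp
qed

text \<open>From families to legs by letting both sides act; conversely \<open>oper_eqI_act\<close>
  applies to the one triple of distinct labels that \<open>l\<close> provides.\<close>

lemma coassoc_act_iff:
  assumes l: "distinct [v0, a0, b0]" "ty v0 = V" "ty a0 = A" "ty b0 = A"
  shows "(\<forall>P \<in> Ob C. pos12 f A P \<bullet> pos13 f V A A P \<bullet> pos23 t V P = pos23 t V P \<bullet> pos12 f A P) \<longleftrightarrow>
    (\<forall>S x v a b. x \<in> El S \<longrightarrow> {v, a, b} \<subseteq> S \<longrightarrow> distinct [v, a, b] \<longrightarrow> ty v = V \<longrightarrow> ty a = A \<longrightarrow> ty b = A \<longrightarrow>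
      on2 f v a (on2 f v b (on2 t a b x)) = on2 t a b (on2 f v a x))" (is "(\<forall>P \<in> Ob C. ?F P = ?G P) \<longleftrightarrow> ?R")
proof
  assume e: "\<forall>P \<in> Ob C. ?F P = ?G P"
  show ?R
  proof (intro allI impI)
    fix S x v a b assume x: "x \<in> El S" and l: "{v, a, b} \<subseteq> S" "distinct [v, a, b]" "ty v = V" "ty a = A" "ty b = A"
    have "act ?F [b, a, v] [b, a, v] x = act ?G [b, a, v] [b, a, v] x"
      using e x by (intro act_cong) (auto simp: El_fst El_fin)
    then show "on2 f v a (on2 f v b (on2 t a b x)) = on2 t a b (on2 f v a x)"
      unfolding act_coassoc[OF x l] .
  qed
next
  assume R: ?R
  show "\<forall>P \<in> Ob C. ?F P = ?G P"
  proof
    fix P assume P: "P \<in> Ob C"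
    show "?F P = ?G P"
    proof (rule oper_eqI_act[of ?F "[b0, a0, v0]" "[b0, a0, v0]" ?G, OF _ _ _ _ _ P])
      fix x assume x: "x \<in> El (set [b0, a0, v0])"
      have s: "{v0, a0, b0} \<subseteq> set [b0, a0, v0]" by auto
      show "act ?F [b0, a0, v0] [b0, a0, v0] x = act ?G [b0, a0, v0] [b0, a0, v0] x"
        unfolding act_coassoc[OF x s l] using R x s l by blast
    qed (use oper_coassoc l in auto)
  qed
qed

end

context
  fixes V A f g m
  assumes o: "V \<in> Ob C" "A \<in> Ob C" and f: "oper f [A, V] [A, V]" and g: "oper g [A, V] [A, V]" and m: "oper m [A, A] [A]"
begin

lemma oper_compat:
  "oper (\<lambda>P. m (P \<odot> V) \<bullet> sg P A V \<star> idt A \<bullet> f (P \<odot> A)) [A, V, A] [A, V]"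
  "oper (\<lambda>P. m (P \<odot> V) \<bullet> g P \<star> idt A \<bullet> sg P A V \<star> idt A) [A, V, A] [A, V]"
proof -
  have 1: "oper (\<lambda>P. m (P \<odot> V)) [A, A, V] [A, V]" "oper (\<lambda>P. sg P A V \<star> idt A) [A, V, A] [A, A, V]"
    "oper (\<lambda>P. f (P \<odot> A)) [A, V, A] [A, V, A]" "oper (\<lambda>P. g P \<star> idt A) [A, A, V] [A, A, V]"
    using oper_pre[OF m, of "[V]"] oper_post[OF oper_sg[of A V], of A] oper_pre[OF f, of "[A]"] oper_post[OF g, of A] o by simp_all
  show "oper (\<lambda>P. m (P \<odot> V) \<bullet> sg P A V \<star> idt A \<bullet> f (P \<odot> A)) [A, V, A] [A, V]"
    by (rule oper_cmp[OF oper_cmp[OF 1(3,2)] 1(1)])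
  show "oper (\<lambda>P. m (P \<odot> V) \<bullet> g P \<star> idt A \<bullet> sg P A V \<star> idt A) [A, V, A] [A, V]"
    by (rule oper_cmp[OF oper_cmp[OF 1(2,4)] 1(1)])
qed

lemma act_compat:
  assumes x: "x \<in> El S" and l: "{v, a, b} \<subseteq> S" "distinct [v, a, b]" "ty v = V" "ty a = A" "ty b = A"
  shows "act (\<lambda>P. m (P \<odot> V) \<bullet> sg P A V \<star> idt A \<bullet> f (P \<odot> A)) [a, v, b] [a, v] x = act m [a, b] [a] (on2 f v a x)"
    "act (\<lambda>P. m (P \<odot> V) \<bullet> g P \<star> idt A \<bullet> sg P A V \<star> idt A) [a, v, b] [a, v] x = act m [a, b] [a] (on2 g v b x)"
proof -
  let ?S = "\<lambda>P. sg P A V \<star> idt A" and ?M = "\<lambda>P. m (P \<odot> V)"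
  have ne: "a \<noteq> v" "b \<noteq> v" "b \<noteq> a" using l by auto
  have S: "lop ?S [a, v, b] [a, b, v]" "act ?S [a, v, b] [a, b, v] y = y" if "y \<in> El S" for y
    using act_sg_post[OF that, of b v a] l ne by simp_all
  have M: "lop ?M [a, b, v] [a, v]" "act ?M [a, b, v] [a, v] y = act m [a, b] [a] y" if "y \<in> El S" for y
    using oper_pre[OF m, of "[V]"] o l ne act_pre[OF that, of m "[a, b]" "[a]" "[v]"] m by (auto simp: lop_def ready_def)
  have F: "lop (\<lambda>P. f (P \<odot> A)) [a, v, b] [a, v, b]" "act (\<lambda>P. f (P \<odot> A)) [a, v, b] [a, v, b] x = on2 f v a x"
    using oper_pos23[OF f o(2)] act_pos23[OF x, of f a v b] f l ne by (auto simp: lop_def pos23_def[abs_def])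
  have G: "lop (\<lambda>P. g P \<star> idt A) [a, b, v] [a, b, v]" "act (\<lambda>P. g P \<star> idt A) [a, b, v] [a, b, v] x = on2 g v b x"
    using oper_pos12[OF g o(2)] act_pos12[OF x, of g b v a] g l ne by (auto simp: lop_def pos12_def[abs_def])
  have mm: "on2 f v a x \<in> El S" "on2 g v b x \<in> El S" using x l f g by (simp_all add: on2_El)
  have rd: "ready [a, v, b] [a, v, b] S" "ready [a, v, b] [a, b, v] S" "ready [a, v, b] [a, v] S" using l by (auto simp: ready_def)
  have C1: "lop (\<lambda>P. ?S P \<bullet> f (P \<odot> A)) [a, v, b] [a, b, v]" using F(1) S(1)[OF x] by (auto simp: lop_def intro: oper_cmp)
  have C2: "lop (\<lambda>P. g P \<star> idt A \<bullet> ?S P) [a, v, b] [a, b, v]" using G(1) S(1)[OF x] by (auto simp: lop_def intro: oper_cmp)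
  show "act (\<lambda>P. m (P \<odot> V) \<bullet> sg P A V \<star> idt A \<bullet> f (P \<odot> A)) [a, v, b] [a, v] x = act m [a, b] [a] (on2 f v a x)"
    unfolding act_cmp[OF x C1 M(1)[OF x] rd(2,3)] act_cmp[OF x F(1) S(1)[OF x] rd(1,2)] F(2) S(2)[OF mm(1)] M(2)[OF mm(1)] ..
  show "act (\<lambda>P. m (P \<odot> V) \<bullet> g P \<star> idt A \<bullet> sg P A V \<star> idt A) [a, v, b] [a, v] x = act m [a, b] [a] (on2 g v b x)"
    unfolding act_cmp[OF x C2 M(1)[OF x] rd(2,3)] act_cmp[OF x S(1)[OF x] G(1) rd(2,2)] S(2)[OF x] G(2) M(2)[OF mm(2)] ..
qed

lemma compat_act_iff:
  assumes l: "distinct [v0, a0, b0]" "ty v0 = V" "ty a0 = A" "ty b0 = A"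
  shows "(\<forall>P \<in> Ob C. m (P \<odot> V) \<bullet> sg P A V \<star> idt A \<bullet> f (P \<odot> A) = m (P \<odot> V) \<bullet> g P \<star> idt A \<bullet> sg P A V \<star> idt A) \<longleftrightarrow>
    (\<forall>S x v a b. x \<in> El S \<longrightarrow> {v, a, b} \<subseteq> S \<longrightarrow> distinct [v, a, b] \<longrightarrow> ty v = V \<longrightarrow> ty a = A \<longrightarrow> ty b = A \<longrightarrow>
      act m [a, b] [a] (on2 f v a x) = act m [a, b] [a] (on2 g v b x))" (is "(\<forall>P \<in> Ob C. ?F P = ?G P) \<longleftrightarrow> ?R")
proof
  assume e: "\<forall>P \<in> Ob C. ?F P = ?G P"
  show ?R
  proof (intro allI impI)
    fix S x v a b assume x: "x \<in> El S" and l: "{v, a, b} \<subseteq> S" "distinct [v, a, b]" "ty v = V" "ty a = A" "ty b = A"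
    have "act ?F [a, v, b] [a, v] x = act ?G [a, v, b] [a, v] x"
      using e x by (intro act_cong) (auto simp: El_fst El_fin)
    then show "act m [a, b] [a] (on2 f v a x) = act m [a, b] [a] (on2 g v b x)"
      unfolding act_compat[OF x l] .
  qed
next
  assume R: ?R
  show "\<forall>P \<in> Ob C. ?F P = ?G P"
  proof
    fix P assume P: "P \<in> Ob C"
    show "?F P = ?G P"
    proof (rule oper_eqI_act[of ?F "[a0, v0, b0]" "[a0, v0]" ?G, OF _ _ _ _ _ P])
      fix x assume x: "x \<in> El (set [a0, v0, b0])"
      have s: "{v0, a0, b0} \<subseteq> set [a0, v0, b0]" by auto
      show "act ?F [a0, v0, b0] [a0, v0] x = act ?G [a0, v0, b0] [a0, v0] x"
        unfolding act_compat[OF x s l] using R x s l by blast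
    qed (use oper_compat l in auto)
  qed
qed

end

context
  fixes V A f k
  assumes o: "V \<in> Ob C" "A \<in> Ob C" and f: "oper f [A, V] [A, V]" and k: "oper k [A] []"
begin

lemma act_counit:
  assumes x: "x \<in> El S" and l: "{v, a} \<subseteq> S" "distinct [v, a]" "ty v = V" "ty a = A"
  shows "act (\<lambda>P. k (P \<odot> V) \<bullet> f P) [a, v] [v] x = act k [a] [] (on2 f v a x)" "act (\<lambda>P. k (P \<odot> V)) [a, v] [v] x = act k [a] [] x"
proof -
  have K: "lop (\<lambda>P. k (P \<odot> V)) [a, v] [v]" "act (\<lambda>P. k (P \<odot> V)) [a, v] [v] y = act k [a] [] y" if "y \<in> El S" for y
    using oper_pre[OF k, of "[V]"] o l act_pre[OF that, of k "[a]" "[]" "[v]"] k by (auto simp: lop_def ready_def)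
  have m: "on2 f v a x \<in> El S" using x l f by (simp add: on2_El)
  have F: "lop f [a, v] [a, v]" using f l by (auto simp: lop_def)
  show "act (\<lambda>P. k (P \<odot> V)) [a, v] [v] x = act k [a] [] x" by (rule K(2)[OF x])
  show "act (\<lambda>P. k (P \<odot> V) \<bullet> f P) [a, v] [v] x = act k [a] [] (on2 f v a x)"
    unfolding K(2)[OF m, symmetric] by (rule act_cmp[OF x F K(1)[OF x]]) (use l in \<open>auto simp: ready_def\<close>)
qed

lemma counit_act_iff:
  assumes l: "distinct [v0, a0]" "ty v0 = V" "ty a0 = A"
  shows "(\<forall>P \<in> Ob C. k (P \<odot> V) \<bullet> f P = k (P \<odot> V)) \<longleftrightarrow>
    (\<forall>S x v a. x \<in> El S \<longrightarrow> {v, a} \<subseteq> S \<longrightarrow> distinct [v, a] \<longrightarrow> ty v = V \<longrightarrow> ty a = A \<longrightarrow>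
      act k [a] [] (on2 f v a x) = act k [a] [] x)" (is "(\<forall>P \<in> Ob C. ?F P = ?G P) \<longleftrightarrow> ?R")
proof
  assume e: "\<forall>P \<in> Ob C. ?F P = ?G P"
  show ?R
  proof (intro allI impI)
    fix S x v a assume x: "x \<in> El S" and l: "{v, a} \<subseteq> S" "distinct [v, a]" "ty v = V" "ty a = A"
    have "act ?F [a, v] [v] x = act ?G [a, v] [v] x"
      using e x by (intro act_cong) (auto simp: El_fst El_fin)
    then show "act k [a] [] (on2 f v a x) = act k [a] [] x"
      unfolding act_counit[OF x l] .
  qed
next
  assume R: ?R
  have K: "oper ?G [A, V] [V]" using oper_pre[OF k, of "[V]"] o by simp
  show "\<forall>P \<in> Ob C. ?F P = ?G P"
  proof
    fix P assume P: "P \<in> Ob C"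
    show "?F P = ?G P"
    proof (rule oper_eqI_act[of ?F "[a0, v0]" "[v0]" ?G, OF _ _ _ _ _ P])
      fix x assume x: "x \<in> El (set [a0, v0])"
      have s: "{v0, a0} \<subseteq> set [a0, v0]" by auto
      show "act ?F [a0, v0] [v0] x = act ?G [a0, v0] [v0] x"
        unfolding act_counit[OF x s l] using R x s l by blast
    qed (use oper_cmp[OF f K] K l in auto)
  qed
qed

end

context
  fixes X A v
  assumes o: "X \<in> Ob C" "A \<in> Ob C" and v: "mor v" "dm v = X \<odot> A" "cd v = X \<odot> A"
begin

text \<open>Both sides of the axiom are matched factor by factor with families through
  \<open>itw_cmp\<close>; the inverse braiding is the braiding because C is symmetric.\<close>

lemma coassoc_raw_iff:
  assumes t: "mor t" "dm t = A \<odot> A" "cd t = A \<odot> A"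
  shows "raw v \<otimes> \<one> A \<cdot> Braid_inv C A X \<otimes> \<one> A \<cdot> whisk C A X A X A (raw v) \<cdot> \<c> X A \<otimes> \<one> A \<cdot> whisk C X A A A A (raw t)
      = whisk C X A A A A (raw t) \<cdot> raw v \<otimes> \<one> A \<longleftrightarrow>
    (\<forall>P \<in> Ob C. pos12 (fam [A, X] [A, X] v) A P \<bullet> pos13 (fam [A, X] [A, X] v) X A A P \<bullet> pos23 (fam [A, A] [A, A] t) X P
       = pos23 (fam [A, A] [A, A] t) X P \<bullet> pos12 (fam [A, X] [A, X] v) A P)"
proof -
  let ?h1 = "(((v \<star> idt A \<bullet> bra A X \<star> idt A) \<bullet> wh A X A X A v) \<bullet> bra X A \<star> idt A) \<bullet> wh X A A A A t"
  let ?h2 = "wh X A A A A t \<bullet> v \<star> idt A"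
  have m: "mor ?h1" "mor ?h2" "dm ?h1 = dm ?h2" "cd ?h1 = cd ?h2" using o v t by simp_all
  have r: "raw ?h1 = raw v \<otimes> \<one> A \<cdot> Braid_inv C A X \<otimes> \<one> A \<cdot> whisk C A X A X A (raw v) \<cdot> \<c> X A \<otimes> \<one> A \<cdot> whisk C X A A A A (raw t)"
    "raw ?h2 = whisk C X A A A A (raw t) \<cdot> raw v \<otimes> \<one> A"
    using o v t by (simp_all add: raw_cmp raw_ten raw_idt raw_str raw_ops Braid_inv_eq)
  note w1 = itw_wh[OF o(1) o(2) o(2) o(2) o(2) t] and w2 = itw_wh[OF o(2) o(1) o(2) o(1) o(2) v]
    and b1 = itw_bra[OF o(1) o(2) o(2)] and b2 = itw_bra[OF o(2) o(1) o(2)] and p = itw_post[OF o(1) o(2) o(2) o(1) o(2) v]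
  have c1: "itw (bet3 X A A) (bet3 X A A) (\<lambda>P. fam [A, X] [A, X] v P \<star> idt A \<bullet> sg P A X \<star> idt A \<bullet> fam [A, X] [A, X] v (P \<odot> A)
       \<bullet> sg P X A \<star> idt A \<bullet> fam [A, A] [A, A] t (P \<odot> X)) ?h1"
    unfolding cmp_assoc using v t by (intro itw_cmp[OF _ p] itw_cmp[OF _ b2] itw_cmp[OF _ w2] itw_cmp[OF _ b1] w1) simp_all
  have c2: "itw (bet3 X A A) (bet3 X A A) (\<lambda>P. fam [A, A] [A, A] t (P \<odot> X) \<bullet> fam [A, X] [A, X] v P \<star> idt A) ?h2"
    using v t by (intro itw_cmp[OF p w1]) simp_all
  show ?thesis
    unfolding r[symmetric] mor_eq_iff[OF m, symmetric] itw_eq[OF c1 c2 m(3,4)]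
    by (simp add: pos12_def pos13_def pos23_def cmp_assoc)
qed

lemma counit_raw_iff:
  assumes k: "mor k" "dm k = A" "cd k = \<I>"
  shows "one_counit C (raw k) X \<cdot> raw v = one_counit C (raw k) X \<longleftrightarrow>
    (\<forall>P \<in> Ob C. fam [A] [] k (P \<odot> X) \<bullet> fam [A, X] [A, X] v P = fam [A] [] k (P \<odot> X))"
proof -
  let ?h1 = "oco k X \<bullet> v" and ?h2 = "oco k X"
  have m: "mor ?h1" "mor ?h2" "dm ?h1 = dm ?h2" "cd ?h1 = cd ?h2" using o v k by simp_all
  have r: "raw ?h1 = one_counit C (raw k) X \<cdot> raw v" "raw ?h2 = one_counit C (raw k) X"
    using o v k by (simp_all add: raw_cmp raw_ops)
  note c2 = itw_oco[OF o k]
  have c1: "itw (bet2 X A) (bet1 X) (\<lambda>P. fam [A] [] k (P \<odot> X) \<bullet> fam [A, X] [A, X] v P) ?h1"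
    using v k by (intro itw_cmp[OF itw_fam2[OF o o v] c2]) simp
  show ?thesis
    using itw_eq[OF c1 c2 m(3,4)] unfolding mor_eq_iff[OF m] r .
qed

lemma compat_raw_iff:
  assumes u: "mor u" "dm u = X \<odot> A" "cd u = X \<odot> A" and k: "mor k" "dm k = A \<odot> A" "cd k = A"
  shows "one_mult C A (raw k) X \<cdot> \<c> A X \<otimes> \<one> A \<cdot> whisk C A X A X A (raw v)
      = one_mult C A (raw k) X \<cdot> raw u \<otimes> \<one> A \<cdot> \<c> A X \<otimes> \<one> A \<longleftrightarrow>
    (\<forall>P \<in> Ob C. fam [A, A] [A] k (P \<odot> X) \<bullet> sg P A X \<star> idt A \<bullet> fam [A, X] [A, X] v (P \<odot> A)
       = fam [A, A] [A] k (P \<odot> X) \<bullet> fam [A, X] [A, X] u P \<star> idt A \<bullet> sg P A X \<star> idt A)"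
proof -
  let ?h1 = "(omul A k X \<bullet> bra A X \<star> idt A) \<bullet> wh A X A X A v" and ?h2 = "(omul A k X \<bullet> u \<star> idt A) \<bullet> bra A X \<star> idt A"
  have m: "mor ?h1" "mor ?h2" "dm ?h1 = dm ?h2" "cd ?h1 = cd ?h2" using o v u k by simp_all
  have r: "raw ?h1 = one_mult C A (raw k) X \<cdot> \<c> A X \<otimes> \<one> A \<cdot> whisk C A X A X A (raw v)"
    "raw ?h2 = one_mult C A (raw k) X \<cdot> raw u \<otimes> \<one> A \<cdot> \<c> A X \<otimes> \<one> A"
    using o v u k by (simp_all add: raw_cmp raw_ten raw_idt raw_str raw_ops)
  note w = itw_wh[OF o(2) o(1) o(2) o(1) o(2) v] and b = itw_bra[OF o(2) o(1) o(2)] and mu = itw_omul[OF o k]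
    and p = itw_post[OF o(1) o(2) o(2) o(1) o(2) u]
  have c1: "itw (bet3 A X A) (bet2 X A) (\<lambda>P. fam [A, A] [A] k (P \<odot> X) \<bullet> sg P A X \<star> idt A \<bullet> fam [A, X] [A, X] v (P \<odot> A)) ?h1"
    unfolding cmp_assoc using v k by (intro itw_cmp[OF _ mu] itw_cmp[OF _ b] w) simp_all
  have c2: "itw (bet3 A X A) (bet2 X A) (\<lambda>P. fam [A, A] [A] k (P \<odot> X) \<bullet> fam [A, X] [A, X] u P \<star> idt A \<bullet> sg P A X \<star> idt A) ?h2"
    unfolding cmp_assoc using u k by (intro itw_cmp[OF _ mu] itw_cmp[OF _ p] b) simp_all
  show ?thesis
    unfolding r[symmetric] mor_eq_iff[OF m, symmetric] itw_eq[OF c1 c2 m(3,4)] ..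
qed

end

end

section \<open>The given multiplier Hopf monoid\<close>

locale hopf_data = symmetric_monoidal_category C
  for C :: "('o, 'm, 'z) brmoncat_scheme" (structure) +
  fixes Q :: "'o \<Rightarrow> 'o \<Rightarrow> 'm set" and A :: 'o and t1 t2 t3 t4 e :: 'm
  assumes Q_class: "regular_epi_class C Q"
    and regular: "regular_multiplier_bimonoid C A t1 t2 t3 t4 e"
    and hopf: "multiplier_Hopf_monoid C A t1 t2 e"
    and nondeg: "nondegenerate C A (mult C A t1 e)"
    and dense: "e \<in> Q A \<I>"
begin

lemma data:
  "A \<in> Ob C" "t1 \<in> Hom C (A \<odot> A) (A \<odot> A)" "t2 \<in> Hom C (A \<odot> A) (A \<odot> A)" "t3 \<in> Hom C (A \<odot> A) (A \<odot> A)" "e \<in> Hom C A \<I>"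
  "t1 \<otimes> \<one> A \<cdot> Braid_inv C A A \<otimes> \<one> A \<cdot> whisk C A A A A A t1 \<cdot> \<c> A A \<otimes> \<one> A \<cdot> whisk C A A A A A t1
       = whisk C A A A A A t1 \<cdot> t1 \<otimes> \<one> A"
  "one_counit C e A \<cdot> t1 = one_counit C e A"
  "whisk C A A A A A t1 \<cdot> t2 \<otimes> \<one> A = t2 \<otimes> \<one> A \<cdot> whisk C A A A A A t1"
  "counit_one C e A \<cdot> t1 = one_counit C e A \<cdot> t2"
  "one_mult C A (mult C A t1 e) A \<cdot> \<c> A A \<otimes> \<one> A \<cdot> whisk C A A A A A t1
       = one_mult C A (mult C A t1 e) A \<cdot> t3 \<otimes> \<one> A \<cdot> \<c> A A \<otimes> \<one> A"
  using regular unfolding regular_multiplier_bimonoid_def multiplier_bimonoid_def Let_def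
  by (simp_all add: reverse_braiding_def)

definition "T1 = tag (A \<odot> A) (A \<odot> A) t1"
definition "T2 = tag (A \<odot> A) (A \<odot> A) t2"
definition "T3 = tag (A \<odot> A) (A \<odot> A) t3"
definition "T1i = tag (A \<odot> A) (A \<odot> A) (inverse_mor C (A \<odot> A) (A \<odot> A) t1)"
definition "T2i = tag (A \<odot> A) (A \<odot> A) (inverse_mor C (A \<odot> A) (A \<odot> A) t2)"
definition "E = tag A \<I> e"
definition "M = coo E A \<bullet> T1"

lemma A_Ob'[simp]: "A \<in> Ob C" by (rule data(1))

lemma T_simps[simp]: "mor T1" "mor T2" "mor T3" "mor E"
  "dm T1 = A \<odot> A" "cd T1 = A \<odot> A" "dm T2 = A \<odot> A" "cd T2 = A \<odot> A" "dm T3 = A \<odot> A" "cd T3 = A \<odot> A"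
  "dm T1i = A \<odot> A" "cd T1i = A \<odot> A" "dm T2i = A \<odot> A" "cd T2i = A \<odot> A" "dm E = A" "cd E = \<I>"
  "raw T1 = t1" "raw T2 = t2" "raw T3 = t3" "raw E = e"
  using data by (simp_all add: T1_def T2_def T3_def T1i_def T2i_def E_def raw_tag)

lemma M_simps[simp]: "mor M" "dm M = A \<odot> A" "cd M = A" "raw M = mult C A t1 e"
  by (simp_all add: M_def mult_def raw_cmp raw_ops)

lemma T_inv[simp]: "mor T1i" "mor T2i" "T1 \<bullet> T1i = idt (A \<odot> A)" "T1i \<bullet> T1 = idt (A \<odot> A)"
  "T2 \<bullet> T2i = idt (A \<odot> A)" "T2i \<bullet> T2 = idt (A \<odot> A)"
proof -
  have "inverse_pair C (A \<odot> A) (A \<odot> A) t1 (inverse_mor C (A \<odot> A) (A \<odot> A) t1)"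
    "inverse_pair C (A \<odot> A) (A \<odot> A) t2 (inverse_mor C (A \<odot> A) (A \<odot> A) t2)"
    using hopf by (auto simp: multiplier_Hopf_monoid_def intro: is_iso_pair)
  then show "mor T1i" "mor T2i" "T1 \<bullet> T1i = idt (A \<odot> A)" "T1i \<bullet> T1 = idt (A \<odot> A)"
    "T2 \<bullet> T2i = idt (A \<odot> A)" "T2i \<bullet> T2 = idt (A \<odot> A)"
    by (auto simp: inverse_pair_def T1_def T2_def T1i_def T2i_def cmp_tag idt_def)
qed

lemma M_T2: "M = oco E A \<bullet> T2"
proof -
  have "raw M = raw (oco E A \<bullet> T2)" using data(9) by (simp add: mult_def raw_cmp raw_ops)
  then show ?thesis using mor_eq_iff[of M "oco E A \<bullet> T2"] by simp
qed

text \<open>Density in tagged form: a coequalizer presentation of e that is preserved by tensoring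
  with X on the left.\<close>

lemma dense_coequalizer:
  assumes "X \<in> Ob C"
  obtains W f g where "mor f" "mor g" "dm f = W" "dm g = W" "cd f = A" "cd g = A" 
    "idt X \<star> E \<bullet> idt X \<star> f = idt X \<star> E \<bullet> idt X \<star> g"
    "\<forall>h. mor h \<longrightarrow> dm h = X \<odot> A \<longrightarrow> h \<bullet> idt X \<star> f = h \<bullet> idt X \<star> g \<longrightarrow>
       (\<exists>!k. mor k \<and> dm k = X \<odot> \<I> \<and> cd k = cd h \<and> k \<bullet> idt X \<star> E = h)"
proof -
  obtain W f g where c: "coequalizer C W A \<I> f g e"
    and cX: "coequalizer C (X \<odot> W) (X \<odot> A) (X \<odot> \<I>) (\<one> X \<otimes> f) (\<one> X \<otimes> g) (\<one> X \<otimes> e)"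
    using regular_epi_class.Q_preserved[OF Q_class dense] assms by blast
  let ?f = "tag W A f" and ?g = "tag W A g"
  have fg: "f \<in> Hom C W A" "g \<in> Hom C W A" using c by (auto simp: coequalizer_def)
  have m: "mor ?f" "mor ?g" using fg by simp_all
  have r: "raw (idt X \<star> ?f) = \<one> X \<otimes> f" "raw (idt X \<star> ?g) = \<one> X \<otimes> g" "raw (idt X \<star> E) = \<one> X \<otimes> e"
    using fg assms by (simp_all add: raw_ten raw_idt raw_tag)
  show thesis
  proof (rule that[OF m])
    show "idt X \<star> E \<bullet> idt X \<star> ?f = idt X \<star> E \<bullet> idt X \<star> ?g"
      using cX fg assms by (subst mor_eq_iff) (simp_all add: raw_cmp r coequalizer_def)
  next
    show "\<forall>h. mor h \<longrightarrow> dm h = X \<odot> A \<longrightarrow> h \<bullet> idt X \<star> ?f = h \<bullet> idt X \<star> ?g \<longrightarrow>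
       (\<exists>!k. mor k \<and> dm k = X \<odot> \<I> \<and> cd k = cd h \<and> k \<bullet> idt X \<star> E = h)"
    proof (intro allI impI)
    fix h assume h: "mor h" "dm h = X \<odot> A" "h \<bullet> idt X \<star> ?f = h \<bullet> idt X \<star> ?g"
    have hh: "raw h \<in> Hom C (X \<odot> A) (cd h)" using raw_hom[OF h(1)] h(2) by simp
    have "raw h \<cdot> \<one> X \<otimes> f = raw h \<cdot> \<one> X \<otimes> g"
      using arg_cong[OF h(3), of raw] h(1,2) fg assms by (simp add: raw_cmp r)
    then obtain k where k: "k \<in> Hom C (X \<odot> \<I>) (cd h)" "k \<cdot> \<one> X \<otimes> e = raw h"
      and u: "\<And>k'. k' \<in> Hom C (X \<odot> \<I>) (cd h) \<Longrightarrow> k' \<cdot> \<one> X \<otimes> e = raw h \<Longrightarrow> k' = k"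
      using cX hh unfolding coequalizer_def by metis
    show "\<exists>!k. mor k \<and> dm k = X \<odot> \<I> \<and> cd k = cd h \<and> k \<bullet> idt X \<star> E = h"
    proof (rule ex1I[of _ "tag (X \<odot> \<I>) (cd h) k"])
      show "mor (tag (X \<odot> \<I>) (cd h) k) \<and> dm (tag (X \<odot> \<I>) (cd h) k) = X \<odot> \<I> \<and> cd (tag (X \<odot> \<I>) (cd h) k) = cd h \<and>
          tag (X \<odot> \<I>) (cd h) k \<bullet> idt X \<star> E = h"
        using k h assms by (auto simp: mor_eq_iff raw_cmp r raw_tag)
    next
      fix k' assume k': "mor k' \<and> dm k' = X \<odot> \<I> \<and> cd k' = cd h \<and> k' \<bullet> idt X \<star> E = h"
      then have kk: "mor k'" "dm k' = X \<odot> \<I>" "cd k' = cd h" and e: "k' \<bullet> idt X \<star> E = h" by auto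
      have "raw k' \<in> Hom C (X \<odot> \<I>) (cd h)" "raw (k' \<bullet> idt X \<star> E) = raw k' \<cdot> \<one> X \<otimes> e"
        using raw_hom[OF kk(1)] kk assms by (simp_all add: raw_cmp r)
      then have "raw k' \<in> Hom C (X \<odot> \<I>) (cd h)" "raw k' \<cdot> \<one> X \<otimes> e = raw h" unfolding e by simp_all
      then have "raw k' = k" by (rule u)
      then show "k' = tag (X \<odot> \<I>) (cd h) k" using k' tag_raw[of k'] by simp
    qed
    qed
  qed simp_all
qed

text \<open>The uniqueness clause of the coequalizer makes 1e an epimorphism.\<close>

lemma counit_whisker_epi:
  assumes "X \<in> Ob C" "mor h" "mor h'" "dm h = X \<odot> \<I>" "dm h' = X \<odot> \<I>" "cd h = cd h'" "h \<bullet> idt X \<star> E = h' \<bullet> idt X \<star> E"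
  shows "h = h'"
proof -
  obtain W f g where c: "mor f" "mor g" "dm f = W" "dm g = W" "cd f = A" "cd g = A" 
    "idt X \<star> E \<bullet> idt X \<star> f = idt X \<star> E \<bullet> idt X \<star> g"
    "\<forall>h. mor h \<longrightarrow> dm h = X \<odot> A \<longrightarrow> h \<bullet> idt X \<star> f = h \<bullet> idt X \<star> g \<longrightarrow>
       (\<exists>!k. mor k \<and> dm k = X \<odot> \<I> \<and> cd k = cd h \<and> k \<bullet> idt X \<star> E = h)"
    by (rule dense_coequalizer[OF assms(1)])
  have "\<exists>!k. mor k \<and> dm k = X \<odot> \<I> \<and> cd k = cd (h \<bullet> idt X \<star> E) \<and> k \<bullet> idt X \<star> E = h \<bullet> idt X \<star> E"
    using assms c(1-7) by (intro c(8)[rule_format]) (simp_all add: cmp_assoc)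
  then show ?thesis using assms by (metis cd_cmp)
qed

end

locale hopf_data_legs = hopf_data C Q A t1 t2 t3 t4 e + legs C ty
  for C :: "('o, 'm, 'z) brmoncat_scheme" (structure) and Q A t1 t2 t3 t4 e ty +
  assumes A_inf: "infinite {n. ty n = A}"
begin

abbreviation "F V \<equiv> fam [A, V] [A, V]"

lemma fresh_A: "finite S \<Longrightarrow> \<exists>d. d \<notin> S \<and> ty d = A"
  using A_inf by (metis (mono_tags, lifting) finite_subset mem_Collect_eq subsetI)

lemma oper_F: "V \<in> Ob C \<Longrightarrow> mor v \<Longrightarrow> dm v = V \<odot> A \<Longrightarrow> cd v = V \<odot> A \<Longrightarrow> oper (F V v) [A, V] [A, V]"
  by (rule oper_fam) simp_all
lemma oper_E: "oper (fam [A] [] E) [A] []" and oper_M: "oper (fam [A, A] [A] M) [A, A] [A]"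
  by (rule oper_fam; simp)+

lemma labels3: obtains a b c where "distinct [a, b, c]" "ty a = A" "ty b = A" "ty c = A"
proof -
  obtain a where a: "ty a = A" using fresh_A[of "{}"] by auto
  obtain b where b: "b \<noteq> a" "ty b = A" using fresh_A[of "{a}"] by auto
  obtain c where c: "c \<noteq> a" "c \<noteq> b" "ty c = A" using fresh_A[of "{a, b}"] by auto
  show thesis by (rule that[of a b c]) (use a b c in auto)
qed

lemma fam_M: "P \<in> Ob C \<Longrightarrow> fam [A, A] [A] M P = omul A M P"
  by (simp add: fam_def omul_def)
lemma fam_E: "P \<in> Ob C \<Longrightarrow> fam [A] [] E P = run P \<bullet> idt P \<star> E"
  by (simp add: fam_counit)

lemma itw_M: "itw (bet2 A A) (bet1 A) (fam [A, A] [A] M) M"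
  by (simp add: itw_def fam_def)

lemma M_left: "P \<in> Ob C \<Longrightarrow> fam [A, A] [A] M P = fam [A] [] E P \<star> idt A \<bullet> F A T1 P"
proof -
  have "itw (bet2 A A) (bet1 A) (\<lambda>P. fam [A] [] E P \<star> idt A \<bullet> F A T1 P) (coo E A \<bullet> T1)"
    by (intro itw_cmp[OF itw_fam2 itw_coo]) simp_all
  from itw_eq[OF itw_M this] show "P \<in> Ob C \<Longrightarrow> fam [A, A] [A] M P = fam [A] [] E P \<star> idt A \<bullet> F A T1 P"
    by (simp add: M_def)
qed

lemma M_right: "P \<in> Ob C \<Longrightarrow> fam [A, A] [A] M P = fam [A] [] E (P \<odot> A) \<bullet> F A T2 P"
proof -
  have "itw (bet2 A A) (bet1 A) (\<lambda>P. fam [A] [] E (P \<odot> A) \<bullet> F A T2 P) (oco E A \<bullet> T2)"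
    by (intro itw_cmp[OF itw_fam2 itw_oco]) simp_all
  from itw_eq[OF itw_M this] show "P \<in> Ob C \<Longrightarrow> fam [A, A] [A] M P = fam [A] [] E (P \<odot> A) \<bullet> F A T2 P"
    by (simp add: M_T2)
qed

lemma T1_T2: "P \<in> Ob C \<Longrightarrow> pos23 (F A T1) A P \<bullet> pos12 (F A T2) A P = pos12 (F A T2) A P \<bullet> pos23 (F A T1) A P"
proof -
  let ?h1 = "wh A A A A A T1 \<bullet> T2 \<star> idt A" and ?h2 = "T2 \<star> idt A \<bullet> wh A A A A A T1"
  have m: "mor ?h1" "mor ?h2" "dm ?h1 = dm ?h2" "cd ?h1 = cd ?h2" by simp_all
  have "raw ?h1 = raw ?h2" using data(8) by (simp add: raw_cmp raw_ten raw_idt raw_ops)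
  then have e: "?h1 = ?h2" using mor_eq_iff[OF m] by simp
  have "itw (bet3 A A A) (bet3 A A A) (\<lambda>P. F A T1 (P \<odot> A) \<bullet> F A T2 P \<star> idt A) ?h1"
    "itw (bet3 A A A) (bet3 A A A) (\<lambda>P. F A T2 P \<star> idt A \<bullet> F A T1 (P \<odot> A)) ?h2"
    by (intro itw_cmp[OF itw_post itw_wh] itw_cmp[OF itw_wh itw_post]; simp)+
  from itw_eq[OF this m(3,4)] e show "P \<in> Ob C \<Longrightarrow> ?thesis" by (simp add: pos12_def pos23_def)
qed

text \<open>Bridge to the non-degeneracy axiom: the fresh leg d stands at the right end of the word,
  so multiplication by d from the left involves a swap.\<close>

lemma at_Mu:
  assumes x: "x \<in> El S" and l: "a \<in> S" "d \<notin> S" "ty a = A" "ty d = A" "distinct r" "set r = S - {a}"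
  shows "at (act (fam [A, A] [A] M) [d, a] [d] (ext d x)) (d # r) = omul A M (obl r) \<bullet> at x (a # r) \<star> idt A"
    "at (act (fam [A, A] [A] M) [a, d] [a] (ext d x)) (a # r) = omul A M (obl r) \<bullet> sg (obl r) A A \<bullet> at x (a # r) \<star> idt A"
proof -
  have X: "ext d x \<in> El (insert d S)" by (rule ext_El[OF x l(2)])
  have L: "lop (fam [A, A] [A] M) [d, a] [d]" "lop (fam [A, A] [A] M) [a, d] [a]" using oper_M l by (auto simp: lop_def)
  have rd: "ready [d, a] [d] (insert d S)" "ready [a, d] [a] (insert d S)" using l by (auto simp: ready_def)
  have ar: "distinct (a # r)" "set (a # r) = S" using l by auto
  have s1: "set r = insert d S - set [d, a]" "set r = insert d S - set [a, d]" using l by auto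
  have ae: "at (ext d x) (d # a # r) = at x (a # r) \<star> idt A" using at_ext[OF x l(2) ar] l by simp
  show "at (act (fam [A, A] [A] M) [d, a] [d] (ext d x)) (d # r) = omul A M (obl r) \<bullet> at x (a # r) \<star> idt A"
    using act_at[OF X L(1) rd(1) l(5) s1(1)] ae by (simp add: fam_M)
  have "at (ext d x) ([] @ a # d # r) = rwl [] (sg (obl r) (ty a) (ty d)) \<bullet> at (ext d x) ([] @ d # a # r)"
    by (rule at_swap[OF X]) (use l in auto)
  then show "at (act (fam [A, A] [A] M) [a, d] [a] (ext d x)) (a # r) = omul A M (obl r) \<bullet> sg (obl r) A A \<bullet> at x (a # r) \<star> idt A"
    using act_at[OF X L(2) rd(2) l(5) s1(2)] ae l by (simp add: fam_M)
qed

text \<open>Non-degeneracy on the left in the form in which the fresh leg is attached on the right.\<close>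

lemma omul_sg:
  assumes R: "R \<in> Ob C"
  shows "M \<star> idt R \<bullet> ali A A R \<bullet> idt A \<star> bra R A = bra R A \<bullet> omul A M R \<bullet> sg R A A \<bullet> bra A (R \<odot> A)"
proof -
  \<comment> \<open>\<open>h1\<close> and \<open>h2\<close> are two instances of the hexagon with
    one associator moved to the other side.\<close>
  have h1: "al R A A \<bullet> bra A (R \<odot> A) = idt R \<star> bra A A \<bullet> al R A A \<bullet> bra A R \<star> idt A \<bullet> ali A R A"
    using R hexagon_al[of A R A, THEN arg_cong[of _ _ "\<lambda>h. h \<bullet> ali A R A"]] by (simp add: cmp_assoc)
  have h2: "bra R (A \<odot> A) \<bullet> al R A A = ali A A R \<bullet> idt A \<star> bra R A \<bullet> al A R A \<bullet> bra R A \<star> idt A"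
    using R hexagon_al[of R A A, THEN arg_cong[of _ _ "\<lambda>h. ali A A R \<bullet> h"]] by (simp add: ali_al[THEN reassoc])
  have "bra R A \<bullet> omul A M R \<bullet> sg R A A \<bullet> bra A (R \<odot> A)
     = bra R A \<bullet> idt R \<star> M \<bullet> idt R \<star> bra A A \<bullet> al R A A \<bullet> bra A (R \<odot> A)"
    using R by (simp add: omul_def sg_def cmp_assoc al_ali[THEN reassoc])
  also have "\<dots> = bra R A \<bullet> idt R \<star> M \<bullet> al R A A \<bullet> bra A R \<star> idt A \<bullet> ali A R A"
    unfolding h1 using R by (simp add: wl_cmp[symmetric, THEN reassoc])
  also have "\<dots> = M \<star> idt R \<bullet> bra R (A \<odot> A) \<bullet> al R A A \<bullet> bra A R \<star> idt A \<bullet> ali A R A"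
    using R bra_nat[of "idt R" M, OF _ _ refl refl refl refl, THEN reassoc] by (simp add: cmp_assoc)
  also have "\<dots> = M \<star> idt R \<bullet> ali A A R \<bullet> idt A \<star> bra R A \<bullet> al A R A \<bullet> (bra R A \<bullet> bra A R) \<star> idt A \<bullet> ali A R A"
    using R h2[THEN reassoc] by (simp add: cmp_assoc wr_cmp del: bra_bra)
  also have "\<dots> = M \<star> idt R \<bullet> ali A A R \<bullet> idt A \<star> bra R A" using R by simp
  finally show ?thesis ..
qed

text \<open>For the second claim, \<open>omul_sg\<close> and naturality of the symmetry carry the
  test by left multiplication, stated in C with A in front, to the form with A at the end.\<close>

lemma nondeg_tagged:
  assumes R: "R \<in> Ob C" and g: "mor g" "mor h" "dm g = dm h" "cd g = R \<odot> A" "cd h = R \<odot> A"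
  shows "omul A M R \<bullet> g \<star> idt A = omul A M R \<bullet> h \<star> idt A \<Longrightarrow> g = h"
    "omul A M R \<bullet> sg R A A \<bullet> g \<star> idt A = omul A M R \<bullet> sg R A A \<bullet> h \<star> idt A \<Longrightarrow> g = h"
proof -
  have o: "dm h \<in> Ob C" using g by simp
  note nd = nondeg[unfolded nondegenerate_def, rule_format, OF o R]
  have rg: "raw g \<in> Hom C (dm h) (R \<odot> A)" "raw h \<in> Hom C (dm h) (R \<odot> A)" using raw_hom[OF g(1)] raw_hom[OF g(2)] g by simp_all
  show "g = h" if e: "omul A M R \<bullet> g \<star> idt A = omul A M R \<bullet> h \<star> idt A"
  proof -
    have "one_mult C A (mult C A t1 e) R \<cdot> raw g \<otimes> \<one> A = one_mult C A (mult C A t1 e) R \<cdot> raw h \<otimes> \<one> A"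
      using arg_cong[OF e, of raw] R g by (simp add: raw_cmp raw_ten raw_idt raw_ops)
    then have "raw g = raw h" using nd rg by (auto dest: inj_onD)
    then show ?thesis using mor_eq_iff[OF g(1,2)] g by simp
  qed
  show "g = h" if e: "omul A M R \<bullet> sg R A A \<bullet> g \<star> idt A = omul A M R \<bullet> sg R A A \<bullet> h \<star> idt A"
  proof -
    let ?g = "bra R A \<bullet> g" and ?h = "bra R A \<bullet> h"
    have m: "mor ?g" "mor ?h" "dm ?g = dm h" "dm ?h = dm h" "cd ?g = A \<odot> R" "cd ?h = A \<odot> R" using R g by simp_all
    have k: "(M \<star> idt R \<bullet> ali A A R) \<bullet> idt A \<star> (bra R A \<bullet> k) = bra R A \<bullet> (omul A M R \<bullet> sg R A A \<bullet> k \<star> idt A) \<bullet> bra A (dm h)"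
      if "mor k" "dm k = dm h" "cd k = R \<odot> A" for k
    proof -
      have "(M \<star> idt R \<bullet> ali A A R) \<bullet> idt A \<star> (bra R A \<bullet> k) = (M \<star> idt R \<bullet> ali A A R \<bullet> idt A \<star> bra R A) \<bullet> idt A \<star> k"
        using R that by (simp add: wl_cmp cmp_assoc)
      also have "\<dots> = bra R A \<bullet> (omul A M R \<bullet> sg R A A \<bullet> k \<star> idt A) \<bullet> bra A (dm h)"
        unfolding omul_sg[OF R] using R that bra_nat[of "idt A" k, OF _ _ refl refl refl refl] by (simp add: cmp_assoc)
      finally show ?thesis .
    qed
    have "(M \<star> idt R \<bullet> ali A A R) \<bullet> idt A \<star> ?g = (M \<star> idt R \<bullet> ali A A R) \<bullet> idt A \<star> ?h"
      unfolding k[OF g(1) g(3) g(4)] k[OF g(2) refl g(5)] e ..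
    from arg_cong[OF this, of raw]
    have "mult C A t1 e \<otimes> \<one> R \<cdot> Assoc_inv C A A R \<cdot> \<one> A \<otimes> raw ?g = mult C A t1 e \<otimes> \<one> R \<cdot> Assoc_inv C A A R \<cdot> \<one> A \<otimes> raw ?h"
      using R m by (simp add: raw_cmp raw_ten raw_idt raw_str del: M_simps(4)) (simp add: raw_cmp)
    moreover have "raw ?g \<in> Hom C (dm h) (A \<odot> R)" "raw ?h \<in> Hom C (dm h) (A \<odot> R)"
      using raw_hom[OF m(1)] raw_hom[OF m(2)] m by simp_all
    ultimately have "raw ?g = raw ?h" using nd by (auto dest: inj_onD)
    then have "?g = ?h" using mor_eq_iff[OF m(1,2)] m by simp
    then show ?thesis by (rule isom_mono[rotated]) (use R g in simp_all)
  qed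
qed

text \<open>The algebraic identities come from the axioms in C, translated into families and then to
  legs; non-degeneracy and density are read off from a word that ends with the leg in
  question.\<close>

sublocale hopf_legs C ty A "F A T1" "F A T1i" "F A T2" "F A T2i" "F A T3" "fam [A] [] E" "fam [A, A] [A] M"
proof unfold_locales
  obtain a0 b0 c0 where l0: "distinct [a0, b0, c0]" "ty a0 = A" "ty b0 = A" "ty c0 = A" by (rule labels3)
  note oT = oper_F[of A T1] oper_F[of A T1i] oper_F[of A T2] oper_F[of A T2i] oper_F[of A T3] 
  show "A \<in> Ob C" by simp
  show "infinite {n. ty n = A}" by (rule A_inf)
  show o1: "oper (F A T1) [A, A] [A, A]" and "oper (F A T1i) [A, A] [A, A]" and o2: "oper (F A T2) [A, A] [A, A]"
    and "oper (F A T2i) [A, A] [A, A]" and o3: "oper (F A T3) [A, A] [A, A]"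
    by (rule oT; simp)+
  show "oper (fam [A] [] E) [A] []" "oper (fam [A, A] [A] M) [A, A] [A]" by (rule oper_E oper_M)+
  have fus: "\<forall>P \<in> Ob C. pos12 (F A T1) A P \<bullet> pos13 (F A T1) A A A P \<bullet> pos23 (F A T1) A P = pos23 (F A T1) A P \<bullet> pos12 (F A T1) A P"
    using coassoc_raw_iff[of A A T1 T1] data(6) by simp
  have cou: "\<forall>P \<in> Ob C. fam [A] [] E (P \<odot> A) \<bullet> F A T1 P = fam [A] [] E (P \<odot> A)"
    using counit_raw_iff[of A A T1 E] data(7) by simp
  have com: "\<forall>P \<in> Ob C. fam [A, A] [A] M (P \<odot> A) \<bullet> sg P A A \<star> idt A \<bullet> F A T1 (P \<odot> A) = fam [A, A] [A] M (P \<odot> A) \<bullet> F A T3 P \<star> idt A \<bullet> sg P A A \<star> idt A"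
    using compat_raw_iff[of A A T1 T3 M] data(10) by simp
  fix x y :: "nat set \<times> 'o \<times> 'm option \<times> 'o" and S
  {
    fix a b c assume h: "x \<in> El S" "{a, b, c} \<subseteq> S" "distinct [a, b, c]" "ty a = A" "ty b = A" "ty c = A"
    show "on2 (F A T1) a b (on2 (F A T1) a c (on2 (F A T1) b c x)) = on2 (F A T1) b c (on2 (F A T1) a b x)"
      using fus coassoc_act_iff[OF A_Ob' A_Ob' o1 o1 l0] h by blast
    show "on2 (F A T1) b c (on2 (F A T2) a b x) = on2 (F A T2) a b (on2 (F A T1) b c x)"
    proof -
      have L: "lop (pos23 (F A T1) A) [c, b, a] [c, b, a]" "lop (pos12 (F A T2) A) [c, b, a] [c, b, a]"
        using h oper_pos23[OF o1 A_Ob'] oper_pos12[OF o2 A_Ob'] by (auto simp: lop_def)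
      have m: "on2 (F A T2) a b x \<in> El S" "on2 (F A T1) b c x \<in> El S" using h o1 o2 by (simp_all add: on2_El)
      have "act (\<lambda>P. pos23 (F A T1) A P \<bullet> pos12 (F A T2) A P) [c, b, a] [c, b, a] x = act (\<lambda>P. pos12 (F A T2) A P \<bullet> pos23 (F A T1) A P) [c, b, a] [c, b, a] x"
        using T1_T2 h(1) by (intro act_cong) (auto simp: El_fst El_fin)
      then show ?thesis
        using act_chain[OF h(1) L(1,2)] act_chain[OF h(1) L(2,1)] act_pos12[OF h(1), of "F A T2" b a c]
          act_pos23[OF h(1), of "F A T1" c b a] act_pos12[OF m(2), of "F A T2" b a c] act_pos23[OF m(1), of "F A T1" c b a] h o1 o2
        by simp
    qed
    show "act (fam [A, A] [A] M) [c, b] [c] (on2 (F A T3) a b x) = act (fam [A, A] [A] M) [c, b] [c] (on2 (F A T1) a c x)"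
    proof -
      have "{a, c, b} \<subseteq> S" "distinct [a, c, b]" using h by auto
      then show ?thesis using com compat_act_iff[OF A_Ob' A_Ob' o1 o3 oper_M l0] h by metis
    qed
  }
  {
    fix a b assume h: "x \<in> El S" "{a, b} \<subseteq> S" "a \<noteq> b" "ty a = A" "ty b = A"
    have h2: "distinct [a, b]" and l2: "distinct [a0, b0]" using h l0 by simp_all
    show "act (fam [A] [] E) [b] [] (on2 (F A T1) a b x) = act (fam [A] [] E) [b] [] x"
      by (rule iffD1[OF counit_act_iff[OF A_Ob' A_Ob' o1 oper_E l2 l0(2,3)] cou, rule_format, OF h(1,2) h2 h(4,5)])
    show "act (fam [A, A] [A] M) [b, a] [b] x = act (fam [A] [] E) [a] [] (on2 (F A T1) a b x)"
    proof -
      have L: "lop (F A T1) [b, a] [b, a]" "lop (\<lambda>P. fam [A] [] E P \<star> idt A) [b, a] [b]" "lop (fam [A] [] E) [a] []"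
        using o1 oper_post[OF oper_E, of A] oper_E h by (auto simp: lop_def)
      have m: "on2 (F A T1) a b x \<in> El S" using h o1 by (simp add: on2_El)
      have "act (fam [A, A] [A] M) [b, a] [b] x = act (\<lambda>P. fam [A] [] E P \<star> idt A \<bullet> F A T1 P) [b, a] [b] x"
        using M_left h(1) by (intro act_cong) (auto simp: El_fst El_fin)
      also have "\<dots> = act (\<lambda>P. fam [A] [] E P \<star> idt A) [b, a] [b] (on2 (F A T1) a b x)"
        by (rule act_cmp[OF h(1) L(1,2)]) (use h in \<open>auto simp: ready_def\<close>)
      also have "\<dots> = act (fam [A] [] E) [a] [] (on2 (F A T1) a b x)"
        using act_post[OF m L(3), of b] h by (auto simp: ready_def)
      finally show ?thesis .
    qed
    show "act (fam [A, A] [A] M) [b, a] [a] x = act (fam [A] [] E) [b] [] (on2 (F A T2) a b x)"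
    proof -
      have "act (fam [A, A] [A] M) [b, a] [a] x = act (\<lambda>P. fam [A] [] E (P \<odot> A) \<bullet> F A T2 P) [b, a] [a] x"
        using M_right h(1) by (intro act_cong) (auto simp: El_fst El_fin)
      also have "\<dots> = act (fam [A] [] E) [b] [] (on2 (F A T2) a b x)"
        by (rule act_counit(1)[OF A_Ob' A_Ob' o2 oper_E h(1,2) h2 h(4,5)])
      finally show ?thesis .
    qed
    have inv: "on2 (F A g) a b (on2 (F A f) a b x) = x"
      if "mor f" "mor g" "dm f = A \<odot> A" "cd f = A \<odot> A" "dm g = A \<odot> A" "cd g = A \<odot> A" "g \<bullet> f = idt (A \<odot> A)" for f g
    proof (rule act_inverse[OF oper_F oper_F _ h(1,2,3)])
      fix P assume "P \<in> Ob C"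
      then show "F A g P \<bullet> F A f P = idt (P \<odot> A \<odot> A)"
        using that by (simp add: fam_def cmp_assoc al_ali[THEN reassoc] wl_cmp[symmetric, THEN reassoc])
    qed (use h that in simp_all)
    show "on2 (F A T1) a b (on2 (F A T1i) a b x) = x" "on2 (F A T1i) a b (on2 (F A T1) a b x) = x"
      "on2 (F A T2) a b (on2 (F A T2i) a b x) = x" "on2 (F A T2i) a b (on2 (F A T2) a b x) = x"
      by (rule inv; simp)+
  }
  {
    fix a d assume h: "x \<in> El S" "y \<in> El S" "a \<in> S" "d \<notin> S" "ty a = A" "ty d = A" "dm (snd x) = dm (snd y)"
    let ?r = "can (S - {a})"
    have r: "distinct ?r" "set ?r = S - {a}" using El_fin[OF h(1)] by auto
    have ar: "distinct (a # ?r)" "set (a # ?r) = S" using r h by auto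
    note g = mor_at[OF h(1) ar] mor_at[OF h(2) ar]
    have eq: "x = y" if "at x (a # ?r) = at y (a # ?r)" using El_eqI[OF h(1,2) ar that] .
    show "x = y" if "act (fam [A, A] [A] M) [d, a] [d] (ext d x) = act (fam [A, A] [A] M) [d, a] [d] (ext d y)"
    proof (rule eq, rule nondeg_tagged(1)[of "obl ?r"])
      show "omul A M (obl ?r) \<bullet> at x (a # ?r) \<star> idt A = omul A M (obl ?r) \<bullet> at y (a # ?r) \<star> idt A"
        using that unfolding at_Mu(1)[OF h(1,3-6) r, symmetric] at_Mu(1)[OF h(2,3-6) r, symmetric] by simp
    qed (use g h in simp_all)
    show "x = y" if "act (fam [A, A] [A] M) [a, d] [a] (ext d x) = act (fam [A, A] [A] M) [a, d] [a] (ext d y)"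
    proof (rule eq, rule nondeg_tagged(2)[of "obl ?r"])
      show "omul A M (obl ?r) \<bullet> sg (obl ?r) A A \<bullet> at x (a # ?r) \<star> idt A = omul A M (obl ?r) \<bullet> sg (obl ?r) A A \<bullet> at y (a # ?r) \<star> idt A"
        using that unfolding at_Mu(2)[OF h(1,3-6) r, symmetric] at_Mu(2)[OF h(2,3-6) r, symmetric] by simp
    qed (use g h in simp_all)
  }
  {
    fix d assume h: "x \<in> El S" "y \<in> El S" "d \<notin> S" "ty d = A" "dm (snd x) = dm (snd y)"
      "act (fam [A] [] E) [d] [] (ext d x) = act (fam [A] [] E) [d] [] (ext d y)"
    let ?r = "can S"
    have r: "distinct ?r" "set ?r = S" using El_fin[OF h(1)] by auto
    have at: "at (act (fam [A] [] E) [d] [] (ext d z)) ?r = (at z ?r \<bullet> run (dm (snd z))) \<bullet> idt (dm (snd z)) \<star> E" if z: "z \<in> El S" for z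
    proof -
      have X: "ext d z \<in> El (insert d S)" by (rule ext_El[OF z h(3)])
      have L: "lop (fam [A] [] E) [d] []" using oper_E h by (simp add: lop_def)
      have "at (act (fam [A] [] E) [d] [] (ext d z)) ([] @ ?r) = fam [A] [] E (obl ?r) \<bullet> at (ext d z) ([d] @ ?r)"
        by (rule act_at[OF X L]) (use r h in \<open>auto simp: ready_def\<close>)
      also have "\<dots> = run (obl ?r) \<bullet> idt (obl ?r) \<star> E \<bullet> at z ?r \<star> idt A"
        using at_ext[OF z h(3) r] h by (simp add: fam_E cmp_assoc)
      also have "\<dots> = run (obl ?r) \<bullet> at z ?r \<star> idt \<I> \<bullet> idt (dm (snd z)) \<star> E"
        using interchange[OF mor_at[OF z r] T_simps(4) refl refl refl refl] by simp
      also have "\<dots> = (at z ?r \<bullet> run (dm (snd z))) \<bullet> idt (dm (snd z)) \<star> E"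
        using run_nat[OF mor_at[OF z r] refl refl, THEN reassoc] by (simp add: cmp_assoc)
      finally show ?thesis by simp
    qed
    note g = mor_at[OF h(1) r] mor_at[OF h(2) r]
    have o: "dm (snd y) \<in> Ob C" using mor_dm[OF g(2)] by simp
    \<comment> \<open>Up to the unit constraint, the counit of the adjoined leg is precomposition
      with 1e, which is an epimorphism.\<close>
    have "at x ?r \<bullet> run (dm (snd y)) = at y ?r \<bullet> run (dm (snd y))"
    proof (rule counit_whisker_epi[OF o])
      show "(at x ?r \<bullet> run (dm (snd y))) \<bullet> idt (dm (snd y)) \<star> E = (at y ?r \<bullet> run (dm (snd y))) \<bullet> idt (dm (snd y)) \<star> E"
        using at[OF h(1)] at[OF h(2)] h(5,6) by simp
    qed (use g h(5) o in simp_all)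
    then have "at x ?r = at y ?r" by (rule isom_epi[rotated]) (use g o h in simp_all)
    then show "x = y" by (rule El_eqI[OF h(1,2) r])
  }
  fix P u assume P: "P \<in> Ob C" and u: "mor u" "dm u = P \<odot> A"
    and e: "\<And>x y. mor x \<Longrightarrow> mor y \<Longrightarrow> dm x = dm y \<Longrightarrow> cd x = P \<odot> A \<Longrightarrow> cd y = P \<odot> A \<Longrightarrow>
      fam [A] [] E P \<bullet> x = fam [A] [] E P \<bullet> y \<Longrightarrow> u \<bullet> x = u \<bullet> y"
  obtain W f g where c: "mor f" "mor g" "dm f = W" "dm g = W" "cd f = A" "cd g = A" 
    "idt P \<star> E \<bullet> idt P \<star> f = idt P \<star> E \<bullet> idt P \<star> g"
    "\<forall>h. mor h \<longrightarrow> dm h = P \<odot> A \<longrightarrow> h \<bullet> idt P \<star> f = h \<bullet> idt P \<star> g \<longrightarrow>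
       (\<exists>!k. mor k \<and> dm k = P \<odot> \<I> \<and> cd k = cd h \<and> k \<bullet> idt P \<star> E = h)"
    by (rule dense_coequalizer[OF P])
  \<comment> \<open>The pair whose coequalizer is 1e is itself identified by the counit, so the
    hypothesis on \<open>u\<close> applies to it.\<close>
  have "u \<bullet> idt P \<star> f = u \<bullet> idt P \<star> g"
    using P c(1-7) by (intro e) (simp_all add: fam_E cmp_assoc)
  then obtain k where k: "mor k" "dm k = P \<odot> \<I>" "cd k = cd u" "k \<bullet> idt P \<star> E = u"
    using c(8)[rule_format, OF u] by auto
  show "\<exists>k. mor k \<and> dm k = P \<and> cd k = cd u \<and> k \<bullet> fam [A] [] E P = u"
    using P k by (intro exI[of _ "k \<bullet> runi P"]) (simp add: fam_E cmp_assoc runi_run[THEN reassoc])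
qed

end

section \<open>Triangle identities in family form\<close>

context symmetric_monoidal_category
begin

lemma unit_families:
  "P \<in> Ob C \<Longrightarrow> V \<in> Ob C \<Longrightarrow> W \<in> Ob C \<Longrightarrow> mor h \<Longrightarrow> dm h = \<I> \<Longrightarrow> cd h = V \<odot> W \<Longrightarrow>
    fam [] [W, V] h P = ali P V W \<bullet> idt P \<star> h \<bullet> runi P"
  "P \<in> Ob C \<Longrightarrow> V \<in> Ob C \<Longrightarrow> W \<in> Ob C \<Longrightarrow> mor k \<Longrightarrow> dm k = W \<odot> V \<Longrightarrow> cd k = \<I> \<Longrightarrow>
    fam [V, W] [] k P = run P \<bullet> idt P \<star> k \<bullet> al P W V"
  by (simp_all add: fam_def)

context
  fixes V V' h k
  assumes o: "V \<in> Ob C" "V' \<in> Ob C" and h: "mor h" "dm h = \<I>" "cd h = V \<odot> V'" and k: "mor k" "dm k = V' \<odot> V" "cd k = \<I>"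
begin

text \<open>The prefix P is carried through the associators by the pentagon and naturality until the
  triangle identity for V appears whiskered by P.\<close>

lemma families_zig:
  assumes t: "run V \<bullet> idt V \<star> k \<bullet> al V V' V \<bullet> h \<star> idt V = lun V" and P: "P \<in> Ob C"
  shows "fam [V, V'] [] k (P \<odot> V) \<bullet> fam [] [V', V] h P \<star> idt V = idt (P \<odot> V)"
proof -
  have 1: "run (P \<odot> V) \<bullet> idt (P \<odot> V) \<star> k = idt P \<star> (run V \<bullet> idt V \<star> k) \<bullet> al P V (V' \<odot> V)"
    using o k P al_nat[of "idt P" "idt V" k, OF _ _ _ refl refl refl refl refl refl, symmetric] run_tensor[of P V, THEN reassoc]
    by (simp add: cmp_assoc wl_cmp)
  have 2: "al P V (V' \<odot> V) \<bullet> al (P \<odot> V) V' V \<bullet> ali P V V' \<star> idt V = idt P \<star> al V V' V \<bullet> al P (V \<odot> V') V"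
    using o P by (simp add: pentagon_al[symmetric, THEN reassoc, unfolded cmp_assoc] wr_cmp[symmetric])
  have 3: "al P (V \<odot> V') V \<bullet> (idt P \<star> h) \<star> idt V = idt P \<star> (h \<star> idt V) \<bullet> al P \<I> V"
    using o h P al_nat[of "idt P" h "idt V", OF _ _ _ refl refl refl refl refl refl] by simp
  have "fam [V, V'] [] k (P \<odot> V) \<bullet> fam [] [V', V] h P \<star> idt V
     = (run (P \<odot> V) \<bullet> idt (P \<odot> V) \<star> k) \<bullet> (al (P \<odot> V) V' V \<bullet> ali P V V' \<star> idt V) \<bullet> (idt P \<star> h) \<star> idt V \<bullet> runi P \<star> idt V"
    using o h k P by (simp add: unit_families wr_cmp cmp_assoc)
  also have "\<dots> = idt P \<star> (run V \<bullet> idt V \<star> k) \<bullet> (idt P \<star> al V V' V \<bullet> al P (V \<odot> V') V) \<bullet> (idt P \<star> h) \<star> idt V \<bullet> runi P \<star> idt V"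
    unfolding 1 using 2[THEN reassoc] by (simp add: cmp_assoc)
  also have "\<dots> = idt P \<star> (run V \<bullet> idt V \<star> k) \<bullet> idt P \<star> al V V' V \<bullet> (idt P \<star> (h \<star> idt V) \<bullet> al P \<I> V) \<bullet> runi P \<star> idt V"
    using 3[THEN reassoc] by (simp add: cmp_assoc)
  also have "\<dots> = idt P \<star> (run V \<bullet> idt V \<star> k \<bullet> al V V' V \<bullet> h \<star> idt V) \<bullet> al P \<I> V \<bullet> runi P \<star> idt V"
    using o h k P by (simp add: wl_cmp cmp_assoc)
  also have "\<dots> = idt (P \<odot> V)"
    unfolding t using o P triangle_al[of P V, THEN reassoc] by (simp add: wr_cmp[symmetric])
  finally show ?thesis .
qed

lemma families_zag:
  assumes t: "lun V' \<bullet> k \<star> idt V' \<bullet> ali V' V V' \<bullet> idt V' \<star> h = run V'" and P: "P \<in> Ob C"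
  shows "fam [V, V'] [] k P \<star> idt V' \<bullet> fam [] [V', V] h (P \<odot> V') = idt (P \<odot> V')"
proof -
  have 1: "run P \<star> idt V' \<bullet> (idt P \<star> k) \<star> idt V' \<bullet> ali P (V' \<odot> V) V' = idt P \<star> (lun V' \<bullet> k \<star> idt V')"
  proof -
    have "run P \<star> idt V' \<bullet> (idt P \<star> k) \<star> idt V' = idt P \<star> (lun V' \<bullet> k \<star> idt V') \<bullet> al P (V' \<odot> V) V'"
      using o k P al_nat[of "idt P" k "idt V'", OF _ _ _ refl refl refl refl refl refl, symmetric] triangle_al[of P V', THEN reassoc]
      by (simp add: wl_cmp cmp_assoc)
    from this[THEN reassoc] show ?thesis using o k P by (simp add: cmp_assoc)
  qed
  have 2: "al P V' V \<star> idt V' \<bullet> ali (P \<odot> V') V V' = ali P (V' \<odot> V) V' \<bullet> idt P \<star> ali V' V V' \<bullet> al P V' (V \<odot> V')"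
  proof -
    have "ali P (V' \<odot> V) V' \<bullet> idt P \<star> ali V' V V' \<bullet> al P V' (V \<odot> V')
       = ali P (V' \<odot> V) V' \<bullet> idt P \<star> ali V' V V' \<bullet> (al P V' (V \<odot> V') \<bullet> al (P \<odot> V') V V') \<bullet> ali (P \<odot> V') V V'"
      using o P by (simp add: cmp_assoc)
    also have "\<dots> = al P V' V \<star> idt V' \<bullet> ali (P \<odot> V') V V'"
      using o P by (simp add: pentagon_al[symmetric] cmp_assoc wl_cmp[symmetric, THEN reassoc] ali_al[THEN reassoc])
    finally show ?thesis ..
  qed
  have 3: "al P V' (V \<odot> V') \<bullet> idt (P \<odot> V') \<star> h = idt P \<star> (idt V' \<star> h) \<bullet> al P V' \<I>"
    using o h P al_nat[of "idt P" "idt V'" h, OF _ _ _ refl refl refl refl refl refl] by simp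
  have 4: "al P V' \<I> \<bullet> runi (P \<odot> V') = idt P \<star> runi V'"
  proof (rule isom_mono[of "idt P \<star> run V'"])
    show "idt P \<star> run V' \<bullet> al P V' \<I> \<bullet> runi (P \<odot> V') = idt P \<star> run V' \<bullet> idt P \<star> runi V'"
      using o P run_tensor[of P V', THEN reassoc] by (simp add: wl_cmp[symmetric])
  qed (use o P in simp_all)
  have "fam [V, V'] [] k P \<star> idt V' \<bullet> fam [] [V', V] h (P \<odot> V')
     = run P \<star> idt V' \<bullet> (idt P \<star> k) \<star> idt V' \<bullet> (al P V' V \<star> idt V' \<bullet> ali (P \<odot> V') V V') \<bullet> idt (P \<odot> V') \<star> h \<bullet> runi (P \<odot> V')"
    using o h k P by (simp add: unit_families wr_cmp cmp_assoc)
  also have "\<dots> = idt P \<star> (lun V' \<bullet> k \<star> idt V') \<bullet> idt P \<star> ali V' V V' \<bullet> (al P V' (V \<odot> V') \<bullet> idt (P \<odot> V') \<star> h) \<bullet> runi (P \<odot> V')"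
    unfolding 2 1[symmetric] by (simp add: cmp_assoc)
  also have "\<dots> = idt P \<star> (lun V' \<bullet> k \<star> idt V') \<bullet> idt P \<star> ali V' V V' \<bullet> idt P \<star> (idt V' \<star> h) \<bullet> idt P \<star> runi V'"
    unfolding 3 4[symmetric] by (simp add: cmp_assoc)
  also have "\<dots> = idt P \<star> ((lun V' \<bullet> k \<star> idt V' \<bullet> ali V' V V' \<bullet> idt V' \<star> h) \<bullet> runi V')"
    using o h k P by (simp add: wl_cmp cmp_assoc)
  also have "\<dots> = idt (P \<odot> V')" unfolding t using o P by simp
  finally show ?thesis .
qed

end

lemma intertwine_inverse:
  assumes h: "mor h" "dm h = X" "cd h = Y" and k: "mor k" "dm k = Y" "cd k = X" "k \<bullet> h = idt X" "h \<bullet> k = idt Y"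
    and A: "A \<in> Ob C" and xy: "mor x" "dm x = X \<odot> A" "cd x = X \<odot> A" "mor y" "dm y = Y \<odot> A" "cd y = Y \<odot> A"
    and e: "y \<bullet> h \<star> idt A = h \<star> idt A \<bullet> x"
  shows "x \<bullet> k \<star> idt A = k \<star> idt A \<bullet> y"
proof -
  have XY: "X \<in> Ob C" "Y \<in> Ob C" using h by auto
  have "x \<bullet> k \<star> idt A = (k \<bullet> h) \<star> idt A \<bullet> x \<bullet> k \<star> idt A" using k(1-4) A xy XY by simp
  also have "\<dots> = k \<star> idt A \<bullet> (h \<star> idt A \<bullet> x) \<bullet> k \<star> idt A" using h k(1-3) A by (simp add: wr_cmp cmp_assoc)
  also have "\<dots> = k \<star> idt A \<bullet> y \<bullet> (h \<bullet> k) \<star> idt A" unfolding e[symmetric] using h k(1-3) A by (simp add: wr_cmp cmp_assoc)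
  also have "\<dots> = k \<star> idt A \<bullet> y" using k A xy XY by simp
  finally show ?thesis .
qed

end

section \<open>Comodules in C as coactions on legs\<close>

context hopf_data_legs
begin

definition struct where "struct V v \<longleftrightarrow> mor v \<and> dm v = V \<odot> A \<and> cd v = V \<odot> A"

lemma structD: "struct V v \<Longrightarrow> mor v" "struct V v \<Longrightarrow> dm v = V \<odot> A" "struct V v \<Longrightarrow> cd v = V \<odot> A"
  by (simp_all add: struct_def)

lemma labelled_Ob: "labelled V \<Longrightarrow> V \<in> Ob C" by (simp add: labelled_def)

lemma oper_T: "oper (F A T1) [A, A] [A, A]" "oper (F A T3) [A, A] [A, A]"
  by (rule oper_F; simp)+

lemma labels_ex: assumes "labelled V" obtains v a b where "distinct [v, a, b]" "ty v = V" "ty a = A" "ty b = A"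
proof -
  obtain v where v: "ty v = V" using labelled_fresh[OF assms, of "{}"] by auto
  obtain a where a: "a \<noteq> v" "ty a = A" using fresh[of "{v}"] by auto
  obtain b where b: "b \<noteq> v" "b \<noteq> a" "ty b = A" using fresh[of "{v, a}"] by auto
  show thesis by (rule that[of v a b]) (use v a b in auto)
qed

text \<open>Each axiom is translated by two equivalences, from morphisms to families and from
  families to legs; coassociativity and counitality of the second structure map follow from the
  other three conditions.\<close>

lemma comodule_iff:
  assumes V: "labelled V" and vs: "struct V v" and us: "struct V u"
  shows "comodule C A t1 t3 e (V, raw v, raw u) \<longleftrightarrow> coaction V (F V v) \<and> counital V (F V v) \<and> compatible V (F V v) (F V u)"
proof -
  obtain v0 a0 b0 where l: "distinct [v0, a0, b0]" "ty v0 = V" "ty a0 = A" "ty b0 = A" by (rule labels_ex[OF V])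
  have l2: "distinct [v0, a0]" using l by simp
  note o = labelled_Ob[OF V] and v = structD[OF vs] and u = structD[OF us]
  note ov = oper_F[OF o v] and ou = oper_F[OF o u]
  have h: "raw v \<in> Hom C (V \<odot> A) (V \<odot> A)" "raw u \<in> Hom C (V \<odot> A) (V \<odot> A)"
    using raw_hom[OF v(1)] raw_hom[OF u(1)] v u by simp_all
  let ?E = "\<lambda>v t. raw v \<otimes> \<one> A \<cdot> \<c> A V \<otimes> \<one> A \<cdot> whisk C A V A V A (raw v) \<cdot> \<c> V A \<otimes> \<one> A \<cdot> whisk C V A A A A t
      = whisk C V A A A A t \<cdot> raw v \<otimes> \<one> A"
  let ?N = "\<lambda>v. one_counit C e V \<cdot> raw v = one_counit C e V"
  let ?K = "one_mult C A (mult C A t1 e) V \<cdot> \<c> A V \<otimes> \<one> A \<cdot> whisk C A V A V A (raw v)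
      = one_mult C A (mult C A t1 e) V \<cdot> raw u \<otimes> \<one> A \<cdot> \<c> A V \<otimes> \<one> A"
  have D: "comodule C A t1 t3 e (V, raw v, raw u) \<longleftrightarrow> ?E v t1 \<and> ?N v \<and> ?E u t3 \<and> ?N u \<and> ?K"
    using o h by (simp add: comodule_def Let_def Braid_inv_eq)
  note br = Braid_inv_eq[OF A_Ob' o]
  have E1: "?E v t1 \<longleftrightarrow> coaction V (F V v)"
    using coassoc_raw_iff[OF o A_Ob' v T_simps(1,5,6), unfolded T_simps(17) br] o ov
    by (simp only: coaction_def coassoc_act_iff[OF o A_Ob' ov oper_T(1) l] simp_thms)
  have E3: "?E u t3 \<longleftrightarrow> (\<forall>S x v a b. x \<in> El S \<longrightarrow> {v, a, b} \<subseteq> S \<longrightarrow> distinct [v, a, b] \<longrightarrow> ty v = V \<longrightarrow> ty a = A \<longrightarrow> ty b = A \<longrightarrow>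
      on2 (F V u) v a (on2 (F V u) v b (on2 (F A T3) a b x)) = on2 (F A T3) a b (on2 (F V u) v a x))"
    using coassoc_raw_iff[OF o A_Ob' u T_simps(3,9,10), unfolded T_simps(19) br]
    by (simp only: coassoc_act_iff[OF o A_Ob' ou oper_T(2) l])
  have N: "?N v \<longleftrightarrow> counital V (F V v)" "?N u \<longleftrightarrow> counital V (F V u)"
    using counit_raw_iff[OF o A_Ob' v T_simps(4,15,16), unfolded T_simps(20)]
      counit_raw_iff[OF o A_Ob' u T_simps(4,15,16), unfolded T_simps(20)]
    by (simp_all only: counital_def counit_act_iff[OF o A_Ob' ov oper_E l2(1) l(2,3)] counit_act_iff[OF o A_Ob' ou oper_E l2(1) l(2,3)])
  have K: "?K \<longleftrightarrow> compatible V (F V v) (F V u)"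
    using compat_raw_iff[OF o A_Ob' v u M_simps(1-3), unfolded M_simps(4)] ou
    by (simp only: compatible_def compat_act_iff[OF o A_Ob' ov ou oper_M l] simp_thms)
  show ?thesis unfolding D E1 E3 N K
    using coassoc_right[of V "F V v" "F V u"] counital_compatible[of V "F V v" "F V u"] ov by blast
qed

lemma comodule_structs:
  assumes "comodule C A t1 t3 e (V, v1, v3)"
  shows "struct V (tag (V \<odot> A) (V \<odot> A) v1)" "struct V (tag (V \<odot> A) (V \<odot> A) v3)"
    "raw (tag (V \<odot> A) (V \<odot> A) v1) = v1" "raw (tag (V \<odot> A) (V \<odot> A) v3) = v3"
  using assms by (simp_all add: comodule_def Let_def struct_def raw_tag)

definition ten1 where
  "ten1 V W v w = ((bra W V \<star> idt A \<bullet> wh W V A V A v) \<bullet> bra V W \<star> idt A) \<bullet> wh V W A W A w"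
definition ten3 where
  "ten3 V W v w = ((wh V W A W A w \<bullet> bra W V \<star> idt A) \<bullet> wh W V A V A v) \<bullet> bra V W \<star> idt A"

lemma struct_ten:
  assumes "V \<in> Ob C" "W \<in> Ob C" "struct V v" "struct W w"
  shows "struct (V \<odot> W) (ten1 V W v w)" "struct (V \<odot> W) (ten3 V W v w)"
  using assms by (simp_all add: struct_def ten1_def ten3_def)

lemma comodule_tensor_raw:
  assumes "V \<in> Ob C" "W \<in> Ob C" "struct V v" "struct W w" "struct V v'" "struct W w'"
  shows "comodule_tensor C A (V, raw v, raw v') (W, raw w, raw w') = (V \<odot> W, raw (ten1 V W v w), raw (ten3 V W v' w'))"
  using assms by (simp add: comodule_tensor_def ten1_def ten3_def struct_def raw_cmp raw_ten raw_idt raw_str raw_ops Braid_inv_eq)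

lemma F_of_itw:
  assumes i: "itw (bet3 V W A) (bet3 V W A) G h" and P: "P \<in> Ob C" and o: "V \<in> Ob C" "W \<in> Ob C"
    and h: "struct (V \<odot> W) h"
  shows "F (V \<odot> W) h P = al P V W \<star> idt A \<bullet> G P \<bullet> ali P V W \<star> idt A"
proof -
  note h = structD[OF h]
  have g: "mor (G P)" "dm (G P) = P \<odot> V \<odot> W \<odot> A" "cd (G P) = P \<odot> V \<odot> W \<odot> A"
    and e: "(al P (V \<odot> W) A \<bullet> al P V W \<star> idt A) \<bullet> G P = idt P \<star> h \<bullet> al P (V \<odot> W) A \<bullet> al P V W \<star> idt A"
    using i P unfolding itw_def bet3_def by auto
  have "al P V W \<star> idt A \<bullet> G P \<bullet> ali P V W \<star> idt A
     = ali P (V \<odot> W) A \<bullet> ((al P (V \<odot> W) A \<bullet> al P V W \<star> idt A) \<bullet> G P) \<bullet> ali P V W \<star> idt A"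
    using o P g by (simp add: cmp_assoc ali_al[THEN reassoc])
  also have "\<dots> = F (V \<odot> W) h P"
    unfolding e using o P h by (simp add: fam_def cmp_assoc wr_cmp[symmetric])
  finally show ?thesis ..
qed

text \<open>The conjugations by the symmetry written out in \<open>ten1\<close> and
  \<open>ten3\<close> are those contained in \<open>pos13\<close>.\<close>

lemma F_ten:
  assumes o: "V \<in> Ob C" "W \<in> Ob C" and s: "struct V v" "struct W w" and P: "P \<in> Ob C"
  shows "F (V \<odot> W) (ten1 V W v w) P = tens V W (F V v) (F W w) P"
    and "F (V \<odot> W) (ten3 V W v w) P = tens' V W (F V v) (F W w) P"
proof -
  note v = structD[OF s(1)] and w = structD[OF s(2)]
  note w1 = itw_wh[OF o(2,1) A_Ob' o(1) A_Ob' v] and w2 = itw_wh[OF o A_Ob' o(2) A_Ob' w]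
    and b1 = itw_bra[OF o A_Ob'] and b2 = itw_bra[OF o(2,1) A_Ob']
  have "itw (bet3 V W A) (bet3 V W A) (\<lambda>P. (sg P W V \<star> idt A \<bullet> F V v (P \<odot> W) \<bullet> sg P V W \<star> idt A) \<bullet> F W w (P \<odot> V)) (ten1 V W v w)"
    unfolding cmp_assoc ten1_def using v w by (intro itw_cmp[OF _ b2] itw_cmp[OF _ w1] itw_cmp[OF _ b1] w2) simp_all
  from F_of_itw[OF this P o struct_ten(1)[OF o s]]
  show "F (V \<odot> W) (ten1 V W v w) P = tens V W (F V v) (F W w) P"
    by (simp add: tens_def pos13_def pos23_def cmp_assoc)
  have "itw (bet3 V W A) (bet3 V W A) (\<lambda>P. F W w (P \<odot> V) \<bullet> sg P W V \<star> idt A \<bullet> F V v (P \<odot> W) \<bullet> sg P V W \<star> idt A) (ten3 V W v w)"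
    unfolding cmp_assoc ten3_def using v w by (intro itw_cmp[OF _ w2] itw_cmp[OF _ b2] itw_cmp[OF _ w1] b1) simp_all
  from F_of_itw[OF this P o struct_ten(2)[OF o s]]
  show "F (V \<odot> W) (ten3 V W v w) P = tens' V W (F V v) (F W w) P"
    by (simp add: tens'_def pos13_def pos23_def cmp_assoc)
qed

lemma comodule_ten:
  assumes l: "labelled V" "labelled W" "labelled (V \<odot> W)" and s: "struct V v" "struct V v'" "struct W w" "struct W w'"
    and c: "comodule C A t1 t3 e (V, raw v, raw v')" "comodule C A t1 t3 e (W, raw w, raw w')"
  shows "comodule C A t1 t3 e (V \<odot> W, raw (ten1 V W v w), raw (ten3 V W v' w'))"
proof -
  note o = labelled_Ob[OF l(1)] labelled_Ob[OF l(2)]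
  note op = oper_F[OF o(1) structD[OF s(1)]] oper_F[OF o(2) structD[OF s(3)]]
  note cv = c(1)[unfolded comodule_iff[OF l(1) s(1,2)]] and cw = c(2)[unfolded comodule_iff[OF l(2) s(3,4)]]
  have "coaction (V \<odot> W) (F (V \<odot> W) (ten1 V W v w)) \<longleftrightarrow> coaction (V \<odot> W) (tens V W (F V v) (F W w))"
    by (rule coaction_cong) (rule F_ten(1)[OF o s(1,3)])
  moreover have "counital (V \<odot> W) (F (V \<odot> W) (ten1 V W v w)) \<longleftrightarrow> counital (V \<odot> W) (tens V W (F V v) (F W w))"
    by (rule counital_cong) (rule F_ten(1)[OF o s(1,3)])
  moreover have "compatible (V \<odot> W) (F (V \<odot> W) (ten1 V W v w)) (F (V \<odot> W) (ten3 V W v' w')) \<longleftrightarrow>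
      compatible (V \<odot> W) (tens V W (F V v) (F W w)) (tens' V W (F V v') (F W w'))"
    by (rule compatible_cong; rule F_ten[OF o s(1,3)] F_ten[OF o s(2,4)]; assumption)
  ultimately show ?thesis
    unfolding comodule_iff[OF l(3) struct_ten(1)[OF o s(1,3)] struct_ten(2)[OF o s(2,4)]]
    using coaction_tens[OF o op] counital_tens[OF o op] compatible_tens[OF o op] cv cw l by blast
qed

lemma comodule_hom_iff:
  assumes l: "X \<in> Ob C" "Y \<in> Ob C" and s: "struct X x" "struct X x'" "struct Y y" "struct Y y'" and h: "mor h" "dm h = X" "cd h = Y"
  shows "raw h \<in> comodule_hom C A t1 t3 e (X, raw x, raw x') (Y, raw y, raw y') \<longleftrightarrow>
     comodule C A t1 t3 e (X, raw x, raw x') \<and> comodule C A t1 t3 e (Y, raw y, raw y') \<and>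
     y \<bullet> h \<star> idt A = h \<star> idt A \<bullet> x \<and> y' \<bullet> h \<star> idt A = h \<star> idt A \<bullet> x'"
proof -
  have "raw h \<in> Hom C X Y" using raw_hom[OF h(1)] h by simp
  moreover have "y \<bullet> h \<star> idt A = h \<star> idt A \<bullet> x \<longleftrightarrow> raw y \<cdot> raw h \<otimes> \<one> A = raw h \<otimes> \<one> A \<cdot> raw x"
    if "struct X x" "struct Y y" for x y
    using that h by (subst mor_eq_iff) (simp_all add: struct_def raw_cmp raw_ten raw_idt)
  ultimately show ?thesis using s by (simp add: comodule_hom_def)
qed

lemma oper_arrow: assumes "mor h" "dm h = X" "cd h = Y" shows "oper (\<lambda>P. idt P \<star> h) [X] [Y]"
proof -
  have "oper (fam [X] [Y] h) [X] [Y]" using assms by (intro oper_fam) auto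
  moreover have "fam [X] [Y] h P = idt P \<star> h" if "P \<in> Ob C" for P using assms that by (auto simp: fam_def)
  ultimately show ?thesis by (metis (no_types, lifting) oper_cong)
qed

text \<open>The leg condition becomes an equation of families by \<open>oper_eqI_act\<close>, and
  this an equation in C by \<open>itw_eq\<close>.\<close>

lemma leg_hom_intertwines:
  assumes l: "labelled X" "labelled Y" and s: "struct X x" "struct Y y" and h: "mor h" "dm h = X" "cd h = Y"
    and lh: "leg_hom X Y (F X x) (F Y y) (\<lambda>P. idt P \<star> h)"
  shows "y \<bullet> h \<star> idt A = h \<star> idt A \<bullet> x"
proof -
  note o = labelled_Ob[OF l(1)] labelled_Ob[OF l(2)] and x = structD[OF s(1)] and y = structD[OF s(2)]
  note op = oper_F[OF o(1) x] oper_F[OF o(2) y] and oh = oper_arrow[OF h]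
  let ?H = "\<lambda>P. idt P \<star> h"
  have oH: "oper (\<lambda>P. ?H P \<star> idt A) [A, X] [A, Y]" using oper_post[OF oh, of A] by simp
  obtain p where p: "ty p = X" using labelled_fresh[OF l(1), of "{}"] by auto
  obtain q where q: "q \<noteq> p" "ty q = Y" using labelled_fresh[OF l(2), of "{p}"] by auto
  obtain a where a: "a \<noteq> p" "a \<noteq> q" "ty a = A" using fresh[of "{p, q}"] by auto
  note d = p q a
  have L: "lop (F X x) [a, p] [a, p]" "lop (F Y y) [a, q] [a, q]" "lop (\<lambda>P. ?H P \<star> idt A) [a, p] [a, q]" "lop ?H [p] [q]"
    using op oh oH d by (auto simp: lop_def)
  have rd: "ready [a, p] [a, q] {a, p}" "ready [a, p] [a, p] {a, p}" "ready [p] [q] {a, p}" using d by (auto simp: ready_def)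
  have op_eq: "F Y y P \<bullet> ?H P \<star> idt A = ?H P \<star> idt A \<bullet> F X x P" if P: "P \<in> Ob C" for P
  proof (rule oper_eqI_act[of "\<lambda>P. F Y y P \<bullet> ?H P \<star> idt A" "[a, p]" "[a, q]" "\<lambda>P. ?H P \<star> idt A \<bullet> F X x P"])
    show "oper (\<lambda>P. F Y y P \<bullet> ?H P \<star> idt A) (map ty [a, p]) (map ty [a, q])"
      "oper (\<lambda>P. ?H P \<star> idt A \<bullet> F X x P) (map ty [a, p]) (map ty [a, q])"
      using oper_cmp[OF oH op(2)] oper_cmp[OF op(1) oH] d by simp_all
    fix z assume "z \<in> El (set [a, p])"
    then have z: "z \<in> El {a, p}" by simp
    have m: "on2 (F X x) p a z \<in> El {a, p}" using on2_El[OF z] op d by simp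
    have post: "act (\<lambda>P. ?H P \<star> idt A) [a, p] [a, q] z = act ?H [p] [q] z" if "z \<in> El {a, p}" for z
      using act_post[OF that L(4), of a] rd d by (auto simp: ready_def)
    have "act (\<lambda>P. F Y y P \<bullet> ?H P \<star> idt A) [a, p] [a, q] z = on2 (F Y y) q a (act ?H [p] [q] z)"
      using act_cmp[OF z L(3,2) rd(1,1)] post[OF z] by simp
    also have "\<dots> = act ?H [p] [q] (on2 (F X x) p a z)"
      using lh[unfolded leg_hom_def, rule_format, OF z, of p a q] d by simp
    also have "\<dots> = act (\<lambda>P. ?H P \<star> idt A \<bullet> F X x P) [a, p] [a, q] z"
      using act_cmp[OF z L(1,3) rd(2,1)] post[OF m] by simp
    finally show "act (\<lambda>P. F Y y P \<bullet> ?H P \<star> idt A) [a, p] [a, q] z = act (\<lambda>P. ?H P \<star> idt A \<bullet> F X x P) [a, p] [a, q] z" .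
  qed (use P d in auto)
  have iH: "itw (bet2 X A) (bet2 Y A) (\<lambda>P. ?H P \<star> idt A) (h \<star> idt A)"
    unfolding itw_def
  proof (intro conjI ballI)
    fix P assume "P \<in> Ob C"
    then show "al P Y A \<bullet> ?H P \<star> idt A = idt P \<star> (h \<star> idt A) \<bullet> al P X A"
      using h al_nat[of "idt P" h "idt A", OF _ _ _ refl refl refl refl refl refl] by simp
  qed (use o h in simp_all)
  have "itw (bet2 X A) (bet2 Y A) (\<lambda>P. F Y y P \<bullet> ?H P \<star> idt A) (y \<bullet> h \<star> idt A)"
    "itw (bet2 X A) (bet2 Y A) (\<lambda>P. ?H P \<star> idt A \<bullet> F X x P) (h \<star> idt A \<bullet> x)"
    using itw_cmp[OF iH itw_fam2[OF o(2) A_Ob' o(2) A_Ob' y]] itw_cmp[OF itw_fam2[OF o(1) A_Ob' o(1) A_Ob' x] iH] x y h by simp_all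
  from itw_eq[OF this] show ?thesis using op_eq h x y by simp
qed

text \<open>The condition on the second structure maps is supplied by
  \<open>leg_hom_right\<close>.\<close>

lemma comodule_homI:
  assumes l: "labelled X" "labelled Y" and s: "struct X x" "struct X x'" "struct Y y" "struct Y y'" and h: "mor h" "dm h = X" "cd h = Y"
    and c: "comodule C A t1 t3 e (X, raw x, raw x')" "comodule C A t1 t3 e (Y, raw y, raw y')"
    and lh: "leg_hom X Y (F X x) (F Y y) (\<lambda>P. idt P \<star> h)"
  shows "raw h \<in> comodule_hom C A t1 t3 e (X, raw x, raw x') (Y, raw y, raw y')"
proof -
  note o = labelled_Ob[OF l(1)] labelled_Ob[OF l(2)]
  have "compatible X (F X x) (F X x')" "compatible Y (F Y y) (F Y y')"
    using c comodule_iff[OF l(1) s(1,2)] comodule_iff[OF l(2) s(3,4)] by auto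
  then have "leg_hom X Y (F X x') (F Y y') (\<lambda>P. idt P \<star> h)"
    using oper_F[OF o(1) structD[OF s(1)]] oper_F[OF o(2) structD[OF s(3)]] by (intro leg_hom_right[OF oper_arrow[OF h] lh])
  then show ?thesis
    using leg_hom_intertwines[OF l s(1,3) h lh] leg_hom_intertwines[OF l s(2,4) h] c comodule_hom_iff[OF o s h] by simp
qed

lemma F_unit: "P \<in> Ob C \<Longrightarrow> F \<I> (idt (\<I> \<odot> A)) P = unit_coaction P"
  by (simp add: fam_def unit_coaction_def)

lemma comodule_unit:
  assumes l: "labelled \<I>" shows "struct \<I> (idt (\<I> \<odot> A))" "comodule C A t1 t3 e (\<I>, raw (idt (\<I> \<odot> A)), raw (idt (\<I> \<odot> A)))"
proof -
  show s: "struct \<I> (idt (\<I> \<odot> A))" by (simp add: struct_def)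
  have o: "oper unit_coaction [A, \<I>] [A, \<I>]"
    using oper_F[OF labelled_Ob[OF l] structD[OF s]] F_unit by (metis (no_types, lifting) oper_cong)
  have "coaction \<I> unit_coaction"
    unfolding coaction_def
  proof (intro conjI allI impI)
    fix S x i a b assume x: "x \<in> El S" and h: "{i, a, b} \<subseteq> S" "distinct [i, a, b]" "ty i = \<I>" "ty a = A" "ty b = A"
    have m: "on2 (F A T1) a b x \<in> El S" using h by (intro on2_El[OF x]) auto
    show "on2 unit_coaction i a (on2 unit_coaction i b (on2 (F A T1) a b x)) = on2 (F A T1) a b (on2 unit_coaction i a x)"
      using unit_on2[OF m, of i a] unit_on2[OF m, of i b] unit_on2[OF x, of i a] h by simp
  qed (use labelled_Ob[OF l] o in auto)
  moreover have "counital \<I> unit_coaction"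
    unfolding counital_def
  proof (intro allI impI)
    fix S x i a assume x: "x \<in> El S" and h: "{i, a} \<subseteq> S" "distinct [i, a]" "ty i = \<I>" "ty a = A"
    show "Ep a (on2 unit_coaction i a x) = Ep a x" using unit_on2[OF x, of i a] h by simp
  qed
  moreover have "compatible \<I> unit_coaction unit_coaction"
    unfolding compatible_def
  proof (intro conjI allI impI)
    fix S x i a b assume x: "x \<in> El S" and h: "{i, a, b} \<subseteq> S" "distinct [i, a, b]" "ty i = \<I>" "ty a = A" "ty b = A"
    show "Mu b a (on2 unit_coaction i a x) = Mu b a (on2 unit_coaction i b x)"
      using unit_on2[OF x, of i a] unit_on2[OF x, of i b] h by simp
  qed (use o in auto)
  moreover have "coaction \<I> (F \<I> (idt (\<I> \<odot> A))) \<longleftrightarrow> coaction \<I> unit_coaction"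
    by (rule coaction_cong) (rule F_unit)
  moreover have "counital \<I> (F \<I> (idt (\<I> \<odot> A))) \<longleftrightarrow> counital \<I> unit_coaction"
    by (rule counital_cong) (rule F_unit)
  moreover have "compatible \<I> (F \<I> (idt (\<I> \<odot> A))) (F \<I> (idt (\<I> \<odot> A))) \<longleftrightarrow> compatible \<I> unit_coaction unit_coaction"
    by (rule compatible_cong; rule F_unit; assumption)
  ultimately show "comodule C A t1 t3 e (\<I>, raw (idt (\<I> \<odot> A)), raw (idt (\<I> \<odot> A)))"
    unfolding comodule_iff[OF l s s] by simp
qed

end

section \<open>The monoidal category of comodules and the dual comodule\<close>

context hopf_data_legs
begin

lemma comodules_sel:
  "Ob (comodules C A t1 t3 e) = {M. comodule C A t1 t3 e M}" "Hom (comodules C A t1 t3 e) = comodule_hom C A t1 t3 e"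
  "Id (comodules C A t1 t3 e) = (\<lambda>M. \<one> (fst M))" "Comp (comodules C A t1 t3 e) = Comp C"
  "TenO (comodules C A t1 t3 e) = comodule_tensor C A" "Ten (comodules C A t1 t3 e) = Ten C"
  "Unit (comodules C A t1 t3 e) = (\<I>, \<one> (\<I> \<odot> A), \<one> (\<I> \<odot> A))"
  "Assoc (comodules C A t1 t3 e) = (\<lambda>L M N. \<alpha> (fst L) (fst M) (fst N))"
  "LUnit (comodules C A t1 t3 e) = (\<lambda>M. \<ll> (fst M))" "RUnit (comodules C A t1 t3 e) = (\<lambda>M. \<rr> (fst M))"
  by (simp_all add: comodules_def)

lemma comodules_inverse_pair:
  "inverse_pair (comodules C A t1 t3 e) X Y f g \<Longrightarrow> inverse_pair C (fst X) (fst Y) f g"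
  by (cases X; cases Y) (auto simp: inverse_pair_def comodules_sel comodule_hom_def)

lemma tens_cong:
  assumes "V \<in> Ob C" "W \<in> Ob C" "\<And>P. P \<in> Ob C \<Longrightarrow> f P = f' P" "\<And>P. P \<in> Ob C \<Longrightarrow> g P = g' P" "P \<in> Ob C"
  shows "tens V W f g P = tens V W f' g' P"
  using assms by (simp add: tens_def pos13_def pos23_def)

context
  fixes U V W u u' v v' w w'
  assumes l: "labelled U" "labelled V" "labelled W" "labelled (U \<odot> V)" "labelled (V \<odot> W)"
      "labelled (U \<odot> V \<odot> W)" "labelled (U \<odot> (V \<odot> W))"
    and s: "struct U u" "struct U u'" "struct V v" "struct V v'" "struct W w" "struct W w'"
    and c: "comodule C A t1 t3 e (U, raw u, raw u')" "comodule C A t1 t3 e (V, raw v, raw v')"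
      "comodule C A t1 t3 e (W, raw w, raw w')"
begin

text \<open>A left dual among comodules refers to the inverse associator of that category; to
  identify it with the one of C, the associator and its inverse in C have to be comodule
  morphisms.\<close>

lemma assoc_comodule_hom:
  "\<alpha> U V W \<in> comodule_hom C A t1 t3 e
     (comodule_tensor C A (comodule_tensor C A (U, raw u, raw u') (V, raw v, raw v')) (W, raw w, raw w'))
     (comodule_tensor C A (U, raw u, raw u') (comodule_tensor C A (V, raw v, raw v') (W, raw w, raw w')))"
  "Assoc_inv C U V W \<in> comodule_hom C A t1 t3 e
     (comodule_tensor C A (U, raw u, raw u') (comodule_tensor C A (V, raw v, raw v') (W, raw w, raw w')))
     (comodule_tensor C A (comodule_tensor C A (U, raw u, raw u') (V, raw v, raw v')) (W, raw w, raw w'))"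
proof -
  let ?X = "comodule_tensor C A (comodule_tensor C A (U, raw u, raw u') (V, raw v, raw v')) (W, raw w, raw w')"
  let ?Y = "comodule_tensor C A (U, raw u, raw u') (comodule_tensor C A (V, raw v, raw v') (W, raw w, raw w'))"
  note o = labelled_Ob[OF l(1)] labelled_Ob[OF l(2)] labelled_Ob[OF l(3)] labelled_Ob[OF l(4)] labelled_Ob[OF l(5)]
     labelled_Ob[OF l(6)] labelled_Ob[OF l(7)]
  note s1 = struct_ten(1)[OF o(1,2) s(1,3)] struct_ten(2)[OF o(1,2) s(2,4)] struct_ten(1)[OF o(2,3) s(3,5)] struct_ten(2)[OF o(2,3) s(4,6)]
  note s2 = struct_ten(1)[OF o(4,3) s1(1) s(5)] struct_ten(2)[OF o(4,3) s1(2) s(6)]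
    struct_ten(1)[OF o(1,5) s(1) s1(3)] struct_ten(2)[OF o(1,5) s(2) s1(4)]
  note cs = comodule_ten[OF l(4,3,6) s1(1,2) s(5,6) comodule_ten[OF l(1,2,4) s(1-4) c(1,2)] c(3)]
    comodule_ten[OF l(1,5,7) s(1,2) s1(3,4) c(1) comodule_ten[OF l(2,3,5) s(3-6) c(2,3)]]
  note op = oper_F[OF o(1) structD[OF s(1)]] oper_F[OF o(2) structD[OF s(3)]] oper_F[OF o(3) structD[OF s(5)]]
  let ?x = "ten1 (U \<odot> V) W (ten1 U V u v) w" and ?x' = "ten3 (U \<odot> V) W (ten3 U V u' v') w'"
  let ?y = "ten1 U (V \<odot> W) u (ten1 V W v w)" and ?y' = "ten3 U (V \<odot> W) u' (ten3 V W v' w')"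
  have X: "?X = (U \<odot> V \<odot> W, raw ?x, raw ?x')" and Y: "?Y = (U \<odot> (V \<odot> W), raw ?y, raw ?y')"
    using o s s1 by (simp_all add: comodule_tensor_raw)
  have fx: "F (U \<odot> V \<odot> W) ?x P = tens (U \<odot> V) W (tens U V (F U u) (F V v)) (F W w) P" if "P \<in> Ob C" for P
    using tens_cong[OF o(4,3) F_ten(1)[OF o(1,2) s(1,3)] refl that] F_ten(1)[OF o(4,3) s1(1) s(5) that] by simp
  have fy: "F (U \<odot> (V \<odot> W)) ?y P = tens U (V \<odot> W) (F U u) (tens V W (F V v) (F W w)) P" if "P \<in> Ob C" for P
    using tens_cong[OF o(1,5) refl F_ten(1)[OF o(2,3) s(3,5)] that] F_ten(1)[OF o(1,5) s(1) s1(3) that] by simp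
  have "leg_hom (U \<odot> V \<odot> W) (U \<odot> (V \<odot> W)) (F (U \<odot> V \<odot> W) ?x) (F (U \<odot> (V \<odot> W)) ?y) (\<lambda>P. idt P \<star> al U V W)"
  proof (subst leg_hom_cong)
    show "leg_hom (U \<odot> V \<odot> W) (U \<odot> (V \<odot> W)) (tens (U \<odot> V) W (tens U V (F U u) (F V v)) (F W w))
       (tens U (V \<odot> W) (F U u) (tens V W (F V v) (F W w))) (\<lambda>P. idt P \<star> al U V W)"
      by (rule leg_hom_assoc[OF o(1-3) op l(1-5)])
  qed (rule refl fx fy; assumption)+
  then have h: "raw (al U V W) \<in> comodule_hom C A t1 t3 e ?X ?Y"
    unfolding X Y using o by (intro comodule_homI[OF l(6,7) s2 _ _ _ cs]) simp_all
  then show "\<alpha> U V W \<in> comodule_hom C A t1 t3 e ?X ?Y" using o by (simp add: raw_str)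
  have m: "mor (al U V W)" "dm (al U V W) = U \<odot> V \<odot> W" "cd (al U V W) = U \<odot> (V \<odot> W)"
    "mor (ali U V W)" "dm (ali U V W) = U \<odot> (V \<odot> W)" "cd (ali U V W) = U \<odot> V \<odot> W"
    "ali U V W \<bullet> al U V W = idt (U \<odot> V \<odot> W)" "al U V W \<bullet> ali U V W = idt (U \<odot> (V \<odot> W))"
    using o by simp_all
  note e = h[unfolded X Y comodule_hom_iff[OF o(6,7) s2 m(1-3)]]
  have "raw (ali U V W) \<in> comodule_hom C A t1 t3 e ?Y ?X"
    unfolding X Y comodule_hom_iff[OF o(7,6) s2(3,4,1,2) m(4-6)]
    using e intertwine_inverse[OF m A_Ob' structD[OF s2(1)] structD[OF s2(3)]]
      intertwine_inverse[OF m A_Ob' structD[OF s2(2)] structD[OF s2(4)]] by blast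
  then show "Assoc_inv C U V W \<in> comodule_hom C A t1 t3 e ?Y ?X" using o by (simp add: raw_str)
qed

text \<open>An inverse among comodules is an inverse in C, where inverses are unique.\<close>

lemma comodules_Assoc_inv:
  "Assoc_inv (comodules C A t1 t3 e) (U, raw u, raw u') (V, raw v, raw v') (W, raw w, raw w') = Assoc_inv C U V W"
proof -
  let ?L = "(U, raw u, raw u')" and ?M = "(V, raw v, raw v')" and ?N = "(W, raw w, raw w')"
  let ?X = "comodule_tensor C A (comodule_tensor C A ?L ?M) ?N" and ?Y = "comodule_tensor C A ?L (comodule_tensor C A ?M ?N)"
  have f: "fst ?X = U \<odot> V \<odot> W" "fst ?Y = U \<odot> (V \<odot> W)" by (simp_all add: comodule_tensor_def)
  note a = assoc_pair[OF labelled_Ob[OF l(1)] labelled_Ob[OF l(2)] labelled_Ob[OF l(3)]]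
  have "inverse_mor (comodules C A t1 t3 e) ?X ?Y (\<alpha> U V W) = Assoc_inv C U V W"
    unfolding inverse_mor_def
  proof (rule the_equality)
    show "inverse_pair (comodules C A t1 t3 e) ?X ?Y (\<alpha> U V W) (Assoc_inv C U V W)"
      using a assoc_comodule_hom unfolding inverse_pair_def comodules_sel f by simp
    fix g assume "inverse_pair (comodules C A t1 t3 e) ?X ?Y (\<alpha> U V W) g"
    from inverse_pair_unique[OF comodules_inverse_pair[OF this, unfolded f] a] show "g = Assoc_inv C U V W" .
  qed
  then show ?thesis unfolding Assoc_inv_def[of "comodules C A t1 t3 e"] comodules_sel by simp
qed

end

lemma struct_ex:
  assumes G: "oper G [A, W] [A, W]" and W: "W \<in> Ob C"
  shows "\<exists>d. struct W d \<and> (\<forall>P \<in> Ob C. G P = F W d P)"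
proof (rule oper_fam_ex[OF G])
  show "short [A, W]" "short [A, W]" using W by simp_all
  fix d assume "mor d" "dm d = brk [A, W]" "cd d = brk [A, W]" and e: "\<And>P. P \<in> Ob C \<Longrightarrow> G P = F W d P"
  then have "struct W d" by (simp add: struct_def)
  then show "\<exists>d. struct W d \<and> (\<forall>P \<in> Ob C. G P = F W d P)" using e by blast
qed

text \<open>The duality data \<eta>, \<epsilon> of C are kept. Labels are required for the objects
  underlying the comodules between which \<eta>, \<epsilon> and the inverse associator are shown to
  be morphisms.\<close>

lemma dual_comodule_ex:
  assumes l: "labelled V" "labelled V'" "labelled \<I>" "labelled (V \<odot> V')" "labelled (V' \<odot> V)"
      "labelled (V' \<odot> V \<odot> V')" "labelled (V' \<odot> (V \<odot> V'))"
    and ld: "left_dual C V V' \<eta> \<epsilon>" and c: "comodule C A t1 t3 e (V, v1, v3)"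
  shows "\<exists>v1' v3'. left_dual (comodules C A t1 t3 e) (V, v1, v3) (V', v1', v3') \<eta> \<epsilon>"
proof -
  note o = labelled_Ob[OF l(1)] labelled_Ob[OF l(2)]
  define v u where "v = tag (V \<odot> A) (V \<odot> A) v1" and "u = tag (V \<odot> A) (V \<odot> A) v3"
  define h k where "h = tag \<I> (V \<odot> V') \<eta>" and "k = tag (V' \<odot> V) \<I> \<epsilon>"
  have s: "struct V v" "struct V u" and r: "raw v = v1" "raw u = v3"
    using comodule_structs[OF c] by (simp_all add: v_def u_def)
  have hk: "mor h" "dm h = \<I>" "cd h = V \<odot> V'" "mor k" "dm k = V' \<odot> V" "cd k = \<I>" and rhk: "raw h = \<eta>" "raw k = \<epsilon>"
    using ld by (simp_all add: left_dual_def h_def k_def raw_tag)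
  have z1: "run V \<bullet> idt V \<star> k \<bullet> al V V' V \<bullet> h \<star> idt V = lun V"
    using ld o hk by (subst mor_eq_iff) (simp_all add: cmp_assoc[symmetric] raw_cmp raw_ten raw_idt raw_str rhk left_dual_def)
  have z2: "lun V' \<bullet> k \<star> idt V' \<bullet> ali V' V V' \<bullet> idt V' \<star> h = run V'"
    using ld o hk by (subst mor_eq_iff) (simp_all add: cmp_assoc[symmetric] raw_cmp raw_ten raw_idt raw_str rhk left_dual_def)
  have cv: "comodule C A t1 t3 e (V, raw v, raw u)" using c r by simp
  note cv' = cv[unfolded comodule_iff[OF l(1) s]]
  have vex: "\<exists>v. ty v = V" using labelled_ex[OF l(1)] .
  let ?eta = "fam [] [V', V] h" and ?eps = "fam [V, V'] [] k"
  interpret D: dual_legs "F A T1" "F A T1i" "F A T2" "F A T2i" "F A T3" "fam [A] [] E" "fam [A, A] [A] M" C ty A V V' ?eta ?eps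
  proof unfold_locales
    show "oper ?eta [] [V', V]" "oper ?eps [V, V'] []" using o hk by (auto intro!: oper_fam)
  qed (use l families_zig[OF o hk z1] families_zag[OF o hk z2] in blast)+
  \<comment> \<open>The inverse of the first structure map and its companion; their transposes,
    turned into morphisms of C by \<open>struct_ex\<close>, are the structure maps on V'.\<close>
  obtain f' where f': "oper f' [A, V] [A, V]" "\<And>P. P \<in> Ob C \<Longrightarrow> f' P \<bullet> F V v P = idt (P \<odot> V \<odot> A)"
    "\<And>P. P \<in> Ob C \<Longrightarrow> F V v P \<bullet> f' P = idt (P \<odot> V \<odot> A)"
    using coaction_invertible[of V "F V v" "F V u"] cv' vex by metis
  obtain g' where g': "compatible V f' g'"
    using inverse_compatible_ex[of V "F V v" "F V u" f'] cv' vex f' by metis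
  note g'o = compatibleD(1)[OF g']
  obtain d1 where d1: "struct V' d1" "\<And>P. P \<in> Ob C \<Longrightarrow> D.dualop f' P = F V' d1 P"
    using struct_ex[OF D.oper_dualop[OF f'(1)] o(2)] by blast
  obtain d3 where d3: "struct V' d3" "\<And>P. P \<in> Ob C \<Longrightarrow> D.dualop g' P = F V' d3 P"
    using struct_ex[OF D.oper_dualop[OF g'o] o(2)] by blast
  have cong: "coaction V' (D.dualop f') = coaction V' (F V' d1)" "counital V' (D.dualop f') = counital V' (F V' d1)"
    "compatible V' (D.dualop f') (D.dualop g') = compatible V' (F V' d1) (F V' d3)"
    by (rule coaction_cong counital_cong compatible_cong; rule d1(2) d3(2); assumption)+
  have cd: "comodule C A t1 t3 e (V', raw d1, raw d3)"
    unfolding comodule_iff[OF l(2) d1(1) d3(1)] cong[symmetric]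
    using D.coaction_dual[of "F V v" f'] D.counital_dual[of "F V v" f'] D.compatible_dual[of "F V v" f' g'] cv' f' g' by blast
  note u0 = comodule_unit[OF l(3)]
  note sV = struct_ten(1)[OF o s(1) d1(1)] struct_ten(2)[OF o s(2) d3(1)]
    struct_ten(1)[OF o(2,1) d1(1) s(1)] struct_ten(2)[OF o(2,1) d3(1) s(2)]
  note cV = comodule_ten[OF l(1,2,4) s d1(1) d3(1) cv cd] comodule_ten[OF l(2,1,5) d1(1) d3(1) s cd cv]
  have "leg_hom \<I> (V \<odot> V') (F \<I> (idt (\<I> \<odot> A))) (F (V \<odot> V') (ten1 V V' v d1)) (\<lambda>P. idt P \<star> h)
     \<longleftrightarrow> leg_hom \<I> (V \<odot> V') unit_coaction (tens V V' (F V v) (D.dualop f')) (\<lambda>P. al P V V' \<bullet> ?eta P \<bullet> run P)"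
    using o hk F_unit F_ten(1)[OF o s(1) d1(1)] tens_cong[OF o refl d1(2)]
    by (intro leg_hom_cong) (simp_all add: unit_families cmp_assoc al_ali[THEN reassoc])
  then have "leg_hom \<I> (V \<odot> V') (F \<I> (idt (\<I> \<odot> A))) (F (V \<odot> V') (ten1 V V' v d1)) (\<lambda>P. idt P \<star> h)"
    using D.leg_hom_eta[of "F V v" f'] cv' f' by blast
  from comodule_homI[OF l(3,4) u0(1,1) sV(1,2) hk(1-3) u0(2) cV(1) this]
  have eta: "\<eta> \<in> comodule_hom C A t1 t3 e (\<I>, \<one> (\<I> \<odot> A), \<one> (\<I> \<odot> A)) (comodule_tensor C A (V, v1, v3) (V', raw d1, raw d3))"
    using comodule_tensor_raw[OF o s(1) d1(1) s(2) d3(1)] unit_ob by (simp add: rhk r raw_idt)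
  have "leg_hom (V' \<odot> V) \<I> (F (V' \<odot> V) (ten1 V' V d1 v)) (F \<I> (idt (\<I> \<odot> A))) (\<lambda>P. idt P \<star> k)
     \<longleftrightarrow> leg_hom (V' \<odot> V) \<I> (tens V' V (D.dualop f') (F V v)) unit_coaction (\<lambda>P. runi P \<bullet> ?eps P \<bullet> ali P V' V)"
    using o hk F_unit F_ten(1)[OF o(2,1) d1(1) s(1)] tens_cong[OF o(2,1) d1(2) refl]
    by (intro leg_hom_cong) (simp_all add: unit_families cmp_assoc runi_run[THEN reassoc])
  then have "leg_hom (V' \<odot> V) \<I> (F (V' \<odot> V) (ten1 V' V d1 v)) (F \<I> (idt (\<I> \<odot> A))) (\<lambda>P. idt P \<star> k)"
    using D.leg_hom_eps[of "F V v" f'] cv' f' by blast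
  from comodule_homI[OF l(5,3) sV(3,4) u0(1,1) hk(4-6) cV(2) u0(2) this]
  have eps: "\<epsilon> \<in> comodule_hom C A t1 t3 e (comodule_tensor C A (V', raw d1, raw d3) (V, v1, v3)) (\<I>, \<one> (\<I> \<odot> A), \<one> (\<I> \<odot> A))"
    using comodule_tensor_raw[OF o(2,1) d1(1) s(1) d3(1) s(2)] unit_ob by (simp add: rhk r raw_idt)
  have ai: "Assoc_inv (comodules C A t1 t3 e) (V', raw d1, raw d3) (V, v1, v3) (V', raw d1, raw d3) = Assoc_inv C V' V V'"
    using comodules_Assoc_inv[OF l(2,1,2,5,4,6,7) d1(1) d3(1) s d1(1) d3(1) cd cv cd] by (simp add: r)
  have "left_dual (comodules C A t1 t3 e) (V, v1, v3) (V', raw d1, raw d3) \<eta> \<epsilon>"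
    using ld c cd eta eps unfolding left_dual_def comodules_sel ai by simp
  then show ?thesis by blast
qed

end

text \<open>A position i of X in the list recurs at every i + k * length Xs.\<close>

lemma infinite_periodic:
  assumes "X \<in> set Xs" shows "infinite {n. Xs ! (n mod length Xs) = X}"
proof -
  obtain i where i: "i < length Xs" "Xs ! i = X" using assms by (auto simp: in_set_conv_nth)
  have "inj (\<lambda>k. i + k * length Xs)" using i(1) by (intro injI) auto
  then have "infinite (range (\<lambda>k. i + k * length Xs))" using finite_imageD infinite_UNIV_nat by blast
  moreover have "range (\<lambda>k. i + k * length Xs) \<subseteq> {n. Xs ! (n mod length Xs) = X}" using i by auto
  ultimately show ?thesis using finite_subset by blast
qed

theorem theorem4p10:
  fixes C :: "('o, 'm) brmoncat"
    and Q :: "'o \<Rightarrow> 'o \<Rightarrow> 'm set"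
    and A V V' :: 'o
    and t1 t2 t3 t4 e \<eta> \<epsilon> :: 'm
  assumes "symmetric_monoidal_category C"
    and "regular_epi_class C Q"
    and "regular_multiplier_bimonoid C A t1 t2 t3 t4 e"
    and "multiplier_Hopf_monoid C A t1 t2 e"
    and "nondegenerate C A (mult C A t1 e)"
    and "e \<in> Q A (Unit C)"
    and "left_dual C V V' \<eta> \<epsilon>"
  shows "\<forall>v1 v3. (V, v1, v3) \<in> Ob (comodules C A t1 t3 e) \<longrightarrow>
    (\<exists>v1' v3' \<eta>' \<epsilon>'.
       left_dual (comodules C A t1 t3 e) (V, v1, v3) (V', v1', v3') \<eta>' \<epsilon>')"
proof (intro allI impI)
  fix v1 v3 assume c: "(V, v1, v3) \<in> Ob (comodules C A t1 t3 e)"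
  interpret hopf_data C Q A t1 t2 t3 t4 e
    using assms by (simp add: hopf_data_def hopf_data_axioms_def)
  have o: "V \<in> Ob C" "V' \<in> Ob C" using assms(7) by (simp_all add: left_dual_def)
  let ?T = "\<lambda>X Y. TenO C X Y"
  \<comment> \<open>The objects on which legs are needed: A and those that
    \<open>dual_comodule_ex\<close> requires to be labelled.\<close>
  define Xs where "Xs = [A, V, V', Unit C, ?T V V', ?T V' V, ?T (?T V' V) V', ?T V' (?T V V')]"
  \<comment> \<open>Periodicity provides fresh legs of each of these objects.\<close>
  define ty where "ty n = Xs ! (n mod length Xs)" for n
  have Xs: "X \<in> Ob C" if "X \<in> set Xs" for X using that o unfolding Xs_def by (auto simp: tensor_ob unit_ob)
  have ty: "ty n \<in> Ob C" for n unfolding ty_def by (rule Xs, rule nth_mem) (simp add: Xs_def)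
  have inf: "infinite {n. ty n = X}" if "X \<in> set Xs" for X
    unfolding ty_def by (rule infinite_periodic[OF that])
  interpret hopf_data_legs C Q A t1 t2 t3 t4 e ty
    by unfold_locales (rule ty, rule inf, simp add: Xs_def)
  have "labelled X" if "X \<in> set Xs" for X using Xs[OF that] inf[OF that] by (simp add: labelled_def)
  then have "\<exists>v1' v3'. left_dual (comodules C A t1 t3 e) (V, v1, v3) (V', v1', v3') \<eta> \<epsilon>"
    using c by (intro dual_comodule_ex[OF _ _ _ _ _ _ _ assms(7)]) (simp_all add: Xs_def comodules_def)
  then show "\<exists>v1' v3' \<eta>' \<epsilon>'. left_dual (comodules C A t1 t3 e) (V, v1, v3) (V', v1', v3') \<eta>' \<epsilon>'" by blast
qed

end
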